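(* Let $1<p\le q<\infty$, let $\omega\in\mathcal{R}$ be a regular weight and let $\mu$ be a positive Borel measure on $\mathbb{D}$. Then the following statements are equivalent: (i) $\mathcal{T}_\mu:A^p_\omega\to A^q_\omega$ is bounded; (ii) the function $z\mapsto \dfrac{\widetilde{\mathcal{T}}_\mu(z)}{\omega(S(z))^{\frac1p+\frac1{q'}-1}}$ belongs to $L^\infty$; (iii) $\mu$ is a $\frac{s(p+q')}{pq'}$-Carleson measure for $A^s_\omega$ for some (equivalently for all) $0<s<\infty$; (iv) the function $z\mapsto\dfrac{\mu(S(z))}{\omega(S(z))^{\frac1p+\frac1{q'}}}$ belongs to $L^\infty$. Moreover, for each $0<s<\infty$, $$\|\mathcal{T}_\mu\|_{A^p_\omega\to A^q_\omega}\asymp\left\|\frac{\widetilde{\mathcal{T}}_\mu(\cdot)}{\omega(S(\cdot))^{\frac1p+\frac1{q'}-1}}\right\|_{L^\infty}\asymp\|Id\|^{\frac{s(p+q')}{pq'}}_{A^s_\omega\to L^{\frac{s(p+q')}{pq'}}_\mu}\asymp\left\|\frac{\mu(S(\cdot))}{\omega(S(\cdot))^{\frac1p+\frac1{q'}}}\right\|_{L^\infty},$$ where the constants of comparison do not depend on $\mu$.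
   Context: $\mathbb{D}$ is the open unit disc of $\mathbb{C}$, $\mathbb{T}$ its boundary, $\mathcal{H}(\mathbb{D})$ the space of analytic functions in $\mathbb{D}$, and $dA=\frac{dx\,dy}{\pi}$. A weight is a nonnegative integrable function $\omega$ on $\mathbb{D}$; it is radial if $\omega(z)=\omega(|z|)$. For a radial weight put $\widehat\omega(z)=\int_{|z|}^1\omega(s)\,ds$, and it is assumed throughout that $\widehat\omega(r)>0$ for $0\le r<1$. A radial weight is in $\widehat{\mathcal{D}}$ if there is $C>0$ with $\widehat\omega(r)\le C\widehat\omega(\frac{1+r}{2})$ for all $0\le r<1$. A radial weight $\omega\in\widehat{\mathcal D}$ is regular, $\omega\in\mathcal{R}$, if $\omega(r)\asymp\frac{1}{1-r}\int_r^1\omega(s)\,ds$ for $0\le r<1$. Here $a\asymp b$ means $C^{-1}a\le b\le Ca$ for some constant $C>0$ independent of the relevant variables. For $0<p<\infty$, $A^p_\omega$ is the space of $f\in\mathcal{H}(\mathbb{D})$ with $\|f\|_{A^p_\omega}^p=\int_{\mathbb{D}}|f|^p\omega\,dA<\infty$. $B^\omega_z$ are the reproducing kernels of the Hilbert space $A^2_\omega$, i.e. $f(z)=\langle f,B^\omega_z\rangle_{A^2_\omega}=\int_{\mathbb{D}}f\,\overline{B^\omega_z}\,\omega\,dA$ for $f\in A^2_\omega$, and $b^\omega_z=B^\omega_z/\|B^\omega_z\|_{A^2_\omega}$. The Toeplitz operator is $\mathcal{T}_\mu(f)(z)=\int_{\mathbb{D}}f(\zeta)\overline{B^\omega_z(\zeta)}\,d\mu(\zeta)$.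 Its Berezin transform is $\widetilde{\mathcal{T}}_\mu(z)=\langle\mathcal{T}_\mu(b^\omega_z),b^\omega_z\rangle_{A^2_\omega}$, which for finite $\mu$ equals $\int_{\mathbb{D}}|b^\omega_z|^2\,d\mu$; the latter expression (with values in $[0,\infty]$) is taken as the meaning of $\widetilde{\mathcal{T}}_\mu(z)$ in general. For $1<q<\infty$, $q'$ is the conjugate exponent, $\frac1q+\frac1{q'}=1$. For an interval $I\subset\mathbb{T}$ with arc length $|I|$, the Carleson square is $S(I)=\{re^{it}\in\mathbb{D}:e^{it}\in I,\ 1-|I|\le r<1\}$. For $a\in\mathbb{D}\setminus\{0\}$, $I_a=\{e^{i\theta}:|\arg(ae^{-i\theta})|\le\frac{1-|a|}{2}\}$ and $S(a)=S(I_a)$; also $S(0)=\mathbb{D}$. For a Borel set $E\subset\mathbb D$, $\omega(E)=\int_E\omega\,dA$. The $L^\infty$-norm is the supremum over $\mathbb{D}$. For $0<p,q<\infty$, $\mu$ is a $q$-Carleson measure for $A^p_\omega$ if the identity operator $Id:A^p_\omega\to L^q_\mu=L^q(\mathbb{D},\mu)$ is bounded. *)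

theory Defs
  imports "HOL-Analysis.Analysis"
begin

abbreviation disc :: "complex set" where
  "disc \<equiv> ball 0 1"

(* Two-sided comparison of [0,\<infinity>]-valued quantities; a constant 0 < C < \<infinity> makes this
   the same as C^{-1} a \<le> b \<le> C a. *)
definition comparable :: "real \<Rightarrow> ennreal \<Rightarrow> ennreal \<Rightarrow> bool" where
  "comparable C a b \<longleftrightarrow> a \<le> ennreal C * b \<and> b \<le> ennreal C * a"

(* Powers with exponent a > 0 on [0,\<infinity>]. *)
definition ennpow :: "ennreal \<Rightarrow> real \<Rightarrow> ennreal" where
  "ennpow x a = (if x = \<infinity> then \<infinity> else ennreal (enn2real x powr a))"

definition weight_tail :: "(complex \<Rightarrow> real) \<Rightarrow> real \<Rightarrow> ennreal" where
  "weight_tail \<omega> r = (\<integral>\<^sup>+ s \<in> {r..<1}. ennreal (\<omega> (complex_of_real s)) \<partial>lebesgue)"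

definition radial_weight :: "(complex \<Rightarrow> real) \<Rightarrow> bool" where
  "radial_weight \<omega> \<longleftrightarrow>
     (\<forall>z\<in>disc. 0 \<le> \<omega> z) \<and> set_integrable lebesgue disc \<omega> \<and>
     (\<forall>z\<in>disc. \<omega> z = \<omega> (complex_of_real (norm z))) \<and>
     (\<forall>r\<in>{0..<1}. 0 < weight_tail \<omega> r)"

definition doubling_weight :: "(complex \<Rightarrow> real) \<Rightarrow> bool" where
  "doubling_weight \<omega> \<longleftrightarrow> radial_weight \<omega> \<and>
     (\<exists>C>0. \<forall>r\<in>{0..<1}. weight_tail \<omega> r \<le> ennreal C * weight_tail \<omega> ((1 + r) / 2))"

definition regular_weight :: "(complex \<Rightarrow> real) \<Rightarrow> bool" where
  "regular_weight \<omega> \<longleftrightarrow> doubling_weight \<omega> \<and>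
     (\<exists>C>0. \<forall>r\<in>{0..<1}.
        comparable C (ennreal (\<omega> (complex_of_real r))) (weight_tail \<omega> r / ennreal (1 - r)))"

(* The measure \<omega> dA on the disc, where dA = dx dy / \<pi>. *)
definition weight_measure :: "(complex \<Rightarrow> real) \<Rightarrow> complex measure" where
  "weight_measure \<omega> = density (lebesgue_on disc) (\<lambda>z. ennreal (\<omega> z / pi))"

definition Lp_norm :: "real \<Rightarrow> 'a measure \<Rightarrow> ('a \<Rightarrow> complex) \<Rightarrow> ennreal" where
  "Lp_norm p M f = ennpow (\<integral>\<^sup>+ z. ennreal (norm (f z) powr p) \<partial>M) (1 / p)"

definition Lp_space :: "real \<Rightarrow> 'a measure \<Rightarrow> ('a \<Rightarrow> complex) set" where
  "Lp_space p M = {f \<in> borel_measurable M. Lp_norm p M f < \<infinity>}"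

definition bergman_norm :: "real \<Rightarrow> (complex \<Rightarrow> real) \<Rightarrow> (complex \<Rightarrow> complex) \<Rightarrow> ennreal" where
  "bergman_norm p \<omega> f = Lp_norm p (weight_measure \<omega>) f"

(* Functions on the disc are represented by total functions; their values outside the disc
   are arbitrary and never used. *)
definition bergman_space :: "real \<Rightarrow> (complex \<Rightarrow> real) \<Rightarrow> (complex \<Rightarrow> complex) set" where
  "bergman_space p \<omega> = {f. f holomorphic_on disc \<and> bergman_norm p \<omega> f < \<infinity>}"

(* The reproducing kernel B_z of A^2_\<omega>, which is uniquely determined on the disc. *)
definition bergman_kernel :: "(complex \<Rightarrow> real) \<Rightarrow> complex \<Rightarrow> complex \<Rightarrow> complex" where
  "bergman_kernel \<omega> z = (SOME B. B \<in> bergman_space 2 \<omega> \<and>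
     (\<forall>f \<in> bergman_space 2 \<omega>. f z = (\<integral>\<zeta>. f \<zeta> * cnj (B \<zeta>) \<partial>weight_measure \<omega>)))"

definition normalized_kernel :: "(complex \<Rightarrow> real) \<Rightarrow> complex \<Rightarrow> complex \<Rightarrow> complex" where
  "normalized_kernel \<omega> z \<zeta> =
     bergman_kernel \<omega> z \<zeta> / of_real (enn2real (bergman_norm 2 \<omega> (bergman_kernel \<omega> z)))"

(* T is an operator defined on D; it is bounded from the (quasi)normed space (X, NX) to (Y, NY)
   with constant C if in particular every element of X lies in the domain D. *)
definition op_bound ::
  "'a set \<Rightarrow> ('a \<Rightarrow> ennreal) \<Rightarrow> 'b set \<Rightarrow> ('b \<Rightarrow> ennreal) \<Rightarrow> 'a set \<Rightarrow> ('a \<Rightarrow> 'b) \<Rightarrow> ennreal \<Rightarrow> bool" where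
  "op_bound X NX Y NY D T C \<longleftrightarrow> (\<forall>f\<in>X. f \<in> D \<and> T f \<in> Y \<and> NY (T f) \<le> C * NX f)"

definition bounded_op ::
  "'a set \<Rightarrow> ('a \<Rightarrow> ennreal) \<Rightarrow> 'b set \<Rightarrow> ('b \<Rightarrow> ennreal) \<Rightarrow> 'a set \<Rightarrow> ('a \<Rightarrow> 'b) \<Rightarrow> bool" where
  "bounded_op X NX Y NY D T \<longleftrightarrow> (\<exists>C<\<infinity>. op_bound X NX Y NY D T C)"

(* The operator norm; it is \<infinity> if T is not bounded. *)
definition op_norm ::
  "'a set \<Rightarrow> ('a \<Rightarrow> ennreal) \<Rightarrow> 'b set \<Rightarrow> ('b \<Rightarrow> ennreal) \<Rightarrow> 'a set \<Rightarrow> ('a \<Rightarrow> 'b) \<Rightarrow> ennreal" where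
  "op_norm X NX Y NY D T = Inf {C. op_bound X NX Y NY D T C}"

definition borel_measure_on_disc :: "complex measure \<Rightarrow> bool" where
  "borel_measure_on_disc \<mu> \<longleftrightarrow> sets \<mu> = sets (restrict_space borel disc)"

definition toeplitz ::
  "(complex \<Rightarrow> real) \<Rightarrow> complex measure \<Rightarrow> (complex \<Rightarrow> complex) \<Rightarrow> complex \<Rightarrow> complex" where
  "toeplitz \<omega> \<mu> f z = (\<integral>\<zeta>. f \<zeta> * cnj (bergman_kernel \<omega> z \<zeta>) \<partial>\<mu>)"

(* The integral defining the Toeplitz operator has to converge absolutely; the Bochner
   integral of a non-integrable function is the junk value 0. *)
definition toeplitz_domain ::
  "(complex \<Rightarrow> real) \<Rightarrow> complex measure \<Rightarrow> (complex \<Rightarrow> complex) set" where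
  "toeplitz_domain \<omega> \<mu> =
     {f. \<forall>z\<in>disc. integrable \<mu> (\<lambda>\<zeta>. f \<zeta> * cnj (bergman_kernel \<omega> z \<zeta>))}"

definition toeplitz_bounded ::
  "real \<Rightarrow> real \<Rightarrow> (complex \<Rightarrow> real) \<Rightarrow> complex measure \<Rightarrow> bool" where
  "toeplitz_bounded p q \<omega> \<mu> \<longleftrightarrow>
     bounded_op (bergman_space p \<omega>) (bergman_norm p \<omega>) (bergman_space q \<omega>) (bergman_norm q \<omega>)
       (toeplitz_domain \<omega> \<mu>) (toeplitz \<omega> \<mu>)"

definition toeplitz_norm ::
  "real \<Rightarrow> real \<Rightarrow> (complex \<Rightarrow> real) \<Rightarrow> complex measure \<Rightarrow> ennreal" where
  "toeplitz_norm p q \<omega> \<mu> =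
     op_norm (bergman_space p \<omega>) (bergman_norm p \<omega>) (bergman_space q \<omega>) (bergman_norm q \<omega>)
       (toeplitz_domain \<omega> \<mu>) (toeplitz \<omega> \<mu>)"

definition berezin :: "(complex \<Rightarrow> real) \<Rightarrow> complex measure \<Rightarrow> complex \<Rightarrow> ennreal" where
  "berezin \<omega> \<mu> z = (\<integral>\<^sup>+ \<zeta>. ennreal ((norm (normalized_kernel \<omega> z \<zeta>))\<^sup>2) \<partial>\<mu>)"

definition carleson_measure ::
  "real \<Rightarrow> real \<Rightarrow> (complex \<Rightarrow> real) \<Rightarrow> complex measure \<Rightarrow> bool" where
  "carleson_measure t s \<omega> \<mu> \<longleftrightarrow>
     bounded_op (bergman_space s \<omega>) (bergman_norm s \<omega>) (Lp_space t \<mu>) (Lp_norm t \<mu>) UNIV id"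

definition embedding_norm ::
  "real \<Rightarrow> real \<Rightarrow> (complex \<Rightarrow> real) \<Rightarrow> complex measure \<Rightarrow> ennreal" where
  "embedding_norm s t \<omega> \<mu> =
     op_norm (bergman_space s \<omega>) (bergman_norm s \<omega>) (Lp_space t \<mu>) (Lp_norm t \<mu>) UNIV id"

definition arc_length :: "complex set \<Rightarrow> real" where
  "arc_length I = measure lebesgue {t \<in> {0..<2 * pi}. cis t \<in> I}"

definition carleson_square :: "complex set \<Rightarrow> complex set" where
  "carleson_square I =
     {of_real r * cis t |r t. cis t \<in> I \<and> 0 \<le> r \<and> 1 - arc_length I \<le> r \<and> r < 1}"

definition carleson_arc :: "complex \<Rightarrow> complex set" where
  "carleson_arc a = {cis \<theta> |\<theta>. \<bar>Arg (a * cis (- \<theta>))\<bar> \<le> (1 - norm a) / 2}"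

definition carleson_box :: "complex \<Rightarrow> complex set" where
  "carleson_box a = (if a = 0 then disc else carleson_square (carleson_arc a))"

definition weight_box :: "(complex \<Rightarrow> real) \<Rightarrow> complex \<Rightarrow> real" where
  "weight_box \<omega> z = measure (weight_measure \<omega>) (carleson_box z)"

definition sup_norm_on_disc :: "(complex \<Rightarrow> ennreal) \<Rightarrow> ennreal" where
  "sup_norm_on_disc g = (SUP z\<in>disc. g z)"

definition berezin_quotient ::
  "real \<Rightarrow> (complex \<Rightarrow> real) \<Rightarrow> complex measure \<Rightarrow> complex \<Rightarrow> ennreal" where
  "berezin_quotient e \<omega> \<mu> z = berezin \<omega> \<mu> z / ennreal (weight_box \<omega> z powr e)"

definition box_quotient ::
  "real \<Rightarrow> (complex \<Rightarrow> real) \<Rightarrow> complex measure \<Rightarrow> complex \<Rightarrow> ennreal" where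
  "box_quotient e \<omega> \<mu> z = emeasure \<mu> (carleson_box z) / ennreal (weight_box \<omega> z powr e)"

end

theory Submission
  imports Defs "HOL-Complex_Analysis.Complex_Analysis"
begin

text \<open>
  With \<open>\<alpha> = 1/p + 1/q' = 1 + 1/p - 1/q\<close>, the four quantities bound each other in a cycle
  \<open>box \<rightarrow> Toeplitz \<rightarrow> Berezin \<rightarrow> embedding \<rightarrow> box\<close> (\<open>norms_cycle\<close>), and \<open>s\<close> occurs in the embedding
  only.

  A regular weight enters only through its tail. If \<open>\<Omega>(t)\<close> is the integral of \<open>\<omega>\<close> over \<open>[1 - t, 1)\<close>,
  then \<open>\<omega>(z)\<close> is comparable with \<open>\<Omega>(t) / t\<close> for \<open>t = 1 - |z|\<close>, and \<open>\<Omega>\<close> grows between two positive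
  powers of \<open>t\<close>: the upper power is the doubling condition, the lower one is regularity
  (\<open>regular_weight_profile\<close>). The locale \<open>regular_profile\<close> collects these facts, and
  \<open>box_size t = t \<Omega>(t)\<close> is the size of \<open>\<omega>(S(z))\<close> (\<open>weight_box_bounds\<close>).

  The analytic core is the pointwise bound \<open>|B\<^sub>z(\<zeta>)| \<le> C / box_size |1 - cnj z \<zeta>|\<close>
  (\<open>kernel_upper\<close>). The monomials are orthogonal, so \<open>B\<^sub>z(\<zeta>)\<close> is the power series in
  \<open>w = cnj z \<zeta>\<close> whose coefficients are the reciprocals of the moments of \<open>\<omega>\<close>. The differences of
  order \<open>k\<close> of the moments are again integrals of powers of \<open>|\<zeta>|\<close> and gain a factor
  \<open>(n + 1)\<^bsup>-k\<^esup>\<close>; this property is inherited by reciprocals, and summation by parts of high order turns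
  it into decay in \<open>|1 - w|\<close>. On the diagonal, and by Cauchy's estimate on small discs
  \<open>|\<zeta> - z| < \<delta> (1 - |z|)\<close>, the bound is sharp (\<open>kernel_near_diagonal_lower\<close>).

  All remaining integrals reduce to the Forelli--Rudin estimate for powers of \<open>1 - |\<xi>|\<close> and
  \<open>|1 - cnj z \<xi>|\<close>, because \<open>\<Omega>\<close> lies between powers (\<open>weighted_forelli_rudin\<close>). The four arrows of the
  cycle are then as follows.

  \<^item> A bound on Carleson squares gives one on small discs. The product of \<open>|f|\<close> and
  the bound for \<open>|B\<^sub>z|\<close> is dominated by its averages over small discs, by subharmonicity, so
  that \<open>\<mu>\<close> may be replaced by \<open>\<omega> dA\<close> at the cost of a factor
  \<open>box_size\<^bsup>\<alpha> - 1\<^esup>\<close>. Point evaluation absorbs this factor and turns \<open>|f|\<close> into \<open>|f|\<^bsup>p/q\<^esup>\<close>, and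
  Schur's test bounds the operator with kernel \<open>1 / box_size |1 - cnj z \<xi>|\<close> on \<open>L\<^bsup>q\<^esup>\<close>
  (\<open>toeplitz_of_disc_bound\<close>).
  \<^item> The Berezin transform is \<open>(T B\<^sub>z)(z)\<close> divided by the squared norm of \<open>B\<^sub>z\<close>, which point evaluation
  in \<open>A\<^bsup>q\<^esup>\<close> and the norm of \<open>B\<^sub>z\<close> in \<open>A\<^bsup>p\<^esup>\<close> control (\<open>berezin_of_toeplitz\<close>).
  \<^item> Where \<open>|B\<^sub>z|\<close> is large the Berezin transform bounds \<open>\<mu>\<close> on small discs
  (\<open>disc_bound_of_berezin\<close>); averaging and point evaluation as above give the embedding
  (\<open>carleson_embedding\<close>).
  \<^item> Testing the embedding on a power of \<open>1 / (1 - cnj z \<zeta>)\<close> bounds the measure of squares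
  (\<open>box_of_embedding\<close>).
\<close>

section \<open>Planar Lebesgue measure: rotations and polar coordinates\<close>

lemma lborel_complex_eq_distr:
  "(lborel :: complex measure) = distr (lborel \<Otimes>\<^sub>M lborel) borel (\<lambda>p. Complex (fst p) (snd p))"
proof (rule lborel_eqI)
  have [measurable]: "(\<lambda>p. Complex (fst p) (snd p)) \<in> borel_measurable (lborel \<Otimes>\<^sub>M lborel)"
    by (simp add: borel_measurable_complex_iff)
  fix l u :: complex assume le: "\<And>b. b \<in> Basis \<Longrightarrow> l \<bullet> b \<le> u \<bullet> b"
  have le': "Re l \<le> Re u" "Im l \<le> Im u" 
    using le[of 1] le[of \<i>] by (auto simp: Basis_complex_def)
  have eq: "(\<lambda>p. Complex (fst p) (snd p)) -` box l u \<inter> space (lborel \<Otimes>\<^sub>M lborel)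
      = {Re l<..<Re u} \<times> {Im l<..<Im u}"
    by (auto simp: in_box_complex_iff space_pair_measure)
  show "emeasure (distr (lborel \<Otimes>\<^sub>M lborel) borel (\<lambda>p. Complex (fst p) (snd p))) (box l u) = (\<Prod>b\<in>Basis. (u - l) \<bullet> b)"
    using le' by (subst emeasure_distr)
      (auto simp: eq Basis_complex_def lborel.emeasure_pair_measure_Times ennreal_mult'')
qed simp

lemma nn_integral_complex:
  fixes F :: "complex \<Rightarrow> ennreal"
  assumes [measurable]: "F \<in> borel_measurable borel"
  shows "(\<integral>\<^sup>+z. F z \<partial>lborel) = (\<integral>\<^sup>+x. \<integral>\<^sup>+y. F (Complex x y) \<partial>lborel \<partial>lborel)"
    and "(\<integral>\<^sup>+z. F z \<partial>lborel) = (\<integral>\<^sup>+y. \<integral>\<^sup>+x. F (Complex x y) \<partial>lborel \<partial>lborel)"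
proof -
  have [measurable]: "(\<lambda>p. Complex (fst p) (snd p)) \<in> borel_measurable (lborel \<Otimes>\<^sub>M lborel)"
    by (simp add: borel_measurable_complex_iff)
  have "(\<integral>\<^sup>+z. F z \<partial>lborel) = (\<integral>\<^sup>+p. F (Complex (fst p) (snd p)) \<partial>(lborel \<Otimes>\<^sub>M lborel))"
    by (subst lborel_complex_eq_distr) (simp add: nn_integral_distr)
  then show "(\<integral>\<^sup>+z. F z \<partial>lborel) = (\<integral>\<^sup>+x. \<integral>\<^sup>+y. F (Complex x y) \<partial>lborel \<partial>lborel)"
    and "(\<integral>\<^sup>+z. F z \<partial>lborel) = (\<integral>\<^sup>+y. \<integral>\<^sup>+x. F (Complex x y) \<partial>lborel \<partial>lborel)"
    by (simp_all add: lborel.nn_integral_fst[symmetric] lborel_pair.Fubini'[symmetric] split_beta)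
qed

lemma measurable_Complex_const [measurable]:
  "(\<lambda>(x, y). Complex x y) \<in> borel_measurable (borel \<Otimes>\<^sub>M borel)"
  "Complex x \<in> borel_measurable borel" "(\<lambda>x. Complex x y) \<in> borel_measurable borel"
  by (simp_all add: borel_measurable_complex_iff split_beta)

lemma measurable_Complex [measurable (raw)]:
  assumes "f \<in> borel_measurable M" "g \<in> borel_measurable M"
  shows "(\<lambda>x. Complex (f x) (g x)) \<in> borel_measurable M"
  using assms by (simp add: borel_measurable_complex_iff)

text \<open>
  When the cosine is nonzero, a rotation is the composition of two affine substitutions in one
  coordinate each, whose Jacobians cancel.
\<close>

lemma nn_integral_lborel_rotate_aux:
  fixes F :: "complex \<Rightarrow> ennreal"
  assumes [measurable]: "F \<in> borel_measurable borel" and c: "norm c = 1" "Re c \<noteq> 0"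
  shows "(\<integral>\<^sup>+z. F (c * z) \<partial>lborel) = (\<integral>\<^sup>+z. F z \<partial>lborel)"
proof -
  define a b where "a = Re c" and "b = Im c"
  have ab: "a\<^sup>2 + b\<^sup>2 = 1" "a \<noteq> 0" using c by (auto simp: a_def b_def cmod_def)
  have "(\<integral>\<^sup>+z. F z \<partial>lborel) = (\<integral>\<^sup>+u. \<integral>\<^sup>+v. F (Complex u v) \<partial>lborel \<partial>lborel)"
    by (rule nn_integral_complex) simp
  also have "\<dots> = (\<integral>\<^sup>+u. ennreal \<bar>1/a\<bar> * (\<integral>\<^sup>+y. F (Complex u (b*u/a + (1/a) * y)) \<partial>lborel) \<partial>lborel)"
    using ab by (intro nn_integral_cong nn_integral_real_affine) auto
  also have "\<dots> = ennreal \<bar>1/a\<bar> * (\<integral>\<^sup>+u. (\<integral>\<^sup>+y. F (Complex u (b*u/a + (1/a) * y)) \<partial>lborel) \<partial>lborel)"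
    by (simp add: nn_integral_cmult)
  also have "\<dots> = ennreal \<bar>1/a\<bar> * (\<integral>\<^sup>+y. (\<integral>\<^sup>+u. F (Complex u (b*u/a + (1/a) * y)) \<partial>lborel) \<partial>lborel)"
    by (subst lborel_pair.Fubini') simp_all
  also have "\<dots> = ennreal \<bar>1/a\<bar> * (\<integral>\<^sup>+y. ennreal \<bar>a\<bar> * (\<integral>\<^sup>+x. F (Complex (-b*y + a*x) (b*(-b*y+a*x)/a + (1/a) * y)) \<partial>lborel) \<partial>lborel)"
    using ab by (intro arg_cong[where f="(*) (ennreal \<bar>1/a\<bar>)"] nn_integral_cong nn_integral_real_affine) auto
  also have "\<dots> = ennreal \<bar>1/a\<bar> * (ennreal \<bar>a\<bar> * (\<integral>\<^sup>+y. (\<integral>\<^sup>+x. F (Complex (-b*y + a*x) (b*(-b*y+a*x)/a + (1/a) * y)) \<partial>lborel) \<partial>lborel))"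
    by (simp add: nn_integral_cmult)
  also have "\<dots> = (\<integral>\<^sup>+y. (\<integral>\<^sup>+x. F (Complex (-b*y + a*x) (b*(-b*y+a*x)/a + (1/a) * y)) \<partial>lborel) \<partial>lborel)"
    using ab by (simp add: mult.assoc[symmetric] ennreal_mult''[symmetric])
  also have "\<dots> = (\<integral>\<^sup>+y. (\<integral>\<^sup>+x. F (c * Complex x y) \<partial>lborel) \<partial>lborel)"
  proof -
    have "Complex (-b*y + a*x) (b*(-b*y+a*x)/a + (1/a) * y) = c * Complex x y" for x y
    proof -
      have "b*(-b*y+a*x)/a + (1/a) * y = ((a\<^sup>2 + b\<^sup>2) * y - b*b*y + a*b*x)/a"
        using ab by (simp add: field_simps)
      also have "\<dots> = b * x + a * y"
        using \<open>a \<noteq> 0\<close> by (simp add: field_simps power2_eq_square)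
      finally show ?thesis by (auto simp: complex_eq_iff a_def b_def)
    qed
    then show ?thesis by simp
  qed
  also have "\<dots> = (\<integral>\<^sup>+z. F (c * z) \<partial>lborel)"
    by (rule nn_integral_complex(2)[symmetric]) simp
  finally show ?thesis by simp
qed

lemma nn_integral_lborel_rotate:
  fixes F :: "complex \<Rightarrow> ennreal"
  assumes [measurable]: "F \<in> borel_measurable borel" and c: "norm c = 1"
  shows "(\<integral>\<^sup>+z. F (c * z) \<partial>lborel) = (\<integral>\<^sup>+z. F z \<partial>lborel)"
proof (cases "Re c = 0")
  case True
  \<comment> \<open>A rotation by a right angle is the composition of two rotations by half of it.\<close>
  define d where "d = cis (pi/4)"
  have d: "norm d = 1" "Re d \<noteq> 0" by (auto simp: d_def cos_45)
  have "Im c = 1 \<or> Im c = -1" using c True by (auto simp: cmod_def abs_if split: if_splits)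
  then have "Re (c * cnj d) \<noteq> 0" "norm (c * cnj d) = 1"
    using True d c by (auto simp: d_def norm_mult sin_45)
  moreover have "d * cnj d = 1" by (simp add: d_def complex_eq_iff power2_eq_square[symmetric])
  ultimately have "(\<integral>\<^sup>+z. F z \<partial>lborel) = (\<integral>\<^sup>+z. F ((c * cnj d) * z) \<partial>lborel)"
    by (intro nn_integral_lborel_rotate_aux[symmetric]) auto
  also have "\<dots> = (\<integral>\<^sup>+z. F ((c * cnj d) * (d * z)) \<partial>lborel)"
    using d by (intro nn_integral_lborel_rotate_aux[symmetric, of "\<lambda>z. F ((c * cnj d) * z)"]) auto
  also have "\<dots> = (\<integral>\<^sup>+z. F (c * z) \<partial>lborel)"
  proof -
    have "c * cnj d * (d * z) = c * z" for z
    proof -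
      have "c * cnj d * (d * z) = c * (d * cnj d) * z" by (simp add: mult_ac)
      then show ?thesis using \<open>d * cnj d = 1\<close> by simp
    qed
    then show ?thesis by (simp only:)
  qed
  finally show ?thesis by simp
qed (use assms nn_integral_lborel_rotate_aux in auto)

lemma lborel_distr_rotate:
  assumes c: "norm (c::complex) = 1"
  shows "distr lborel borel ((*) c) = lborel"
proof (rule measure_eqI)
  fix A assume A: "A \<in> sets (distr lborel borel ((*) c))"
  then have [measurable]: "A \<in> sets borel" by simp
  have "emeasure (distr lborel borel ((*) c)) A = (\<integral>\<^sup>+z. indicator A z \<partial>distr lborel borel ((*) c))"
    by simp
  also have "\<dots> = (\<integral>\<^sup>+z. indicator A (c * z) \<partial>lborel)"
    by (subst nn_integral_distr) auto
  also have "\<dots> = (\<integral>\<^sup>+z. indicator A z \<partial>lborel)" by (rule nn_integral_lborel_rotate) (use c in auto)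
  finally show "emeasure (distr lborel borel ((*) c)) A = emeasure lborel A" by simp
qed simp

lemma lebesgue_distr_rotate:
  assumes c: "norm (c::complex) = 1"
  shows "(*) c \<in> lebesgue \<rightarrow>\<^sub>M lebesgue" "distr lebesgue lebesgue ((*) c) = lebesgue"
proof -
  have m: "(*) c \<in> lebesgue \<rightarrow>\<^sub>M lborel" by (rule measurable_completion) simp
  have eq: "distr lebesgue lborel ((*) c) = lborel"
    using lborel_distr_rotate[OF c] by (simp add: distr_completion cong: distr_cong)
  show "(*) c \<in> lebesgue \<rightarrow>\<^sub>M lebesgue"
    by (rule completion.measurable_completion2[OF m]) (simp add: eq)
  show "distr lebesgue lebesgue ((*) c) = lebesgue"
    using completion.completion_distr_eq[OF m] by (simp add: eq)
qed

definition sector :: "complex set" where "sector = {z. 0 < Re z \<and> \<bar>Im z\<bar> \<le> Re z}"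

lemma sector_borel [measurable]: "sector \<in> sets borel"
  unfolding sector_def by measurable

definition slope_unit :: "real \<Rightarrow> complex" where
  "slope_unit t = Complex (1 / sqrt (1 + t\<^sup>2)) (t / sqrt (1 + t\<^sup>2))"

lemma slope_unit_measurable [measurable]: "slope_unit \<in> borel_measurable borel"
  unfolding slope_unit_def by measurable

lemma norm_slope_unit [simp]: "norm (slope_unit t) = 1"
proof -
  have "0 < 1 + t\<^sup>2" by (simp add: add_pos_nonneg)
  then show ?thesis by (simp add: slope_unit_def cmod_def power_divide add_divide_distrib[symmetric])
qed

text \<open>
  Polar coordinates with the slope \<open>t = tan \<theta>\<close> in place of the angle, so that only affine
  one-dimensional substitutions occur; \<open>dt / (1 + t\<^sup>2)\<close> is the angular measure.
\<close>

lemma nn_integral_sector: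
  fixes F :: "complex \<Rightarrow> ennreal"
  assumes [measurable]: "F \<in> borel_measurable borel"
  shows "(\<integral>\<^sup>+z. indicator sector z * F z \<partial>lborel)
    = (\<integral>\<^sup>+t. \<integral>\<^sup>+r. indicator {-1..1} t * indicator {0<..} r * ennreal (r / (1 + t\<^sup>2)) * F (of_real r * slope_unit t) \<partial>lborel \<partial>lborel)"
proof -
  have "(\<integral>\<^sup>+z. indicator sector z * F z \<partial>lborel)
    = (\<integral>\<^sup>+x. \<integral>\<^sup>+y. indicator sector (Complex x y) * F (Complex x y) \<partial>lborel \<partial>lborel)"
    by (rule nn_integral_complex) simp
  also have "\<dots> = (\<integral>\<^sup>+x. \<integral>\<^sup>+t. indicator {-1..1} t * (indicator {0<..} x * ennreal x * F (Complex x (x*t))) \<partial>lborel \<partial>lborel)"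
  proof (rule nn_integral_cong)
    fix x :: real
    show "(\<integral>\<^sup>+y. indicator sector (Complex x y) * F (Complex x y) \<partial>lborel)
      = (\<integral>\<^sup>+t. indicator {-1..1} t * (indicator {0<..} x * ennreal x * F (Complex x (x*t))) \<partial>lborel)"
    proof (cases "x > 0")
      case True
      have "(\<integral>\<^sup>+y. indicator sector (Complex x y) * F (Complex x y) \<partial>lborel)
        = ennreal \<bar>x\<bar> * (\<integral>\<^sup>+t. indicator sector (Complex x (0 + x*t)) * F (Complex x (0 + x*t)) \<partial>lborel)"
        using True by (intro nn_integral_real_affine) auto
      also have "\<dots> = (\<integral>\<^sup>+t. ennreal \<bar>x\<bar> * (indicator sector (Complex x (0 + x*t)) * F (Complex x (0 + x*t))) \<partial>lborel)"
        by (simp add: nn_integral_cmult)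
      also have "\<dots> = (\<integral>\<^sup>+t. indicator {-1..1} t * (indicator {0<..} x * ennreal x * F (Complex x (x*t))) \<partial>lborel)"
      proof (rule nn_integral_cong)
        fix t :: real
        have "\<bar>x * t\<bar> \<le> x \<longleftrightarrow> t \<in> {-1..1}" using True by (auto simp: abs_mult abs_le_iff)
        then show "ennreal \<bar>x\<bar> * (indicator sector (Complex x (0 + x*t)) * F (Complex x (0 + x*t)))
          = indicator {-1..1} t * (indicator {0<..} x * ennreal x * F (Complex x (x*t)))"
          using True by (auto simp: sector_def indicator_def)
      qed
      finally show ?thesis .
    qed (simp add: sector_def)
  qed
  also have "\<dots> = (\<integral>\<^sup>+t. \<integral>\<^sup>+x. indicator {-1..1} t * (indicator {0<..} x * ennreal x * F (Complex x (x*t))) \<partial>lborel \<partial>lborel)"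
    by (subst lborel_pair.Fubini') simp_all
  also have "\<dots> = (\<integral>\<^sup>+t. \<integral>\<^sup>+r. indicator {-1..1} t * indicator {0<..} r * ennreal (r / (1 + t\<^sup>2)) * F (of_real r * slope_unit t) \<partial>lborel \<partial>lborel)"
  proof (rule nn_integral_cong)
    fix t :: real
    define c where "c = 1 / sqrt (1 + t\<^sup>2)"
    have pos: "0 < 1 + t\<^sup>2" by (simp add: add_pos_nonneg)
    then have c: "c > 0" "c * c = 1 / (1 + t\<^sup>2)" by (auto simp: c_def)
    have su: "Complex (c * r) (c * r * t) = of_real r * slope_unit t" for r
      by (simp add: slope_unit_def c_def complex_eq_iff)
    have "(\<integral>\<^sup>+x. indicator {-1..1} t * (indicator {0<..} x * ennreal x * F (Complex x (x*t))) \<partial>lborel)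
      = ennreal \<bar>c\<bar> * (\<integral>\<^sup>+r. indicator {-1..1} t * (indicator {0<..} (0 + c * r) * ennreal (0 + c * r) * F (Complex (0 + c*r) ((0 + c*r)*t))) \<partial>lborel)"
      using c by (intro nn_integral_real_affine) auto
    also have "\<dots> = (\<integral>\<^sup>+r. ennreal c * (indicator {-1..1} t * (indicator {0<..} (c * r) * ennreal (c * r) * F (Complex (c*r) ((c*r)*t)))) \<partial>lborel)"
      using c by (simp add: nn_integral_cmult)
    also have "\<dots> = (\<integral>\<^sup>+r. indicator {-1..1} t * indicator {0<..} r * ennreal (r / (1 + t\<^sup>2)) * F (of_real r * slope_unit t) \<partial>lborel)"
    proof (rule nn_integral_cong)
      fix r :: real
      show "ennreal c * (indicator {-1..1} t * (indicator {0<..} (c * r) * ennreal (c * r) * F (Complex (c*r) ((c*r)*t))))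
        = indicator {-1..1} t * indicator {0<..} r * ennreal (r / (1 + t\<^sup>2)) * F (of_real r * slope_unit t)"
      proof (cases "r > 0")
        case True
        have "ennreal c * ennreal (c * r) = ennreal (r / (1 + t\<^sup>2))"
          using c True by (simp add: ennreal_mult''[symmetric] mult.assoc[symmetric])
        then have "ennreal c * (ennreal (c * r) * X) = ennreal (r / (1 + t\<^sup>2)) * X" for X
          by (simp add: mult.assoc[symmetric])
        then show ?thesis unfolding su using True c
          by (simp add: indicator_def)
      qed (use c in \<open>auto simp: zero_less_mult_iff\<close>)
    qed
    finally show "(\<integral>\<^sup>+x. indicator {-1..1} t * (indicator {0<..} x * ennreal x * F (Complex x (x*t))) \<partial>lborel)
      = (\<integral>\<^sup>+r. indicator {-1..1} t * indicator {0<..} r * ennreal (r / (1 + t\<^sup>2)) * F (of_real r * slope_unit t) \<partial>lborel)" .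
  qed
  finally show ?thesis .
qed

text \<open>Up to the origin, the plane is the union of the four right-angle rotations of the sector.\<close>

lemma nn_integral_radial_le_sector:
  fixes G :: "real \<Rightarrow> ennreal"
  assumes [measurable]: "G \<in> borel_measurable borel"
  shows "(\<integral>\<^sup>+z. G (norm (z::complex)) \<partial>lborel) \<le> 4 * (\<integral>\<^sup>+z. indicator sector z * G (norm (z::complex)) \<partial>lborel)"
proof -
  have cover: "\<exists>k<4. \<i> ^ k * z \<in> sector" if "z \<noteq> 0" for z
  proof -
    have "Re z \<noteq> 0 \<or> Im z \<noteq> 0" using that by (auto simp: complex_eq_iff)
    then have "z \<in> sector \<or> \<i> * z \<in> sector \<or> - z \<in> sector \<or> - \<i> * z \<in> sector"
      by (auto simp: sector_def abs_if)
    then have "\<i> ^ 0 * z \<in> sector \<or> \<i> ^ 1 * z \<in> sector \<or> \<i> ^ 2 * z \<in> sector \<or> \<i> ^ 3 * z \<in> sector"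
      by (simp add: power3_eq_cube)
    then show ?thesis
    proof (elim disjE)
      assume "\<i> ^ 0 * z \<in> sector" then show ?thesis by (intro exI[of _ 0]) simp
    next assume "\<i> ^ 1 * z \<in> sector" then show ?thesis by (intro exI[of _ 1]) simp
    next assume "\<i> ^ 2 * z \<in> sector" then show ?thesis by (intro exI[of _ 2]) simp
    next assume "\<i> ^ 3 * z \<in> sector" then show ?thesis by (intro exI[of _ 3]) simp
    qed
  qed
  have "(\<integral>\<^sup>+z. G (norm (z::complex)) \<partial>lborel) \<le> (\<integral>\<^sup>+z. (\<Sum>k<4::nat. indicator sector (\<i>^k * z) * G (norm (\<i>^k * z))) \<partial>lborel)"
  proof (rule nn_integral_mono_AE)
    have "AE z in lborel. z \<noteq> (0::complex)" by (rule AE_lborel_singleton)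
    then show "AE z::complex in lborel. G (norm z) \<le> (\<Sum>k<4::nat. indicator sector (\<i>^k * z) * G (norm (\<i>^k * z)))"
    proof eventually_elim
      fix z :: complex assume "z \<noteq> 0"
      then obtain k where k: "k < 4" "\<i>^k * z \<in> sector" using cover by blast
      have "G (norm z) = indicator sector (\<i>^k * z) * G (norm (\<i>^k * z))"
        using k by (simp add: norm_mult norm_power)
      also have "\<dots> \<le> (\<Sum>k<4::nat. indicator sector (\<i>^k * z) * G (norm (\<i>^k * z)))"
        using k by (intro member_le_sum) auto
      finally show "G (norm z) \<le> (\<Sum>k<4::nat. indicator sector (\<i>^k * z) * G (norm (\<i>^k * z)))" .
    qed
  qed
  also have "\<dots> = (\<Sum>k<4::nat. \<integral>\<^sup>+z. indicator sector (\<i>^k * z) * G (norm (\<i>^k * z)) \<partial>lborel)"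
    by (rule nn_integral_sum) simp
  also have "\<dots> = (\<Sum>k<4::nat. \<integral>\<^sup>+z. indicator sector z * G (norm z) \<partial>lborel)"
    by (intro sum.cong refl nn_integral_lborel_rotate[where F="\<lambda>z. indicator sector z * G (norm z)"])
       (auto simp: norm_power)
  finally show ?thesis by simp
qed

text \<open>
  On the sector \<open>1/2 \<le> 1 / (1 + t\<^sup>2) \<le> 1\<close>, so that the angular integral lies between 1 and 2.
\<close>

lemma nn_integral_sector_radial:
  fixes G :: "real \<Rightarrow> ennreal"
  assumes [measurable]: "G \<in> borel_measurable borel"
  shows "(\<integral>\<^sup>+z. indicator sector z * G (norm (z::complex)) \<partial>lborel) \<le> 2 * (\<integral>\<^sup>+r. indicator {0<..} r * ennreal r * G r \<partial>lborel)"
    and "(\<integral>\<^sup>+r. indicator {0<..} r * ennreal r * G r \<partial>lborel) \<le> (\<integral>\<^sup>+z. indicator sector z * G (norm (z::complex)) \<partial>lborel)"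
proof -
  define I where "I = (\<integral>\<^sup>+r. indicator {0<..} r * ennreal r * G r \<partial>lborel)"
  have eq: "(\<integral>\<^sup>+z. indicator sector z * G (norm (z::complex)) \<partial>lborel)
     = (\<integral>\<^sup>+t. indicator {-1..1} t * ennreal (1 / (1 + t\<^sup>2)) * I \<partial>lborel)"
    unfolding I_def
  proof (subst nn_integral_sector, simp, rule nn_integral_cong)
    fix t :: real
    have "indicator {-1..1} t * indicator {0<..} r * ennreal (r / (1 + t\<^sup>2)) * G (norm (of_real r * slope_unit t))
       = indicator {-1..1} t * ennreal (1 / (1 + t\<^sup>2)) * (indicator {0<..} r * ennreal r * G r)" for r
    proof (cases "r > 0")
      case True
      have "ennreal (r / (1 + t\<^sup>2)) = ennreal (1 / (1 + t\<^sup>2)) * ennreal r"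
        using True by (simp add: ennreal_mult''[symmetric])
      then show ?thesis using True by (simp add: norm_mult mult_ac)
    qed simp
    then show "(\<integral>\<^sup>+r. indicator {-1..1} t * indicator {0<..} r * ennreal (r / (1 + t\<^sup>2)) * G (norm (of_real r * slope_unit t)) \<partial>lborel)
       = indicator {-1..1} t * ennreal (1 / (1 + t\<^sup>2)) * (\<integral>\<^sup>+r. indicator {0<..} r * ennreal r * G r \<partial>lborel)"
      by (simp add: nn_integral_cmult)
  qed
  have "(\<integral>\<^sup>+t. indicator {-1..1::real} t * ennreal (1 / (1 + t\<^sup>2)) * I \<partial>lborel) \<le> (\<integral>\<^sup>+t. I * indicator {-1..1::real} t \<partial>lborel)"
  proof (rule nn_integral_mono)
    fix t :: real
    have "ennreal (1 / (1 + t\<^sup>2)) \<le> ennreal 1" by (intro ennreal_leI) (simp add: add_pos_nonneg)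
    then have "ennreal (1 / (1 + t\<^sup>2)) * I \<le> 1 * I" by (intro mult_right_mono) auto
    then show "indicator {-1..1} t * ennreal (1 / (1 + t\<^sup>2)) * I \<le> I * indicator {-1..1} t"
      by (simp add: indicator_def)
  qed
  also have "\<dots> = I * 2" by (subst nn_integral_cmult_indicator) auto
  finally show "(\<integral>\<^sup>+z. indicator sector z * G (norm (z::complex)) \<partial>lborel) \<le> 2 * (\<integral>\<^sup>+r. indicator {0<..} r * ennreal r * G r \<partial>lborel)"
    using eq by (simp add: I_def mult.commute)
  have "I = I * ennreal (1/2) * 2"
  proof -
    have "ennreal (1/2) * ennreal 2 = ennreal 1" by (subst ennreal_mult''[symmetric]) auto
    then show ?thesis by (simp add: mult.assoc)
  qed
  also have "\<dots> = (\<integral>\<^sup>+t. I * ennreal (1/2) * indicator {-1..1::real} t \<partial>lborel)"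
    by (subst nn_integral_cmult_indicator) auto
  also have "\<dots> \<le> (\<integral>\<^sup>+t. indicator {-1..1::real} t * ennreal (1 / (1 + t\<^sup>2)) * I \<partial>lborel)"
  proof (rule nn_integral_mono)
    fix t :: real
    show "I * ennreal (1/2) * indicator {-1..1} t \<le> indicator {-1..1} t * ennreal (1 / (1 + t\<^sup>2)) * I"
    proof (cases "t \<in> {-1..1}")
      case True
      then have "t\<^sup>2 \<le> 1" by (auto simp: abs_square_le_1)
      then have "ennreal (1/2) \<le> ennreal (1 / (1 + t\<^sup>2))"
        by (intro ennreal_leI divide_left_mono) (auto simp: add_pos_nonneg)
      then have "I * ennreal (1/2) \<le> I * ennreal (1 / (1 + t\<^sup>2))" by (rule mult_left_mono) simp
      then show ?thesis using True by (simp add: mult.commute)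
    qed simp
  qed
  finally show "(\<integral>\<^sup>+r. indicator {0<..} r * ennreal r * G r \<partial>lborel) \<le> (\<integral>\<^sup>+z. indicator sector z * G (norm (z::complex)) \<partial>lborel)"
    using eq by (simp add: I_def)
qed

lemma nn_integral_radial:
  fixes G :: "real \<Rightarrow> ennreal"
  assumes [measurable]: "G \<in> borel_measurable borel"
  shows "(\<integral>\<^sup>+z. G (norm (z::complex)) \<partial>lborel) \<le> 8 * (\<integral>\<^sup>+r. indicator {0<..} r * ennreal r * G r \<partial>lborel)"
    and "(\<integral>\<^sup>+r. indicator {0<..} r * ennreal r * G r \<partial>lborel) \<le> (\<integral>\<^sup>+z. G (norm (z::complex)) \<partial>lborel)"
proof -
  have "(\<integral>\<^sup>+z. G (norm (z::complex)) \<partial>lborel) \<le> 4 * (2 * (\<integral>\<^sup>+r. indicator {0<..} r * ennreal r * G r \<partial>lborel))"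
    by (rule order_trans[OF nn_integral_radial_le_sector mult_left_mono[OF nn_integral_sector_radial(1)]]) auto
  then show "(\<integral>\<^sup>+z. G (norm (z::complex)) \<partial>lborel) \<le> 8 * (\<integral>\<^sup>+r. indicator {0<..} r * ennreal r * G r \<partial>lborel)"
    by (simp add: mult.assoc[symmetric])
  have "(\<integral>\<^sup>+z. indicator sector z * G (norm (z::complex)) \<partial>lborel) \<le> (\<integral>\<^sup>+z. G (norm (z::complex)) \<partial>lborel)"
    by (intro nn_integral_mono) (auto simp: indicator_def)
  then show "(\<integral>\<^sup>+r. indicator {0<..} r * ennreal r * G r \<partial>lborel) \<le> (\<integral>\<^sup>+z. G (norm (z::complex)) \<partial>lborel)"
    using nn_integral_sector_radial(2)[of G] by auto
qed

section \<open>The Forelli--Rudin estimate\<close>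

lemma ball_borel [measurable]: "ball (z::complex) r \<in> sets borel"
  by simp

lemma nn_integral_powr_near_0:
  fixes \<eta> h :: real
  assumes "0 < \<eta>" "0 < h"
  shows "(\<integral>\<^sup>+s. indicator {0<..h} s * ennreal (s powr (\<eta> - 1)) \<partial>lborel) = ennreal (h powr \<eta> / \<eta>)"
proof -
  have "((\<lambda>s. s powr (\<eta> - 1)) has_integral (h powr (\<eta> - 1 + 1) / (\<eta> - 1 + 1))) {0..h}"
    using assms by (intro has_integral_powr_from_0) auto
  then have "((\<lambda>s. s powr (\<eta> - 1)) has_integral (h powr \<eta> / \<eta>)) {0..h}" by simp
  then have "(\<integral>\<^sup>+s. ennreal (indicator {0..h} s * s powr (\<eta> - 1)) \<partial>lborel) = ennreal (h powr \<eta> / \<eta>)"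
    using assms by (subst nn_integral_has_integral_lebesgue[symmetric]) (auto simp: nn_integral_completion)
  moreover have "(\<integral>\<^sup>+s. ennreal (indicator {0..h} s * s powr (\<eta> - 1)) \<partial>lborel)
     = (\<integral>\<^sup>+s. indicator {0<..h} s * ennreal (s powr (\<eta> - 1)) \<partial>lborel)"
  proof (rule nn_integral_cong_AE)
    have "AE s in lborel. s \<noteq> (0::real)" by (rule AE_lborel_singleton)
    then show "AE s in lborel. ennreal (indicator {0..h} s * s powr (\<eta> - 1)) = indicator {0<..h} s * ennreal (s powr (\<eta> - 1))"
      by eventually_elim (auto simp: indicator_def)
  qed
  ultimately show ?thesis by simp
qed

lemma nn_integral_powr_at_top:
  fixes d h :: real
  assumes "0 < d" "0 < h"
  shows "(\<integral>\<^sup>+s. ennreal (s powr (- d - 1)) * indicator {h..} s \<partial>lborel) = ennreal (h powr (- d) / d)"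
proof -
  have "(\<integral>\<^sup>+s. ennreal (s powr (- d - 1)) * indicator {h..} s \<partial>lborel) = ennreal (0 - (- (h powr (- d) / d)))"
  proof (rule nn_integral_FTC_atLeast)
    show "DERIV (\<lambda>s. - (s powr (- d) / d)) s :> s powr (- d - 1)" if "h \<le> s" for s
      using that assms by (auto intro!: derivative_eq_intros)
    have "((\<lambda>s::real. s powr (- d)) \<longlongrightarrow> 0) at_top"
      using assms by (intro tendsto_neg_powr filterlim_ident) auto
    then have "((\<lambda>s::real. - (s powr (- d) / d)) \<longlongrightarrow> - (0 / d)) at_top"
      using assms by (intro tendsto_intros) auto
    then show "((\<lambda>s::real. - (s powr (- d) / d)) \<longlongrightarrow> 0) at_top" by simp
  qed (use assms in auto)
  then show ?thesis by simp
qed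

text \<open>
  Below \<open>s = h\<close> the second factor is at most \<open>h\<^bsup>-D\<^esup>\<close>, above it is at most \<open>s\<^bsup>-D\<^esup>\<close>.
\<close>

lemma nn_integral_powr_shift_le:
  fixes \<eta> D h :: real
  assumes "0 < \<eta>" "\<eta> < D" "0 < h"
  shows "(\<integral>\<^sup>+s. indicator {0<..} s * ennreal (s powr (\<eta> - 1) * (s + h) powr (- D)) \<partial>lborel)
    \<le> ennreal ((1 / \<eta> + 1 / (D - \<eta>)) * h powr (\<eta> - D))"
proof -
  have "(\<integral>\<^sup>+s. indicator {0<..} s * ennreal (s powr (\<eta> - 1) * (s + h) powr (- D)) \<partial>lborel)
    \<le> (\<integral>\<^sup>+s. ennreal (h powr (- D)) * (indicator {0<..h} s * ennreal (s powr (\<eta> - 1)))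
           + ennreal (s powr (- (D - \<eta>) - 1)) * indicator {h..} s \<partial>lborel)"
  proof (rule nn_integral_mono)
    fix s :: real
    consider "s \<le> 0" | "0 < s" "s \<le> h" | "h < s" by linarith
    then show "indicator {0<..} s * ennreal (s powr (\<eta> - 1) * (s + h) powr (- D))
      \<le> ennreal (h powr (- D)) * (indicator {0<..h} s * ennreal (s powr (\<eta> - 1)))
           + ennreal (s powr (- (D - \<eta>) - 1)) * indicator {h..} s"
    proof cases
      case 2
      have "(s + h) powr (- D) \<le> h powr (- D)" using 2 assms by (intro powr_mono2') auto
      then have "s powr (\<eta> - 1) * (s + h) powr (- D) \<le> h powr (- D) * s powr (\<eta> - 1)"
        by (metis mult.commute mult_left_mono powr_ge_zero)
      then have "ennreal (s powr (\<eta> - 1) * (s + h) powr (- D)) \<le> ennreal (h powr (- D)) * ennreal (s powr (\<eta> - 1))"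
        by (simp add: ennreal_mult''[symmetric] ennreal_leI)
      then show ?thesis using 2 by (auto simp: add_increasing2)
    next
      case 3
      have "(s + h) powr (- D) \<le> s powr (- D)" using 3 assms by (intro powr_mono2') auto
      then have "s powr (\<eta> - 1) * (s + h) powr (- D) \<le> s powr (\<eta> - 1) * s powr (- D)"
        by (intro mult_left_mono) auto
      also have "\<dots> = s powr (- (D - \<eta>) - 1)" by (simp add: powr_add[symmetric] algebra_simps)
      finally have "ennreal (s powr (\<eta> - 1) * (s + h) powr (- D)) \<le> ennreal (s powr (- (D - \<eta>) - 1))"
        by (rule ennreal_leI)
      then show ?thesis using 3 assms by auto
    qed auto
  qed
  also have "\<dots> = ennreal (h powr (- D)) * ennreal (h powr \<eta> / \<eta>) + ennreal (h powr (- (D - \<eta>)) / (D - \<eta>))"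
  proof -
    have "(\<integral>\<^sup>+s. ennreal (h powr (- D)) * (indicator {0<..h} s * ennreal (s powr (\<eta> - 1)))
           + ennreal (s powr (- (D - \<eta>) - 1)) * indicator {h..} s \<partial>lborel)
      = ennreal (h powr (- D)) * (\<integral>\<^sup>+s. (indicator {0<..h} s * ennreal (s powr (\<eta> - 1))) \<partial>lborel)
           + (\<integral>\<^sup>+s. ennreal (s powr (- (D - \<eta>) - 1)) * indicator {h..} s \<partial>lborel)"
      by (subst nn_integral_add) (auto simp: nn_integral_cmult)
    also have "(\<integral>\<^sup>+s. (indicator {0<..h} s * ennreal (s powr (\<eta> - 1))) \<partial>lborel) = ennreal (h powr \<eta> / \<eta>)"
      using assms by (intro nn_integral_powr_near_0) auto
    also have "(\<integral>\<^sup>+s. ennreal (s powr (- (D - \<eta>) - 1)) * indicator {h..} s \<partial>lborel) = ennreal (h powr (- (D - \<eta>)) / (D - \<eta>))"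
      using assms by (intro nn_integral_powr_at_top) auto
    finally show ?thesis .
  qed
  also have "\<dots> = ennreal ((1 / \<eta> + 1 / (D - \<eta>)) * h powr (\<eta> - D))"
  proof -
    have "h powr (- D) * (h powr \<eta> / \<eta>) = h powr (\<eta> - D) / \<eta>"
      by (simp add: powr_add[symmetric])
    then show ?thesis using assms
      by (simp add: ennreal_mult''[symmetric] ennreal_plus[symmetric] field_simps del: ennreal_plus)
  qed
  finally show ?thesis .
qed

lemma nn_integral_abs_shift_le:
  fixes B h :: real
  assumes "1 < B" "0 < h"
  shows "(\<integral>\<^sup>+t. ennreal ((\<bar>t\<bar> + h) powr (- B)) \<partial>lborel) \<le> ennreal (2 * (1 + 1 / (B - 1)) * h powr (1 - B))"
proof -
  define I where "I = (\<integral>\<^sup>+s. indicator {0<..} s * ennreal (s powr (1 - 1) * (s + h) powr (- B)) \<partial>lborel)"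
  have "(\<integral>\<^sup>+t. ennreal ((\<bar>t\<bar> + h) powr (- B)) \<partial>lborel)
    = (\<integral>\<^sup>+t. indicator {0<..} t * ennreal (t powr (1 - 1) * (t + h) powr (- B))
          + indicator {0<..} (0 + (-1) * t) * ennreal ((0 + (-1) * t) powr (1 - 1) * ((0 + (-1) * t) + h) powr (- B)) \<partial>lborel)"
  proof (rule nn_integral_cong_AE)
    have "AE s in lborel. s \<noteq> (0::real)" by (rule AE_lborel_singleton)
    then show "AE t in lborel. ennreal ((\<bar>t\<bar> + h) powr (- B)) = indicator {0<..} t * ennreal (t powr (1 - 1) * (t + h) powr (- B))
          + indicator {0<..} (0 + (-1) * t) * ennreal ((0 + (-1) * t) powr (1 - 1) * ((0 + (-1) * t) + h) powr (- B))"
      by eventually_elim (auto simp: indicator_def)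
  qed
  also have "\<dots> = I + (\<integral>\<^sup>+t. indicator {0<..} (0 + (-1) * t) * ennreal ((0 + (-1) * t) powr (1 - 1) * ((0 + (-1) * t) + h) powr (- B)) \<partial>lborel)"
    unfolding I_def by (rule nn_integral_add) auto
  also have "(\<integral>\<^sup>+t. indicator {0<..} (0 + (-1) * t) * ennreal ((0 + (-1) * t) powr (1 - 1) * ((0 + (-1) * t) + h) powr (- B)) \<partial>lborel) = I"
    unfolding I_def
    by (subst (2) nn_integral_real_affine[where c="-1" and t=0]) auto
  also have "I + I \<le> ennreal ((1 / 1 + 1 / (B - 1)) * h powr (1 - B)) + ennreal ((1 / 1 + 1 / (B - 1)) * h powr (1 - B))"
    unfolding I_def using assms by (intro add_mono nn_integral_powr_shift_le) auto
  also have "\<dots> = ennreal (2 * (1 + 1 / (B - 1)) * h powr (1 - B))"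
    using assms by (subst ennreal_plus[symmetric]) (auto simp: algebra_simps)
  finally show ?thesis .
qed

lemma one_minus_norm_le_dist_kernel:
  assumes "norm z \<le> 1" "norm \<xi> \<le> 1"
  shows "1 - norm z \<le> norm (1 - cnj z * \<xi>)" "1 - norm \<xi> \<le> norm (1 - cnj z * \<xi>)"
proof -
  have "1 - norm z * norm \<xi> \<le> norm (1 - cnj z * \<xi>)"
    using norm_triangle_ineq2[of 1 "cnj z * \<xi>"] by (simp add: norm_mult)
  moreover have "norm z * norm \<xi> \<le> norm z" "norm z * norm \<xi> \<le> norm \<xi>"
    using assms by (auto simp: mult_left_le mult_right_le_one_le mult_left_le_one_le)
  ultimately show "1 - norm z \<le> norm (1 - cnj z * \<xi>)" "1 - norm \<xi> \<le> norm (1 - cnj z * \<xi>)"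
    by linarith+
qed

text \<open>
  The distance dominates each of \<open>1 - r\<close>, \<open>1 - x\<close> and \<open>|t| / 3\<close>; for the last one this is seen on the
  imaginary part if \<open>x r \<ge> 1/2\<close>, and otherwise the distance is at least \<open>1/2\<close>.
\<close>

lemma dist_kernel_on_sector:
  assumes x: "0 \<le> x" "x < 1" and r: "0 < r" "r < 1" and t: "\<bar>t\<bar> \<le> 1"
  shows "((1 - r) + (1 - x) + \<bar>t\<bar>) / 5 \<le> norm (1 - of_real x * (of_real r * slope_unit t))"
proof -
  let ?\<xi> = "of_real r * slope_unit t :: complex"
  let ?d = "norm (1 - of_real x * ?\<xi>)"
  have n: "norm ?\<xi> = r" using r by (simp add: norm_mult)
  have 1: "1 - x \<le> ?d" "1 - r \<le> ?d"
    using one_minus_norm_le_dist_kernel[of "of_real x" ?\<xi>] x r n by auto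
  have 2: "1 - x * r \<le> ?d"
    using norm_triangle_ineq2[of 1 "of_real x * ?\<xi>"] n x by (simp add: norm_mult)
  have "\<bar>t\<bar> \<le> 3 * ?d"
  proof (cases "x * r \<ge> 1/2")
    case True
    have sq: "1 \<le> sqrt (1 + t\<^sup>2)" by simp
    have "t\<^sup>2 \<le> 1" using t by (simp add: abs_square_le_1)
    then have "sqrt (1 + t\<^sup>2) \<le> sqrt ((3/2)\<^sup>2)" by (intro real_sqrt_le_mono) (auto simp: power2_eq_square)
    then have s: "sqrt (1 + t\<^sup>2) \<le> 3/2" by simp
    have "\<bar>t\<bar> / (3/2) \<le> \<bar>t\<bar> / sqrt (1 + t\<^sup>2)" using s by (intro divide_left_mono) (auto simp: add_pos_nonneg)
    then have "1/2 * (\<bar>t\<bar> / (3/2)) \<le> x * r * (\<bar>t\<bar> / sqrt (1 + t\<^sup>2))" using True by (intro mult_mono) auto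
    also have "\<dots> = \<bar>Im (1 - of_real x * ?\<xi>)\<bar>" using x r sq
      by (simp add: slope_unit_def abs_mult abs_divide)
    also have "\<dots> \<le> ?d" by (rule abs_Im_le_cmod)
    finally show ?thesis by simp
  next
    case False
    then show ?thesis using 2 t by linarith
  qed
  moreover have "(a + b + c) / 5 \<le> d" if "a \<le> d" "b \<le> d" "c \<le> 3 * d" for a b c d :: real
    using that by simp
  ultimately show ?thesis using 1 by blast
qed

lemma dist_one_off_sector:
  assumes "0 \<le> x" "x \<le> 1" "\<xi> \<notin> sector"
  shows "1/2 \<le> norm (1 - of_real x * \<xi>)"
proof (cases "Re \<xi> \<le> 0")
  case True
  have "1 - x * Re \<xi> \<ge> 1" using True assms by (simp add: mult_nonneg_nonpos)
  moreover have "1 - x * Re \<xi> \<le> norm (1 - of_real x * \<xi>)"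
    using complex_Re_le_cmod[of "1 - of_real x * \<xi>"] by simp
  ultimately show ?thesis by linarith
next
  case False
  then have "Re \<xi> < \<bar>Im \<xi>\<bar>" using assms by (auto simp: sector_def)
  then have "x * Re \<xi> \<le> x * \<bar>Im \<xi>\<bar>" using assms by (intro mult_left_mono) auto
  moreover have "x * \<bar>Im \<xi>\<bar> \<le> norm (1 - of_real x * \<xi>)"
    using abs_Im_le_cmod[of "1 - of_real x * \<xi>"] assms by (simp add: abs_mult)
  moreover have "1 - x * Re \<xi> \<le> norm (1 - of_real x * \<xi>)"
    using complex_Re_le_cmod[of "1 - of_real x * \<xi>"] by simp
  ultimately show ?thesis by linarith
qed

lemma nn_integral_disc_powr:
  fixes \<eta> :: real
  assumes "0 < \<eta>"
  shows "(\<integral>\<^sup>+\<xi>. indicator disc \<xi> * ennreal ((1 - norm \<xi>) powr (\<eta> - 1)) \<partial>lborel) \<le> ennreal (8 / \<eta>)"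
proof -
  let ?G = "\<lambda>r. indicator {..<1} r * ennreal ((1 - r) powr (\<eta> - 1))"
  have "(\<integral>\<^sup>+\<xi>. indicator disc \<xi> * ennreal ((1 - norm \<xi>) powr (\<eta> - 1)) \<partial>lborel) = (\<integral>\<^sup>+\<xi>. ?G (norm (\<xi>::complex)) \<partial>lborel)"
    by (intro nn_integral_cong) (auto simp: indicator_def)
  also have "\<dots> \<le> 8 * (\<integral>\<^sup>+r. indicator {0<..} r * ennreal r * ?G r \<partial>lborel)"
    by (rule nn_integral_radial) simp
  also have "(\<integral>\<^sup>+r. indicator {0<..} r * ennreal r * ?G r \<partial>lborel)
      \<le> (\<integral>\<^sup>+r. indicator {0<..1} (1 + (-1) * r) * ennreal ((1 + (-1) * r) powr (\<eta> - 1)) \<partial>lborel)"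
  proof (rule nn_integral_mono)
    fix r :: real
    have "ennreal r * ennreal ((1 - r) powr (\<eta> - 1)) \<le> 1 * ennreal ((1 - r) powr (\<eta> - 1))" if "r < 1"
      using that by (intro mult_right_mono) auto
    then show "indicator {0<..} r * ennreal r * ?G r \<le> indicator {0<..1} (1 + (-1) * r) * ennreal ((1 + (-1) * r) powr (\<eta> - 1))"
      by (auto simp: indicator_def)
  qed
  also have "\<dots> = (\<integral>\<^sup>+s. indicator {0<..1} s * ennreal (s powr (\<eta> - 1)) \<partial>lborel)"
    by (subst (2) nn_integral_real_affine[where c="-1" and t=1]) auto
  also have "\<dots> = ennreal (1 powr \<eta> / \<eta>)" using assms by (intro nn_integral_powr_near_0) auto
  finally have "(\<integral>\<^sup>+\<xi>. indicator disc \<xi> * ennreal ((1 - norm \<xi>) powr (\<eta> - 1)) \<partial>lborel) \<le> 8 * ennreal (1 / \<eta>)"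
    by (simp add: mult_left_mono)
  also have "\<dots> = ennreal (8 / \<eta>)"
    using assms by (subst ennreal_numeral[symmetric], subst ennreal_mult[symmetric]) auto
  finally show ?thesis .
qed

text \<open>
  On the sector around the direction of \<open>z\<close> the distance \<open>|1 - cnj z * \<xi>|\<close> is at least a fifth of
  \<open>(1 - |\<xi>|) + (1 - |z|) + |t|\<close>, which lets the double integral be bounded by a product;
  off the sector it is bounded below.
\<close>

lemma forelli_rudin_real:
  fixes \<eta> A :: real
  assumes \<eta>: "0 < \<eta>" and A: "1 + \<eta> < A"
  obtains C where "0 < C"
    "\<And>x. 0 \<le> x \<Longrightarrow> x < 1 \<Longrightarrow>
      (\<integral>\<^sup>+\<xi>. indicator disc \<xi> * ennreal ((1 - norm \<xi>) powr (\<eta> - 1) * norm (1 - of_real x * \<xi>) powr (- A)) \<partial>lborel)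
      \<le> ennreal (C * (1 - x) powr (1 + \<eta> - A))"
proof -
  \<comment> \<open>The exponent is split as \<open>A = B + D\<close> with \<open>B > 1\<close> for the integral over \<open>t\<close> and \<open>D > \<eta>\<close> for the one over \<open>r\<close>.\<close>
  define B where "B = (1 + A - \<eta>) / 2"
  define D where "D = A - B"
  have B: "1 < B" and D: "\<eta> < D" using A by (auto simp: B_def D_def field_simps)
  define C1 where "C1 = 5 powr A * ((1 / \<eta> + 1 / (D - \<eta>)) * (2 * (1 + 1 / (B - 1))))"
  define C2 where "C2 = 2 powr A * (8 / \<eta>)"
  have pos: "0 < C1" "0 < C2" using \<eta> D B by (auto simp: C1_def C2_def intro!: mult_pos_pos add_pos_pos)
  show ?thesis
  proof (rule that[of "C1 + C2"])
    show "0 < C1 + C2" using pos by simp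
    fix x :: real assume x: "0 \<le> x" "x < 1"
    define h where "h = 1 - x"
    have h: "0 < h" "h \<le> 1" using x by (auto simp: h_def)
    let ?F = "\<lambda>\<xi>. indicator disc \<xi> * ennreal ((1 - norm \<xi>) powr (\<eta> - 1) * norm (1 - of_real x * \<xi>) powr (- A))"
    let ?S = "\<lambda>s. indicator {0<..} s * ennreal (s powr (\<eta> - 1) * (s + h) powr (- D))"
    let ?T = "\<lambda>t. ennreal ((\<bar>t\<bar> + h) powr (- B))"
    have "(\<integral>\<^sup>+\<xi>. indicator sector \<xi> * ?F \<xi> \<partial>lborel)
      = (\<integral>\<^sup>+t. \<integral>\<^sup>+r. indicator {-1..1} t * indicator {0<..} r * ennreal (r / (1 + t\<^sup>2)) * ?F (of_real r * slope_unit t) \<partial>lborel \<partial>lborel)"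
      by (rule nn_integral_sector) measurable
    also have "\<dots> \<le> (\<integral>\<^sup>+t. \<integral>\<^sup>+r. ennreal (5 powr A) * (?T t * ?S (1 + (-1) * r)) \<partial>lborel \<partial>lborel)"
    proof (intro nn_integral_mono)
      fix t r :: real
      show "indicator {-1..1} t * indicator {0<..} r * ennreal (r / (1 + t\<^sup>2)) * ?F (of_real r * slope_unit t)
         \<le> ennreal (5 powr A) * (?T t * ?S (1 + (-1) * r))"
      proof (cases "t \<in> {-1..1} \<and> 0 < r \<and> r < 1")
        case True
        then have t: "\<bar>t\<bar> \<le> 1" and r: "0 < r" "r < 1" by auto
        let ?d = "norm (1 - of_real x * (of_real r * slope_unit t))"
        have n: "norm (of_real r * slope_unit t :: complex) = r" using r by (simp add: norm_mult)
        have d: "((1 - r) + h + \<bar>t\<bar>) / 5 \<le> ?d"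
          using dist_kernel_on_sector[OF x r t] by (simp add: h_def)
        have "?d powr (- A) \<le> (((1 - r) + h + \<bar>t\<bar>) / 5) powr (- A)"
          using d A \<eta> r h by (intro powr_mono2') auto
        also have "\<dots> = 5 powr A * (((1 - r) + h + \<bar>t\<bar>) powr (- A))"
          using r h by (simp add: powr_divide powr_minus field_simps)
        also have "((1 - r) + h + \<bar>t\<bar>) powr (- A) = ((1 - r) + h + \<bar>t\<bar>) powr (- D) * ((1 - r) + h + \<bar>t\<bar>) powr (- B)"
          by (simp add: powr_add[symmetric] D_def)
        also have "\<dots> \<le> ((1 - r) + h) powr (- D) * (\<bar>t\<bar> + h) powr (- B)"
          using r h B D \<eta> by (intro mult_mono powr_mono2') auto
        finally have 1: "?d powr (- A) \<le> 5 powr A * (((1 - r) + h) powr (- D) * (\<bar>t\<bar> + h) powr (- B))"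
          by (simp add: mult_left_mono)
        have "r / (1 + t\<^sup>2) \<le> 1 / 1" using r by (intro frac_le) auto
        then have "ennreal (r / (1 + t\<^sup>2)) \<le> ennreal 1" by (intro ennreal_leI) simp
        then have "ennreal (r / (1 + t\<^sup>2)) * ennreal ((1 - r) powr (\<eta> - 1) * ?d powr (- A))
           \<le> ennreal 1 * ennreal ((1 - r) powr (\<eta> - 1) * (5 powr A * (((1 - r) + h) powr (- D) * (\<bar>t\<bar> + h) powr (- B))))"
          using 1 by (intro mult_mono ennreal_leI mult_left_mono) auto
        also have "\<dots> = ennreal (5 powr A) * (?T t * ?S (1 + (-1) * r))"
          using r by (simp add: ennreal_mult''[symmetric] mult_ac)
        finally show ?thesis using True n by simp
      next
        case False
        have "norm (of_real r * slope_unit t :: complex) = \<bar>r\<bar>" by (simp add: norm_mult)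
        with False have "indicator {-1..1} t * indicator {0<..} r * ennreal (r / (1 + t\<^sup>2)) * ?F (of_real r * slope_unit t) = 0"
          by (auto simp: indicator_def)
        then show ?thesis by (simp only: zero_le)
      qed
    qed
    also have "\<dots> = ennreal (5 powr A) * ((\<integral>\<^sup>+r. ?S (1 + (-1) * r) \<partial>lborel) * (\<integral>\<^sup>+t. ?T t \<partial>lborel))"
    proof -
      have "(\<integral>\<^sup>+t. \<integral>\<^sup>+r. a * (T t * S r) \<partial>lborel \<partial>lborel) = a * ((\<integral>\<^sup>+r. S r \<partial>lborel) * (\<integral>\<^sup>+t. T t \<partial>lborel))"
        if [measurable]: "T \<in> borel_measurable borel" "S \<in> borel_measurable borel"
        for T S :: "real \<Rightarrow> ennreal" and a
        by (simp add: nn_integral_cmult nn_integral_multc mult.commute)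
      then show ?thesis by simp
    qed
    also have "(\<integral>\<^sup>+r. ?S (1 + (-1) * r) \<partial>lborel) = (\<integral>\<^sup>+s. ?S s \<partial>lborel)"
      by (subst (2) nn_integral_real_affine[where c="-1" and t=1]) auto
    also have "ennreal (5 powr A) * ((\<integral>\<^sup>+s. ?S s \<partial>lborel) * (\<integral>\<^sup>+t. ?T t \<partial>lborel))
      \<le> ennreal (5 powr A) * (ennreal ((1 / \<eta> + 1 / (D - \<eta>)) * h powr (\<eta> - D)) * ennreal (2 * (1 + 1 / (B - 1)) * h powr (1 - B)))"
      using \<eta> D B h by (intro mult_left_mono mult_mono nn_integral_powr_shift_le nn_integral_abs_shift_le) auto
    also have "\<dots> = ennreal (C1 * h powr (1 + \<eta> - A))"
    proof -
      have "h powr (1 + \<eta> - A) = h powr (\<eta> - D) * h powr (1 - B)"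
        by (simp add: powr_add[symmetric] D_def algebra_simps)
      then show ?thesis using \<eta> D B by (simp add: C1_def ennreal_mult''[symmetric] mult_ac)
    qed
    finally have S: "(\<integral>\<^sup>+\<xi>. indicator sector \<xi> * ?F \<xi> \<partial>lborel) \<le> ennreal (C1 * h powr (1 + \<eta> - A))" .
    have "(\<integral>\<^sup>+\<xi>. indicator (- sector) \<xi> * ?F \<xi> \<partial>lborel)
      \<le> (\<integral>\<^sup>+\<xi>. ennreal (2 powr A) * (indicator disc \<xi> * ennreal ((1 - norm \<xi>) powr (\<eta> - 1))) \<partial>lborel)"
    proof (rule nn_integral_mono)
      fix \<xi> :: complex
      show "indicator (- sector) \<xi> * ?F \<xi> \<le> ennreal (2 powr A) * (indicator disc \<xi> * ennreal ((1 - norm \<xi>) powr (\<eta> - 1)))"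
      proof (cases "\<xi> \<in> disc \<and> \<xi> \<notin> sector")
        case True
        have "norm (1 - of_real x * \<xi>) powr (- A) \<le> (1/2) powr (- A)"
          using True x A \<eta> by (intro powr_mono2' dist_one_off_sector) auto
        also have "\<dots> = 2 powr A" by (simp add: powr_minus powr_divide)
        finally have "(1 - norm \<xi>) powr (\<eta> - 1) * norm (1 - of_real x * \<xi>) powr (- A) \<le> (1 - norm \<xi>) powr (\<eta> - 1) * 2 powr A"
          by (intro mult_left_mono) auto
        then show ?thesis using True by (simp add: ennreal_mult''[symmetric] ennreal_leI mult.commute)
      qed (auto simp: indicator_def)
    qed
    also have "\<dots> \<le> ennreal (2 powr A) * ennreal (8 / \<eta>)"
      using nn_integral_disc_powr[OF \<eta>] by (simp add: nn_integral_cmult mult_left_mono)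
    also have "\<dots> \<le> ennreal (C2 * h powr (1 + \<eta> - A))"
    proof -
      have "1 powr (1 + \<eta> - A) \<le> h powr (1 + \<eta> - A)" using h A by (intro powr_mono2') auto
      then have "C2 * 1 \<le> C2 * h powr (1 + \<eta> - A)" using pos by (intro mult_left_mono) auto
      then show ?thesis by (simp add: C2_def ennreal_mult''[symmetric] ennreal_leI \<eta> less_imp_le)
    qed
    finally have N: "(\<integral>\<^sup>+\<xi>. indicator (- sector) \<xi> * ?F \<xi> \<partial>lborel) \<le> ennreal (C2 * h powr (1 + \<eta> - A))" .
    have "(\<integral>\<^sup>+\<xi>. ?F \<xi> \<partial>lborel) = (\<integral>\<^sup>+\<xi>. indicator sector \<xi> * ?F \<xi> + indicator (- sector) \<xi> * ?F \<xi> \<partial>lborel)"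
      by (intro nn_integral_cong) (simp add: indicator_def)
    also have "\<dots> = (\<integral>\<^sup>+\<xi>. indicator sector \<xi> * ?F \<xi> \<partial>lborel) + (\<integral>\<^sup>+\<xi>. indicator (- sector) \<xi> * ?F \<xi> \<partial>lborel)"
      by (rule nn_integral_add) simp_all
    also have "\<dots> \<le> ennreal (C1 * h powr (1 + \<eta> - A)) + ennreal (C2 * h powr (1 + \<eta> - A))"
      by (rule add_mono[OF S N])
    also have "\<dots> = ennreal ((C1 + C2) * (1 - x) powr (1 + \<eta> - A))"
      using pos by (subst ennreal_plus[symmetric]) (auto simp: h_def algebra_simps)
    finally show "(\<integral>\<^sup>+\<xi>. ?F \<xi> \<partial>lborel) \<le> ennreal ((C1 + C2) * (1 - x) powr (1 + \<eta> - A))" .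
  qed
qed

lemma forelli_rudin:
  fixes \<eta> A :: real
  assumes \<eta>: "0 < \<eta>" and A: "1 + \<eta> < A"
  obtains C where "0 < C"
    "\<And>z. norm z < 1 \<Longrightarrow>
      (\<integral>\<^sup>+\<xi>. indicator disc \<xi> * ennreal ((1 - norm \<xi>) powr (\<eta> - 1) * norm (1 - cnj z * \<xi>) powr (- A)) \<partial>lborel)
      \<le> ennreal (C * (1 - norm z) powr (1 + \<eta> - A))"
proof -
  obtain C where C: "0 < C"
    "\<And>x. 0 \<le> x \<Longrightarrow> x < 1 \<Longrightarrow>
      (\<integral>\<^sup>+\<xi>. indicator disc \<xi> * ennreal ((1 - norm \<xi>) powr (\<eta> - 1) * norm (1 - of_real x * \<xi>) powr (- A)) \<partial>lborel)
      \<le> ennreal (C * (1 - x) powr (1 + \<eta> - A))"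
    using forelli_rudin_real[OF assms] by blast
  show ?thesis
  proof (rule that[OF C(1)])
    fix z :: complex assume z: "norm z < 1"
    define u where "u = cis (- Arg z)"
    have u: "norm u = 1" "cnj z = of_real (norm z) * u"
      unfolding u_def using rcis_cmod_Arg[of z] by (auto simp: rcis_def cis_cnj complex_eq_iff)
    let ?F = "\<lambda>\<xi>. indicator disc \<xi> * ennreal ((1 - norm \<xi>) powr (\<eta> - 1) * norm (1 - of_real (norm z) * \<xi>) powr (- A))"
    have "(\<integral>\<^sup>+\<xi>. indicator disc \<xi> * ennreal ((1 - norm \<xi>) powr (\<eta> - 1) * norm (1 - cnj z * \<xi>) powr (- A)) \<partial>lborel)
       = (\<integral>\<^sup>+\<xi>. ?F (u * \<xi>) \<partial>lborel)"
      using u by (intro nn_integral_cong) (simp add: norm_mult indicator_def mult.assoc)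
    also have "\<dots> = (\<integral>\<^sup>+\<xi>. ?F \<xi> \<partial>lborel)" by (rule nn_integral_lborel_rotate) (measurable, use u in simp)
    also have "\<dots> \<le> ennreal (C * (1 - norm z) powr (1 + \<eta> - A))" using z by (intro C(2)) auto
    finally show "(\<integral>\<^sup>+\<xi>. indicator disc \<xi> * ennreal ((1 - norm \<xi>) powr (\<eta> - 1) * norm (1 - cnj z * \<xi>) powr (- A)) \<partial>lborel)
       \<le> ennreal (C * (1 - norm z) powr (1 + \<eta> - A))" .
  qed
qed

section \<open>Mean values of holomorphic functions\<close>

lemma cnj_measurable [measurable]: "cnj \<in> borel_measurable borel"
  by (intro borel_measurable_continuous_onI continuous_intros)

lemma cball_borel [measurable]: "cball (z::complex) r \<in> sets borel"
  by simp

lemma rotation_invariant_orthogonal: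
  fixes N :: "complex measure"
  assumes id [measurable]: "(\<lambda>x. x) \<in> N \<rightarrow>\<^sub>M borel"
    and rot: "\<And>c. norm c = 1 \<Longrightarrow> (*) c \<in> N \<rightarrow>\<^sub>M N" "\<And>c. norm c = 1 \<Longrightarrow> distr N N ((*) c) = N"
    and "m \<noteq> n"
  shows "(\<integral>\<zeta>. indicator (cball 0 \<rho>) \<zeta> *\<^sub>R (\<zeta> ^ m * cnj \<zeta> ^ n) \<partial>N) = 0"
proof -
  \<comment> \<open>The rotation by this angle changes the sign of the integrand.\<close>
  define c where "c = cis (pi / (real m - real n))"
  have c: "norm c = 1" by (simp add: c_def)
  have [measurable]: "(*) c \<in> N \<rightarrow>\<^sub>M N" using rot c by auto
  define x where "x = pi / (real m - real n)"
  have "c ^ m * cnj c ^ n = cis (real m * x) * cis (real n * - x)"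
    by (simp only: c_def x_def cis_cnj Complex.DeMoivre)
  also have "\<dots> = cis (real m * x + real n * - x)" by (rule cis_mult)
  also have "real m * x + real n * - x = (real m - real n) * x" by (simp add: algebra_simps)
  also have "\<dots> = pi" using \<open>m \<noteq> n\<close> by (simp add: x_def)
  finally have "c ^ m * cnj c ^ n = cis pi" .
  then have c1: "c ^ m * cnj c ^ n = -1" by simp
  let ?f = "\<lambda>\<zeta>. indicator (cball 0 \<rho>) \<zeta> *\<^sub>R (\<zeta> ^ m * cnj \<zeta> ^ n) :: complex"
  have [measurable]: "?f \<in> borel_measurable N"
    by (rule measurable_compose[OF id]) measurable
  have "(\<integral>\<zeta>. ?f \<zeta> \<partial>N) = (\<integral>\<zeta>. ?f \<zeta> \<partial>distr N N ((*) c))" using rot(2)[OF c] by simp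
  also have "\<dots> = (\<integral>\<zeta>. ?f (c * \<zeta>) \<partial>N)" by (rule integral_distr) simp_all
  also have "\<dots> = (\<integral>\<zeta>. (c ^ m * cnj c ^ n) * ?f \<zeta> \<partial>N)"
    using c by (intro Bochner_Integration.integral_cong) (auto simp: norm_mult indicator_def power_mult_distrib mult_ac)
  also have "\<dots> = - (\<integral>\<zeta>. ?f \<zeta> \<partial>N)" by (simp add: c1)
  finally show ?thesis by simp
qed

text \<open>
  Integration against a rotation-invariant measure extracts Taylor coefficients; for the
  exponent zero this is the area mean value property.
\<close>

lemma rotation_invariant_coefficient:
  fixes N :: "complex measure" and f :: "complex \<Rightarrow> complex"
  assumes id [measurable]: "(\<lambda>x. x) \<in> N \<rightarrow>\<^sub>M borel"
    and rot: "\<And>c. norm c = 1 \<Longrightarrow> (*) c \<in> N \<rightarrow>\<^sub>M N" "\<And>c. norm c = 1 \<Longrightarrow> distr N N ((*) c) = N"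
    and fin: "emeasure N (space N \<inter> cball 0 \<rho>) < \<infinity>"
    and f: "f holomorphic_on ball 0 R" and \<rho>: "0 \<le> \<rho>" "\<rho> < R"
  shows "(\<integral>\<zeta>. indicator (cball 0 \<rho>) \<zeta> *\<^sub>R (f \<zeta> * cnj \<zeta> ^ n) \<partial>N)
    = (deriv ^^ n) f 0 / fact n * (\<integral>\<zeta>. indicator (cball 0 \<rho>) \<zeta> *\<^sub>R of_real (norm \<zeta> ^ (2 * n)) \<partial>N)"
proof -
  define c where "c = (\<lambda>m. (deriv ^^ m) f 0 / fact m)"
  have sums: "(\<lambda>m. c m * \<zeta> ^ m) sums f \<zeta>" if "norm \<zeta> < R" for \<zeta>
    using holomorphic_power_series[OF f, of \<zeta>] that by (simp add: c_def)
  have summ: "summable (\<lambda>m. norm (c m) * \<rho> ^ m)"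
  proof -
    have n: "norm (of_real ((\<rho> + R) / 2) :: complex) = (\<rho> + R) / 2"
      using \<rho> by (subst norm_of_real) simp
    have "summable (\<lambda>m. c m * (of_real ((\<rho> + R) / 2)) ^ m)"
      by (rule sums_summable[OF sums]) (simp only: n, use \<rho> in simp)
    then have "summable (\<lambda>m. norm (c m * (of_real \<rho>) ^ m))"
      by (rule powser_insidea) (simp only: n, use \<rho> in simp)
    then show ?thesis using \<rho> by (simp add: norm_mult norm_power)
  qed
  define B where "B = cball (0::complex) \<rho>"
  have [measurable]: "B \<in> sets borel" by (simp add: B_def)
  have BN: "space N \<inter> B \<in> sets N" using measurable_sets[OF id, of B] by (simp add: vimage_def Int_def conj_commute)
  let ?g = "\<lambda>m \<zeta>. indicator B \<zeta> *\<^sub>R (c m * \<zeta> ^ m * cnj \<zeta> ^ n) :: complex"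
  have [measurable]: "?g m \<in> borel_measurable N" for m
    by (rule measurable_compose[OF id]) measurable
  have indint: "integrable N (\<lambda>\<zeta>. indicator B \<zeta> * K :: real)" for K
  proof -
    have "integrable N (\<lambda>\<zeta>. indicator (space N \<inter> B) \<zeta> * K)"
      using BN fin by (intro integrable_mult_left integrable_real_indicator) (auto simp: B_def)
    then show ?thesis
      by (rule Bochner_Integration.integrable_cong[THEN iffD1, rotated -1]) (auto simp: indicator_def)
  qed
  have bd: "norm (?g m \<zeta>) \<le> indicator B \<zeta> * (norm (c m) * \<rho> ^ m * \<rho> ^ n)" for m \<zeta>
    using \<rho> by (auto simp: B_def indicator_def norm_mult norm_power intro!: mult_mono power_mono)
  have gint: "integrable N (?g m)" for m
    by (rule Bochner_Integration.integrable_bound[OF indint[of "norm (c m) * \<rho> ^ m * \<rho> ^ n"]]) (use bd \<rho> in \<open>auto intro: order_trans\<close>)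
  have suminf: "(\<Sum>m. ?g m \<zeta>) = indicator B \<zeta> *\<^sub>R (f \<zeta> * cnj \<zeta> ^ n)" for \<zeta>
  proof (cases "\<zeta> \<in> B")
    case True
    then have "(\<lambda>m. c m * \<zeta> ^ m * cnj \<zeta> ^ n) sums (f \<zeta> * cnj \<zeta> ^ n)"
      using \<rho> by (intro sums_mult2 sums) (auto simp: B_def)
    then show ?thesis using True by (simp add: sums_iff)
  qed simp
  have "(\<lambda>m. integral\<^sup>L N (?g m)) sums (\<integral>\<zeta>. (\<Sum>m. ?g m \<zeta>) \<partial>N)"
  proof (rule sums_integral[OF gint])
    show "AE \<zeta> in N. summable (\<lambda>m. norm (?g m \<zeta>))"
    proof (rule AE_I2)
      fix \<zeta>
      show "summable (\<lambda>m. norm (?g m \<zeta>))"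
      proof (rule summable_comparison_test'[where g="\<lambda>m. norm (c m) * \<rho> ^ m * \<rho> ^ n"])
        show "summable (\<lambda>m. norm (c m) * \<rho> ^ m * \<rho> ^ n)" by (intro summable_mult2 summ)
        show "norm (norm (?g m \<zeta>)) \<le> norm (c m) * \<rho> ^ m * \<rho> ^ n" for m
          using bd[of \<zeta> m] \<rho> by (auto simp: indicator_def split: if_splits)
      qed
    qed
    show "summable (\<lambda>m. \<integral>\<zeta>. norm (?g m \<zeta>) \<partial>N)"
    proof (rule summable_comparison_test'[where g="\<lambda>m. norm (c m) * \<rho> ^ m * (\<rho> ^ n * integral\<^sup>L N (\<lambda>\<zeta>. indicator B \<zeta> * 1))"])
      show "summable (\<lambda>m. norm (c m) * \<rho> ^ m * (\<rho> ^ n * integral\<^sup>L N (\<lambda>\<zeta>. indicator B \<zeta> * 1)))"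
        by (intro summable_mult2 summ)
      show "norm (\<integral>\<zeta>. norm (?g m \<zeta>) \<partial>N) \<le> norm (c m) * \<rho> ^ m * (\<rho> ^ n * integral\<^sup>L N (\<lambda>\<zeta>. indicator B \<zeta> * 1))" for m
      proof -
        have "(\<integral>\<zeta>. norm (?g m \<zeta>) \<partial>N) \<le> (\<integral>\<zeta>. indicator B \<zeta> * (norm (c m) * \<rho> ^ m * \<rho> ^ n) \<partial>N)"
          by (intro integral_mono indint integrable_norm gint bd)
        also have "\<dots> = (\<integral>\<zeta>. (norm (c m) * \<rho> ^ m * \<rho> ^ n) * (indicator B \<zeta> * 1) \<partial>N)"
          by (simp add: mult.commute)
        also have "\<dots> = norm (c m) * \<rho> ^ m * (\<rho> ^ n * integral\<^sup>L N (\<lambda>\<zeta>. indicator B \<zeta> * 1))"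
          by (subst integral_mult_right_zero) (simp only: mult.assoc)
        finally show ?thesis by (simp add: integral_nonneg_AE)
      qed
    qed
  qed
  moreover have "integral\<^sup>L N (?g m) = (if m = n then c n * (\<integral>\<zeta>. indicator B \<zeta> *\<^sub>R of_real (norm \<zeta> ^ (2 * n)) \<partial>N) else 0)" for m
  proof -
    have "integral\<^sup>L N (?g m) = (\<integral>\<zeta>. c m * (indicator B \<zeta> *\<^sub>R (\<zeta> ^ m * cnj \<zeta> ^ n)) \<partial>N)"
      by (intro Bochner_Integration.integral_cong) auto
    also have "\<dots> = c m * (\<integral>\<zeta>. (indicator B \<zeta> *\<^sub>R (\<zeta> ^ m * cnj \<zeta> ^ n)) \<partial>N)"
      by (rule integral_mult_right_zero)
    finally have 1: "integral\<^sup>L N (?g m) = c m * (\<integral>\<zeta>. (indicator B \<zeta> *\<^sub>R (\<zeta> ^ m * cnj \<zeta> ^ n)) \<partial>N)" .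
    show ?thesis
    proof (cases "m = n")
      case True
      have "\<zeta> ^ n * cnj \<zeta> ^ n = of_real (norm \<zeta> ^ (2 * n))" for \<zeta>
        by (simp add: power_mult_distrib[symmetric] complex_norm_square[symmetric] power_mult)
      then show ?thesis using 1 True by simp
    next
      case False
      then show ?thesis using 1 rotation_invariant_orthogonal[OF id rot False, of \<rho>] by (simp add: B_def)
    qed
  qed
  ultimately have "(\<lambda>m. if m = n then c n * (\<integral>\<zeta>. indicator B \<zeta> *\<^sub>R of_real (norm \<zeta> ^ (2 * n)) \<partial>N) else 0)
      sums (\<integral>\<zeta>. indicator B \<zeta> *\<^sub>R (f \<zeta> * cnj \<zeta> ^ n) \<partial>N)"
    by (simp only: suminf)
  then show ?thesis
    using sums_single[of n "\<lambda>_. c n * (\<integral>\<zeta>. indicator B \<zeta> *\<^sub>R of_real (norm \<zeta> ^ (2 * n)) \<partial>N)"]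
    by (auto simp: B_def c_def dest: sums_unique2)
qed

lemma mean_value_L1_origin:
  assumes f: "f holomorphic_on ball 0 r" and r: "0 < r"
  shows "ennreal (norm (f 0) * r\<^sup>2) \<le> 2 * (\<integral>\<^sup>+\<xi>. indicator (ball 0 r) \<xi> * ennreal (norm (f \<xi>)) \<partial>lborel)"
proof -
  \<comment> \<open>A closed disc inside, on which \<open>f\<close> is integrable; its area is at least \<open>r\<^sup>2 / 2\<close>.\<close>
  let ?B = "cball (0::complex) (r/2)"
  have cont: "continuous_on ?B f"
    using holomorphic_on_imp_continuous_on[OF f] by (rule continuous_on_subset) (use r in auto)
  have fin: "emeasure lborel ?B < \<infinity>" by (rule emeasure_bounded_finite) simp
  have eq: "(\<integral>\<zeta>. indicator ?B \<zeta> *\<^sub>R f \<zeta> \<partial>lborel) = f 0 * (\<integral>\<zeta>. indicator ?B \<zeta> *\<^sub>R of_real 1 \<partial>lborel)"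
    using rotation_invariant_coefficient[of lborel "r/2" f r 0] fin f r lborel_distr_rotate
    by (simp add: scaleR_conv_of_real mult.commute cong: distr_cong)
  have m: "measure lborel ?B = pi * (r/2)\<^sup>2"
    using r by (simp add: content_cball unit_ball_vol_2)
  have "(\<integral>\<zeta>. indicator ?B \<zeta> *\<^sub>R (of_real 1::complex) \<partial>lborel) = of_real (pi * (r/2)\<^sup>2)"
    using m by (simp add: scaleR_conv_of_real)
  then have "norm (\<integral>\<zeta>. indicator ?B \<zeta> *\<^sub>R f \<zeta> \<partial>lborel) = norm (f 0) * (pi * (r/2)\<^sup>2)"
    unfolding eq by (simp only: norm_mult norm_of_real) simp
  then have "ennreal (norm (f 0) * (pi * (r/2)\<^sup>2)) = ennreal (norm (\<integral>\<zeta>. indicator ?B \<zeta> *\<^sub>R f \<zeta> \<partial>lborel))"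
    by simp
  also have "\<dots> \<le> (\<integral>\<^sup>+\<zeta>. ennreal (norm (indicator ?B \<zeta> *\<^sub>R f \<zeta>)) \<partial>lborel)"
  proof (rule integral_norm_bound_ennreal)
    have "set_integrable lborel ?B f"
      unfolding set_integrable_def by (rule borel_integrable_compact) (use cont in auto)
    then show "integrable lborel (\<lambda>\<zeta>. indicator ?B \<zeta> *\<^sub>R f \<zeta>)" by (simp add: set_integrable_def)
  qed
  also have "\<dots> \<le> (\<integral>\<^sup>+\<xi>. indicator (ball 0 r) \<xi> * ennreal (norm (f \<xi>)) \<partial>lborel)"
    using r by (intro nn_integral_mono) (auto simp: indicator_def)
  finally have 1: "ennreal (norm (f 0) * (pi * (r/2)\<^sup>2)) \<le> (\<integral>\<^sup>+\<xi>. indicator (ball 0 r) \<xi> * ennreal (norm (f \<xi>)) \<partial>lborel)" .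
  have "norm (f 0) * r\<^sup>2 \<le> 2 * (norm (f 0) * (pi * (r/2)\<^sup>2))"
  proof -
    have "norm (f 0) * r\<^sup>2 * 2 \<le> norm (f 0) * r\<^sup>2 * pi" using pi_ge_two by (intro mult_left_mono) auto
    moreover have "2 * (norm (f 0) * (pi * (r/2)\<^sup>2)) = norm (f 0) * r\<^sup>2 * pi / 2" by (simp add: power_divide)
    ultimately show ?thesis by linarith
  qed
  then have "ennreal (norm (f 0) * r\<^sup>2) \<le> ennreal (2 * (norm (f 0) * (pi * (r/2)\<^sup>2)))" by (rule ennreal_leI)
  also have "\<dots> = 2 * ennreal (norm (f 0) * (pi * (r/2)\<^sup>2))" by (simp add: ennreal_mult)
  also have "\<dots> \<le> 2 * (\<integral>\<^sup>+\<xi>. indicator (ball 0 r) \<xi> * ennreal (norm (f \<xi>)) \<partial>lborel)"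
    using 1 by (rule mult_left_mono) simp
  finally show ?thesis .
qed

lemma borel_measurable_indicator_holomorphic:
  assumes "f holomorphic_on ball z r"
  shows "(\<lambda>\<xi>. indicator (ball z r) \<xi> *\<^sub>R f \<xi>) \<in> borel_measurable borel"
  using holomorphic_on_imp_continuous_on[OF assms]
  by (intro borel_measurable_continuous_on_indicator) auto

lemma borel_measurable_indicator_norm:
  fixes f :: "complex \<Rightarrow> complex"
  assumes "(\<lambda>\<xi>. indicator S \<xi> *\<^sub>R f \<xi>) \<in> borel_measurable M" "S \<in> sets M"
  shows "(\<lambda>\<xi>. indicator S \<xi> * ennreal (norm (f \<xi>) powr s)) \<in> borel_measurable M"
proof -
  note [measurable] = assms
  have "(\<lambda>\<xi>. indicator S \<xi> * ennreal (norm (indicator S \<xi> *\<^sub>R f \<xi>) powr s)) \<in> borel_measurable M"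
    by measurable
  moreover have "indicator S \<xi> * ennreal (norm (indicator S \<xi> *\<^sub>R f \<xi>) powr s) = indicator S \<xi> * ennreal (norm (f \<xi>) powr s)" for \<xi>
    by (auto simp: indicator_def)
  ultimately show ?thesis by simp
qed

lemma mean_value_L1:
  assumes f: "f holomorphic_on ball z r" and r: "0 < r"
  shows "ennreal (norm (f z) * r\<^sup>2) \<le> 2 * (\<integral>\<^sup>+\<xi>. indicator (ball z r) \<xi> * ennreal (norm (f \<xi>)) \<partial>lborel)"
proof -
  have f': "(\<lambda>\<xi>. f (z + \<xi>)) holomorphic_on ball 0 r"
    by (rule holomorphic_on_compose_gen[OF _ f, unfolded o_def]) (auto intro!: holomorphic_intros simp: dist_norm)
  have [measurable]: "(\<lambda>\<xi>. indicator (ball z r) \<xi> * ennreal (norm (f \<xi>))) \<in> borel_measurable borel"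
    using borel_measurable_indicator_norm[OF borel_measurable_indicator_holomorphic[OF f], of 1]
    by simp
  have "(\<integral>\<^sup>+\<xi>. indicator (ball z r) \<xi> * ennreal (norm (f \<xi>)) \<partial>lborel)
    = (\<integral>\<^sup>+\<xi>. indicator (ball z r) \<xi> * ennreal (norm (f \<xi>)) \<partial>distr lborel borel ((+) z))"
    by (simp add: lborel_distr_plus)
  also have "\<dots> = (\<integral>\<^sup>+\<xi>. indicator (ball z r) (z + \<xi>) * ennreal (norm (f (z + \<xi>))) \<partial>lborel)"
    by (subst nn_integral_distr) auto
  also have "\<dots> = (\<integral>\<^sup>+\<xi>. indicator (ball 0 r) \<xi> * ennreal (norm (f (z + \<xi>))) \<partial>lborel)"
    by (intro nn_integral_cong) (auto simp: indicator_def dist_norm)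
  finally show ?thesis using mean_value_L1_origin[OF f' r] by simp
qed

text \<open>
  By \<open>|f| \<le> t\<^bsup>1-s\<^esup> |f|\<^bsup>s\<^esup> + t\<close> the mean value bound for \<open>|f|\<close> passes to \<open>|f|\<^bsup>s\<^esup>\<close>; with
  \<open>t = |f z| / (4 \<pi>)\<close> the integral of the second term is absorbed by the left-hand side.
\<close>

lemma submean_power_ge_1:
  fixes f :: "complex \<Rightarrow> complex"
  assumes f: "f holomorphic_on ball z r" and r: "0 < r" and s: "1 \<le> s"
    and I: "(\<integral>\<^sup>+\<xi>. indicator (ball z r) \<xi> * ennreal (norm (f \<xi>) powr s) \<partial>lborel) = ennreal I" "0 \<le> I"
  shows "norm (f z) powr s * r\<^sup>2 \<le> 4 * (4 * pi) powr (s - 1) * I"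
proof (cases "f z = 0")
  case True
  then show ?thesis using I s by simp
next
  case False
  define a where "a = norm (f z)"
  have a: "0 < a" using False by (simp add: a_def)
  define t where "t = a / (4 * pi)"
  have t: "0 < t" using a by (simp add: t_def)
  have [measurable]: "(\<lambda>\<xi>. indicator (ball z r) \<xi> * ennreal (norm (f \<xi>) powr s)) \<in> borel_measurable borel"
    by (intro borel_measurable_indicator_norm borel_measurable_indicator_holomorphic f) auto
  have "(\<integral>\<^sup>+\<xi>. indicator (ball z r) \<xi> * ennreal (norm (f \<xi>)) \<partial>lborel)
     \<le> (\<integral>\<^sup>+\<xi>. ennreal (t powr (1 - s)) * (indicator (ball z r) \<xi> * ennreal (norm (f \<xi>) powr s)) + ennreal t * indicator (ball z r) \<xi> \<partial>lborel)"
  proof (rule nn_integral_mono)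
    fix \<xi>
    have "norm (f \<xi>) \<le> t powr (1 - s) * norm (f \<xi>) powr s + t"
    proof (cases "norm (f \<xi>) \<le> t")
      case False
      then have "norm (f \<xi>) = norm (f \<xi>) powr (1 - s) * norm (f \<xi>) powr s"
        using t by (simp add: powr_add[symmetric])
      also have "\<dots> \<le> t powr (1 - s) * norm (f \<xi>) powr s"
        using False t s by (intro mult_right_mono powr_mono2') auto
      finally show ?thesis using t by simp
    qed (use t in \<open>simp add: add_increasing\<close>)
    then have "ennreal (norm (f \<xi>)) \<le> ennreal (t powr (1 - s)) * ennreal (norm (f \<xi>) powr s) + ennreal t"
      using t by (simp add: ennreal_mult''[symmetric] ennreal_plus[symmetric] ennreal_leI del: ennreal_plus)
    then show "indicator (ball z r) \<xi> * ennreal (norm (f \<xi>)) \<le> ennreal (t powr (1 - s)) * (indicator (ball z r) \<xi> * ennreal (norm (f \<xi>) powr s)) + ennreal t * indicator (ball z r) \<xi>"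
      by (simp add: indicator_def)
  qed
  also have "\<dots> = ennreal (t powr (1 - s)) * ennreal I + ennreal t * emeasure lborel (ball z r)"
    by (subst nn_integral_add) (auto simp: nn_integral_cmult nn_integral_cmult_indicator I)
  also have "emeasure lborel (ball z r) = ennreal (pi * r\<^sup>2)"
    using r by (simp add: emeasure_ball unit_ball_vol_2)
  also have "ennreal (t powr (1 - s)) * ennreal I + ennreal t * ennreal (pi * r\<^sup>2) = ennreal (t powr (1 - s) * I + t * (pi * r\<^sup>2))"
    using I t by (simp add: ennreal_mult''[symmetric] ennreal_plus[symmetric] del: ennreal_plus)
  finally have "ennreal (a * r\<^sup>2) \<le> 2 * ennreal (t powr (1 - s) * I + t * (pi * r\<^sup>2))"
    using mean_value_L1[OF f r] unfolding a_def by (meson mult_left_mono order_trans zero_le)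
  also have "\<dots> = ennreal (2 * (t powr (1 - s) * I + t * (pi * r\<^sup>2)))"
    using I t by (simp add: ennreal_mult)
  finally have "a * r\<^sup>2 \<le> 2 * (t powr (1 - s) * I + t * (pi * r\<^sup>2))"
    using I t by (subst (asm) ennreal_le_iff) auto
  moreover have "2 * (t * (pi * r\<^sup>2)) = a * r\<^sup>2 / 2" by (simp add: t_def)
  moreover have "u \<le> 4 * v" if "u \<le> 2 * (v + w)" "2 * w = u / 2" for u v w :: real
    using that by simp
  ultimately have 1: "a * r\<^sup>2 \<le> 4 * (t powr (1 - s) * I)" by blast
  have "t powr (1 - s) = a powr (1 - s) * (4 * pi) powr (s - 1)"
    using a by (simp add: t_def powr_divide powr_diff divide_simps)
  with 1 have "a powr (s - 1) * (a * r\<^sup>2) \<le> a powr (s - 1) * (4 * (a powr (1 - s) * (4 * pi) powr (s - 1) * I))"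
    by (intro mult_left_mono) auto
  also have "\<dots> = (a powr (s - 1) * a powr (1 - s)) * (4 * (4 * pi) powr (s - 1) * I)" by (simp only: mult_ac)
  also have "a powr (s - 1) * a powr (1 - s) = 1" using a by (simp add: powr_add[symmetric])
  also have "a powr (s - 1) * (a * r\<^sup>2) = a powr s * r\<^sup>2"
    using a by (simp add: powr_diff)
  finally show ?thesis by (simp add: a_def)
qed

text \<open>
  For small exponents \<open>|f|\<close> is estimated at a point where \<open>(R - |\<xi> - z|)\<^bsup>2/s\<^esup> |f \<xi>|\<close> is
  maximal: there the factor \<open>|f|\<^bsup>1-s\<^esup>\<close> of the integrand is absorbed by the maximum.
\<close>

lemma submean_power_less_1:
  fixes f :: "complex \<Rightarrow> complex"
  assumes f: "f holomorphic_on ball z r" and r: "0 < r" and s: "0 < s" "s < 1"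
    and I: "(\<integral>\<^sup>+\<xi>. indicator (ball z r) \<xi> * ennreal (norm (f \<xi>) powr s) \<partial>lborel) = ennreal I" "0 \<le> I"
  shows "norm (f z) powr s * r\<^sup>2 \<le> 4 * (2 * 2 powr (2 / s)) * I"
proof -
  define R where "R = r / 2"
  have R: "0 < R" "R < r" using r by (auto simp: R_def)
  let ?\<phi> = "\<lambda>\<xi>. (R - dist z \<xi>) powr (2 / s) * norm (f \<xi>)"
  have [measurable]: "(\<lambda>\<xi>. indicator (ball z r) \<xi> * ennreal (norm (f \<xi>) powr s)) \<in> borel_measurable borel"
    by (intro borel_measurable_indicator_norm borel_measurable_indicator_holomorphic f) auto
  have "continuous_on (cball z R) f"
    using holomorphic_on_imp_continuous_on[OF f] by (rule continuous_on_subset) (use R in auto)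
  then have "continuous_on (cball z R) ?\<phi>"
    using s by (intro continuous_intros continuous_on_powr') auto
  then obtain x where x: "x \<in> cball z R" "\<And>y. y \<in> cball z R \<Longrightarrow> ?\<phi> y \<le> ?\<phi> x"
    using continuous_attains_sup[of "cball z R" ?\<phi>] R by auto
  define M where "M = ?\<phi> x"
  have Mz: "R powr (2 / s) * norm (f z) \<le> M" using x(2)[of z] R by (simp add: M_def)
  show ?thesis
  proof (cases "f z = 0")
    case True
    then show ?thesis using I s by simp
  next
    case False
    have M: "0 < M" using Mz R False by (smt (verit) mult_pos_pos powr_gt_zero zero_less_norm_iff)
    define \<rho> where "\<rho> = (R - dist z x) / 2"
    have \<rho>: "0 < \<rho>" using M x(1) by (cases "dist z x = R") (auto simp: M_def \<rho>_def)
    have sub: "y \<in> ball z r \<and> norm (f y) \<le> M * \<rho> powr (- (2 / s))" if "y \<in> ball x \<rho>" for y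
    proof -
      have "dist z y \<le> dist z x + dist x y" by (rule dist_triangle)
      then have d: "\<rho> \<le> R - dist z y" using that by (simp add: \<rho>_def field_simps)
      have "\<rho> powr (2 / s) * norm (f y) \<le> ?\<phi> y" using d \<rho> s by (intro mult_right_mono powr_mono2) auto
      also have "\<dots> \<le> M" using x(2)[of y] d \<rho> by (simp add: M_def)
      finally have "norm (f y) \<le> M * \<rho> powr (- (2 / s))" using \<rho> by (simp add: powr_minus field_simps)
      then show ?thesis using d \<rho> R by simp
    qed
    have fx: "f holomorphic_on ball x \<rho>" by (rule holomorphic_on_subset[OF f]) (use sub in auto)
    define K where "K = M powr (1 - s) * \<rho> powr (2 - 2 / s)"
    have "(\<integral>\<^sup>+\<xi>. indicator (ball x \<rho>) \<xi> * ennreal (norm (f \<xi>)) \<partial>lborel)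
      \<le> (\<integral>\<^sup>+\<xi>. ennreal K * (indicator (ball z r) \<xi> * ennreal (norm (f \<xi>) powr s)) \<partial>lborel)"
    proof (rule nn_integral_mono)
      fix \<xi>
      show "indicator (ball x \<rho>) \<xi> * ennreal (norm (f \<xi>)) \<le> ennreal K * (indicator (ball z r) \<xi> * ennreal (norm (f \<xi>) powr s))"
      proof (cases "\<xi> \<in> ball x \<rho>")
        case True
        have "norm (f \<xi>) = norm (f \<xi>) powr (1 - s) * norm (f \<xi>) powr s"
          by (cases "f \<xi> = 0") (auto simp: powr_add[symmetric])
        also have "\<dots> \<le> (M * \<rho> powr (- (2 / s))) powr (1 - s) * norm (f \<xi>) powr s"
          using sub[OF True] s by (intro mult_right_mono powr_mono2) auto
        also have "(M * \<rho> powr (- (2 / s))) powr (1 - s) = M powr (1 - s) * \<rho> powr (- (2 / s) * (1 - s))"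
          using M \<rho> by (simp add: powr_mult powr_powr)
        also have "- (2 / s) * (1 - s) = 2 - 2 / s" using s by (simp add: field_simps)
        finally have "ennreal (norm (f \<xi>)) \<le> ennreal K * ennreal (norm (f \<xi>) powr s)"
          by (simp add: K_def ennreal_mult''[symmetric] ennreal_leI)
        then show ?thesis using True sub[OF True] by simp
      qed simp
    qed
    also have "\<dots> = ennreal K * ennreal I" by (simp add: nn_integral_cmult I)
    finally have "ennreal (norm (f x) * \<rho>\<^sup>2) \<le> 2 * (ennreal K * ennreal I)"
      using mean_value_L1[OF fx \<rho>] by (meson mult_left_mono order_trans zero_le)
    also have "\<dots> = ennreal (2 * (K * I))" using I by (simp add: ennreal_mult K_def)
    finally have "norm (f x) * \<rho>\<^sup>2 \<le> 2 * (K * I)"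
      using I by (subst (asm) ennreal_le_iff) (auto simp: K_def)
    then have "norm (f x) * \<rho> powr 2 * \<rho> powr (2 / s - 2) \<le> 2 * (K * I) * \<rho> powr (2 / s - 2)"
      using \<rho> by (intro mult_right_mono) auto
    also have "\<dots> = 2 * (M powr (1 - s) * (\<rho> powr (2 - 2 / s) * \<rho> powr (2 / s - 2)) * I)"
      by (simp add: K_def mult_ac)
    also have "\<rho> powr (2 - 2 / s) * \<rho> powr (2 / s - 2) = 1" using \<rho> by (simp add: powr_add[symmetric])
    also have "norm (f x) * \<rho> powr 2 * \<rho> powr (2 / s - 2) = norm (f x) * \<rho> powr (2 / s)"
      by (simp add: mult.assoc powr_add[symmetric])
    finally have 1: "norm (f x) * \<rho> powr (2 / s) \<le> 2 * (M powr (1 - s) * I)" by simp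
    have "2 * \<rho> = R - dist z x" by (simp add: \<rho>_def)
    then have "M = (2 * \<rho>) powr (2 / s) * norm (f x)" by (simp only: M_def)
    also have "\<dots> = 2 powr (2 / s) * (norm (f x) * \<rho> powr (2 / s))" using \<rho> by (simp add: powr_mult)
    also have "\<dots> \<le> 2 powr (2 / s) * (2 * (M powr (1 - s) * I))" using 1 by (intro mult_left_mono) auto
    finally have "M powr (s - 1) * M \<le> M powr (s - 1) * (2 powr (2 / s) * (2 * (M powr (1 - s) * I)))"
      by (rule mult_left_mono) simp
    also have "\<dots> = (M powr (s - 1) * M powr (1 - s)) * (2 * 2 powr (2 / s) * I)" by (simp only: mult_ac)
    also have "M powr (s - 1) * M powr (1 - s) = 1" using M by (simp add: powr_add[symmetric])
    also have "M powr (s - 1) * M = M powr s" using M by (simp add: powr_diff)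
    finally have 2: "M powr s \<le> 2 * 2 powr (2 / s) * I" by simp
    have "R\<^sup>2 * norm (f z) powr s = (R powr (2 / s) * norm (f z)) powr s"
      using R s by (simp add: powr_mult powr_powr powr_numeral)
    also have "\<dots> \<le> M powr s" using Mz R s by (intro powr_mono2) auto
    finally show ?thesis using 2 by (simp add: R_def power_divide mult.commute)
  qed
qed

lemma submean_power:
  fixes s :: real
  assumes "0 < s"
  obtains C where "0 < C"
    "\<And>f z r. 0 < r \<Longrightarrow> f holomorphic_on ball z r \<Longrightarrow>
      ennreal (norm (f z) powr s * r\<^sup>2) \<le> ennreal C * (\<integral>\<^sup>+\<xi>. indicator (ball z r) \<xi> * ennreal (norm (f \<xi>) powr s) \<partial>lborel)"
proof -
  define C where "C = (if s < 1 then 4 * (2 * 2 powr (2 / s)) else 4 * (4 * pi) powr (s - 1))"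
  have C: "0 < C" by (simp add: C_def)
  show ?thesis
  proof (rule that[OF C])
    fix f :: "complex \<Rightarrow> complex" and z :: complex and r :: real
    assume r: "0 < r" and f: "f holomorphic_on ball z r"
    define J where "J = (\<integral>\<^sup>+\<xi>. indicator (ball z r) \<xi> * ennreal (norm (f \<xi>) powr s) \<partial>lborel)"
    show "ennreal (norm (f z) powr s * r\<^sup>2) \<le> ennreal C * (\<integral>\<^sup>+\<xi>. indicator (ball z r) \<xi> * ennreal (norm (f \<xi>) powr s) \<partial>lborel)"
    proof (cases J)
      case (real I)
      have "norm (f z) powr s * r\<^sup>2 \<le> C * I"
        using submean_power_ge_1[OF f r, of s I] submean_power_less_1[OF f r, of s I] real assms
        by (cases "s < 1") (auto simp: C_def J_def)
      then show ?thesis using real C by (auto simp: J_def ennreal_mult''[symmetric] ennreal_leI)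
    next
      case top
      then show ?thesis using C by (simp add: J_def ennreal_mult_top)
    qed
  qed
qed

section \<open>Regular weights\<close>

text \<open>
  All that is used of a regular weight: it is radial and comparable with \<open>\<Omega>(t) / t\<close> at distance
  \<open>t\<close> from the boundary, where \<open>\<Omega>\<close>, which stands for the tail of the weight, is monotone and
  grows between two positive powers of \<open>t\<close>. The lower growth bound is restricted to a bounded range,
  because the tail is constant from \<open>t = 1\<close> on, while distances \<open>|1 - cnj z * \<xi>|\<close> reach up to 2.
\<close>

locale regular_profile =
  fixes \<omega> :: "complex \<Rightarrow> real" and \<Omega> :: "real \<Rightarrow> real" and A M \<kappa> :: real
  assumes integrable_weight: "set_integrable lebesgue disc \<omega>"
    and radial: "\<And>z. z \<in> disc \<Longrightarrow> \<omega> z = \<omega> (of_real (norm z))"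
    and constants: "1 \<le> A" "0 < M" "0 < \<kappa>"
    and \<Omega>_mono: "mono \<Omega>"
    and \<Omega>_pos: "\<And>t. 0 < t \<Longrightarrow> 0 < \<Omega> t"
    and \<Omega>_upper: "\<And>s t. 0 < s \<Longrightarrow> s \<le> t \<Longrightarrow> \<Omega> t \<le> A * (t / s) powr M * \<Omega> s"
    and \<Omega>_lower: "\<And>s t. 0 < s \<Longrightarrow> s \<le> t \<Longrightarrow> t \<le> 4 \<Longrightarrow> \<Omega> s \<le> A * (s / t) powr \<kappa> * \<Omega> t"
    and weight_upper: "\<And>z. z \<in> disc \<Longrightarrow> \<omega> z \<le> A * (\<Omega> (1 - norm z) / (1 - norm z))"
    and weight_lower: "\<And>z. z \<in> disc \<Longrightarrow> \<Omega> (1 - norm z) / (1 - norm z) \<le> A * \<omega> z"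
begin

abbreviation \<nu> :: "complex measure" where "\<nu> \<equiv> weight_measure \<omega>"

text \<open>\<open>box_size h\<close> is comparable with the \<open>\<omega>\<close>-measure of a Carleson square of side \<open>h\<close>.\<close>

definition box_size :: "real \<Rightarrow> real" where "box_size t = t * \<Omega> t"

lemma \<Omega>_le: "s \<le> t \<Longrightarrow> \<Omega> s \<le> \<Omega> t"
  using \<Omega>_mono by (rule monoD)

lemma \<Omega>_measurable [measurable]: "\<Omega> \<in> borel_measurable borel"
  using \<Omega>_mono by (rule borel_measurable_mono)

lemma box_size_measurable [measurable]: "box_size \<in> borel_measurable borel"
  unfolding box_size_def by measurable

lemma box_size_pos: "0 < t \<Longrightarrow> 0 < box_size t"
  by (simp add: box_size_def \<Omega>_pos)

lemma box_size_mono: "0 < s \<Longrightarrow> s \<le> t \<Longrightarrow> box_size s \<le> box_size t"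
  unfolding box_size_def by (intro mult_mono \<Omega>_le) (auto intro: less_imp_le \<Omega>_pos)

lemma box_size_growth:
  assumes "0 < s" "s \<le> t" "t \<le> k * s"
  shows "box_size t \<le> A * k powr (M + 1) * box_size s"
proof -
  have k: "0 < k" using assms by (smt (verit) mult_nonpos_nonneg)
  have "box_size t \<le> (k * s) * (A * (t / s) powr M * \<Omega> s)"
    unfolding box_size_def using assms \<Omega>_pos[of t] \<Omega>_pos[of s] by (intro mult_mono \<Omega>_upper) auto
  also have "\<dots> \<le> (k * s) * (A * k powr M * \<Omega> s)"
    using assms constants k \<Omega>_pos[of s] by (intro mult_left_mono mult_right_mono powr_mono2) (auto simp: field_simps)
  also have "\<dots> = A * k powr (M + 1) * box_size s" using k by (simp add: powr_add box_size_def)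
  finally show ?thesis .
qed

lemma weight_nonneg: "z \<in> disc \<Longrightarrow> 0 \<le> \<omega> z"
proof -
  assume z: "z \<in> disc"
  then have "0 < \<Omega> (1 - norm z) / (1 - norm z)" by (simp add: \<Omega>_pos)
  also have "\<dots> \<le> A * \<omega> z" by (rule weight_lower[OF z])
  finally show "0 \<le> \<omega> z" using constants by (simp add: zero_less_mult_iff)
qed

lemma weight_measurable [measurable]:
  "\<omega> \<in> borel_measurable (lebesgue_on disc)"
  "(\<lambda>z. indicator disc z * \<omega> z) \<in> borel_measurable lebesgue"
proof -
  show 1: "(\<lambda>z. indicator disc z * \<omega> z) \<in> borel_measurable lebesgue"
    using integrable_weight by (auto simp: set_integrable_def)
  then show "\<omega> \<in> borel_measurable (lebesgue_on disc)"
    by (subst borel_measurable_restrict_space_iff) auto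
qed

lemma space_weight_measure [simp]: "space (weight_measure v) = disc"
  by (simp add: weight_measure_def space_restrict_space)

lemma sets_weight_measure: "sets (weight_measure v) = sets (lebesgue_on disc)"
  by (simp add: weight_measure_def)

lemma identity_measurable_weight_measure:
  "(\<lambda>x. x) \<in> weight_measure v \<rightarrow>\<^sub>M restrict_space borel disc"
proof (rule measurable_restrict_space2)
  have "(\<lambda>x. x) \<in> lebesgue_on disc \<rightarrow>\<^sub>M borel"
    by (intro measurable_restrict_space1 measurable_completion) simp
  then show "(\<lambda>x. x) \<in> weight_measure v \<rightarrow>\<^sub>M borel"
    by (simp add: measurable_cong_sets[OF sets_weight_measure])
qed simp

lemma identity_measurable_weight_measure' [measurable]: "(\<lambda>x. x) \<in> weight_measure v \<rightarrow>\<^sub>M borel"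
  by (rule measurable_compose[OF identity_measurable_weight_measure measurable_restrict_space1]) simp

lemma nn_integral_weight_measure:
  assumes F: "F \<in> borel_measurable \<nu>"
  shows "(\<integral>\<^sup>+z. F z \<partial>\<nu>) = (\<integral>\<^sup>+z. ennreal (\<omega> z / pi) * F z * indicator disc z \<partial>lborel)"
proof -
  have F': "F \<in> borel_measurable (lebesgue_on disc)"
    using F by (simp add: measurable_cong_sets[OF sets_weight_measure])
  have "(\<integral>\<^sup>+z. F z \<partial>\<nu>) = (\<integral>\<^sup>+z. ennreal (\<omega> z / pi) * F z \<partial>lebesgue_on disc)"
    unfolding weight_measure_def using F' by (subst nn_integral_density) auto
  also have "\<dots> = (\<integral>\<^sup>+z. ennreal (\<omega> z / pi) * F z * indicator disc z \<partial>lebesgue)"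
    by (subst nn_integral_restrict_space) auto
  finally show ?thesis by (simp add: nn_integral_completion)
qed

lemma nn_integral_weight_le:
  assumes F: "F \<in> borel_measurable \<nu>"
  shows "(\<integral>\<^sup>+z. F z \<partial>\<nu>) \<le> (\<integral>\<^sup>+z. indicator disc z * (ennreal (A * (\<Omega> (1 - norm z) / (1 - norm z))) * F z) \<partial>lborel)"
  unfolding nn_integral_weight_measure[OF F]
proof (rule nn_integral_mono)
  fix z
  show "ennreal (\<omega> z / pi) * F z * indicator disc z \<le> indicator disc z * (ennreal (A * (\<Omega> (1 - norm z) / (1 - norm z))) * F z)"
  proof (cases "z \<in> disc")
    case True
    have "\<omega> z / pi \<le> \<omega> z / 1" using weight_nonneg[OF True] pi_ge_two by (intro divide_left_mono) auto
    then have "ennreal (\<omega> z / pi) \<le> ennreal (A * (\<Omega> (1 - norm z) / (1 - norm z)))"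
      using weight_upper[OF True] by (intro ennreal_leI) simp
    then show ?thesis using True by (simp add: mult_right_mono)
  qed simp
qed

lemma nn_integral_weight_ge:
  assumes F: "F \<in> borel_measurable \<nu>"
  shows "(\<integral>\<^sup>+z. indicator disc z * (ennreal (1 / (4 * A) * (\<Omega> (1 - norm z) / (1 - norm z))) * F z) \<partial>lborel) \<le> (\<integral>\<^sup>+z. F z \<partial>\<nu>)"
  unfolding nn_integral_weight_measure[OF F]
proof (rule nn_integral_mono)
  fix z
  show "indicator disc z * (ennreal (1 / (4 * A) * (\<Omega> (1 - norm z) / (1 - norm z))) * F z) \<le> ennreal (\<omega> z / pi) * F z * indicator disc z"
  proof (cases "z \<in> disc")
    case True
    have "\<omega> z / 4 \<le> \<omega> z / pi" using weight_nonneg[OF True] pi_less_4 by (intro divide_left_mono) auto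
    moreover have "1 / (4 * A) * (\<Omega> (1 - norm z) / (1 - norm z)) \<le> 1 / (4 * A) * (A * \<omega> z)"
      using weight_lower[OF True] constants by (intro mult_left_mono) auto
    moreover have "1 / (4 * A) * (A * \<omega> z) = \<omega> z / 4" using constants by simp
    ultimately have "ennreal (1 / (4 * A) * (\<Omega> (1 - norm z) / (1 - norm z))) \<le> ennreal (\<omega> z / pi)"
      by (intro ennreal_leI) linarith
    then show ?thesis using True by (simp add: mult_right_mono)
  qed simp
qed

lemma finite_weight_measure: "finite_measure \<nu>"
proof
  have "emeasure \<nu> (space \<nu>) = (\<integral>\<^sup>+z. 1 \<partial>\<nu>)" by simp
  also have "\<dots> = (\<integral>\<^sup>+z. ennreal (\<omega> z / pi) * indicator disc z \<partial>lborel)"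
    by (subst nn_integral_weight_measure) auto
  also have "\<dots> \<le> (\<integral>\<^sup>+z. ennreal (norm (indicator disc z *\<^sub>R \<omega> z)) \<partial>lebesgue)"
    unfolding nn_integral_completion
  proof (rule nn_integral_mono)
    fix z
    show "ennreal (\<omega> z / pi) * indicator disc z \<le> ennreal (norm (indicator disc z *\<^sub>R \<omega> z))"
    proof (cases "z \<in> disc")
      case True
      have "\<omega> z / pi \<le> \<omega> z / 1" using weight_nonneg[OF True] pi_ge_two by (intro divide_left_mono) auto
      then show ?thesis using True by (auto intro!: ennreal_leI)
    qed simp
  qed
  also have "\<dots> < \<infinity>" using integrable_weight by (simp add: set_integrable_def integrable_iff_bounded)
  finally show "emeasure \<nu> (space \<nu>) \<noteq> \<infinity>" by simp
qed

lemma weight_measure_rotate: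
  assumes c: "norm c = 1"
  shows "(*) c \<in> \<nu> \<rightarrow>\<^sub>M \<nu>" "distr \<nu> \<nu> ((*) c) = \<nu>"
proof -
  have cc: "cnj c * c = 1"
    using c complex_norm_square[of c] by (simp add: mult.commute)
  have 1: "(*) c \<in> lebesgue_on disc \<rightarrow>\<^sub>M lebesgue_on disc"
    by (intro measurable_restrict_space3 lebesgue_distr_rotate c) (use c in \<open>auto simp: norm_mult\<close>)
  then show m: "(*) c \<in> \<nu> \<rightarrow>\<^sub>M \<nu>" by (simp add: measurable_cong_sets[OF sets_weight_measure sets_weight_measure])
  show "distr \<nu> \<nu> ((*) c) = \<nu>"
  proof (rule measure_eqI)
    fix S assume "S \<in> sets (distr \<nu> \<nu> ((*) c))"
    then have S [measurable]: "S \<in> sets \<nu>" by simp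
    then have Sd: "S \<subseteq> disc" using sets.sets_into_space[OF S] by simp
    let ?F = "\<lambda>z. ennreal (indicator disc z * \<omega> z / pi) * indicator S z"
    have Sl [measurable]: "S \<in> sets lebesgue" using S unfolding sets_weight_measure sets_restrict_space by (auto intro!: sets.Int)
    have "emeasure \<nu> S = (\<integral>\<^sup>+z. indicator S z \<partial>\<nu>)" by simp
    also have "\<dots> = (\<integral>\<^sup>+z. ?F z \<partial>lebesgue)"
      unfolding nn_integral_completion by (subst nn_integral_weight_measure) (auto intro!: nn_integral_cong simp: indicator_def)
    also have "\<dots> = (\<integral>\<^sup>+z. ?F z \<partial>distr lebesgue lebesgue ((*) c))" by (simp add: lebesgue_distr_rotate c)
    also have "\<dots> = (\<integral>\<^sup>+z. ?F (c * z) \<partial>lebesgue)"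
      by (rule nn_integral_distr) (use lebesgue_distr_rotate[OF c] in auto)
    also have "\<dots> = (\<integral>\<^sup>+z. indicator S (c * z) \<partial>\<nu>)"
    proof -
      have "(\<lambda>z. indicator S (c * z) :: ennreal) \<in> borel_measurable \<nu>"
        by (rule measurable_compose[OF m]) simp
      moreover have "?F (c * z) = ennreal (\<omega> z / pi) * indicator S (c * z) * indicator disc z" for z
      proof (cases "z \<in> disc")
        case True
        then have "c * z \<in> disc" using c by (simp add: norm_mult)
        then have "\<omega> (c * z) = \<omega> z" using radial[of "c * z"] radial[of z] True c by (simp add: norm_mult)
        then show ?thesis using True \<open>c * z \<in> disc\<close> by simp
      next
        case False
        then have "c * z \<notin> disc" using c by (simp add: norm_mult)
        then show ?thesis using False by simp
      qed
      ultimately show ?thesis by (simp add: nn_integral_weight_measure nn_integral_completion)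
    qed
    also have "\<dots> = (\<integral>\<^sup>+z. indicator S z \<partial>distr \<nu> \<nu> ((*) c))" using m by (subst nn_integral_distr) auto
    also have "\<dots> = emeasure (distr \<nu> \<nu> ((*) c)) S" by simp
    finally show "emeasure (distr \<nu> \<nu> ((*) c)) S = emeasure \<nu> S" by simp
  qed simp
qed

lemma continuous_measurable_weight_measure:
  assumes "continuous_on disc f"
  shows "f \<in> borel_measurable \<nu>"
  by (rule measurable_compose[OF identity_measurable_weight_measure borel_measurable_continuous_on_restrict[OF assms]])

lemma kernel_dist_bounds:
  assumes "z \<in> disc" "\<xi> \<in> disc"
  shows "1 - norm z \<le> norm (1 - cnj z * \<xi>)" "1 - norm \<xi> \<le> norm (1 - cnj z * \<xi>)"
    "norm (1 - cnj z * \<xi>) \<le> 2" "0 < norm (1 - cnj z * \<xi>)"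
proof -
  show 1: "1 - norm z \<le> norm (1 - cnj z * \<xi>)" "1 - norm \<xi> \<le> norm (1 - cnj z * \<xi>)"
    using one_minus_norm_le_dist_kernel[of z \<xi>] assms by auto
  show "0 < norm (1 - cnj z * \<xi>)" using 1(1) assms(1) by (simp only: mem_ball_0)
  have "norm z * norm \<xi> \<le> 1 * 1" using assms by (intro mult_mono) auto
  then show "norm (1 - cnj z * \<xi>) \<le> 2"
    using norm_triangle_ineq4[of 1 "cnj z * \<xi>"] by (simp add: norm_mult)
qed

text \<open>
  The growth conditions on \<open>\<Omega>\<close> trade the weighted integrand for powers of \<open>1 - |\<xi>|\<close> and
  \<open>|1 - cnj z * \<xi>|\<close>. The condition on \<open>\<beta>\<close> keeps the resulting power of \<open>1 - |\<xi>|\<close> above \<open>-1\<close>.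
\<close>

lemma weighted_forelli_rudin:
  fixes a \<beta> :: real
  assumes \<beta>: "0 \<le> \<beta>" "\<beta> < \<kappa> * (1 - \<beta>)" and a: "1 < a + \<beta>"
  obtains C where "0 < C"
    "\<And>z. z \<in> disc \<Longrightarrow>
      (\<integral>\<^sup>+\<xi>. ennreal (box_size (norm (1 - cnj z * \<xi>)) powr (- a) * box_size (1 - norm \<xi>) powr (- \<beta>)) \<partial>\<nu>)
      \<le> ennreal (C * box_size (1 - norm z) powr (1 - \<beta> - a))"
proof -
  define \<eta> where "\<eta> = \<kappa> * (1 - \<beta>) - \<beta>"
  have \<eta>: "0 < \<eta>" using \<beta> by (simp add: \<eta>_def)
  have \<beta>1: "\<beta> < 1" using \<beta> constants by (smt (verit) mult_nonneg_nonpos)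
  obtain C where C: "0 < C"
    "\<And>z. norm z < 1 \<Longrightarrow>
      (\<integral>\<^sup>+\<xi>. indicator disc \<xi> * ennreal ((1 - norm \<xi>) powr (\<eta> - 1) * norm (1 - cnj z * \<xi>) powr (- (\<eta> + \<beta> + a))) \<partial>lborel)
      \<le> ennreal (C * (1 - norm z) powr (1 + \<eta> - (\<eta> + \<beta> + a)))"
    using forelli_rudin[of \<eta> "\<eta> + \<beta> + a"] \<eta> a by (auto simp: algebra_simps)
  define K where "K = A * A powr (1 - \<beta>)"
  have K: "0 < K" using constants by (simp add: K_def)
  show ?thesis
  proof (rule that[of "K * C"])
    show "0 < K * C" using K C by simp
    fix z assume z: "z \<in> disc"
    define h where "h = 1 - norm z"
    have h: "0 < h" using z by (simp add: h_def)
    let ?F = "\<lambda>\<xi>. ennreal (box_size (norm (1 - cnj z * \<xi>)) powr (- a) * box_size (1 - norm \<xi>) powr (- \<beta>))"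
    let ?P = "\<lambda>\<xi>. (1 - norm \<xi>) powr (\<eta> - 1) * norm (1 - cnj z * \<xi>) powr (- (\<eta> + \<beta> + a))"
    have meas: "(\<lambda>\<xi>. indicator disc \<xi> * ennreal (?P \<xi>)) \<in> borel_measurable borel" by measurable
    have "(\<integral>\<^sup>+\<xi>. ?F \<xi> \<partial>\<nu>) \<le> (\<integral>\<^sup>+\<xi>. indicator disc \<xi> * (ennreal (A * (\<Omega> (1 - norm \<xi>) / (1 - norm \<xi>))) * ?F \<xi>) \<partial>lborel)"
      by (rule nn_integral_weight_le) measurable
    also have "\<dots> \<le> (\<integral>\<^sup>+\<xi>. ennreal (K * \<Omega> h powr (1 - \<beta> - a)) * (indicator disc \<xi> * ennreal (?P \<xi>)) \<partial>lborel)"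
    proof (rule nn_integral_mono)
      fix \<xi>
      show "indicator disc \<xi> * (ennreal (A * (\<Omega> (1 - norm \<xi>) / (1 - norm \<xi>))) * ?F \<xi>)
         \<le> ennreal (K * \<Omega> h powr (1 - \<beta> - a)) * (indicator disc \<xi> * ennreal (?P \<xi>))"
      proof (cases "\<xi> \<in> disc")
        case True
        define s d where "s = 1 - norm \<xi>" and "d = norm (1 - cnj z * \<xi>)"
        have s: "0 < s" using True by (simp add: s_def)
        have d: "h \<le> d" "s \<le> d" "d \<le> 2" "0 < d"
          using kernel_dist_bounds[OF z True] by (simp_all add: s_def d_def h_def)
        have p: "0 < \<Omega> s" "0 < \<Omega> d" "0 < \<Omega> h" using s d h by (simp_all add: \<Omega>_pos)
        have 1: "\<Omega> s powr (1 - \<beta>) \<le> (A * (s / d) powr \<kappa> * \<Omega> d) powr (1 - \<beta>)"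
          using p \<beta>1 s d by (intro powr_mono2 \<Omega>_lower) auto
        have 2: "(A * (s / d) powr \<kappa> * \<Omega> d) powr (1 - \<beta>) = A powr (1 - \<beta>) * (s / d) powr (\<kappa> * (1 - \<beta>)) * \<Omega> d powr (1 - \<beta>)"
          using p constants s d by (simp add: powr_mult powr_powr)
        have 3: "(s / d) powr (\<kappa> * (1 - \<beta>)) = s powr (\<eta> + \<beta>) * d powr (- (\<eta> + \<beta>))"
          using s d by (simp add: \<eta>_def powr_divide powr_minus divide_simps)
        have 4: "\<Omega> d powr (1 - \<beta> - a) \<le> \<Omega> h powr (1 - \<beta> - a)"
          using p d a by (intro powr_mono2' \<Omega>_le) auto
        have "A * (\<Omega> s / s) * (box_size d powr (- a) * box_size s powr (- \<beta>))
           = A * s powr (- \<beta> - 1) * d powr (- a) * \<Omega> d powr (- a) * \<Omega> s powr (1 - \<beta>)"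
          using s d p by (simp add: box_size_def powr_mult powr_diff powr_minus divide_simps)
        also have "\<dots> \<le> A * s powr (- \<beta> - 1) * d powr (- a) * \<Omega> d powr (- a) * (A powr (1 - \<beta>) * (s powr (\<eta> + \<beta>) * d powr (- (\<eta> + \<beta>))) * \<Omega> d powr (1 - \<beta>))"
          using 1 2 3 constants by (intro mult_left_mono) auto
        also have "\<dots> = K * ((s powr (- \<beta> - 1) * s powr (\<eta> + \<beta>)) * (d powr (- a) * d powr (- (\<eta> + \<beta>)))) * (\<Omega> d powr (- a) * \<Omega> d powr (1 - \<beta>))"
          by (simp add: K_def mult_ac)
        also have "s powr (- \<beta> - 1) * s powr (\<eta> + \<beta>) = s powr (\<eta> - 1)"
          by (simp add: powr_add[symmetric])
        also have "d powr (- a) * d powr (- (\<eta> + \<beta>)) = d powr (- (\<eta> + \<beta> + a))"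
          by (simp add: powr_add[symmetric] algebra_simps)
        also have "\<Omega> d powr (- a) * \<Omega> d powr (1 - \<beta>) = \<Omega> d powr (1 - \<beta> - a)"
          by (simp add: powr_add[symmetric] algebra_simps)
        also have "K * (s powr (\<eta> - 1) * d powr (- (\<eta> + \<beta> + a))) * \<Omega> d powr (1 - \<beta> - a)
            \<le> K * (s powr (\<eta> - 1) * d powr (- (\<eta> + \<beta> + a))) * \<Omega> h powr (1 - \<beta> - a)"
          using 4 K by (intro mult_left_mono) auto
        finally have "A * (\<Omega> s / s) * (box_size d powr (- a) * box_size s powr (- \<beta>))
            \<le> K * \<Omega> h powr (1 - \<beta> - a) * (s powr (\<eta> - 1) * d powr (- (\<eta> + \<beta> + a)))"
          by (simp only: mult_ac)
        then have "ennreal (A * (\<Omega> s / s)) * ennreal (box_size d powr (- a) * box_size s powr (- \<beta>))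
            \<le> ennreal (K * \<Omega> h powr (1 - \<beta> - a)) * ennreal (s powr (\<eta> - 1) * d powr (- (\<eta> + \<beta> + a)))"
          by (simp add: ennreal_mult''[symmetric] ennreal_leI)
        then show ?thesis using True by (simp add: s_def d_def)
      qed simp
    qed
    also have "\<dots> = ennreal (K * \<Omega> h powr (1 - \<beta> - a)) * (\<integral>\<^sup>+\<xi>. (indicator disc \<xi> * ennreal (?P \<xi>)) \<partial>lborel)"
      by (rule nn_integral_cmult) (use meas in simp)
    also have "\<dots> \<le> ennreal (K * \<Omega> h powr (1 - \<beta> - a)) * ennreal (C * h powr (1 + \<eta> - (\<eta> + \<beta> + a)))"
      using C(2)[of z] z unfolding h_def by (intro mult_left_mono) auto
    also have "\<dots> = ennreal (K * C * box_size (1 - norm z) powr (1 - \<beta> - a))"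
    proof -
      have "box_size h powr (1 - \<beta> - a) = h powr (1 + \<eta> - (\<eta> + \<beta> + a)) * \<Omega> h powr (1 - \<beta> - a)"
        using h \<Omega>_pos[OF h] by (simp add: box_size_def powr_mult algebra_simps)
      then show ?thesis using C K by (simp add: h_def[symmetric] ennreal_mult''[symmetric] mult_ac)
    qed
    finally show "(\<integral>\<^sup>+\<xi>. ?F \<xi> \<partial>\<nu>) \<le> ennreal (K * C * box_size (1 - norm z) powr (1 - \<beta> - a))" .
  qed
qed

text \<open>
  For \<open>\<gamma> > M + 1\<close> the integrand decays faster than \<open>box_size\<close> grows, and the part of the disc at
  distance \<open>1 - |z|\<close> from \<open>z\<close> determines the size of the integral. These are the norms of the
  functions on which Carleson squares are tested.
\<close>

lemma test_function_norm:
  fixes \<gamma> :: real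
  assumes \<gamma>: "M + 1 < \<gamma>"
  obtains C where "0 < C"
    "\<And>z. z \<in> disc \<Longrightarrow>
      (\<integral>\<^sup>+\<xi>. ennreal (norm (1 - cnj z * \<xi>) powr (- \<gamma>)) \<partial>\<nu>)
      \<le> ennreal (C * ((1 - norm z) powr (- \<gamma>) * box_size (1 - norm z)))"
proof -
  obtain C where C: "0 < C"
    "\<And>z. norm z < 1 \<Longrightarrow>
      (\<integral>\<^sup>+\<xi>. indicator disc \<xi> * ennreal ((1 - norm \<xi>) powr (\<kappa> - 1) * norm (1 - cnj z * \<xi>) powr (- (\<gamma> + \<kappa> - M))) \<partial>lborel)
      \<le> ennreal (C * (1 - norm z) powr (1 + \<kappa> - (\<gamma> + \<kappa> - M)))"
    using forelli_rudin[of \<kappa> "\<gamma> + \<kappa> - M"] \<gamma> constants by auto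
  show ?thesis
  proof (rule that[of "A ^ 3 * C"])
    show "0 < A ^ 3 * C" using constants C by simp
    fix z assume z: "z \<in> disc"
    define h where "h = 1 - norm z"
    have h: "0 < h" using z by (simp add: h_def)
    let ?F = "\<lambda>\<xi>. ennreal (norm (1 - cnj z * \<xi>) powr (- \<gamma>))"
    let ?P = "\<lambda>\<xi>. (1 - norm \<xi>) powr (\<kappa> - 1) * norm (1 - cnj z * \<xi>) powr (- (\<gamma> + \<kappa> - M))"
    have meas: "(\<lambda>\<xi>. indicator disc \<xi> * ennreal (?P \<xi>)) \<in> borel_measurable borel" by measurable
    have "(\<integral>\<^sup>+\<xi>. ?F \<xi> \<partial>\<nu>) \<le> (\<integral>\<^sup>+\<xi>. indicator disc \<xi> * (ennreal (A * (\<Omega> (1 - norm \<xi>) / (1 - norm \<xi>))) * ?F \<xi>) \<partial>lborel)"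
      by (rule nn_integral_weight_le) measurable
    also have "\<dots> \<le> (\<integral>\<^sup>+\<xi>. ennreal (A ^ 3 * (h powr (- M) * \<Omega> h)) * (indicator disc \<xi> * ennreal (?P \<xi>)) \<partial>lborel)"
    proof (rule nn_integral_mono)
      fix \<xi>
      show "indicator disc \<xi> * (ennreal (A * (\<Omega> (1 - norm \<xi>) / (1 - norm \<xi>))) * ?F \<xi>)
         \<le> ennreal (A ^ 3 * (h powr (- M) * \<Omega> h)) * (indicator disc \<xi> * ennreal (?P \<xi>))"
      proof (cases "\<xi> \<in> disc")
        case True
        define s d where "s = 1 - norm \<xi>" and "d = norm (1 - cnj z * \<xi>)"
        have s: "0 < s" using True by (simp add: s_def)
        have d: "h \<le> d" "s \<le> d" "d \<le> 2" "0 < d"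
          using kernel_dist_bounds[OF z True] by (simp_all add: s_def d_def h_def)
        have p: "0 < \<Omega> s" "0 < \<Omega> d" "0 < \<Omega> h" using s d h by (simp_all add: \<Omega>_pos)
        have "\<Omega> s \<le> A * (s / d) powr \<kappa> * \<Omega> d" using s d by (intro \<Omega>_lower) auto
        also have "\<dots> \<le> A * (s / d) powr \<kappa> * (A * (d / h) powr M * \<Omega> h)"
          using d h constants by (intro mult_left_mono \<Omega>_upper) auto
        finally have 1: "\<Omega> s \<le> A * (s / d) powr \<kappa> * (A * (d / h) powr M * \<Omega> h)" .
        have "A * (\<Omega> s / s) * d powr (- \<gamma>) \<le> A * ((A * (s / d) powr \<kappa> * (A * (d / h) powr M * \<Omega> h)) / s) * d powr (- \<gamma>)"
          using 1 constants s by (intro mult_right_mono mult_left_mono divide_right_mono) auto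
        also have "\<dots> = A ^ 3 * (h powr (- M) * \<Omega> h) * (s powr (\<kappa> - 1) * d powr (- (\<gamma> + \<kappa> - M)))"
          using s d h by (simp add: powr_divide powr_diff powr_add powr_minus power3_eq_cube divide_simps)
        finally have "ennreal (A * (\<Omega> s / s)) * ennreal (d powr (- \<gamma>))
            \<le> ennreal (A ^ 3 * (h powr (- M) * \<Omega> h)) * ennreal (s powr (\<kappa> - 1) * d powr (- (\<gamma> + \<kappa> - M)))"
          by (simp add: ennreal_mult''[symmetric] ennreal_leI)
        then show ?thesis using True by (simp add: s_def d_def)
      qed simp
    qed
    also have "\<dots> = ennreal (A ^ 3 * (h powr (- M) * \<Omega> h)) * (\<integral>\<^sup>+\<xi>. (indicator disc \<xi> * ennreal (?P \<xi>)) \<partial>lborel)"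
      by (rule nn_integral_cmult) (use meas in simp)
    also have "\<dots> \<le> ennreal (A ^ 3 * (h powr (- M) * \<Omega> h)) * ennreal (C * h powr (1 + \<kappa> - (\<gamma> + \<kappa> - M)))"
      using C(2)[of z] z unfolding h_def by (intro mult_left_mono) auto
    also have "\<dots> = ennreal (A ^ 3 * C * (h powr (- \<gamma>) * box_size h))"
    proof -
      have "h powr (- M) * h powr (1 + \<kappa> - (\<gamma> + \<kappa> - M)) = h powr (- \<gamma>) * h"
        using h by (simp add: powr_diff powr_add powr_minus divide_simps)
      then have "A ^ 3 * (h powr (- M) * \<Omega> h) * (C * h powr (1 + \<kappa> - (\<gamma> + \<kappa> - M))) = A ^ 3 * C * (h powr (- \<gamma>) * box_size h)"
        unfolding box_size_def by algebra
      moreover have "0 \<le> C * h powr (1 + \<kappa> - (\<gamma> + \<kappa> - M))" using C by simp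
      ultimately show ?thesis by (simp only: ennreal_mult''[symmetric])
    qed
    finally show "(\<integral>\<^sup>+\<xi>. ?F \<xi> \<partial>\<nu>) \<le> ennreal (A ^ 3 * C * ((1 - norm z) powr (- \<gamma>) * box_size (1 - norm z)))"
      by (simp add: h_def)
  qed
qed

lemma weight_on_ball:
  assumes z: "z \<in> disc" and \<xi>: "\<xi> \<in> ball z ((1 - norm z) / 2)"
  shows "\<xi> \<in> disc" "(1 - norm z) / 2 \<le> 1 - norm \<xi>" "1 - norm \<xi> \<le> 2 * (1 - norm z)"
    "\<Omega> (1 - norm z) / (1 - norm z) \<le> 2 * A * 2 powr M * (\<Omega> (1 - norm \<xi>) / (1 - norm \<xi>))"
proof -
  define h s where "h = 1 - norm z" and "s = 1 - norm \<xi>"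
  have h: "0 < h" using z by (simp add: h_def)
  have "dist z \<xi> < h / 2" using \<xi> by (simp add: h_def)
  moreover have "norm \<xi> \<le> norm z + dist z \<xi>" "norm z \<le> norm \<xi> + dist z \<xi>"
    by (metis add.commute dist_norm norm_triangle_sub norm_minus_commute)+
  ultimately have s: "h / 2 \<le> s" "s \<le> 2 * h" using h by (auto simp: s_def h_def)
  then show "\<xi> \<in> disc" "(1 - norm z) / 2 \<le> 1 - norm \<xi>" "1 - norm \<xi> \<le> 2 * (1 - norm z)"
    using h by (auto simp: s_def h_def)
  have "\<Omega> h \<le> A * (h / (h / 2)) powr M * \<Omega> (h / 2)" using h by (intro \<Omega>_upper) auto
  also have "\<dots> \<le> A * 2 powr M * \<Omega> s" using h s constants by (simp add: \<Omega>_le)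
  finally have "\<Omega> h / h \<le> (A * 2 powr M * \<Omega> s) / (s / 2)"
    using s h constants \<Omega>_pos[of s] by (intro frac_le) auto
  then show "\<Omega> (1 - norm z) / (1 - norm z) \<le> 2 * A * 2 powr M * (\<Omega> (1 - norm \<xi>) / (1 - norm \<xi>))"
    by (simp add: s_def h_def mult_ac)
qed

text \<open>
  On the disc of radius \<open>\<delta> h\<close>, \<open>h = 1 - |z|\<close>, the density of \<open>\<nu>\<close> is comparable with its value
  \<open>\<Omega>(h) / h\<close> at the centre, so that the disc has measure comparable with \<open>h \<Omega>(h) = box_size h\<close>.
\<close>

lemma point_evaluation_local:
  fixes s \<delta> :: real
  assumes s: "0 < s" and \<delta>: "0 < \<delta>" "\<delta> \<le> 1/2"
  obtains C where "0 < C"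
    "\<And>f z. f holomorphic_on disc \<Longrightarrow> z \<in> disc \<Longrightarrow>
      ennreal (norm (f z) powr s * box_size (1 - norm z))
      \<le> ennreal C * (\<integral>\<^sup>+\<xi>. indicator (ball z (\<delta> * (1 - norm z))) \<xi> * ennreal (norm (f \<xi>) powr s) \<partial>\<nu>)"
proof -
  obtain C where C: "0 < C"
    "\<And>f z r. 0 < r \<Longrightarrow> f holomorphic_on ball z r \<Longrightarrow>
      ennreal (norm (f z) powr s * r\<^sup>2) \<le> ennreal C * (\<integral>\<^sup>+\<xi>. indicator (ball z r) \<xi> * ennreal (norm (f \<xi>) powr s) \<partial>lborel)"
    using submean_power[OF s] by blast
  define K where "K = 2 * A * 2 powr M * (4 * A)"
  have K: "0 < K" using constants by (simp add: K_def)
  show ?thesis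
  proof (rule that[of "C * K / \<delta>\<^sup>2"])
    show "0 < C * K / \<delta>\<^sup>2" using C K \<delta> by simp
    fix f z assume f: "f holomorphic_on disc" and z: "z \<in> disc"
    define h where "h = 1 - norm z"
    have h: "0 < h" using z by (simp add: h_def)
    define B where "B = ball z (\<delta> * h)"
    have "\<delta> * h \<le> h / 2" using \<delta> h by (simp add: mult_right_mono)
    then have B: "B \<subseteq> ball z (h / 2)" by (auto simp: B_def)
    have Bd: "B \<subseteq> disc" using B weight_on_ball(1)[OF z] by (auto simp: h_def)
    have fB: "f holomorphic_on ball z (\<delta> * h)" by (rule holomorphic_on_subset[OF f]) (use Bd in \<open>simp add: B_def\<close>)
    let ?F = "\<lambda>\<xi>. indicator B \<xi> * ennreal (norm (f \<xi>) powr s)"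
    have F: "?F \<in> borel_measurable borel"
      unfolding B_def by (intro borel_measurable_indicator_norm borel_measurable_indicator_holomorphic fB) auto
    have FN: "?F \<in> borel_measurable \<nu>"
      by (rule measurable_compose[OF identity_measurable_weight_measure' F])
    have "ennreal (norm (f z) powr s * box_size h) = ennreal (\<Omega> h / h / \<delta>\<^sup>2) * ennreal (norm (f z) powr s * (\<delta> * h)\<^sup>2)"
      using h \<delta> by (simp add: ennreal_mult''[symmetric] box_size_def power_mult_distrib) (simp add: power2_eq_square mult_ac)
    also have "\<dots> \<le> ennreal (\<Omega> h / h / \<delta>\<^sup>2) * (ennreal C * (\<integral>\<^sup>+\<xi>. ?F \<xi> \<partial>lborel))"
      unfolding B_def using h \<delta> by (intro mult_left_mono C(2) fB) auto
    also have "\<dots> = ennreal (C / \<delta>\<^sup>2) * (ennreal (\<Omega> h / h) * (\<integral>\<^sup>+\<xi>. ?F \<xi> \<partial>lborel))"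
      using C(1) h \<Omega>_pos[OF h] by (simp add: mult.assoc[symmetric] ennreal_mult''[symmetric]) (simp add: mult_ac)
    also have "\<dots> = ennreal (C / \<delta>\<^sup>2) * (\<integral>\<^sup>+\<xi>. ennreal (\<Omega> h / h) * ?F \<xi> \<partial>lborel)"
      using F by (simp add: nn_integral_cmult)
    also have "\<dots> \<le> ennreal (C / \<delta>\<^sup>2) * (\<integral>\<^sup>+\<xi>. ennreal K * (indicator disc \<xi> * (ennreal (1 / (4 * A) * (\<Omega> (1 - norm \<xi>) / (1 - norm \<xi>))) * ?F \<xi>)) \<partial>lborel)"
    proof (intro mult_left_mono nn_integral_mono)
      fix \<xi>
      show "ennreal (\<Omega> h / h) * ?F \<xi> \<le> ennreal K * (indicator disc \<xi> * (ennreal (1 / (4 * A) * (\<Omega> (1 - norm \<xi>) / (1 - norm \<xi>))) * ?F \<xi>))"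
      proof (cases "\<xi> \<in> B")
        case True
        then have \<xi>: "\<xi> \<in> ball z (h / 2)" using B by auto
        have "\<Omega> h / h \<le> 2 * A * 2 powr M * (\<Omega> (1 - norm \<xi>) / (1 - norm \<xi>))"
          using weight_on_ball(4)[OF z] \<xi> by (simp add: h_def)
        also have "\<dots> = K * (1 / (4 * A) * (\<Omega> (1 - norm \<xi>) / (1 - norm \<xi>)))"
        proof -
          have "K * (1 / (4 * A)) = 2 * A * 2 powr M" using constants by (simp add: K_def)
          then show ?thesis by (simp only: mult.assoc[symmetric])
        qed
        finally have "ennreal (\<Omega> h / h) \<le> ennreal K * ennreal (1 / (4 * A) * (\<Omega> (1 - norm \<xi>) / (1 - norm \<xi>)))"
          using K by (subst ennreal_mult'[symmetric]) (auto intro: ennreal_leI)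
        then have "ennreal (\<Omega> h / h) * ?F \<xi> \<le> ennreal K * ennreal (1 / (4 * A) * (\<Omega> (1 - norm \<xi>) / (1 - norm \<xi>))) * ?F \<xi>"
          by (rule mult_right_mono) simp
        then show ?thesis using True Bd by (simp add: mult.assoc subset_eq)
      qed simp
    qed simp
    also have "\<dots> = ennreal (C / \<delta>\<^sup>2) * (ennreal K * (\<integral>\<^sup>+\<xi>. (indicator disc \<xi> * (ennreal (1 / (4 * A) * (\<Omega> (1 - norm \<xi>) / (1 - norm \<xi>))) * ?F \<xi>)) \<partial>lborel))"
      using F by (subst nn_integral_cmult) auto
    also have "\<dots> \<le> ennreal (C / \<delta>\<^sup>2) * (ennreal K * (\<integral>\<^sup>+\<xi>. ?F \<xi> \<partial>\<nu>))"
      by (intro mult_left_mono nn_integral_weight_ge FN) auto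
    also have "\<dots> = ennreal (C * K / \<delta>\<^sup>2) * (\<integral>\<^sup>+\<xi>. ?F \<xi> \<partial>\<nu>)"
      using K C(1) by (simp add: mult.assoc[symmetric] ennreal_mult''[symmetric])
    finally show "ennreal (norm (f z) powr s * box_size (1 - norm z))
      \<le> ennreal (C * K / \<delta>\<^sup>2) * (\<integral>\<^sup>+\<xi>. indicator (ball z (\<delta> * (1 - norm z))) \<xi> * ennreal (norm (f \<xi>) powr s) \<partial>\<nu>)"
      by (simp add: B_def h_def)
  qed
qed

end

section \<open>Sequences with regularly decaying differences\<close>

definition decrement :: "(nat \<Rightarrow> real) \<Rightarrow> nat \<Rightarrow> real" where "decrement f n = f n - f (Suc n)"

text \<open>
  Discrete analogue of a symbol class: every difference up to order \<open>k\<close> gains one power of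
  \<open>n + 1\<close> over the majorant \<open>g\<close>.
\<close>

definition symbol_class :: "nat \<Rightarrow> (nat \<Rightarrow> real) \<Rightarrow> (nat \<Rightarrow> real) \<Rightarrow> bool" where
  "symbol_class k g f \<longleftrightarrow> (\<exists>C\<ge>0. \<forall>j\<le>k. \<forall>n. \<bar>(decrement ^^ j) f n\<bar> * (real n + 1) ^ j \<le> C * g n)"

lemma decrement_Suc: "(decrement ^^ j) (\<lambda>n. f (Suc n)) n = (decrement ^^ j) f (Suc n)"
  by (induction j arbitrary: n) (auto simp: decrement_def)

lemma decrement_add: "(decrement ^^ j) (\<lambda>n. f n + h n) n = (decrement ^^ j) f n + (decrement ^^ j) h n"
  by (induction j arbitrary: n) (auto simp: decrement_def)

lemma decrement_minus: "(decrement ^^ j) (\<lambda>n. - f n) n = - (decrement ^^ j) f n"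
  by (induction j arbitrary: n) (auto simp: decrement_def)

lemma decrement_mult: "decrement (\<lambda>n. f n * h n) = (\<lambda>n. f n * decrement h n + decrement f n * h (Suc n))"
  by (auto simp: decrement_def algebra_simps)

lemma symbol_class_mono:
  assumes "symbol_class k g f" "j \<le> k" "\<And>n. g n \<le> c * g' n" "0 \<le> c"
  shows "symbol_class j g' f"
proof -
  obtain C where C: "C \<ge> 0" "\<And>j n. j \<le> k \<Longrightarrow> \<bar>(decrement ^^ j) f n\<bar> * (real n + 1) ^ j \<le> C * g n"
    using assms(1) by (auto simp: symbol_class_def)
  have "\<bar>(decrement ^^ i) f n\<bar> * (real n + 1) ^ i \<le> (C * c) * g' n" if "i \<le> j" for i n
    using C(2)[of i n] mult_left_mono[OF assms(3)[of n] C(1)] that assms(2) by (simp add: mult.assoc)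
  moreover have "C * c \<ge> 0" using C assms by simp
  ultimately show ?thesis unfolding symbol_class_def by blast
qed

lemma symbol_class_decrement:
  assumes "symbol_class (Suc k) g f"
  shows "symbol_class k (\<lambda>n. g n / (real n + 1)) (decrement f)"
proof -
  obtain C where C: "C \<ge> 0" "\<And>j n. j \<le> Suc k \<Longrightarrow> \<bar>(decrement ^^ j) f n\<bar> * (real n + 1) ^ j \<le> C * g n"
    using assms(1) by (auto simp: symbol_class_def)
  have "\<bar>(decrement ^^ i) (decrement f) n\<bar> * (real n + 1) ^ i \<le> C * (g n / (real n + 1))" if "i \<le> k" for i n
  proof -
    have "\<bar>(decrement ^^ Suc i) f n\<bar> * (real n + 1) ^ Suc i \<le> C * g n" using that by (intro C(2)) auto
    then have "\<bar>(decrement ^^ i) (decrement f) n\<bar> * (real n + 1) ^ i * (real n + 1) \<le> C * g n"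
      by (simp add: funpow_swap1 mult_ac)
    then show ?thesis by (simp add: pos_le_divide_eq)
  qed
  then show ?thesis unfolding symbol_class_def using C(1) by blast
qed

lemma symbol_class_from_decrement:
  assumes "symbol_class k (\<lambda>n. g n / (real n + 1)) (decrement f)" "\<And>n. \<bar>f n\<bar> \<le> B * g n" "B \<ge> 0" "\<And>n. 0 \<le> g n"
  shows "symbol_class (Suc k) g f"
proof -
  obtain C where C: "C \<ge> 0" "\<And>j n. j \<le> k \<Longrightarrow> \<bar>(decrement ^^ j) (decrement f) n\<bar> * (real n + 1) ^ j \<le> C * (g n / (real n + 1))"
    using assms(1) by (auto simp: symbol_class_def)
  have "\<bar>(decrement ^^ i) f n\<bar> * (real n + 1) ^ i \<le> (C + B) * g n" if "i \<le> Suc k" for i n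
  proof (cases i)
    case 0
    then show ?thesis using assms(2)[of n] mult_nonneg_nonneg[OF C(1) assms(4)[of n]] by (simp add: algebra_simps)
  next
    case (Suc j)
    then have "\<bar>(decrement ^^ j) (decrement f) n\<bar> * (real n + 1) ^ j \<le> C * g n / (real n + 1)"
      using C(2)[of j n] that by simp
    then have "\<bar>(decrement ^^ j) (decrement f) n\<bar> * (real n + 1) ^ j * (real n + 1) \<le> C * g n"
      by (simp add: pos_le_divide_eq)
    then show ?thesis using Suc mult_nonneg_nonneg[OF assms(3) assms(4)[of n]] by (simp add: funpow_swap1 algebra_simps)
  qed
  moreover have "C + B \<ge> 0" using C assms by simp
  ultimately show ?thesis unfolding symbol_class_def by blast
qed

lemma symbol_class_shift:
  assumes "symbol_class k g f" "\<And>n. g (Suc n) \<le> c * g n" "0 \<le> c"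
  shows "symbol_class k g (\<lambda>n. f (Suc n))"
proof -
  obtain C where C: "C \<ge> 0" "\<And>j n. j \<le> k \<Longrightarrow> \<bar>(decrement ^^ j) f n\<bar> * (real n + 1) ^ j \<le> C * g n"
    using assms(1) by (auto simp: symbol_class_def)
  have "\<bar>(decrement ^^ i) (\<lambda>n. f (Suc n)) n\<bar> * (real n + 1) ^ i \<le> (C * c) * g n" if "i \<le> k" for i n
  proof -
    have "\<bar>(decrement ^^ i) f (Suc n)\<bar> * (real n + 1) ^ i \<le> \<bar>(decrement ^^ i) f (Suc n)\<bar> * (real (Suc n) + 1) ^ i"
      by (intro mult_left_mono power_mono) auto
    also have "\<dots> \<le> C * g (Suc n)" using that by (rule C(2))
    also have "\<dots> \<le> C * (c * g n)" using C assms by (intro mult_left_mono) auto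
    finally show ?thesis by (simp add: decrement_Suc mult.assoc)
  qed
  moreover have "C * c \<ge> 0" using C assms by simp
  ultimately show ?thesis unfolding symbol_class_def by blast
qed

lemma symbol_class_add:
  assumes "symbol_class k g f" "symbol_class k g h"
  shows "symbol_class k g (\<lambda>n. f n + h n)"
proof -
  obtain C where C: "C \<ge> 0" "\<And>j n. j \<le> k \<Longrightarrow> \<bar>(decrement ^^ j) f n\<bar> * (real n + 1) ^ j \<le> C * g n"
    using assms(1) by (auto simp: symbol_class_def)
  obtain D where D: "D \<ge> 0" "\<And>j n. j \<le> k \<Longrightarrow> \<bar>(decrement ^^ j) h n\<bar> * (real n + 1) ^ j \<le> D * g n"
    using assms(2) by (auto simp: symbol_class_def)
  have "\<bar>(decrement ^^ i) (\<lambda>n. f n + h n) n\<bar> * (real n + 1) ^ i \<le> (C + D) * g n" if "i \<le> k" for i n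
  proof -
    have "\<bar>(decrement ^^ i) (\<lambda>n. f n + h n) n\<bar> * (real n + 1) ^ i
      \<le> (\<bar>(decrement ^^ i) f n\<bar> + \<bar>(decrement ^^ i) h n\<bar>) * (real n + 1) ^ i"
      by (intro mult_right_mono) (auto simp: decrement_add)
    then show ?thesis using C(2)[OF that, of n] D(2)[OF that, of n] by (simp add: algebra_simps)
  qed
  moreover have "C + D \<ge> 0" using C D by simp
  ultimately show ?thesis unfolding symbol_class_def by blast
qed

lemma symbol_class_minus: "symbol_class k g f \<Longrightarrow> symbol_class k g (\<lambda>n. - f n)"
  by (simp add: symbol_class_def decrement_minus)

lemma symbol_class_bound:
  assumes "symbol_class k g f"
  obtains C where "C \<ge> 0" "\<And>n. \<bar>f n\<bar> \<le> C * g n"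
proof -
  obtain C where "C \<ge> 0" "\<And>j n. j \<le> k \<Longrightarrow> \<bar>(decrement ^^ j) f n\<bar> * (real n + 1) ^ j \<le> C * g n"
    using assms(1) by (auto simp: symbol_class_def)
  from this(1) this(2)[of 0] show ?thesis by (intro that[of C]) auto
qed

text \<open>
  By the product rule \<open>decrement_mult\<close> and induction on the order; the shift of one factor costs a
  constant, because the majorant \<open>g2\<close> cannot jump up.
\<close>

lemma symbol_class_mult:
  assumes "symbol_class k g1 f" "symbol_class k g2 h" "\<And>n. g2 (Suc n) \<le> c * g2 n" "0 \<le> c"
    "\<And>n. 0 \<le> g1 n" "\<And>n. 0 \<le> g2 n"
  shows "symbol_class k (\<lambda>n. g1 n * g2 n) (\<lambda>n. f n * h n)"
  using assms
proof (induction k arbitrary: f h g1 g2)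
  case 0
  obtain C where C: "C \<ge> 0" "\<And>n. \<bar>f n\<bar> \<le> C * g1 n"
    using 0(1) by (auto simp: symbol_class_def)
  obtain D where D: "D \<ge> 0" "\<And>n. \<bar>h n\<bar> \<le> D * g2 n"
    using 0(2) by (auto simp: symbol_class_def)
  have "\<bar>f n * h n\<bar> \<le> (C * D) * (g1 n * g2 n)" for n
  proof -
    have "\<bar>f n\<bar> * \<bar>h n\<bar> \<le> (C * g1 n) * (D * g2 n)" using C D 0 by (intro mult_mono) auto
    then show ?thesis by (simp add: abs_mult mult_ac)
  qed
  moreover have "0 \<le> C * D" using C D by simp
  ultimately show ?case by (auto simp: symbol_class_def)
next
  case (Suc k)
  obtain C where C: "C \<ge> 0" "\<And>n. \<bar>f n\<bar> \<le> C * g1 n"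
    using symbol_class_bound[OF Suc(2)] by blast
  obtain D where D: "D \<ge> 0" "\<And>n. \<bar>h n\<bar> \<le> D * g2 n"
    using symbol_class_bound[OF Suc(3)] by blast
  have f: "symbol_class k g1 f" and h: "symbol_class k g2 h"
    using symbol_class_mono[OF Suc(2), of k 1 g1] symbol_class_mono[OF Suc(3), of k 1 g2] by auto
  have "symbol_class k (\<lambda>n. g1 n * (g2 n / (real n + 1))) (\<lambda>n. f n * decrement h n)"
  proof (rule Suc.IH[OF f symbol_class_decrement[OF Suc(3)] _ Suc(5,6)])
    show "g2 (Suc n) / (real (Suc n) + 1) \<le> c * (g2 n / (real n + 1))" for n
    proof -
      have "g2 (Suc n) / (real (Suc n) + 1) \<le> (c * g2 n) / (real n + 1)"
        using Suc.prems by (intro frac_le) auto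
      then show ?thesis by simp
    qed
    show "0 \<le> g2 n / (real n + 1)" for n using Suc.prems by simp
  qed
  moreover have "symbol_class k (\<lambda>n. (g1 n / (real n + 1)) * g2 n) (\<lambda>n. decrement f n * h (Suc n))"
    by (rule Suc.IH[OF symbol_class_decrement[OF Suc(2)] symbol_class_shift[OF h Suc(4,5)] Suc(4,5)])
       (use Suc.prems in auto)
  ultimately have "symbol_class k (\<lambda>n. (g1 n * g2 n) / (real n + 1)) (decrement (\<lambda>n. f n * h n))"
    unfolding decrement_mult by (intro symbol_class_add) simp_all
  then show ?case
  proof (rule symbol_class_from_decrement)
    show "\<bar>f n * h n\<bar> \<le> (C * D) * (g1 n * g2 n)" for n
    proof -
      have "\<bar>f n\<bar> * \<bar>h n\<bar> \<le> (C * g1 n) * (D * g2 n)" using C D Suc.prems by (intro mult_mono) auto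
      then show ?thesis by (simp add: abs_mult mult_ac)
    qed
  qed (use C D Suc.prems in auto)
qed

text \<open>
  A reciprocal satisfies \<open>decrement (1/f) n = - decrement f n * (1 / f n) * (1 / f (n+1))\<close>, so its
  differences of order \<open>k + 1\<close> are controlled by those of order at most \<open>k\<close>.
\<close>

lemma symbol_class_inverse:
  assumes "\<And>k. symbol_class k g f" and g: "\<And>n. 0 < g n" "\<And>n. g (Suc n) \<le> g n" "\<And>n. g n \<le> c * g (Suc n)"
    and f: "\<And>n. g n \<le> d * f n" "0 < d"
  shows "symbol_class k (\<lambda>n. 1 / g n) (\<lambda>n. 1 / f n)"
proof (induction k)
  have c: "0 < c" using g(1)[of 0] g(1)[of 1] g(3)[of 0] by (smt (verit) mult_nonpos_nonneg One_nat_def)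
  have fpos: "0 < f n" for n using g(1)[of n] f(1)[of n] f(2) by (smt (verit) mult_nonneg_nonpos)
  have bd: "\<bar>1 / f n\<bar> \<le> d * (1 / g n)" for n
    using fpos[of n] g(1)[of n] f(1)[of n] by (simp add: field_simps)
  case 0
  show ?case unfolding symbol_class_def using bd f by (intro exI[of _ d]) auto
next
  case (Suc k)
  have c: "0 < c" using g(1)[of 0] g(1)[of 1] g(3)[of 0] by (smt (verit) mult_nonpos_nonneg One_nat_def)
  have fpos: "0 < f n" for n using g(1)[of n] f(1)[of n] f(2) by (smt (verit) mult_nonneg_nonpos)
  have bd: "\<bar>1 / f n\<bar> \<le> d * (1 / g n)" for n
    using fpos[of n] g(1)[of n] f(1)[of n] by (simp add: field_simps)
  have slow: "1 / g (Suc n) \<le> c * (1 / g n)" for n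
    using g(1)[of n] g(1)[of "Suc n"] g(3)[of n] by (simp add: field_simps)
  have "symbol_class k (\<lambda>n. 1 / g n * (1 / g n)) (\<lambda>n. 1 / f n * (1 / f (Suc n)))"
    using c g by (intro symbol_class_mult[OF Suc symbol_class_shift[OF Suc slow] slow]) (auto intro: less_imp_le)
  then have "symbol_class k (\<lambda>n. g n / (real n + 1) * (1 / g n * (1 / g n))) (\<lambda>n. decrement f n * (1 / f n * (1 / f (Suc n))))"
  proof (rule symbol_class_mult[OF symbol_class_decrement[OF assms(1)]])
    show "1 / g (Suc n) * (1 / g (Suc n)) \<le> (c * c) * (1 / g n * (1 / g n))" for n
    proof -
      have "1 / g (Suc n) * (1 / g (Suc n)) \<le> (c * (1 / g n)) * (c * (1 / g n))"
        using slow[of n] g(1)[of "Suc n"] g(1)[of n] c by (intro mult_mono) auto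
      then show ?thesis by (simp only: mult_ac)
    qed
  qed (use c g in \<open>auto intro: less_imp_le\<close>)
  moreover have "g n / (real n + 1) * (1 / g n * (1 / g n)) = 1 / g n / (real n + 1)" for n
    using g(1)[of n] by simp
  moreover have "decrement (\<lambda>n. 1 / f n) = (\<lambda>n. - (decrement f n * (1 / f n * (1 / f (Suc n)))))"
  proof
    fix n
    show "decrement (\<lambda>n. 1 / f n) n = - (decrement f n * (1 / f n * (1 / f (Suc n))))"
      using fpos[of n] fpos[of "Suc n"] by (simp add: decrement_def field_simps)
  qed
  ultimately have "symbol_class k (\<lambda>n. 1 / g n / (real n + 1)) (decrement (\<lambda>n. 1 / f n))"
    using symbol_class_minus by simp
  then show ?case using bd f g by (intro symbol_class_from_decrement[where B=d]) (auto intro: less_imp_le)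
qed

lemma summable_poly_powser:
  fixes x :: real
  assumes "\<bar>x\<bar> < 1"
  shows "summable (\<lambda>n. (real n + 1) ^ P * x ^ n)"
  using assms
proof (induction P arbitrary: x)
  case 0
  then show ?case by (simp add: summable_geometric)
next
  case (Suc P)
  have "summable (\<lambda>n. diffs (\<lambda>n. (real n + 1) ^ P) n * y ^ n)" if "norm y < 1" for y :: real
    by (rule termdiff_converges[where K=1]) (use that Suc.IH in auto)
  then have *: "summable (\<lambda>n. diffs (\<lambda>n. (real n + 1) ^ P) n * \<bar>x\<bar> ^ n)" using Suc.prems by simp
  show ?case
  proof (rule summable_comparison_test'[OF *])
    fix n :: nat
    have "(real n + 1) ^ Suc P \<le> (real n + 1) * (real (Suc n) + 1) ^ P"
      by (auto intro!: mult_left_mono power_mono)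
    then have "(real n + 1) ^ Suc P * \<bar>x\<bar> ^ n \<le> (real n + 1) * (real (Suc n) + 1) ^ P * \<bar>x\<bar> ^ n"
      by (rule mult_right_mono) simp
    then show "norm ((real n + 1) ^ Suc P * x ^ n) \<le> diffs (\<lambda>n. (real n + 1) ^ P) n * \<bar>x\<bar> ^ n"
      by (simp add: diffs_def abs_mult power_abs add.commute)
  qed
qed

section \<open>Moments of the weight\<close>

text \<open>
  One term of the exponential series at \<open>1 + x\<close>.
\<close>

lemma exp_decay_le:
  assumes "0 \<le> (x::real)"
  shows "exp (- x) \<le> fact D * exp 1 * (1 + x) powr (- real D)"
proof -
  have "(\<Sum>k\<in>{D}. (1 + x) ^ k / fact k) \<le> (\<Sum>k. (1 + x) ^ k / fact k)"
    using summable_exp[of "1 + x"] assms by (intro sum_le_suminf) (auto simp: divide_inverse mult.commute)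
  then have "(1 + x) ^ D / fact D \<le> (\<Sum>k. (1 + x) ^ k / fact k)" by simp
  also have "\<dots> = exp (1 + x)" by (simp add: exp_def divide_inverse mult.commute)
  finally have "(1 + x) ^ D * exp (- x) \<le> fact D * exp (1 + x) * exp (- x)"
    by (intro mult_right_mono) (auto simp: field_simps)
  also have "\<dots> = fact D * exp 1" by (simp add: exp_add exp_minus)
  finally show ?thesis using assms by (simp add: powr_minus powr_realpow field_simps)
qed

context regular_profile
begin

text \<open>
  The differences of order \<open>k\<close> of the moments (see \<open>decrement_moment\<close>) in the form of integrals, which shows
  that they are nonnegative.
\<close>

definition moment_diff :: "nat \<Rightarrow> nat \<Rightarrow> real" where
  "moment_diff k n = (\<integral>\<zeta>. norm \<zeta> ^ (2 * n) * (1 - norm \<zeta> ^ 2) ^ k \<partial>\<nu>)"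

abbreviation moment :: "nat \<Rightarrow> real" where "moment \<equiv> moment_diff 0"

text \<open>
  The majorant for the moments: \<open>|\<zeta>|\<^bsup>2n\<^esup>\<close> is of size one at distance up to \<open>1 / (n + 1)\<close> from the
  circle and small well inside.
\<close>

definition tail_scale :: "nat \<Rightarrow> real" where "tail_scale n = \<Omega> (1 / (real n + 1))"

lemma tail_scale_pos: "0 < tail_scale n"
  by (simp add: tail_scale_def \<Omega>_pos)

lemma tail_scale_Suc_le: "tail_scale (Suc n) \<le> tail_scale n"
  unfolding tail_scale_def by (intro \<Omega>_le frac_le) auto

lemma tail_scale_mono: "m \<le> n \<Longrightarrow> tail_scale n \<le> tail_scale m"
  by (rule lift_Suc_antimono_le[of tail_scale, OF tail_scale_Suc_le])

lemma tail_scale_le: 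
  assumes "m \<le> n"
  shows "tail_scale m \<le> A * ((real n + 1) / (real m + 1)) powr M * tail_scale n"
  using \<Omega>_upper[of "1 / (real n + 1)" "1 / (real m + 1)"] assms by (simp add: tail_scale_def frac_le)

lemma moment_diff_integrand_bounds:
  assumes "\<zeta> \<in> disc"
  shows "0 \<le> norm \<zeta> ^ (2 * n) * (1 - norm \<zeta> ^ 2) ^ k" "norm \<zeta> ^ (2 * n) * (1 - norm \<zeta> ^ 2) ^ k \<le> 1"
proof -
  have 1: "0 \<le> norm \<zeta> ^ 2" "norm \<zeta> ^ 2 \<le> 1" using assms by (auto simp: power_le_one)
  then show "0 \<le> norm \<zeta> ^ (2 * n) * (1 - norm \<zeta> ^ 2) ^ k" by simp
  have "norm \<zeta> ^ (2 * n) * (1 - norm \<zeta> ^ 2) ^ k \<le> 1 * 1"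
    using 1 assms by (intro mult_mono power_le_one) auto
  then show "norm \<zeta> ^ (2 * n) * (1 - norm \<zeta> ^ 2) ^ k \<le> 1" by simp
qed

lemma moment_diff_integrable: "integrable \<nu> (\<lambda>\<zeta>. norm \<zeta> ^ (2 * n) * (1 - norm \<zeta> ^ 2) ^ k)"
proof (rule finite_measure.integrable_const_bound[OF finite_weight_measure, of _ 1])
  show "AE \<zeta> in \<nu>. norm (norm \<zeta> ^ (2 * n) * (1 - norm \<zeta> ^ 2) ^ k) \<le> 1"
  proof (rule AE_I2)
    fix \<zeta> assume "\<zeta> \<in> space \<nu>"
    then show "norm (norm \<zeta> ^ (2 * n) * (1 - norm \<zeta> ^ 2) ^ k) \<le> 1"
      using moment_diff_integrand_bounds[of \<zeta> n k] by simp
  qed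
qed measurable

lemma moment_diff_nonneg: "0 \<le> moment_diff k n"
  unfolding moment_diff_def by (rule integral_nonneg_AE) (auto intro!: AE_I2 moment_diff_integrand_bounds)

lemma ennreal_moment_diff: "ennreal (moment_diff k n) = (\<integral>\<^sup>+\<zeta>. ennreal (norm \<zeta> ^ (2 * n) * (1 - norm \<zeta> ^ 2) ^ k) \<partial>\<nu>)"
  unfolding moment_diff_def
  by (subst nn_integral_eq_integral[OF moment_diff_integrable]) (auto intro!: AE_I2 moment_diff_integrand_bounds)

lemma moment_diff_Suc: "moment_diff (Suc k) n = moment_diff k n - moment_diff k (Suc n)"
proof -
  have "moment_diff k n - moment_diff k (Suc n)
    = (\<integral>\<zeta>. norm \<zeta> ^ (2 * n) * (1 - norm \<zeta> ^ 2) ^ k - norm \<zeta> ^ (2 * Suc n) * (1 - norm \<zeta> ^ 2) ^ k \<partial>\<nu>)"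
    unfolding moment_diff_def by (rule Bochner_Integration.integral_diff[symmetric]) (rule moment_diff_integrable)+
  also have "\<dots> = moment_diff (Suc k) n" unfolding moment_diff_def
    by (intro Bochner_Integration.integral_cong) (auto simp: algebra_simps power2_eq_square)
  finally show ?thesis by simp
qed

lemma decrement_moment: "(decrement ^^ k) moment n = moment_diff k n"
  by (induction k arbitrary: n) (auto simp: decrement_def moment_diff_Suc)

text \<open>
  In terms of \<open>s = 1 - r\<close> and \<open>h = 1 / (n + 1)\<close>, the power \<open>r\<^bsup>2n+1\<^esup> \<le> exp (-s/h)\<close> decays faster
  than any power of \<open>s / h\<close>, while \<open>\<Omega>(s) / \<Omega>(h)\<close> is bounded by powers of \<open>s / h\<close> and
  \<open>(1 - r\<^sup>2)\<^bsup>k\<^esup>\<close> contributes \<open>s\<^bsup>k\<^esup>\<close>, that is, a factor \<open>h\<^bsup>k\<^esup>\<close> after integration.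
\<close>

lemma moment_diff_upper:
  obtains C where "0 < C" "\<And>n. moment_diff k n * (real n + 1) ^ k \<le> C * tail_scale n"
proof -
  \<comment> \<open>Decay of this order makes the two resulting integrals converge for large \<open>s\<close>.\<close>
  obtain D :: nat where D: "real k + \<kappa> + M < real D" using reals_Archimedean2 by blast
  define c1 where "c1 = 1 / (real k + \<kappa>) + 1 / (real D - (real k + \<kappa>))"
  define c2 where "c2 = 1 / (real k + M) + 1 / (real D - (real k + M))"
  have c: "0 < c1" "0 < c2" using D constants by (auto simp: c1_def c2_def intro!: add_pos_pos)
  define K where "K = A * A * 2 ^ k * (fact D * exp 1)"
  have K: "0 < K" using constants by (simp add: K_def)
  show ?thesis
  proof (rule that[of "8 * K * (c1 + c2)"])
    show "0 < 8 * K * (c1 + c2)" using K c by simp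
    fix n :: nat
    define h where "h = 1 / (real n + 1)"
    have h: "0 < h" "h \<le> 1" by (auto simp: h_def)
    let ?I = "\<lambda>\<eta> s. indicator {0<..} s * ennreal (s powr (\<eta> - 1) * (s + h) powr (- real D))"
    let ?G = "\<lambda>r. indicator {..<1} r * (ennreal (A * (\<Omega> (1 - r) / (1 - r))) * ennreal (r ^ (2 * n) * (1 - r ^ 2) ^ k))"
    have "ennreal (moment_diff k n) \<le> (\<integral>\<^sup>+z. indicator disc z * (ennreal (A * (\<Omega> (1 - norm z) / (1 - norm z))) * ennreal (norm z ^ (2 * n) * (1 - norm z ^ 2) ^ k)) \<partial>lborel)"
      unfolding ennreal_moment_diff by (rule nn_integral_weight_le) measurable
    also have "\<dots> = (\<integral>\<^sup>+z. ?G (norm (z::complex)) \<partial>lborel)"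
      by (intro nn_integral_cong) (simp add: indicator_def)
    also have "\<dots> \<le> 8 * (\<integral>\<^sup>+r. indicator {0<..} r * ennreal r * ?G r \<partial>lborel)"
      by (rule nn_integral_radial) measurable
    also have "(\<integral>\<^sup>+r. indicator {0<..} r * ennreal r * ?G r \<partial>lborel)
      \<le> (\<integral>\<^sup>+r. ennreal (K * \<Omega> h * h powr (real D - \<kappa>)) * ?I (real k + \<kappa>) (1 + (-1) * r)
             + ennreal (K * \<Omega> h * h powr (real D - M)) * ?I (real k + M) (1 + (-1) * r) \<partial>lborel)"
    proof (rule nn_integral_mono)
      fix r :: real
      show "indicator {0<..} r * ennreal r * ?G r
        \<le> ennreal (K * \<Omega> h * h powr (real D - \<kappa>)) * ?I (real k + \<kappa>) (1 + (-1) * r)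
             + ennreal (K * \<Omega> h * h powr (real D - M)) * ?I (real k + M) (1 + (-1) * r)"
      proof (cases "0 < r \<and> r < 1")
        case True
        define s where "s = 1 - r"
        have s: "0 < s" "s < 1" "r = 1 - s" using True by (auto simp: s_def)
        have p: "0 < \<Omega> h" "0 < \<Omega> s" using h s by (simp_all add: \<Omega>_pos)
        have 1: "\<Omega> s \<le> A * ((s / h) powr \<kappa> + (s / h) powr M) * \<Omega> h"
        proof (cases "s \<le> h")
          case True
          then have "\<Omega> s \<le> A * (s / h) powr \<kappa> * \<Omega> h" using s h by (intro \<Omega>_lower) auto
          also have "\<dots> \<le> A * ((s / h) powr \<kappa> + (s / h) powr M) * \<Omega> h"
            using constants p by (intro mult_right_mono mult_left_mono) auto
          finally show ?thesis .
        next
          case False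
          then have "\<Omega> s \<le> A * (s / h) powr M * \<Omega> h" using s h by (intro \<Omega>_upper) auto
          also have "\<dots> \<le> A * ((s / h) powr \<kappa> + (s / h) powr M) * \<Omega> h"
            using constants p by (intro mult_right_mono mult_left_mono) auto
          finally show ?thesis .
        qed
        have 2: "r * r ^ (2 * n) \<le> (fact D * exp 1) * (h powr real D * (s + h) powr (- real D))"
        proof -
          have "r * r ^ (2 * n) = r ^ (n + 1) * r ^ n" by (simp add: power_add mult_2)
          also have "\<dots> \<le> r ^ (n + 1) * 1" using True by (intro mult_left_mono power_le_one) auto
          also have "\<dots> \<le> exp (- s) ^ (n + 1)" using True s exp_ge_add_one_self[of "- s"] by (simp only: mult_1_right) (intro power_mono, auto)
          also have "\<dots> = exp (- (s / h))" 
          proof -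
            have "exp (- s) ^ (n + 1) = exp (real (n + 1) * (- s))" by (rule exp_of_nat_mult[symmetric])
            also have "real (n + 1) * (- s) = - (s / h)" by (simp add: h_def algebra_simps)
            finally show ?thesis .
          qed
          also have "\<dots> \<le> fact D * exp 1 * (1 + s / h) powr (- real D)" using s h by (intro exp_decay_le) auto
          also have "1 + s / h = (s + h) / h" using h by (simp add: field_simps)
          also have "((s + h) / h) powr (- real D) = h powr real D * (s + h) powr (- real D)"
            using s h by (simp add: powr_divide powr_minus field_simps)
          finally show ?thesis .
        qed
        have 3: "(1 - r ^ 2) ^ k \<le> 2 ^ k * s powr real k"
        proof -
          have "(1 - r ^ 2) ^ k \<le> (2 * s) ^ k"
            using True zero_le_power2[of "1 - r"] 
            by (intro power_mono) (auto simp: s_def power2_eq_square algebra_simps mult_le_one)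
          then show ?thesis using s by (simp add: power_mult_distrib powr_realpow)
        qed
        have "r * (A * (\<Omega> s / s) * (r ^ (2 * n) * (1 - r ^ 2) ^ k)) = A * (\<Omega> s / s) * ((r * r ^ (2 * n)) * (1 - r ^ 2) ^ k)"
          by (simp only: mult_ac)
        also have "\<dots> \<le> A * (A * ((s / h) powr \<kappa> + (s / h) powr M) * \<Omega> h / s) *
           (((fact D * exp 1) * (h powr real D * (s + h) powr (- real D))) * (2 ^ k * s powr real k))"
        proof (rule mult_mono[OF mult_left_mono[OF divide_right_mono[OF 1]] mult_mono[OF 2 3]])
          show "0 \<le> (1 - r ^ 2) ^ k" using True by (simp add: power_le_one)
          then show "0 \<le> r * r ^ (2 * n) * (1 - r ^ 2) ^ k" using True by simp
        qed (use s p constants in auto)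
        also have "\<dots> = K * \<Omega> h * h powr (real D - \<kappa>) * (s powr (real k + \<kappa> - 1) * (s + h) powr (- real D))
             + K * \<Omega> h * h powr (real D - M) * (s powr (real k + M - 1) * (s + h) powr (- real D))"
        proof -
          have "(s / h) powr e * h powr real D * s powr real k / s = h powr (real D - e) * s powr (real k + e - 1)" for e
            using s h by (simp add: powr_divide powr_diff powr_add)
          note e = this[of \<kappa>] this[of M]
          have "A * (A * ((s / h) powr \<kappa> + (s / h) powr M) * \<Omega> h / s) *
             (((fact D * exp 1) * (h powr real D * (s + h) powr (- real D))) * (2 ^ k * s powr real k))
             = K * \<Omega> h * (s + h) powr (- real D) * ((s / h) powr \<kappa> * h powr real D * s powr real k / s + (s / h) powr M * h powr real D * s powr real k / s)"
            using s by (simp add: K_def field_simps)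
          also have "\<dots> = K * \<Omega> h * h powr (real D - \<kappa>) * (s powr (real k + \<kappa> - 1) * (s + h) powr (- real D))
             + K * \<Omega> h * h powr (real D - M) * (s powr (real k + M - 1) * (s + h) powr (- real D))"
            unfolding e by (simp add: algebra_simps)
          finally show ?thesis .
        qed
        finally have "ennreal r * (ennreal (A * (\<Omega> s / s)) * ennreal (r ^ (2 * n) * (1 - r ^ 2) ^ k))
           \<le> ennreal (K * \<Omega> h * h powr (real D - \<kappa>) * (s powr (real k + \<kappa> - 1) * (s + h) powr (- real D))
             + K * \<Omega> h * h powr (real D - M) * (s powr (real k + M - 1) * (s + h) powr (- real D)))"
          using True s p constants by (subst ennreal_mult''[symmetric], simp add: power_le_one)+ (rule ennreal_leI)
        also have "\<dots> = ennreal (K * \<Omega> h * h powr (real D - \<kappa>)) * ennreal (s powr (real k + \<kappa> - 1) * (s + h) powr (- real D))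
             + ennreal (K * \<Omega> h * h powr (real D - M)) * ennreal (s powr (real k + M - 1) * (s + h) powr (- real D))"
          using K p by (subst ennreal_plus) (simp_all add: ennreal_mult'')
        finally show ?thesis using True by (simp add: s_def mult.assoc)
      next
        case False
        then have "indicator {0<..} r * ennreal r * ?G r = 0" by (auto simp: indicator_def)
        then show ?thesis by (simp only: zero_le)
      qed
    qed
    also have "\<dots> = ennreal (K * \<Omega> h * h powr (real D - \<kappa>)) * (\<integral>\<^sup>+r. ?I (real k + \<kappa>) (1 + (-1) * r) \<partial>lborel)
             + ennreal (K * \<Omega> h * h powr (real D - M)) * (\<integral>\<^sup>+r. ?I (real k + M) (1 + (-1) * r) \<partial>lborel)"
    proof -
      have "(\<integral>\<^sup>+r. a * F r + b * H r \<partial>lborel) = a * (\<integral>\<^sup>+r. F r \<partial>lborel) + b * (\<integral>\<^sup>+r. H r \<partial>lborel)"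
        if [measurable]: "F \<in> borel_measurable borel" "H \<in> borel_measurable borel" for F H :: "real \<Rightarrow> ennreal" and a b
        by (subst nn_integral_add) (auto simp: nn_integral_cmult)
      then show ?thesis by simp
    qed
    also have "(\<integral>\<^sup>+r. ?I (real k + \<kappa>) (1 + (-1) * r) \<partial>lborel) = (\<integral>\<^sup>+s. ?I (real k + \<kappa>) s \<partial>lborel)"
      by (subst (2) nn_integral_real_affine[where c="-1" and t=1]) auto
    also have "(\<integral>\<^sup>+r. ?I (real k + M) (1 + (-1) * r) \<partial>lborel) = (\<integral>\<^sup>+s. ?I (real k + M) s \<partial>lborel)"
      by (subst (2) nn_integral_real_affine[where c="-1" and t=1]) auto
    also have "ennreal (K * \<Omega> h * h powr (real D - \<kappa>)) * (\<integral>\<^sup>+s. ?I (real k + \<kappa>) s \<partial>lborel)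
             + ennreal (K * \<Omega> h * h powr (real D - M)) * (\<integral>\<^sup>+s. ?I (real k + M) s \<partial>lborel)
         \<le> ennreal (K * \<Omega> h * h powr (real D - \<kappa>)) * ennreal (c1 * h powr (real k + \<kappa> - real D))
             + ennreal (K * \<Omega> h * h powr (real D - M)) * ennreal (c2 * h powr (real k + M - real D))"
      unfolding c1_def c2_def using D h constants
      by (intro add_mono mult_left_mono nn_integral_powr_shift_le) auto
    also have "\<dots> = ennreal (K * (c1 + c2) * \<Omega> h * h ^ k)"
    proof -
      have "h powr (real D - e) * h powr (real k + e - real D) = h ^ k" for e
        using h by (simp add: powr_add[symmetric] powr_realpow)
      note e = this[of \<kappa>] this[of M]
      have "K * \<Omega> h * h powr (real D - \<kappa>) * (c1 * h powr (real k + \<kappa> - real D))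
         + K * \<Omega> h * h powr (real D - M) * (c2 * h powr (real k + M - real D))
         = K * \<Omega> h * c1 * (h powr (real D - \<kappa>) * h powr (real k + \<kappa> - real D))
         + K * \<Omega> h * c2 * (h powr (real D - M) * h powr (real k + M - real D))" by (simp only: mult_ac)
      also have "\<dots> = K * (c1 + c2) * \<Omega> h * h ^ k" unfolding e by (simp add: algebra_simps)
      finally show ?thesis using K c \<Omega>_pos[OF h(1)]
        by (simp add: ennreal_mult''[symmetric] ennreal_plus[symmetric] del: ennreal_plus)
    qed
    finally have "ennreal (moment_diff k n) \<le> 8 * ennreal (K * (c1 + c2) * \<Omega> h * h ^ k)"
      by (simp add: mult_left_mono)
    also have "\<dots> = ennreal (8 * K * (c1 + c2) * \<Omega> h * h ^ k)"
      using K c h \<Omega>_pos[OF h(1)] by (subst ennreal_numeral[symmetric], subst ennreal_mult[symmetric]) (auto simp: mult.assoc)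
    finally have "moment_diff k n \<le> 8 * K * (c1 + c2) * \<Omega> h * h ^ k"
      using K c h \<Omega>_pos[OF h(1)] by (subst (asm) ennreal_le_iff) auto
    then have "moment_diff k n * (real n + 1) ^ k \<le> 8 * K * (c1 + c2) * \<Omega> h * h ^ k * (real n + 1) ^ k"
      by (rule mult_right_mono) simp
    also have "\<dots> = 8 * K * (c1 + c2) * tail_scale n"
      by (simp add: h_def tail_scale_def power_divide)
    finally show "moment_diff k n * (real n + 1) ^ k \<le> 8 * K * (c1 + c2) * tail_scale n" .
  qed
qed

text \<open>
  Integrate only over \<open>1 / (8 N) \<le> 1 - r \<le> 1 / (4 N)\<close>, \<open>N = n + 1\<close>, where \<open>r\<^bsup>2n+1\<^esup> \<ge> 1/2\<close> by
  Bernoulli's inequality.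
\<close>

lemma moment_lower:
  obtains C where "0 < C" "\<And>n. tail_scale n \<le> C * moment n"
proof -
  define C where "C = A * 8 powr M * (16 * A)"
  have C: "0 < C" using constants by (simp add: C_def)
  show ?thesis
  proof (rule that[OF C])
    fix n :: nat
    define N where "N = real n + 1"
    have N: "1 \<le> N" by (simp add: N_def)
    define c where "c = 1 / (4 * A) * (\<Omega> (1 / (8 * N)) * (4 * N)) * (1/2)"
    have c: "0 < c" using constants N by (simp add: c_def \<Omega>_pos)
    let ?G = "\<lambda>r. indicator {..<1} r * (ennreal (1 / (4 * A) * (\<Omega> (1 - r) / (1 - r))) * ennreal (r ^ (2 * n) * (1 - r ^ 2) ^ 0))"
    let ?J = "{1 - 1 / (4 * N) .. 1 - 1 / (8 * N)}"
    have "ennreal c * ennreal (1 / (8 * N)) = (\<integral>\<^sup>+r. ennreal c * indicator ?J r \<partial>lborel)"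
      using N by (subst nn_integral_cmult_indicator) (auto simp: frac_le)
    also have "\<dots> \<le> (\<integral>\<^sup>+r. indicator {0<..} r * ennreal r * ?G r \<partial>lborel)"
    proof (rule nn_integral_mono)
      fix r :: real
      show "ennreal c * indicator ?J r \<le> indicator {0<..} r * ennreal r * ?G r"
      proof (cases "r \<in> ?J")
        case True
        have "1 / (4 * N) \<le> 1 / 4" "0 < 1 / (8 * N)" using N by (auto simp: frac_le)
        then have r: "0 < r" "r < 1" using True by (auto simp only: atLeastAtMost_iff)
        have s: "1 / (8 * N) \<le> 1 - r" "1 - r \<le> 1 / (4 * N)" using True by auto
        have "1 - real m * (1 - r) \<le> r ^ m" for m
          using Bernoulli_inequality[of "- (1 - r)" m] r by (simp add: algebra_simps)
        then have "1 - real (2 * n + 2) * (1 - r) \<le> r ^ (2 * n + 2)" .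
        moreover have "real (2 * n + 2) * (1 - r) \<le> (2 * N) * (1 / (4 * N))"
          using s N r by (intro mult_mono) (auto simp: N_def)
        moreover have "(2 * N) * (1 / (4 * N)) = 1/2" using N by simp
        ultimately have "1/2 \<le> r ^ (2 * n + 2)" by linarith
        also have "r ^ (2 * n + 2) \<le> r ^ (2 * n + 1)" using r by (intro power_decreasing) auto
        finally have 1: "1/2 \<le> r * r ^ (2 * n)" by simp
        have "\<Omega> (1 / (8 * N)) * (4 * N) = \<Omega> (1 / (8 * N)) / (1 / (4 * N))" by simp
        also have "\<dots> \<le> \<Omega> (1 - r) / (1 - r)"
          using s r N \<Omega>_pos[of "1 - r"] by (intro frac_le \<Omega>_le) auto
        finally have "c \<le> 1 / (4 * A) * (\<Omega> (1 - r) / (1 - r)) * (r * r ^ (2 * n))"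
          unfolding c_def using 1 constants r \<Omega>_pos[of "1 - r"] \<Omega>_pos[of "1 / (8 * N)"] N by (intro mult_mono mult_left_mono) auto
        then have "ennreal c \<le> ennreal (r * (1 / (4 * A) * (\<Omega> (1 - r) / (1 - r)) * (r ^ (2 * n))))"
          by (intro ennreal_leI) (simp only: mult_ac)
        also have "\<dots> = ennreal r * (ennreal (1 / (4 * A) * (\<Omega> (1 - r) / (1 - r))) * ennreal (r ^ (2 * n)))"
          using r constants \<Omega>_pos[of "1 - r"] by (simp only: ennreal_mult''[symmetric] zero_le_power less_imp_le)
             (subst ennreal_mult'', auto simp: mult_ac)
        finally show ?thesis using True r by simp
      qed simp
    qed
    also have "\<dots> \<le> (\<integral>\<^sup>+z. ?G (norm (z::complex)) \<partial>lborel)"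
      by (rule nn_integral_radial) measurable
    also have "\<dots> = (\<integral>\<^sup>+z. indicator disc z * (ennreal (1 / (4 * A) * (\<Omega> (1 - norm z) / (1 - norm z))) * ennreal (norm z ^ (2 * n) * (1 - norm z ^ 2) ^ 0)) \<partial>lborel)"
      by (intro nn_integral_cong) (simp add: indicator_def)
    also have "\<dots> \<le> ennreal (moment n)" unfolding ennreal_moment_diff
      by (rule nn_integral_weight_ge) measurable
    finally have "ennreal (c * (1 / (8 * N))) \<le> ennreal (moment n)"
      using N by (simp add: ennreal_mult''[symmetric])
    then have 1: "c * (1 / (8 * N)) \<le> moment n" using moment_diff_nonneg by (subst (asm) ennreal_le_iff) auto
    have "tail_scale n \<le> A * ((1 / N) / (1 / (8 * N))) powr M * \<Omega> (1 / (8 * N))"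
      unfolding tail_scale_def N_def[symmetric] using N by (intro \<Omega>_upper) (auto simp: frac_le)
    also have "\<dots> = A * 8 powr M * (16 * A) * (c * (1 / (8 * N)))"
      using N constants by (simp add: c_def)
    also have "\<dots> \<le> C * moment n" unfolding C_def using 1 constants by (intro mult_left_mono) auto
    finally show "tail_scale n \<le> C * moment n" .
  qed
qed

lemma moment_pos: "0 < moment n"
proof -
  obtain C where C: "0 < C" "\<And>n. tail_scale n \<le> C * moment n" using moment_lower by blast
  then have "0 < C * moment n" using tail_scale_pos[of n] by (meson less_le_trans)
  then show ?thesis using C by (simp add: zero_less_mult_iff)
qed

text \<open>
  The monomials are orthogonal with the moments as squared norms, so these are the Taylor
  coefficients of the reproducing kernel.
\<close>

definition kernel_coeff :: "nat \<Rightarrow> real" where "kernel_coeff n = 1 / moment n"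

lemma kernel_coeff_pos: "0 < kernel_coeff n"
  by (simp add: kernel_coeff_def moment_pos)

lemma kernel_coeff_symbol: "symbol_class k (\<lambda>n. 1 / tail_scale n) kernel_coeff"
proof -
  have "symbol_class k tail_scale moment" for k
  proof -
    have "\<exists>C. 0 < C \<and> (\<forall>n. moment_diff j n * (real n + 1) ^ j \<le> C * tail_scale n)" for j
      using moment_diff_upper[of j] by metis
    then obtain C where C: "\<And>j. 0 < C j" "\<And>j n. moment_diff j n * (real n + 1) ^ j \<le> C j * tail_scale n"
      by metis
    have "\<bar>(decrement ^^ j) moment n\<bar> * (real n + 1) ^ j \<le> (\<Sum>i\<le>k. C i) * tail_scale n" if "j \<le> k" for j n
    proof -
      have "C j \<le> (\<Sum>i\<le>k. C i)" using that C(1) by (intro member_le_sum) (auto intro: less_imp_le)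
      then have "C j * tail_scale n \<le> (\<Sum>i\<le>k. C i) * tail_scale n" using tail_scale_pos[of n] by (intro mult_right_mono) auto
      then show ?thesis using C(2)[of j n] moment_diff_nonneg[of j n] by (simp add: decrement_moment)
    qed
    moreover have "0 \<le> (\<Sum>i\<le>k. C i)" using C(1) by (intro sum_nonneg) (auto intro: less_imp_le)
    ultimately show ?thesis unfolding symbol_class_def by blast
  qed
  moreover obtain d where d: "0 < d" "\<And>n. tail_scale n \<le> d * moment n" using moment_lower by blast
  moreover have "tail_scale n \<le> (A * 2 powr M) * tail_scale (Suc n)" for n
  proof -
    have "tail_scale n \<le> A * ((real (Suc n) + 1) / (real n + 1)) powr M * tail_scale (Suc n)" by (rule tail_scale_le) simp
    also have "\<dots> \<le> A * 2 powr M * tail_scale (Suc n)"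
      using constants tail_scale_pos[of "Suc n"] by (intro mult_right_mono mult_left_mono powr_mono2) (auto simp: field_simps)
    finally show ?thesis .
  qed
  ultimately have "symbol_class k (\<lambda>n. 1 / tail_scale n) (\<lambda>n. 1 / moment n)"
    using tail_scale_pos tail_scale_Suc_le by (intro symbol_class_inverse[where c="A * 2 powr M" and d=d]) auto
  then show ?thesis by (simp add: kernel_coeff_def[abs_def])
qed

lemma kernel_coeff_diff_bound:
  obtains C where "0 < C" "\<And>n. \<bar>(decrement ^^ k) kernel_coeff n\<bar> * (real n + 1) ^ k \<le> C / tail_scale n"
proof -
  obtain C where C: "C \<ge> 0" "\<And>j n. j \<le> k \<Longrightarrow> \<bar>(decrement ^^ j) kernel_coeff n\<bar> * (real n + 1) ^ j \<le> C * (1 / tail_scale n)"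
    using kernel_coeff_symbol[of k] unfolding symbol_class_def by blast
  show ?thesis
  proof (rule that[of "C + 1"])
    fix n
    have "\<bar>(decrement ^^ k) kernel_coeff n\<bar> * (real n + 1) ^ k \<le> C * (1 / tail_scale n)" using C(2)[of k n] by simp
    also have "\<dots> \<le> (C + 1) * (1 / tail_scale n)" using tail_scale_pos[of n] by (intro mult_right_mono) auto
    finally show "\<bar>(decrement ^^ k) kernel_coeff n\<bar> * (real n + 1) ^ k \<le> (C + 1) / tail_scale n" by simp
  qed (use C in simp)
qed

end

section \<open>The kernel\<close>

context regular_profile
begin

text \<open>
  The reproducing kernel at \<open>z\<close> is \<open>\<lambda>\<zeta>. kernel (cnj z * \<zeta>)\<close> (see \<open>bergman_kernel_eq\<close>).
\<close>

definition kernel :: "complex \<Rightarrow> complex" where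
  "kernel w = (\<Sum>n. of_real (kernel_coeff n) * w ^ n)"

text \<open>
  For \<open>j = 0\<close> this is the remainder of the kernel series from \<open>N\<close> on, divided by \<open>w\<^bsup>N\<^esup>\<close>.
\<close>

definition kernel_tail :: "nat \<Rightarrow> nat \<Rightarrow> complex \<Rightarrow> complex" where
  "kernel_tail j N w = (\<Sum>n. of_real ((decrement ^^ j) kernel_coeff (N + n)) * w ^ n)"

lemma summable_kernel_tail:
  fixes w :: complex
  assumes "norm w < 1"
  shows "summable (\<lambda>n. norm (of_real ((decrement ^^ j) kernel_coeff (N + n)) * w ^ n))"
proof -
  obtain C where C: "0 < C" "\<And>n. \<bar>(decrement ^^ j) kernel_coeff n\<bar> * (real n + 1) ^ j \<le> C / tail_scale n"
    using kernel_coeff_diff_bound by blast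
  define P where "P = nat \<lceil>M\<rceil>"
  have P: "M \<le> real P" using constants by (simp add: P_def)
  define B where "B = C * A / tail_scale 0 * (real N + 1) ^ P"
  have "summable (\<lambda>n. B * ((real n + 1) ^ P * norm w ^ n))"
    by (intro summable_mult summable_poly_powser) (use assms in simp)
  then show ?thesis
  proof (rule summable_comparison_test'[where N=0])
    fix n :: nat
    have g: "0 < tail_scale 0" "0 < tail_scale (N + n)" by (rule tail_scale_pos)+
    have "\<bar>(decrement ^^ j) kernel_coeff (N + n)\<bar> * 1 \<le> \<bar>(decrement ^^ j) kernel_coeff (N + n)\<bar> * (real (N + n) + 1) ^ j"
      by (intro mult_left_mono) auto
    also have "\<dots> \<le> C / tail_scale (N + n)" by (rule C(2))
    also have "\<dots> \<le> C * A * (real (N + n) + 1) powr M / tail_scale 0"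
      using tail_scale_le[of 0 "N + n"] g C by (simp add: field_simps)
    also have "\<dots> \<le> C * A * (real (N + n) + 1) ^ P / tail_scale 0"
    proof -
      have "(real (N + n) + 1) powr M \<le> (real (N + n) + 1) powr real P" using P by (intro powr_mono) auto
      also have "\<dots> = (real (N + n) + 1) ^ P" by (rule powr_realpow) simp
      finally show ?thesis using C constants g by (intro divide_right_mono mult_left_mono) auto
    qed
    also have "\<dots> \<le> C * A * ((real N + 1) * (real n + 1)) ^ P / tail_scale 0"
      using C constants g by (intro divide_right_mono mult_left_mono power_mono) (auto simp: algebra_simps)
    also have "\<dots> = B * (real n + 1) ^ P" by (simp add: B_def power_mult_distrib)
    finally have "\<bar>(decrement ^^ j) kernel_coeff (N + n)\<bar> * norm w ^ n \<le> B * (real n + 1) ^ P * norm w ^ n"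
      by (intro mult_right_mono) auto
    then show "norm (norm (of_real ((decrement ^^ j) kernel_coeff (N + n)) * w ^ n)) \<le> B * ((real n + 1) ^ P * norm w ^ n)"
      by (simp add: norm_mult norm_power)
  qed
qed

lemma summable_kernel: "norm (w::complex) < 1 \<Longrightarrow> summable (\<lambda>n. norm (of_real (kernel_coeff n) * w ^ n))"
  using summable_kernel_tail[of w 0 0] by simp

lemma kernel_sums: "norm w < 1 \<Longrightarrow> (\<lambda>n. of_real (kernel_coeff n) * w ^ n) sums kernel w"
  unfolding kernel_def by (rule summable_sums[OF summable_norm_cancel[OF summable_kernel]])

lemma kernel_holomorphic: "kernel holomorphic_on disc"
  using kernel_sums by (intro power_series_holomorphic[where a="\<lambda>n. of_real (kernel_coeff n)"]) auto

text \<open>Summation by parts trades a factor \<open>1 - w\<close> for one more difference of the coefficients.\<close>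

lemma kernel_tail_step:
  assumes w: "norm w < 1"
  shows "(1 - w) * kernel_tail j N w = of_real ((decrement ^^ j) kernel_coeff N) - w * kernel_tail (Suc j) N w"
proof -
  let ?d = "\<lambda>j n. of_real ((decrement ^^ j) kernel_coeff (N + n)) :: complex"
  have s: "summable (\<lambda>n. ?d j n * w ^ n)" for j
    using summable_kernel_tail[OF w, of j N] by (rule summable_norm_cancel)
  have 1: "(\<Sum>n. ?d j (Suc n) * w ^ Suc n) = kernel_tail j N w - ?d j 0 * w ^ 0"
    unfolding kernel_tail_def by (rule suminf_split_head[OF s])
  have d: "?d j (Suc n) = ?d j n - ?d (Suc j) n" for n
  proof -
    have "(decrement ^^ Suc j) kernel_coeff (N + n) = (decrement ^^ j) kernel_coeff (N + n) - (decrement ^^ j) kernel_coeff (N + Suc n)"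
      unfolding funpow.simps o_apply decrement_def by simp
    then show ?thesis by (simp del: funpow.simps)
  qed
  have "(\<Sum>n. ?d j (Suc n) * w ^ Suc n) = (\<Sum>n. w * (?d j n * w ^ n) - w * (?d (Suc j) n * w ^ n))"
  proof (rule suminf_cong)
    fix n
    have "(a - b) * w ^ Suc n = w * (a * w ^ n) - w * (b * w ^ n)" for a b :: complex
      by (simp add: algebra_simps)
    then show "?d j (Suc n) * w ^ Suc n = w * (?d j n * w ^ n) - w * (?d (Suc j) n * w ^ n)"
      unfolding d .
  qed
  also have "\<dots> = (\<Sum>n. w * (?d j n * w ^ n)) - (\<Sum>n. w * (?d (Suc j) n * w ^ n))"
    by (intro suminf_diff[symmetric] summable_mult s)
  also have "\<dots> = w * kernel_tail j N w - w * kernel_tail (Suc j) N w"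
    unfolding kernel_tail_def by (simp only: suminf_mult[OF s])
  finally have "kernel_tail j N w - ?d j 0 = w * kernel_tail j N w - w * kernel_tail (Suc j) N w"
    using 1 by simp
  then show ?thesis by (simp add: algebra_simps)
qed

lemma suminf_inverse_squares_le:
  fixes a :: real
  assumes "1 \<le> a"
  shows "summable (\<lambda>n. 1 / (a + real n)\<^sup>2)" "(\<Sum>n. 1 / (a + real n)\<^sup>2) \<le> 2 / a"
proof -
  let ?f = "\<lambda>n. 1 / (a + real n)"
  have "?f \<longlonglongrightarrow> 0"
    by (intro tendsto_divide_0[OF tendsto_const] filterlim_at_top_imp_at_infinity
        filterlim_tendsto_add_at_top[OF tendsto_const] filterlim_real_sequentially)
  then have "(\<lambda>n. ?f n - ?f (Suc n)) sums (?f 0 - 0)" by (rule telescope_sums')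
  then have t: "(\<lambda>n. 2 * (?f n - ?f (Suc n))) sums (2 * (1 / a))" by (intro sums_mult) simp
  have le: "1 / (a + real n)\<^sup>2 \<le> 2 * (?f n - ?f (Suc n))" for n
  proof -
    define b where "b = a + real n"
    have b: "1 \<le> b" using assms by (simp add: b_def)
    have "2 * (1 / b - 1 / (b + 1)) = 2 / (b * (b + 1))" using b by (simp add: field_simps)
    moreover have "2 / (b * (b + b)) \<le> 2 / (b * (b + 1))"
      using b by (intro divide_left_mono mult_left_mono) auto
    moreover have "2 / (b * (b + b)) = 1 / b\<^sup>2" using b by (simp add: power2_eq_square)
    ultimately show ?thesis by (simp add: b_def algebra_simps)
  qed
  show s: "summable (\<lambda>n. 1 / (a + real n)\<^sup>2)"
    by (rule summable_comparison_test'[OF sums_summable[OF t], of 0]) (use le assms in auto)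
  have "(\<Sum>n. 1 / (a + real n)\<^sup>2) \<le> (\<Sum>n. 2 * (?f n - ?f (Suc n)))"
    by (rule suminf_le[OF le s sums_summable[OF t]])
  also have "\<dots> = 2 / a" using sums_unique[OF t] by simp
  finally show "(\<Sum>n. 1 / (a + real n)\<^sup>2) \<le> 2 / a" .
qed

text \<open>
  Differences of order \<open>k \<ge> M + 2\<close> decay so fast that, with the growth of \<open>1 / tail_scale\<close> by at most the
  power \<open>M\<close> taken into account, a summable factor \<open>(N + n + 1)\<^bsup>-2\<^esup>\<close> remains.
\<close>

lemma kernel_tail_bound_high:
  assumes k: "M + 2 \<le> real k"
  obtains C where "0 < C"
    "\<And>N w. norm w < 1 \<Longrightarrow> norm (kernel_tail k N w) * (real N + 1) ^ k \<le> C * (real N + 1) / tail_scale N"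
proof -
  obtain C where C: "0 < C" "\<And>n. \<bar>(decrement ^^ k) kernel_coeff n\<bar> * (real n + 1) ^ k \<le> C / tail_scale n"
    using kernel_coeff_diff_bound by blast
  have k2: "2 \<le> k" using k constants by linarith
  show ?thesis
  proof (rule that[of "2 * C * A"])
    show "0 < 2 * C * A" using C constants by simp
    fix N :: nat and w :: complex assume w: "norm w < 1"
    define a where "a = real N + 1"
    have a: "1 \<le> a" by (simp add: a_def)
    have g: "0 < tail_scale n" for n by (rule tail_scale_pos)
    let ?d = "\<lambda>n. of_real ((decrement ^^ k) kernel_coeff (N + n)) * w ^ n"
    have bd: "norm (?d n) \<le> (C * A / tail_scale N * a ^ 2 / a ^ k) * (1 / (a + real n)\<^sup>2)" for n
    proof -
      define m where "m = a + real n"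
      have m: "a \<le> m" by (simp add: m_def)
      have "norm (?d n) \<le> \<bar>(decrement ^^ k) kernel_coeff (N + n)\<bar> * 1"
        using w by (auto simp: norm_mult norm_power intro!: mult_left_le power_le_one)
      also have "\<dots> \<le> C / tail_scale (N + n) / m ^ k"
      proof -
        have "real (N + n) + 1 = m" "0 < m ^ k" using m a by (auto simp: m_def a_def)
        then show ?thesis using C(2)[of "N + n"] by (simp only: mult_1_right pos_le_divide_eq)
      qed
      also have "\<dots> \<le> C * (A * (m / a) powr M / tail_scale N) / m ^ k"
      proof -
        have "1 / tail_scale (N + n) \<le> A * (m / a) powr M / tail_scale N"
          using tail_scale_le[of N "N + n"] g[of N] g[of "N + n"] by (simp add: m_def a_def field_simps)
        then have "C * (1 / tail_scale (N + n)) / m ^ k \<le> C * (A * (m / a) powr M / tail_scale N) / m ^ k"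
          using C m a by (intro divide_right_mono mult_left_mono) auto
        then show ?thesis by simp
      qed
      also have "\<dots> \<le> C * (A * (m / a) powr real (k - 2) / tail_scale N) / m ^ k"
        using C m a k k2 g[of N] constants by (intro divide_right_mono mult_left_mono powr_mono) (auto simp: of_nat_diff)
      also have "(m / a) powr real (k - 2) = (m / a) ^ (k - 2)" using m a by (intro powr_realpow) auto
      also have "(m / a) ^ (k - 2) = (m ^ k / m ^ 2) / (a ^ k / a ^ 2)"
        using m a k2 by (simp add: power_diff power_divide)
      also have "C * (A * ((m ^ k / m ^ 2) / (a ^ k / a ^ 2)) / tail_scale N) / m ^ k = (C * A / tail_scale N * a ^ 2 / a ^ k) * (1 / m ^ 2)"
        using m a by (simp add: mult_ac)
      finally show ?thesis by (simp add: m_def)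
    qed
    have "norm (kernel_tail k N w) \<le> (\<Sum>n. norm (?d n))"
      unfolding kernel_tail_def by (rule summable_norm[OF summable_kernel_tail[OF w]])
    also have "\<dots> \<le> (\<Sum>n. (C * A / tail_scale N * a ^ 2 / a ^ k) * (1 / (a + real n)\<^sup>2))"
      by (intro suminf_le bd summable_kernel_tail w summable_mult suminf_inverse_squares_le a)
    also have "\<dots> = (C * A / tail_scale N * a ^ 2 / a ^ k) * (\<Sum>n. (1 / (a + real n)\<^sup>2))"
      by (intro suminf_mult suminf_inverse_squares_le a)
    also have "\<dots> \<le> (C * A / tail_scale N * a ^ 2 / a ^ k) * (2 / a)"
      using C constants a g[of N] by (intro mult_left_mono suminf_inverse_squares_le) auto
    finally have "norm (kernel_tail k N w) * a ^ k \<le> (C * A / tail_scale N * a ^ 2 / a ^ k) * (2 / a) * a ^ k"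
      using a by (intro mult_right_mono) auto
    also have "\<dots> = 2 * C * A * a / tail_scale N" using a by (simp add: power2_eq_square)
    finally show "norm (kernel_tail k N w) * (real N + 1) ^ k \<le> 2 * C * A * (real N + 1) / tail_scale N"
      by (simp add: a_def)
  qed
qed

text \<open>
  Descending induction on the order of the differences: by \<open>kernel_tail_step\<close> one order less costs a
  division by \<open>|1 - w|\<close>, hence a factor at most \<open>N + 1\<close>.
\<close>

lemma kernel_tail_bound:
  obtains C where "0 < C"
    "\<And>N w. norm w < 1 \<Longrightarrow> 1 \<le> (real N + 1) * norm (1 - w) \<Longrightarrow>
       norm (kernel_tail 0 N w) \<le> C * (real N + 1) / tail_scale N"
proof -
  define k where "k = nat \<lceil>M\<rceil> + 2"
  have k: "M + 2 \<le> real k" unfolding k_def using constants by linarith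
  let ?P = "\<lambda>j. \<exists>C>0. \<forall>N (w::complex). norm w < 1 \<longrightarrow> 1 \<le> (real N + 1) * norm (1 - w) \<longrightarrow>
     norm (kernel_tail j N w) * (real N + 1) ^ j \<le> C * (real N + 1) / tail_scale N"
  have "?P 0"
  proof (rule inc_induct[of 0 k])
    show "?P k" using kernel_tail_bound_high[OF k] by metis
    fix j assume "?P (Suc j)"
    then obtain C where C: "0 < C" "\<And>N w. norm w < 1 \<Longrightarrow> 1 \<le> (real N + 1) * norm (1 - w) \<Longrightarrow>
     norm (kernel_tail (Suc j) N w) * (real N + 1) ^ Suc j \<le> C * (real N + 1) / tail_scale N" by blast
    obtain D where D: "0 < D" "\<And>n. \<bar>(decrement ^^ j) kernel_coeff n\<bar> * (real n + 1) ^ j \<le> D / tail_scale n"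
      using kernel_coeff_diff_bound by blast
    show "?P j"
    proof (intro exI[of _ "C + D"] conjI allI impI)
      show "0 < C + D" using C D by simp
      fix N :: nat and w :: complex assume w: "norm w < 1" and N: "1 \<le> (real N + 1) * norm (1 - w)"
      define a where "a = real N + 1"
      have a: "1 \<le> a" by (simp add: a_def)
      have "norm (1 - w) * norm (kernel_tail j N w) \<le> \<bar>(decrement ^^ j) kernel_coeff N\<bar> + norm (kernel_tail (Suc j) N w)"
      proof -
        have "norm (1 - w) * norm (kernel_tail j N w) = norm (of_real ((decrement ^^ j) kernel_coeff N) - w * kernel_tail (Suc j) N w)"
          by (simp only: norm_mult[symmetric] kernel_tail_step[OF w])
        also have "\<dots> \<le> norm (of_real ((decrement ^^ j) kernel_coeff N) :: complex) + norm (w * kernel_tail (Suc j) N w)"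
          by (rule norm_triangle_ineq4)
        also have "\<dots> \<le> \<bar>(decrement ^^ j) kernel_coeff N\<bar> + 1 * norm (kernel_tail (Suc j) N w)"
          unfolding norm_mult norm_of_real using w by (intro add_left_mono mult_right_mono) auto
        finally show ?thesis by simp
      qed
      then have "(norm (1 - w) * norm (kernel_tail j N w)) * a ^ Suc j \<le> (\<bar>(decrement ^^ j) kernel_coeff N\<bar> + norm (kernel_tail (Suc j) N w)) * a ^ Suc j"
        using a by (intro mult_right_mono) auto
      also have "\<dots> = a * (\<bar>(decrement ^^ j) kernel_coeff N\<bar> * a ^ j) + norm (kernel_tail (Suc j) N w) * a ^ Suc j"
        by (simp add: algebra_simps)
      also have "\<dots> \<le> a * (D / tail_scale N) + C * a / tail_scale N"
        using D(2)[of N] C(2)[OF w N] a unfolding a_def by (intro add_mono mult_left_mono) auto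
      also have "\<dots> = (C + D) * a / tail_scale N" by (simp add: add_divide_distrib algebra_simps)
      finally have 1: "(norm (1 - w) * norm (kernel_tail j N w)) * a ^ Suc j \<le> (C + D) * a / tail_scale N" .
      have "1 * (norm (kernel_tail j N w) * a ^ j) \<le> (a * norm (1 - w)) * (norm (kernel_tail j N w) * a ^ j)"
        using N a unfolding a_def by (intro mult_right_mono) auto
      also have "\<dots> = (norm (1 - w) * norm (kernel_tail j N w)) * a ^ Suc j" by simp
      finally show "norm (kernel_tail j N w) * (real N + 1) ^ j \<le> (C + D) * (real N + 1) / tail_scale N"
        using 1 by (simp add: a_def)
    qed
  qed simp
  then show ?thesis using that by auto
qed

text \<open>
  The partial sum up to \<open>N \<approx> 1 / |1 - w|\<close> is estimated termwise; in the tail, summation by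
  parts beats the growth of the coefficients.
\<close>

lemma kernel_upper:
  obtains C where "0 < C" "\<And>w. norm w < 1 \<Longrightarrow> norm (kernel w) \<le> C / box_size (norm (1 - w))"
proof -
  obtain C where C: "0 < C" "\<And>N w. norm w < 1 \<Longrightarrow> 1 \<le> (real N + 1) * norm (1 - w) \<Longrightarrow>
       norm (kernel_tail 0 N w) \<le> C * (real N + 1) / tail_scale N" using kernel_tail_bound by blast
  obtain D where D: "0 < D" "\<And>n. \<bar>kernel_coeff n\<bar> \<le> D / tail_scale n"
    using kernel_coeff_diff_bound[of 0] by auto
  define K where "K = (C + D) * (3 * (A * 3 powr M))"
  have K: "0 < K" using C D constants by (simp add: K_def)
  show ?thesis
  proof (rule that[OF K])
    fix w :: complex assume w: "norm w < 1"
    define t where "t = norm (1 - w)"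
    have t: "0 < t" "t \<le> 2"
      using norm_triangle_ineq2[of 1 w] norm_triangle_ineq4[of 1 w] w by (auto simp: t_def)
    define N where "N = nat \<lfloor>1 / t\<rfloor>"
    define a where "a = real N + 1"
    have fl: "real N = of_int \<lfloor>1 / t\<rfloor>" using t by (simp add: N_def)
    have a: "1 / t \<le> a" "a \<le> 1 / t + 1" unfolding a_def fl by linarith+
    have "1 \<le> 2 / t" using t by simp
    then have a3: "a \<le> 3 / t" using a by (simp add: add_divide_distrib[symmetric])
    have a0: "0 < a" by (simp add: a_def)
    have N: "1 \<le> a * norm (1 - w)" using a t by (simp add: t_def[symmetric] field_simps)
    let ?c = "\<lambda>n. of_real (kernel_coeff n) * w ^ n"
    have "kernel w = (\<Sum>n. ?c (n + N)) + (\<Sum>n<N. ?c n)"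
      unfolding kernel_def by (rule suminf_split_initial_segment[OF summable_norm_cancel[OF summable_kernel[OF w]]])
    also have "(\<Sum>n. ?c (n + N)) = (\<Sum>n. w ^ N * (of_real (kernel_coeff (N + n)) * w ^ n))"
      by (intro suminf_cong) (simp add: power_add add.commute)
    also have "\<dots> = w ^ N * kernel_tail 0 N w"
      unfolding kernel_tail_def using summable_norm_cancel[OF summable_kernel_tail[OF w, of 0 N]]
      by (simp add: suminf_mult)
    finally have "norm (kernel w) \<le> norm (w ^ N * kernel_tail 0 N w) + norm (\<Sum>n<N. ?c n)"
      by (metis norm_triangle_ineq)
    also have "norm (w ^ N * kernel_tail 0 N w) \<le> 1 * (C * a / tail_scale N)"
      unfolding norm_mult a_def using w N
      by (intro mult_mono C(2)) (auto simp: norm_power power_le_one a_def)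
    also have "norm (\<Sum>n<N. ?c n) \<le> a * (D / tail_scale N)"
    proof -
      have "norm (\<Sum>n<N. ?c n) \<le> (\<Sum>n<N. D / tail_scale N)"
      proof (rule order_trans[OF norm_sum sum_mono])
        fix n assume "n \<in> {..<N}"
        have "norm (?c n) \<le> \<bar>kernel_coeff n\<bar> * 1"
          unfolding norm_mult norm_of_real using w by (intro mult_left_mono) (auto simp: norm_power power_le_one)
        also have "\<dots> \<le> D / tail_scale n" using D by simp
        also have "\<dots> \<le> D / tail_scale N"
          using D tail_scale_pos[of n] tail_scale_pos[of N] \<open>n \<in> {..<N}\<close> by (intro divide_left_mono tail_scale_mono) auto
        finally show "norm (?c n) \<le> D / tail_scale N" .
      qed
      also have "\<dots> \<le> a * (D / tail_scale N)"
        using D tail_scale_pos[of N] by (simp add: a_def divide_right_mono)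
      finally show ?thesis .
    qed
    finally have 1: "norm (kernel w) \<le> (C + D) * a / tail_scale N"
      by (simp add: add_divide_distrib algebra_simps)
    have "\<Omega> t \<le> A * (t / (t / 3)) powr M * \<Omega> (t / 3)" using t by (intro \<Omega>_upper) auto
    also have "\<dots> \<le> A * 3 powr M * tail_scale N"
      unfolding tail_scale_def a_def[symmetric] using t a3 a0 constants
      by (intro mult_mono \<Omega>_le) (auto simp: field_simps intro!: less_imp_le \<Omega>_pos)
    finally have 2: "\<Omega> t \<le> A * 3 powr M * tail_scale N" .
    have p: "0 < \<Omega> t" "0 < tail_scale N" using t tail_scale_pos by (auto simp: \<Omega>_pos)
    have "1 / tail_scale N \<le> A * 3 powr M / \<Omega> t" using 2 p by (simp add: field_simps)
    then have "(C + D) * a * (1 / tail_scale N) \<le> (C + D) * (3 / t) * (A * 3 powr M / \<Omega> t)"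
      using a3 a0 C D t p constants by (intro mult_mono) auto
    then have "norm (kernel w) \<le> (C + D) * (3 / t) * (A * 3 powr M / \<Omega> t)"
      using 1 by simp
    also have "\<dots> = K / box_size t" by (simp add: K_def box_size_def)
    finally show "norm (kernel w) \<le> K / box_size (norm (1 - w))" by (simp add: t_def)
  qed
qed

text \<open>
  All terms of the series are nonnegative on the diagonal, and those with \<open>N / 2 \<le> n \<le> N\<close>, where \<open>N\<close> is
  about \<open>1 / (4 (1 - |z|))\<close>, suffice, since \<open>|z|\<^bsup>2n\<^esup> \<ge> 1/2\<close> for them.
\<close>

lemma kernel_diagonal_lower:
  obtains C where "0 < C" "\<And>z. z \<in> disc \<Longrightarrow> C / box_size (1 - norm z) \<le> Re (kernel (of_real ((norm z)\<^sup>2)))"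
proof -
  obtain D where D: "0 < D" "\<And>n. moment n \<le> D * tail_scale n"
    using moment_diff_upper[of 0] by auto
  define C where "C = 1 / (16 * D * (A * 8 powr M))"
  have C: "0 < C" using D constants by (simp add: C_def)
  show ?thesis
  proof (rule that[OF C])
    fix z :: complex assume z: "z \<in> disc"
    define x h where "x = norm z" and "h = 1 - x"
    have x: "0 \<le> x" "x < 1" using z by (auto simp: x_def)
    have h: "0 < h" "h \<le> 1" using x by (auto simp: h_def)
    define N where "N = nat \<lfloor>1 / (4 * h)\<rfloor>"
    have fl: "real N = of_int \<lfloor>1 / (4 * h)\<rfloor>" using h by (simp add: N_def)
    have N: "real N \<le> 1 / (4 * h)" "1 / (4 * h) \<le> real N + 1" unfolding fl by linarith+
    define I where "I = {n. n \<le> N \<and> N \<le> 2 * n}"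
    have fin: "finite I" by (rule finite_subset[of _ "{..N}"]) (auto simp: I_def)
    have "I = {(N + 1) div 2 .. N}" by (auto simp: I_def)
    then have "card I = N + 1 - (N + 1) div 2" by simp
    moreover have "N + 1 \<le> 2 * (N + 1 - (N + 1) div 2)" by linarith
    ultimately have card: "1 / (8 * h) \<le> real (card I)" using N(2) by (simp add: field_simps)
    have sm: "(\<lambda>n. kernel_coeff n * (x\<^sup>2) ^ n) sums Re (kernel (of_real (x\<^sup>2)))"
    proof -
      have "norm (of_real (x\<^sup>2) :: complex) < 1" 
        unfolding norm_of_real using x by (simp add: abs_square_less_1)
      from sums_Re[OF kernel_sums[OF this]] show ?thesis
        by (simp add: of_real_power[symmetric] del: of_real_power)
    qed
    have summand: "1 / (D * (A * 8 powr M * \<Omega> h)) * (1/2) \<le> kernel_coeff n * (x\<^sup>2) ^ n" if n: "n \<in> I" for n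
    proof (rule mult_mono)
      have "1 / (real n + 1) \<le> 8 * h"
      proof -
        have "real N + 1 \<le> 2 * (real n + 1)" using n by (simp add: I_def)
        then have "1 / (4 * h) \<le> 2 * (real n + 1)" using N by linarith
        then show ?thesis using h by (simp add: field_simps)
      qed
      then have "tail_scale n \<le> \<Omega> (8 * h)" unfolding tail_scale_def by (rule \<Omega>_le)
      also have "\<dots> \<le> A * (8 * h / h) powr M * \<Omega> h" using h by (intro \<Omega>_upper) auto
      finally have "tail_scale n \<le> A * 8 powr M * \<Omega> h" using h by simp
      then have "moment n \<le> D * (A * 8 powr M * \<Omega> h)"
        using D(2)[of n] D(1) by (meson less_imp_le mult_left_mono order_trans)
      then show "1 / (D * (A * 8 powr M * \<Omega> h)) \<le> kernel_coeff n"
        unfolding kernel_coeff_def using moment_pos[of n] by (intro frac_le) auto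
      have "1 - real m * (1 - x) \<le> x ^ m" for m
        using Bernoulli_inequality[of "- (1 - x)" m] x by (simp add: algebra_simps)
      then have "1 - real (2 * n) * h \<le> x ^ (2 * n)" unfolding h_def .
      moreover have "real (2 * n) * h \<le> 2 * (1 / (4 * h)) * h"
        using n N h by (intro mult_right_mono) (auto simp: I_def)
      moreover have "2 * (1 / (4 * h)) * h = 1/2" using h by simp
      ultimately have "1/2 \<le> x ^ (2 * n)" by linarith
      then show "1/2 \<le> (x\<^sup>2) ^ n" by (simp only: power_mult)
    qed (auto intro: less_imp_le kernel_coeff_pos)
    have "C / box_size h = 1 / (8 * h) * (1 / (D * (A * 8 powr M * \<Omega> h)) * (1/2))"
    proof -
      have "1 / (16 * d * k) / (s * x) = 1 / (8 * s) * (1 / (d * (k * x)) * (1/2))" for d k s x :: real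
        by simp
      then show ?thesis unfolding C_def box_size_def .
    qed
    also have "\<dots> \<le> real (card I) * (1 / (D * (A * 8 powr M * \<Omega> h)) * (1/2))"
      using card D(1) constants \<Omega>_pos[OF h(1)] by (intro mult_right_mono) (auto intro!: mult_nonneg_nonneg)
    also have "\<dots> = (\<Sum>n\<in>I. 1 / (D * (A * 8 powr M * \<Omega> h)) * (1/2))" by simp
    also have "\<dots> \<le> (\<Sum>n\<in>I. kernel_coeff n * (x\<^sup>2) ^ n)" by (intro sum_mono summand)
    also have "\<dots> \<le> (\<Sum>n. kernel_coeff n * (x\<^sup>2) ^ n)"
      by (intro sum_le_suminf sums_summable[OF sm] fin mult_nonneg_nonneg zero_le_power x(1) less_imp_le[OF kernel_coeff_pos])
    also have "\<dots> = Re (kernel (of_real (x\<^sup>2)))" using sums_unique[OF sm] by simp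
    finally show "C / box_size (1 - norm z) \<le> Re (kernel (of_real ((norm z)\<^sup>2)))" by (simp add: h_def x_def)
  qed
qed

text \<open>
  Near the diagonal the kernel keeps its size: it varies slowly, by Cauchy's estimate on a disc
  of radius comparable with \<open>1 - |z|\<close>.
\<close>

lemma kernel_near_diagonal_lower:
  obtains \<delta> C where "0 < \<delta>" "\<delta> \<le> 1/2" "0 < C"
    "\<And>z \<zeta>. z \<in> disc \<Longrightarrow> \<zeta> \<in> ball z (\<delta> * (1 - norm z)) \<Longrightarrow> C / box_size (1 - norm z) \<le> norm (kernel (cnj z * \<zeta>))"
proof -
  obtain c where c: "0 < c" "\<And>z. z \<in> disc \<Longrightarrow> c / box_size (1 - norm z) \<le> Re (kernel (of_real ((norm z)\<^sup>2)))"
    using kernel_diagonal_lower by blast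
  obtain U where U: "0 < U" "\<And>w. norm w < 1 \<Longrightarrow> norm (kernel w) \<le> U / box_size (norm (1 - w))"
    using kernel_upper by blast
  define V where "V = U * (A * 2 powr (M + 1))"
  have V: "0 < V" using U constants by (simp add: V_def)
  \<comment> \<open>With this radius the kernel varies by at most half of its size \<open>c / box_size\<close> on the diagonal.\<close>
  define \<delta> where "\<delta> = min (1/4) (c / (8 * V))"
  have \<delta>: "0 < \<delta>" "\<delta> \<le> 1/4" "\<delta> * (4 * V) \<le> c / 2" using c V by (auto simp: \<delta>_def min_def field_simps)
  show ?thesis
  proof (rule that[of \<delta> "c / 2"])
    show "0 < \<delta>" "\<delta> \<le> 1/2" "0 < c / 2" using \<delta> c by auto
    fix z \<zeta> assume z: "z \<in> disc" and \<zeta>: "\<zeta> \<in> ball z (\<delta> * (1 - norm z))"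
    define h where "h = 1 - norm z"
    have h: "0 < h" using z by (simp add: h_def)
    define u where "u = (of_real ((norm z)\<^sup>2) :: complex)"
    have u: "u = cnj z * z" unfolding u_def using complex_norm_square[of z] by (simp add: mult.commute)
    have nu: "norm u \<le> 1 - h" unfolding u_def norm_of_real using z by (simp add: h_def power2_eq_square mult_left_le)
    have far: "norm x < 1 \<and> norm (kernel x) \<le> V / box_size h" if "x \<in> cball u (h / 2)" for x
    proof -
      have "norm x \<le> norm u + norm (x - u)" by (metis norm_triangle_sub)
      then have nx: "norm x \<le> 1 - h / 2" using that nu by (simp add: dist_norm norm_minus_commute)
      then have lt: "norm x < 1" using h by linarith
      have "h / 2 \<le> norm (1 - x)" using norm_triangle_ineq2[of 1 x] nx by simp
      then have b: "box_size (h / 2) \<le> box_size (norm (1 - x))" using h by (intro box_size_mono) auto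
      have "box_size h \<le> A * 2 powr (M + 1) * box_size (h / 2)" using h by (intro box_size_growth) auto
      also have "\<dots> \<le> A * 2 powr (M + 1) * box_size (norm (1 - x))" using b constants by (intro mult_left_mono) auto
      finally have b2: "box_size h \<le> A * 2 powr (M + 1) * box_size (norm (1 - x))" .
      have p: "0 < box_size h" "0 < box_size (norm (1 - x))"
        using h b box_size_pos[of "h/2"] box_size_pos[of h] by auto
      have "U / box_size (norm (1 - x)) \<le> V / box_size h"
        using b2 p U by (simp add: V_def field_simps)
      then show ?thesis using U(2)[OF lt] lt by auto
    qed
    have der: "norm (deriv kernel x) \<le> 4 * V / (h * box_size h)" if x: "x \<in> ball u (h / 4)" for x
    proof -
      have sub: "cball x (h / 4) \<subseteq> cball u (h / 2)"
      proof
        fix y assume "y \<in> cball x (h / 4)"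
        then show "y \<in> cball u (h / 2)" using x dist_triangle[of u y x] by simp
      qed
      have "norm ((deriv ^^ 1) kernel x) \<le> fact 1 * (V / box_size h) / (h / 4) ^ 1"
      proof (rule Cauchy_inequality)
        have "cball x (h / 4) \<subseteq> disc" using sub far by auto
        then have hol: "kernel holomorphic_on cball x (h / 4)"
          using kernel_holomorphic holomorphic_on_subset by blast
        then show "kernel holomorphic_on ball x (h / 4)" "continuous_on (cball x (h / 4)) kernel"
          using holomorphic_on_subset[OF hol ball_subset_cball] holomorphic_on_imp_continuous_on by auto
        show "norm (kernel y) \<le> V / box_size h" if "norm (x - y) = h / 4" for y
          using far[of y] sub that by (auto simp: dist_norm)
      qed (use h in simp)
      then show ?thesis by (simp add: field_simps)
    qed
    define w where "w = cnj z * \<zeta>"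
    have "w - u = cnj z * (\<zeta> - z)" by (simp add: w_def u algebra_simps)
    then have "norm (w - u) \<le> 1 * norm (\<zeta> - z)" using z by (simp add: norm_mult mult_left_le_one_le)
    then have wu: "norm (w - u) < \<delta> * h" using \<zeta> by (simp add: h_def dist_norm norm_minus_commute)
    have wb: "w \<in> ball u (h / 4)"
    proof -
      have "\<delta> * h \<le> 1 / 4 * h" using \<delta> h by (intro mult_right_mono) auto
      then show ?thesis using wu by (simp add: dist_norm norm_minus_commute)
    qed
    have "norm (kernel w - kernel u) \<le> 4 * V / (h * box_size h) * norm (w - u)"
    proof (rule field_differentiable_bound[where S="ball u (h / 4)" and f'="deriv kernel"])
      show "(kernel has_field_derivative deriv kernel x) (at x within ball u (h / 4))" if "x \<in> ball u (h / 4)" for x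
      proof -
        have "x \<in> cball u (h / 2)" using that h by simp
        then have "x \<in> disc" using far[of x] by simp
        then have "(kernel has_field_derivative deriv kernel x) (at x)"
          by (rule holomorphic_derivI[OF kernel_holomorphic open_ball])
        then show ?thesis by (rule has_field_derivative_at_within)
      qed
    qed (use wb h der in auto)
    also have "\<dots> \<le> 4 * V / (h * box_size h) * (\<delta> * h)"
      using wu V h box_size_pos[OF h] by (intro mult_left_mono) auto
    also have "\<dots> = \<delta> * (4 * V) / box_size h" using h by simp
    also have "\<dots> \<le> (c / 2) / box_size h" using \<delta>(3) box_size_pos[OF h] by (intro divide_right_mono) auto
    finally have "norm (kernel w - kernel u) \<le> (c / 2) / box_size h" .
    moreover have "c / box_size h \<le> norm (kernel u)"
      using c(2)[OF z] complex_Re_le_cmod[of "kernel u"] by (simp add: h_def u_def)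
    moreover have "norm (kernel u) \<le> norm (kernel w) + norm (kernel w - kernel u)"
      by (metis norm_triangle_sub norm_minus_commute)
    ultimately show "c / 2 / box_size (1 - norm z) \<le> norm (kernel (cnj z * \<zeta>))"
      by (simp add: h_def w_def)
  qed
qed

end

section \<open>Carleson squares\<close>

lemma cos_le_cos_iff_near_0:
  fixes c x :: real
  assumes "0 \<le> c" "c \<le> pi" "\<bar>x\<bar> \<le> pi"
  shows "cos c \<le> cos x \<longleftrightarrow> \<bar>x\<bar> \<le> c"
  using cos_mono_le_eq[of c "\<bar>x\<bar>"] assms by simp

lemma abs_Arg_le_iff:
  assumes "w \<noteq> 0" "0 \<le> c" "c \<le> pi"
  shows "\<bar>Arg w\<bar> \<le> c \<longleftrightarrow> cos c * norm w \<le> Re w"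
proof -
  have "\<bar>Arg w\<bar> \<le> c \<longleftrightarrow> cos c \<le> cos (Arg w)"
    using cos_le_cos_iff_near_0[of c "Arg w"] Arg_bounded[of w] assms by (auto simp: abs_le_iff)
  also have "\<dots> \<longleftrightarrow> cos c * norm w \<le> Re w"
    using assms by (simp add: cos_Arg field_simps)
  finally show ?thesis .
qed

lemma cis_in_carleson_arc:
  assumes a: "a \<in> disc" "a \<noteq> 0"
  shows "cis t \<in> carleson_arc a \<longleftrightarrow> cos ((1 - norm a) / 2) * norm a \<le> Re (a * cis (- t))"
proof -
  have c: "0 \<le> (1 - norm a) / 2" "(1 - norm a) / 2 \<le> pi" using a pi_gt3 by (auto intro: order_trans[of _ 1])
  have "cis t \<in> carleson_arc a \<longleftrightarrow> \<bar>Arg (a * cis (- t))\<bar> \<le> (1 - norm a) / 2"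
  proof
    assume "cis t \<in> carleson_arc a"
    then obtain \<theta> where \<theta>: "cis t = cis \<theta>" "\<bar>Arg (a * cis (- \<theta>))\<bar> \<le> (1 - norm a) / 2"
      by (auto simp: carleson_arc_def)
    then have "cis (- t) = cis (- \<theta>)" by (simp add: cis_cnj[symmetric])
    then show "\<bar>Arg (a * cis (- t))\<bar> \<le> (1 - norm a) / 2" using \<theta> by simp
  qed (auto simp: carleson_arc_def)
  also have "\<dots> \<longleftrightarrow> cos ((1 - norm a) / 2) * norm a \<le> Re (a * cis (- t))"
    using abs_Arg_le_iff[of "a * cis (- t)", OF _ c] a by (simp add: norm_mult)
  finally show ?thesis .
qed

lemma cos_ge_cos_iff_wrapped:
  fixes c x :: real
  assumes c: "0 < c" "c \<le> 1" and x: "- 2 * pi < x" "x < 2 * pi"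
  shows "cos c \<le> cos x \<longleftrightarrow> \<bar>x\<bar> \<le> c \<or> 2 * pi - c \<le> \<bar>x\<bar>"
proof (cases "\<bar>x\<bar> \<le> pi")
  case True
  then show ?thesis using cos_le_cos_iff_near_0[of c x] c pi_gt3 by auto
next
  case False
  have "cos x = cos (2 * pi - \<bar>x\<bar>)" by (simp add: cos_diff)
  then have "cos c \<le> cos x \<longleftrightarrow> \<bar>2 * pi - \<bar>x\<bar>\<bar> \<le> c"
    using cos_le_cos_iff_near_0[of c "2 * pi - \<bar>x\<bar>"] False c pi_gt3 x by auto
  then show ?thesis using False c pi_gt3 x by (auto simp: abs_le_iff)
qed

lemma measure_lebesgue_Icc_Ico:
  fixes x y :: real
  assumes "x \<le> y"
  shows "measure lebesgue {x..y} = y - x" "measure lebesgue {x..<y} = y - x"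
  using assms by (simp_all add: measure_completion)

lemma arc_length_carleson_arc:
  assumes a: "a \<in> disc" "a \<noteq> 0"
  shows "arc_length (carleson_arc a) = 1 - norm a"
proof -
  define c \<phi> where "c = (1 - norm a) / 2" and "\<phi> = Arg2pi a"
  have c: "0 < c" "c \<le> 1/2" using a by (auto simp: c_def)
  have \<phi>: "0 \<le> \<phi>" "\<phi> < 2 * pi" using Arg2pi_ge_0[of a] Arg2pi_lt_2pi[of a] by (auto simp: \<phi>_def)
  have a_eq: "a = of_real (norm a) * cis \<phi>" using Arg2pi_eq[of a] by (simp add: \<phi>_def cis_conv_exp)
  have arc: "cis t \<in> carleson_arc a \<longleftrightarrow> \<bar>\<phi> - t\<bar> \<le> c \<or> 2 * pi - c \<le> \<bar>\<phi> - t\<bar>" if "t \<in> {0..<2 * pi}" for t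
  proof -
    have "Re (a * cis (- t)) = norm a * cos (\<phi> - t)"
      by (subst (1) a_eq) (simp add: mult.assoc cis_mult)
    then have "cis t \<in> carleson_arc a \<longleftrightarrow> cos c \<le> cos (\<phi> - t)"
      using a by (simp add: cis_in_carleson_arc c_def mult.commute)
    then show ?thesis using cos_ge_cos_iff_wrapped[of c "\<phi> - t"] c \<phi> that by auto
  qed
  define E where "E = {t \<in> {0..<2 * pi}. cis t \<in> carleson_arc a}"
  have E: "t \<in> E \<longleftrightarrow> t \<in> {0..<2 * pi} \<and> (\<bar>\<phi> - t\<bar> \<le> c \<or> 2 * pi - c \<le> \<bar>\<phi> - t\<bar>)" for t
    using arc by (auto simp: E_def)
  have pi: "3 < pi" by (rule pi_gt3)
  \<comment> \<open>The arc may wrap around the point 1, where the angle jumps from \<open>2 \<pi>\<close> to 0, on either side.\<close>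
  consider "c \<le> \<phi>" "\<phi> + c < 2 * pi" | "\<phi> < c" | "2 * pi \<le> \<phi> + c" by linarith
  then have "measure lebesgue E = 2 * c"
  proof cases
    case 1
    have "E = {\<phi> - c..\<phi> + c}" by (rule set_eqI) (use 1 c \<phi> pi in \<open>auto simp: E abs_if\<close>)
    then show ?thesis using c by (simp add: measure_lebesgue_Icc_Ico)
  next
    case 2
    have "E = {0..\<phi> + c} \<union> {\<phi> - c + 2 * pi..<2 * pi}"
      by (rule set_eqI) (use 2 c \<phi> pi in \<open>auto simp: E abs_if\<close>)
    moreover have "measure lebesgue ({0..\<phi> + c} \<union> {\<phi> - c + 2 * pi..<2 * pi}) = (\<phi> + c) + (2 * pi - (\<phi> - c + 2 * pi))"
      using 2 c \<phi> pi by (subst measure_Union) (auto simp: measure_lebesgue_Icc_Ico)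
    ultimately show ?thesis by simp
  next
    case 3
    have "E = {\<phi> - c..<2 * pi} \<union> {0..\<phi> + c - 2 * pi}"
      by (rule set_eqI) (use 3 c \<phi> pi in \<open>auto simp: E abs_if\<close>)
    moreover have "measure lebesgue ({\<phi> - c..<2 * pi} \<union> {0..\<phi> + c - 2 * pi}) = (2 * pi - (\<phi> - c)) + (\<phi> + c - 2 * pi)"
      using 3 c \<phi> pi by (subst measure_Union) (auto simp: measure_lebesgue_Icc_Ico)
    ultimately show ?thesis by simp
  qed
  then show ?thesis by (simp add: arc_length_def E_def c_def)
qed

text \<open>
  The cosine turns the condition on the argument into an inequality between continuous functions
  of \<open>\<zeta>\<close>.
\<close>

lemma mem_carleson_box:
  assumes a: "a \<in> disc" "a \<noteq> 0"
  shows "\<zeta> \<in> carleson_box a \<longleftrightarrow> \<zeta> \<in> disc \<and> norm a \<le> norm \<zeta> \<and> cos ((1 - norm a) / 2) * (norm a * norm \<zeta>) \<le> Re (a * cnj \<zeta>)"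
proof
  assume "\<zeta> \<in> carleson_box a"
  then obtain r t where rt: "\<zeta> = of_real r * cis t" "cis t \<in> carleson_arc a" "norm a \<le> r" "r < 1" "0 \<le> r"
    using a by (auto simp: carleson_box_def carleson_square_def arc_length_carleson_arc)
  have n: "norm \<zeta> = r" using rt by (simp add: norm_mult)
  have "cos ((1 - norm a) / 2) * norm a \<le> Re (a * cis (- t))" using rt a by (simp add: cis_in_carleson_arc)
  then have "r * (cos ((1 - norm a) / 2) * norm a) \<le> r * Re (a * cis (- t))" using rt by (intro mult_left_mono) auto
  also have "\<dots> = Re (a * cnj \<zeta>)" by (simp add: rt(1) cis_cnj algebra_simps)
  finally show "\<zeta> \<in> disc \<and> norm a \<le> norm \<zeta> \<and> cos ((1 - norm a) / 2) * (norm a * norm \<zeta>) \<le> Re (a * cnj \<zeta>)"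
    using rt n by (simp add: mult_ac)
next
  assume *: "\<zeta> \<in> disc \<and> norm a \<le> norm \<zeta> \<and> cos ((1 - norm a) / 2) * (norm a * norm \<zeta>) \<le> Re (a * cnj \<zeta>)"
  define r t where "r = norm \<zeta>" and "t = Arg \<zeta>"
  have z: "\<zeta> = of_real r * cis t" using rcis_cmod_Arg[of \<zeta>] by (simp add: rcis_def r_def t_def)
  have r: "0 < r" "norm a \<le> r" "r < 1" using * a by (auto simp: r_def intro: less_le_trans[of 0 "norm a"])
  have "Re (a * cnj \<zeta>) = r * Re (a * cis (- t))" by (simp add: z cis_cnj algebra_simps)
  then have "r * (cos ((1 - norm a) / 2) * norm a) \<le> r * Re (a * cis (- t))"
    using * by (simp add: r_def mult_ac)
  then have "cis t \<in> carleson_arc a" using r a by (simp add: cis_in_carleson_arc)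
  then have "\<zeta> = of_real r * cis t \<and> cis t \<in> carleson_arc a \<and> 0 \<le> r \<and> 1 - (1 - norm a) \<le> r \<and> r < 1"
    using z r by auto
  then have "\<exists>r t. \<zeta> = of_real r * cis t \<and> cis t \<in> carleson_arc a \<and> 0 \<le> r \<and> 1 - (1 - norm a) \<le> r \<and> r < 1"
    by blast
  then show "\<zeta> \<in> carleson_box a"
    using a(2) by (simp only: carleson_box_def carleson_square_def arc_length_carleson_arc[OF a] mem_Collect_eq if_False)
qed

lemma carleson_box_subset: "a \<in> disc \<Longrightarrow> carleson_box a \<subseteq> disc"
  by (cases "a = 0") (auto simp: mem_carleson_box simp del: mem_ball_0, simp_all add: carleson_box_def)

lemma carleson_box_borel:
  assumes "a \<in> disc"
  shows "carleson_box a \<in> sets borel"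
proof (cases "a = 0")
  case False
  have "carleson_box a = disc \<inter> {\<zeta>. norm a \<le> norm \<zeta>} \<inter> {\<zeta>. cos ((1 - norm a) / 2) * (norm a * norm \<zeta>) \<le> Re (a * cnj \<zeta>)}"
    by (rule set_eqI) (simp only: mem_carleson_box[OF assms False] mem_Collect_eq Int_iff conj_assoc)
  also have "\<dots> \<in> sets borel"
    by (intro sets.Int ball_borel borel_closed[OF closed_Collect_le] continuous_intros)
  finally show ?thesis .
qed (simp add: carleson_box_def)

lemma kernel_dist_on_carleson_box:
  assumes a: "a \<in> disc" and \<zeta>: "\<zeta> \<in> carleson_box a"
  shows "norm (1 - cnj a * \<zeta>) \<le> 3 * (1 - norm a)"
proof (cases "a = 0")
  case False
  define h c v where "h = 1 - norm a" and "c = h / 2" and "v = cnj a * \<zeta>"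
  have h: "0 < h" "h \<le> 1" using a by (auto simp: h_def)
  note box = \<zeta>[unfolded mem_carleson_box[OF a False]]
  have "Re v = Re (a * cnj \<zeta>)" by (simp add: v_def)
  then have Re: "cos c * norm v \<le> Re v" using box by (simp add: v_def norm_mult c_def h_def)
  have v1: "norm v \<le> 1" using a box by (simp add: v_def norm_mult mult_le_one)
  have "(1 - h) * (1 - h) \<le> norm v"
    unfolding v_def norm_mult complex_mod_cnj using box h by (intro mult_mono) (auto simp: h_def)
  moreover have "1 - 2 * h \<le> (1 - h) * (1 - h)" by (simp add: algebra_simps)
  ultimately have vl: "1 - norm v \<le> 2 * h" by linarith
  have cos: "1 - cos c \<le> c\<^sup>2 / 2"
  proof -
    have "cos c = 1 - 2 * (sin (c / 2))\<^sup>2" using cos_double_sin[of "c / 2"] by simp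
    moreover have "(sin (c / 2))\<^sup>2 \<le> (c / 2)\<^sup>2"
      using abs_sin_x_le_abs_x[of "c / 2"] by (simp only: abs_le_square_iff)
    ultimately show ?thesis by (simp add: power_divide)
  qed
  have "(norm (1 - v))\<^sup>2 = 1 - 2 * Re v + (norm v)\<^sup>2"
    by (simp add: cmod_power2) (simp add: power2_eq_square algebra_simps)
  also have "\<dots> \<le> 1 - 2 * (cos c * norm v) + (norm v)\<^sup>2" using Re by simp
  also have "\<dots> = (1 - norm v)\<^sup>2 + 2 * norm v * (1 - cos c)" by (simp add: power2_eq_square algebra_simps)
  also have "\<dots> \<le> (2 * h)\<^sup>2 + 2 * 1 * (c\<^sup>2 / 2)"
    using vl v1 cos by (intro add_mono mult_mono power_mono) auto
  also have "\<dots> \<le> (3 * h)\<^sup>2" by (simp add: c_def power2_eq_square)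
  finally have "norm (1 - v) \<le> 3 * h" by (rule power2_le_imp_le) (use h in simp)
  then show ?thesis by (simp add: v_def h_def)
qed simp

lemma mult_cos_le_sin:
  fixes x :: real
  assumes "0 \<le> x" "x \<le> pi"
  shows "x * cos x \<le> sin x"
proof -
  have "sin 0 - 0 * cos 0 \<le> sin x - x * cos (x::real)"
  proof (rule DERIV_nonneg_imp_nondecreasing[OF assms(1)])
    fix y :: real assume y: "0 \<le> y" "y \<le> x"
    have "((\<lambda>y. sin y - y * cos y) has_real_derivative (y * sin y)) (at y)"
      by (auto intro!: derivative_eq_intros)
    moreover have "0 \<le> y * sin y" using y assms by (intro mult_nonneg_nonneg sin_ge_zero) auto
    ultimately show "\<exists>z. ((\<lambda>y. sin y - y * cos y) has_real_derivative z) (at y) \<and> 0 \<le> z" by blast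
  qed
  then show ?thesis by simp
qed

text \<open>
  Relative to \<open>u\<close> the argument of a point of the disc has a tangent of at most \<open>r / (\<rho> - r)\<close>, and hence
  is at most \<open>h / 2\<close>, the half width of the arc.
\<close>

lemma ball_subset_carleson_box:
  assumes u: "norm u = 1" and h: "0 < h" "h < 1" and r: "0 < r"
    and \<rho>: "1 - h \<le> \<rho> - r" "\<rho> + r \<le> 1" "r \<le> h / 2 * (\<rho> - r)"
  shows "ball (of_real \<rho> * u) r \<subseteq> carleson_box (of_real (1 - h) * u)"
proof
  fix \<zeta> assume \<zeta>: "\<zeta> \<in> ball (of_real \<rho> * u) r"
  define a \<eta> where "a = of_real (1 - h) * u" and "\<eta> = cnj u * \<zeta>"
  have na: "norm a = 1 - h" unfolding a_def norm_mult norm_of_real u using h by simp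
  then have a: "a \<in> disc" "a \<noteq> 0" using h by auto
  have uu: "cnj u * u = 1" using complex_norm_square[of u] u by (simp add: mult.commute)
  have "\<eta> - of_real \<rho> = cnj u * (\<zeta> - of_real \<rho> * u)"
    using uu by (simp add: \<eta>_def algebra_simps)
  then have "norm (\<eta> - of_real \<rho>) = norm (\<zeta> - of_real \<rho> * u)" using u by (simp add: norm_mult)
  then have d: "norm (\<eta> - of_real \<rho>) < r" using \<zeta> by (simp add: dist_norm norm_minus_commute)
  have n: "norm \<eta> = norm \<zeta>" using u by (simp add: \<eta>_def norm_mult)
  have Re: "\<rho> - r < Re \<eta>" using abs_Re_le_cmod[of "\<eta> - of_real \<rho>"] d by simp
  have Im: "\<bar>Im \<eta>\<bar> < r" using abs_Im_le_cmod[of "\<eta> - of_real \<rho>"] d by simp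
  have pos: "0 < Re \<eta>" using Re \<rho> h by linarith
  have rp: "0 \<le> \<rho>" using \<rho> h r by linarith
  have n1: "norm \<zeta> < 1" "1 - h \<le> norm \<zeta>"
  proof -
    have "norm \<eta> \<le> norm (of_real \<rho> :: complex) + norm (\<eta> - of_real \<rho>)" by (metis norm_triangle_sub)
    then show "norm \<zeta> < 1" using d \<rho> n rp by simp
    show "1 - h \<le> norm \<zeta>" using complex_Re_le_cmod[of \<eta>] Re \<rho> n by simp
  qed
  define c where "c = h / 2"
  have c: "0 < c" "c \<le> pi / 2" using h pi_gt3 by (auto simp: c_def)
  have cs: "0 \<le> cos c" "0 \<le> sin c" "c * cos c \<le> sin c" using c by (auto intro!: cos_ge_zero sin_ge_zero mult_cos_le_sin)
  have "h / 2 * (\<rho> - r) \<le> h / 2 * Re \<eta>" using Re h by (intro mult_left_mono) auto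
  then have "\<bar>Im \<eta>\<bar> \<le> c * Re \<eta>" unfolding c_def using Im \<rho> by linarith
  then have "cos c * \<bar>Im \<eta>\<bar> \<le> cos c * (c * Re \<eta>)" by (rule mult_left_mono[OF _ cs(1)])
  also have "\<dots> = (c * cos c) * Re \<eta>" by simp
  also have "\<dots> \<le> sin c * Re \<eta>" using cs pos by (intro mult_right_mono) auto
  finally have "(cos c * \<bar>Im \<eta>\<bar>)\<^sup>2 \<le> (sin c * Re \<eta>)\<^sup>2" using cs by (intro power_mono) auto
  then have "(cos c)\<^sup>2 * (Im \<eta>)\<^sup>2 \<le> (1 - (cos c)\<^sup>2) * (Re \<eta>)\<^sup>2" by (simp add: power_mult_distrib sin_squared_eq)
  then have "(cos c * norm \<eta>)\<^sup>2 \<le> (Re \<eta>)\<^sup>2" by (simp add: power_mult_distrib cmod_power2 algebra_simps)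
  then have *: "cos c * norm \<eta> \<le> Re \<eta>" by (rule power2_le_imp_le) (use pos in simp)
  have "a * cnj \<zeta> = of_real (1 - h) * cnj \<eta>" by (simp add: a_def \<eta>_def)
  then have "Re (a * cnj \<zeta>) = (1 - h) * Re \<eta>" by simp
  moreover have "(1 - h) * (cos c * norm \<eta>) \<le> (1 - h) * Re \<eta>" using * h by (intro mult_left_mono) auto
  ultimately have "cos c * (norm a * norm \<zeta>) \<le> Re (a * cnj \<zeta>)" by (simp add: na n mult_ac)
  then have "\<zeta> \<in> carleson_box a"
    unfolding mem_carleson_box[OF a] using n1 by (simp add: na c_def)
  then show "\<zeta> \<in> carleson_box (of_real (1 - h) * u)" by (simp add: a_def)
qed

section \<open>The reproducing kernel\<close>

lemma ennpow_less_top [simp]: "ennpow x a < top \<longleftrightarrow> x < top"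
  by (auto simp: ennpow_def top.not_eq_extremum)

lemma bergman_space_iff:
  "f \<in> bergman_space p \<omega> \<longleftrightarrow>
    f holomorphic_on disc \<and> (\<integral>\<^sup>+z. ennreal (norm (f z) powr p) \<partial>weight_measure \<omega>) < \<infinity>"
  by (simp add: bergman_space_def bergman_norm_def Lp_norm_def)

lemma nn_integral_weight_measure_cong:
  assumes "\<And>z. z \<in> disc \<Longrightarrow> F z = G z"
  shows "(\<integral>\<^sup>+z. F z \<partial>weight_measure \<omega>) = (\<integral>\<^sup>+z. G z \<partial>weight_measure \<omega>)"
  using assms by (intro nn_integral_cong) (simp add: weight_measure_def space_restrict_space)

context regular_profile
begin

lemma holomorphic_measurable:
  "f holomorphic_on disc \<Longrightarrow> f \<in> borel_measurable \<nu>"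
  by (intro continuous_measurable_weight_measure holomorphic_on_imp_continuous_on)

lemma bergman_space_bounded:
  assumes f: "f holomorphic_on disc" and B: "\<And>z. z \<in> disc \<Longrightarrow> norm (f z) \<le> B" and p: "0 \<le> p"
  shows "f \<in> bergman_space p \<omega>"
  unfolding bergman_space_iff
proof (intro conjI f)
  have "(\<integral>\<^sup>+z. ennreal (norm (f z) powr p) \<partial>\<nu>) \<le> (\<integral>\<^sup>+z. ennreal (B powr p) \<partial>\<nu>)"
    using B p by (intro nn_integral_mono ennreal_leI powr_mono2) auto
  also have "\<dots> < \<infinity>"
    using finite_measure.emeasure_finite[OF finite_weight_measure, of disc]
    by (simp add: ennreal_mult_less_top top.not_eq_extremum)
  finally show "(\<integral>\<^sup>+z. ennreal (norm (f z) powr p) \<partial>\<nu>) < \<infinity>" .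
qed

lemma bergman_space_integrable:
  assumes f: "f \<in> bergman_space p \<omega>" and p: "1 \<le> p"
  shows "integrable \<nu> f"
proof (rule integrableI_bounded)
  have hol: "f holomorphic_on disc" and fin: "(\<integral>\<^sup>+z. ennreal (norm (f z) powr p) \<partial>\<nu>) < \<infinity>"
    using f by (auto simp: bergman_space_iff)
  show m [measurable]: "f \<in> borel_measurable \<nu>" by (rule holomorphic_measurable[OF hol])
  have "(\<integral>\<^sup>+z. ennreal (norm (f z)) \<partial>\<nu>) \<le> (\<integral>\<^sup>+z. 1 + ennreal (norm (f z) powr p) \<partial>\<nu>)"
  proof (rule nn_integral_mono)
    fix z
    have "norm (f z) \<le> 1 + norm (f z) powr p"
    proof (cases "norm (f z) \<le> 1")
      case False
      then have "norm (f z) powr 1 \<le> norm (f z) powr p" using p by (intro powr_mono) auto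
      then show ?thesis using False by simp
    qed (simp add: add_increasing2)
    then show "ennreal (norm (f z)) \<le> 1 + ennreal (norm (f z) powr p)"
      by (simp add: ennreal_plus[symmetric] ennreal_leI del: ennreal_plus flip: ennreal_1)
  qed
  also have "\<dots> = emeasure \<nu> disc + (\<integral>\<^sup>+z. ennreal (norm (f z) powr p) \<partial>\<nu>)"
    by (subst nn_integral_add) auto
  also have "\<dots> < \<infinity>"
    using fin finite_measure.emeasure_finite[OF finite_weight_measure, of disc] by (simp add: top.not_eq_extremum)
  finally show "(\<integral>\<^sup>+z. ennreal (norm (f z)) \<partial>\<nu>) < \<infinity>" .
qed

text \<open>
  The Taylor series may be integrated term by term on smaller concentric discs, and dominated
  convergence exhausts the unit disc.
\<close>

lemma taylor_coefficient_integral: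
  assumes f: "f holomorphic_on disc" and int: "integrable \<nu> f"
  shows "(\<integral>\<zeta>. f \<zeta> * cnj \<zeta> ^ n \<partial>\<nu>) = (deriv ^^ n) f 0 / fact n * of_real (moment n)"
proof -
  define \<rho> where "\<rho> = (\<lambda>i::nat. 1 + - inverse (real (Suc i)))"
  have \<rho>: "0 \<le> \<rho> i" "\<rho> i < 1" for i by (auto simp: \<rho>_def field_simps)
  have lim: "\<rho> \<longlonglongrightarrow> 1" unfolding \<rho>_def by (rule LIMSEQ_inverse_real_of_nat_add_minus)
  have ev: "(\<lambda>i. indicator (cball 0 (\<rho> i)) \<zeta> *\<^sub>R g \<zeta>) \<longlonglongrightarrow> g \<zeta>" if "\<zeta> \<in> disc" for g :: "complex \<Rightarrow> complex" and \<zeta>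
  proof (rule tendsto_eventually)
    have "eventually (\<lambda>i. norm \<zeta> < \<rho> i) sequentially" using order_tendstoD(1)[OF lim, of "norm \<zeta>"] that by simp
    then show "eventually (\<lambda>i. indicator (cball 0 (\<rho> i)) \<zeta> *\<^sub>R g \<zeta> = g \<zeta>) sequentially"
      by eventually_elim simp
  qed
  note [measurable] = holomorphic_measurable[OF f]
  have cn [measurable]: "(\<lambda>\<zeta>. cnj \<zeta>) \<in> borel_measurable \<nu>"
    by (rule measurable_compose[OF identity_measurable_weight_measure' cnj_measurable])
  have 1: "(\<lambda>i. \<integral>\<zeta>. indicator (cball 0 (\<rho> i)) \<zeta> *\<^sub>R (f \<zeta> * cnj \<zeta> ^ n) \<partial>\<nu>) \<longlonglongrightarrow> (\<integral>\<zeta>. f \<zeta> * cnj \<zeta> ^ n \<partial>\<nu>)"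
  proof (rule integral_dominated_convergence[where w="\<lambda>\<zeta>. norm (f \<zeta>)"])
    show "AE \<zeta> in \<nu>. norm (indicator (cball 0 (\<rho> i)) \<zeta> *\<^sub>R (f \<zeta> * cnj \<zeta> ^ n)) \<le> norm (f \<zeta>)" for i
      by (intro AE_I2) (auto simp: indicator_def norm_mult norm_power intro!: mult_left_le power_le_one)
  qed (use int in \<open>auto intro!: AE_I2 ev\<close>)
  have 2: "(\<lambda>i. \<integral>\<zeta>. indicator (cball 0 (\<rho> i)) \<zeta> *\<^sub>R of_real (norm \<zeta> ^ (2 * n)) \<partial>\<nu>) \<longlonglongrightarrow> (\<integral>\<zeta>. complex_of_real (norm \<zeta> ^ (2 * n)) \<partial>\<nu>)"
  proof (rule integral_dominated_convergence[where w="\<lambda>\<zeta>. 1"])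
    show "AE \<zeta> in \<nu>. norm (indicator (cball 0 (\<rho> i)) \<zeta> *\<^sub>R complex_of_real (norm \<zeta> ^ (2 * n))) \<le> 1" for i
      by (intro AE_I2) (auto simp: indicator_def norm_power intro!: power_le_one)
    show "integrable \<nu> (\<lambda>\<zeta>. 1::real)" by (rule finite_measure.integrable_const[OF finite_weight_measure])
  qed (auto intro!: AE_I2 ev)
  have 3: "(\<integral>\<zeta>. complex_of_real (norm \<zeta> ^ (2 * n)) \<partial>\<nu>) = of_real (moment n)"
    unfolding moment_diff_def by (subst integral_complex_of_real[symmetric]) simp
  have eq: "(\<integral>\<zeta>. indicator (cball 0 (\<rho> i)) \<zeta> *\<^sub>R (f \<zeta> * cnj \<zeta> ^ n) \<partial>\<nu>)
    = (deriv ^^ n) f 0 / fact n * (\<integral>\<zeta>. indicator (cball 0 (\<rho> i)) \<zeta> *\<^sub>R of_real (norm \<zeta> ^ (2 * n)) \<partial>\<nu>)" for i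
  proof (rule rotation_invariant_coefficient[OF _ weight_measure_rotate _ f])
    show "emeasure \<nu> (space \<nu> \<inter> cball 0 (\<rho> i)) < \<infinity>"
      using finite_measure.emeasure_finite[OF finite_weight_measure] by (simp add: top.not_eq_extremum)
  qed (use \<rho> in auto)
  have "(\<lambda>i. \<integral>\<zeta>. indicator (cball 0 (\<rho> i)) \<zeta> *\<^sub>R (f \<zeta> * cnj \<zeta> ^ n) \<partial>\<nu>) \<longlonglongrightarrow> (deriv ^^ n) f 0 / fact n * of_real (moment n)"
    unfolding eq by (rule tendsto_mult_left[OF 2[unfolded 3]])
  then show ?thesis using LIMSEQ_unique[OF 1] by blast
qed

text \<open>
  With \<open>N = \<nu>\<close> this gives the reproducing property, with \<open>N = \<mu>\<close> the power series expansion of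
  Toeplitz transforms.
\<close>

lemma kernel_series_integral:
  fixes N :: "complex measure"
  assumes sub: "space N \<subseteq> disc" and id: "(\<lambda>x. x) \<in> N \<rightarrow>\<^sub>M borel" and f: "integrable N f" and z: "z \<in> disc"
  shows "integrable N (\<lambda>\<zeta>. f \<zeta> * cnj (kernel (cnj z * \<zeta>)))"
    "(\<lambda>n. of_real (kernel_coeff n) * (\<integral>\<zeta>. f \<zeta> * cnj \<zeta> ^ n \<partial>N) * z ^ n) sums (\<integral>\<zeta>. f \<zeta> * cnj (kernel (cnj z * \<zeta>)) \<partial>N)"
proof -
  let ?t = "\<lambda>n \<zeta>. of_real (kernel_coeff n) * z ^ n * (f \<zeta> * cnj \<zeta> ^ n)"
  have cn: "(\<lambda>\<zeta>. cnj \<zeta>) \<in> borel_measurable N" by (rule measurable_compose[OF id cnj_measurable])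
  note [measurable] = cn borel_measurable_integrable[OF f]
  have int: "integrable N (\<lambda>\<zeta>. f \<zeta> * cnj \<zeta> ^ n)" for n
  proof (rule Bochner_Integration.integrable_bound[OF f])
    show "AE \<zeta> in N. norm (f \<zeta> * cnj \<zeta> ^ n) \<le> norm (f \<zeta>)"
      by (intro AE_I2) (use sub in \<open>auto simp: norm_mult norm_power intro!: mult_left_le power_le_one\<close>)
  qed measurable
  have t: "integrable N (?t n)" for n by (intro integrable_mult_right int)
  have bd: "norm (?t n \<zeta>) \<le> norm (of_real (kernel_coeff n) * z ^ n) * norm (f \<zeta>)" if "\<zeta> \<in> space N" for n \<zeta>
  proof -
    have "norm (cnj \<zeta> ^ n) \<le> 1" using sub that by (auto simp: norm_power intro!: power_le_one)
    then have "norm (f \<zeta> * cnj \<zeta> ^ n) \<le> norm (f \<zeta>)" by (simp add: norm_mult mult_left_le)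
    then show ?thesis unfolding norm_mult[of "of_real (kernel_coeff n) * z ^ n"] by (rule mult_left_mono) simp
  qed
  have s: "summable (\<lambda>n. norm (of_real (kernel_coeff n) * z ^ n))" using z by (intro summable_kernel) simp
  have AE: "AE \<zeta> in N. summable (\<lambda>n. norm (?t n \<zeta>))"
  proof (rule AE_I2)
    fix \<zeta> assume "\<zeta> \<in> space N"
    then show "summable (\<lambda>n. norm (?t n \<zeta>))"
      using bd by (intro summable_comparison_test'[OF summable_mult2[OF s], of 0]) auto
  qed
  have si: "summable (\<lambda>n. \<integral>\<zeta>. norm (?t n \<zeta>) \<partial>N)"
  proof (rule summable_comparison_test'[OF summable_mult2[OF s], of 0])
    fix n
    have "(\<integral>\<zeta>. norm (?t n \<zeta>) \<partial>N) \<le> (\<integral>\<zeta>. norm (of_real (kernel_coeff n) * z ^ n) * norm (f \<zeta>) \<partial>N)"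
      by (intro integral_mono integrable_norm t integrable_mult_right f bd)
    also have "\<dots> = norm (of_real (kernel_coeff n) * z ^ n) * (\<integral>\<zeta>. norm (f \<zeta>) \<partial>N)"
      by (rule integral_mult_right_zero)
    finally show "norm (\<integral>\<zeta>. norm (?t n \<zeta>) \<partial>N) \<le> norm (of_real (kernel_coeff n) * z ^ n) * (\<integral>\<zeta>. norm (f \<zeta>) \<partial>N)"
      by (simp add: integral_nonneg_AE)
  qed
  have sum: "(\<Sum>n. ?t n \<zeta>) = f \<zeta> * cnj (kernel (cnj z * \<zeta>))" if "\<zeta> \<in> space N" for \<zeta>
  proof -
    have "norm (cnj z * \<zeta>) < 1 * 1"
      unfolding norm_mult using that sub z by (intro mult_strict_mono') auto
    then have "(\<lambda>n. cnj (of_real (kernel_coeff n) * (cnj z * \<zeta>) ^ n)) sums cnj (kernel (cnj z * \<zeta>))"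
      using kernel_sums by (subst sums_cnj) simp
    then have "(\<lambda>n. f \<zeta> * cnj (of_real (kernel_coeff n) * (cnj z * \<zeta>) ^ n)) sums (f \<zeta> * cnj (kernel (cnj z * \<zeta>)))"
      by (rule sums_mult)
    moreover have "f \<zeta> * cnj (of_real (kernel_coeff n) * (cnj z * \<zeta>) ^ n) = ?t n \<zeta>" for n
      by (simp add: power_mult_distrib mult_ac)
    ultimately have "(\<lambda>n. ?t n \<zeta>) sums (f \<zeta> * cnj (kernel (cnj z * \<zeta>)))" by (simp only:)
    then show ?thesis by (rule sums_unique[symmetric])
  qed
  have "integrable N (\<lambda>\<zeta>. \<Sum>n. ?t n \<zeta>)" by (rule integrable_suminf[OF t AE si])
  then show "integrable N (\<lambda>\<zeta>. f \<zeta> * cnj (kernel (cnj z * \<zeta>)))"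
    by (rule Bochner_Integration.integrable_cong[THEN iffD1, rotated -1]) (use sum in auto)
  have "(\<lambda>n. integral\<^sup>L N (?t n)) sums (\<integral>\<zeta>. (\<Sum>n. ?t n \<zeta>) \<partial>N)" by (rule sums_integral[OF t AE si])
  also have "(\<integral>\<zeta>. (\<Sum>n. ?t n \<zeta>) \<partial>N) = (\<integral>\<zeta>. f \<zeta> * cnj (kernel (cnj z * \<zeta>)) \<partial>N)"
    by (intro Bochner_Integration.integral_cong) (use sum in auto)
  also have "(\<lambda>n. integral\<^sup>L N (?t n)) = (\<lambda>n. of_real (kernel_coeff n) * (\<integral>\<zeta>. f \<zeta> * cnj \<zeta> ^ n \<partial>N) * z ^ n)"
  proof
    fix n
    have "integral\<^sup>L N (?t n) = of_real (kernel_coeff n) * z ^ n * (\<integral>\<zeta>. f \<zeta> * cnj \<zeta> ^ n \<partial>N)"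
      by (rule integral_mult_right_zero)
    then show "integral\<^sup>L N (?t n) = of_real (kernel_coeff n) * (\<integral>\<zeta>. f \<zeta> * cnj \<zeta> ^ n \<partial>N) * z ^ n"
      by (simp only: mult_ac)
  qed
  finally show "(\<lambda>n. of_real (kernel_coeff n) * (\<integral>\<zeta>. f \<zeta> * cnj \<zeta> ^ n \<partial>N) * z ^ n) sums (\<integral>\<zeta>. f \<zeta> * cnj (kernel (cnj z * \<zeta>)) \<partial>N)" .
qed

lemma kernel_reproducing:
  assumes f: "f holomorphic_on disc" and int: "integrable \<nu> f" and z: "z \<in> disc"
  shows "(\<integral>\<zeta>. f \<zeta> * cnj (kernel (cnj z * \<zeta>)) \<partial>\<nu>) = f z"
proof -
  have "(\<lambda>n. of_real (kernel_coeff n) * (\<integral>\<zeta>. f \<zeta> * cnj \<zeta> ^ n \<partial>\<nu>) * z ^ n) sums (\<integral>\<zeta>. f \<zeta> * cnj (kernel (cnj z * \<zeta>)) \<partial>\<nu>)"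
    by (rule kernel_series_integral(2)[OF _ _ int z]) auto
  moreover have "of_real (kernel_coeff n) * (\<integral>\<zeta>. f \<zeta> * cnj \<zeta> ^ n \<partial>\<nu>) * z ^ n = (deriv ^^ n) f 0 / fact n * (z - 0) ^ n" for n
    using moment_pos[of n] by (simp add: taylor_coefficient_integral[OF f int] kernel_coeff_def)
  ultimately have "(\<lambda>n. (deriv ^^ n) f 0 / fact n * (z - 0) ^ n) sums (\<integral>\<zeta>. f \<zeta> * cnj (kernel (cnj z * \<zeta>)) \<partial>\<nu>)" by simp
  then show ?thesis using holomorphic_power_series[OF f z] by (rule sums_unique2)
qed

lemma mult_in_disc: "z \<in> disc \<Longrightarrow> \<zeta> \<in> disc \<Longrightarrow> cnj z * \<zeta> \<in> disc"
  using mult_strict_mono'[of "norm z" 1 "norm \<zeta>" 1] by (simp add: norm_mult)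

lemma kernel_slice_holomorphic:
  assumes "z \<in> disc"
  shows "(\<lambda>\<zeta>. kernel (cnj z * \<zeta>)) holomorphic_on disc"
  by (rule holomorphic_on_compose_gen[OF _ kernel_holomorphic, unfolded o_def])
     (use assms mult_in_disc in \<open>auto intro!: holomorphic_intros simp del: mem_ball_0\<close>)

lemma kernel_slice_bounded:
  assumes z: "z \<in> disc"
  obtains B where "\<And>\<zeta>. \<zeta> \<in> disc \<Longrightarrow> norm (kernel (cnj z * \<zeta>)) \<le> B"
proof -
  obtain U where U: "0 < U" "\<And>w. norm w < 1 \<Longrightarrow> norm (kernel w) \<le> U / box_size (norm (1 - w))"
    using kernel_upper by blast
  show ?thesis
  proof (rule that)
    fix \<zeta> assume \<zeta>: "\<zeta> \<in> disc"
    have h: "0 < 1 - norm z" using z by simp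
    have "norm (kernel (cnj z * \<zeta>)) \<le> U / box_size (norm (1 - cnj z * \<zeta>))"
      using mult_in_disc[OF z \<zeta>] by (intro U(2)) simp
    also have "\<dots> \<le> U / box_size (1 - norm z)"
      using kernel_dist_bounds[OF z \<zeta>] h U box_size_pos
      by (intro divide_left_mono box_size_mono) (auto intro!: mult_pos_pos)
    finally show "norm (kernel (cnj z * \<zeta>)) \<le> U / box_size (1 - norm z)" .
  qed
qed

lemma kernel_slice_bergman:
  assumes z: "z \<in> disc" and p: "0 \<le> p"
  shows "(\<lambda>\<zeta>. kernel (cnj z * \<zeta>)) \<in> bergman_space p \<omega>"
proof -
  obtain B where "\<And>\<zeta>. \<zeta> \<in> disc \<Longrightarrow> norm (kernel (cnj z * \<zeta>)) \<le> B" using kernel_slice_bounded[OF z] by blast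
  then show ?thesis by (intro bergman_space_bounded kernel_slice_holomorphic z p)
qed

lemma cnj_kernel:
  assumes "norm w < 1"
  shows "cnj (kernel w) = kernel (cnj w)"
proof -
  have "(\<lambda>n. cnj (of_real (kernel_coeff n) * w ^ n)) sums cnj (kernel w)"
    using kernel_sums[OF assms] by (subst sums_cnj)
  then have "(\<lambda>n. of_real (kernel_coeff n) * cnj w ^ n) sums cnj (kernel w)" by simp
  then show ?thesis using kernel_sums[of "cnj w"] assms by (auto dest: sums_unique2)
qed

text \<open>
  Reproducing kernels are unique: integrating two of them against each other evaluates both.
\<close>

lemma bergman_kernel_eq:
  assumes z: "z \<in> disc" and \<zeta>: "\<zeta> \<in> disc"
  shows "bergman_kernel \<omega> z \<zeta> = kernel (cnj z * \<zeta>)"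
proof -
  let ?P = "\<lambda>B. B \<in> bergman_space 2 \<omega> \<and> (\<forall>f \<in> bergman_space 2 \<omega>. f z = (\<integral>\<zeta>. f \<zeta> * cnj (B \<zeta>) \<partial>\<nu>))"
  define B where "B = bergman_kernel \<omega> z"
  have rep: "f w = (\<integral>\<zeta>. f \<zeta> * cnj (kernel (cnj w * \<zeta>)) \<partial>\<nu>)" if "f \<in> bergman_space 2 \<omega>" "w \<in> disc" for f w
    using that bergman_space_integrable[of f 2] kernel_reproducing[of f w] by (simp add: bergman_space_iff)
  have "?P (\<lambda>\<zeta>. kernel (cnj z * \<zeta>))" using rep z kernel_slice_bergman[OF z] by auto
  then have "?P (SOME B. ?P B)" by (rule someI[where P="?P"])
  then have "?P B" unfolding B_def bergman_kernel_def .
  then have B: "B \<in> bergman_space 2 \<omega>" "\<And>f. f \<in> bergman_space 2 \<omega> \<Longrightarrow> f z = (\<integral>\<zeta>. f \<zeta> * cnj (B \<zeta>) \<partial>\<nu>)" by auto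
  have "cnj (B \<zeta>) = cnj (\<integral>x. B x * cnj (kernel (cnj \<zeta> * x)) \<partial>\<nu>)" using rep[OF B(1) \<zeta>] by simp
  also have "\<dots> = (\<integral>x. cnj (B x * cnj (kernel (cnj \<zeta> * x))) \<partial>\<nu>)" by (rule Bochner_Integration.integral_cnj[symmetric])
  also have "\<dots> = (\<integral>x. kernel (cnj \<zeta> * x) * cnj (B x) \<partial>\<nu>)" by (simp add: mult.commute)
  also have "\<dots> = kernel (cnj \<zeta> * z)" using B(2)[OF kernel_slice_bergman[OF \<zeta>, of 2]] by simp
  finally have "B \<zeta> = cnj (kernel (cnj \<zeta> * z))" by (metis complex_cnj_cnj)
  also have "\<dots> = kernel (cnj z * \<zeta>)" using mult_in_disc[OF \<zeta> z] by (subst cnj_kernel) (auto simp: mult.commute)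
  finally show ?thesis by (simp add: B_def)
qed

definition kernel_norm2 :: "complex \<Rightarrow> real" where
  "kernel_norm2 z = (\<integral>\<zeta>. (norm (kernel (cnj z * \<zeta>)))\<^sup>2 \<partial>\<nu>)"

lemma kernel_norm2_eq:
  assumes z: "z \<in> disc"
  shows "of_real (kernel_norm2 z) = kernel (of_real ((norm z)\<^sup>2))"
proof -
  have "complex_of_real (kernel_norm2 z) = (\<integral>\<zeta>. complex_of_real ((norm (kernel (cnj z * \<zeta>)))\<^sup>2) \<partial>\<nu>)"
    unfolding kernel_norm2_def by (rule integral_complex_of_real[symmetric])
  also have "\<dots> = (\<integral>\<zeta>. kernel (cnj z * \<zeta>) * cnj (kernel (cnj z * \<zeta>)) \<partial>\<nu>)"
    by (simp add: complex_norm_square del: of_real_power)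
  also have "\<dots> = kernel (cnj z * z)"
    using kernel_slice_bergman[OF z, of 1] bergman_space_integrable[of _ 1]
    by (intro kernel_reproducing[where f="\<lambda>\<zeta>. kernel (cnj z * \<zeta>)"] kernel_slice_holomorphic z) auto
  also have "cnj z * z = of_real ((norm z)\<^sup>2)" using complex_norm_square[of z] by (simp add: mult.commute)
  finally show ?thesis .
qed

lemma kernel_norm2_bounds:
  obtains c C where "0 < c" "0 < C"
    "\<And>z. z \<in> disc \<Longrightarrow> c / box_size (1 - norm z) \<le> kernel_norm2 z"
    "\<And>z. z \<in> disc \<Longrightarrow> kernel_norm2 z \<le> C / box_size (1 - norm z)"
proof -
  obtain c where c: "0 < c" "\<And>z. z \<in> disc \<Longrightarrow> c / box_size (1 - norm z) \<le> Re (kernel (of_real ((norm z)\<^sup>2)))"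
    using kernel_diagonal_lower by blast
  obtain U where U: "0 < U" "\<And>w. norm w < 1 \<Longrightarrow> norm (kernel w) \<le> U / box_size (norm (1 - w))"
    using kernel_upper by blast
  show ?thesis
  proof (rule that[OF c(1) U(1)])
    fix z assume z: "z \<in> disc"
    have h: "0 < 1 - norm z" using z by simp
    have Re: "kernel_norm2 z = Re (kernel (of_real ((norm z)\<^sup>2)))" by (metis kernel_norm2_eq[OF z] Re_complex_of_real)
    show "c / box_size (1 - norm z) \<le> kernel_norm2 z" using c(2)[OF z] Re by simp
    have zz: "of_real ((norm z)\<^sup>2) = cnj z * z" using complex_norm_square[of z] by (simp add: mult.commute)
    have "kernel_norm2 z \<le> norm (kernel (cnj z * z))" unfolding Re zz by (rule complex_Re_le_cmod)
    also have "\<dots> \<le> U / box_size (norm (1 - cnj z * z))"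
      using mult_in_disc[OF z z] by (intro U(2)) simp
    also have "\<dots> \<le> U / box_size (1 - norm z)"
      using kernel_dist_bounds[OF z z] h U box_size_pos
      by (intro divide_left_mono box_size_mono) (auto intro!: mult_pos_pos)
    finally show "kernel_norm2 z \<le> U / box_size (1 - norm z)" .
  qed
qed

lemma kernel_norm2_pos:
  assumes "z \<in> disc"
  shows "0 < kernel_norm2 z"
proof -
  obtain c C where "0 < c" "\<And>z. z \<in> disc \<Longrightarrow> c / box_size (1 - norm z) \<le> kernel_norm2 z"
    using kernel_norm2_bounds by metis
  then have "c / box_size (1 - norm z) \<le> kernel_norm2 z" "0 < c / box_size (1 - norm z)"
    using assms box_size_pos by auto
  then show ?thesis by linarith
qed

lemma berezin_eq:
  assumes z: "z \<in> disc" and \<mu>: "space \<mu> \<subseteq> disc" "(\<lambda>x. x) \<in> \<mu> \<rightarrow>\<^sub>M restrict_space borel disc"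
  shows "berezin \<omega> \<mu> z = ennreal (1 / kernel_norm2 z) * (\<integral>\<^sup>+\<zeta>. ennreal ((norm (kernel (cnj z * \<zeta>)))\<^sup>2) \<partial>\<mu>)"
proof -
  let ?s = "\<lambda>\<zeta>. kernel (cnj z * \<zeta>)"
  obtain B where B: "\<And>\<zeta>. \<zeta> \<in> disc \<Longrightarrow> norm (?s \<zeta>) \<le> B" using kernel_slice_bounded[OF z] by blast
  have m: "?s \<in> borel_measurable (restrict_space borel disc)"
    by (intro borel_measurable_continuous_on_restrict holomorphic_on_imp_continuous_on kernel_slice_holomorphic z)
  note [measurable] = measurable_compose[OF identity_measurable_weight_measure m] measurable_compose[OF \<mu>(2) m]
  have int: "integrable \<nu> (\<lambda>\<zeta>. (norm (?s \<zeta>))\<^sup>2)"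
    by (rule finite_measure.integrable_const_bound[OF finite_weight_measure, of _ "B\<^sup>2"])
       (auto intro!: AE_I2 power_mono B)
  have "(\<integral>\<^sup>+\<zeta>. ennreal (norm (bergman_kernel \<omega> z \<zeta>) powr 2) \<partial>\<nu>) = (\<integral>\<^sup>+\<zeta>. ennreal ((norm (?s \<zeta>))\<^sup>2) \<partial>\<nu>)"
    by (intro nn_integral_weight_measure_cong) (simp add: bergman_kernel_eq[OF z])
  also have "\<dots> = ennreal (kernel_norm2 z)"
    unfolding kernel_norm2_def by (rule nn_integral_eq_integral[OF int]) auto
  finally have "bergman_norm 2 \<omega> (bergman_kernel \<omega> z) = ennpow (ennreal (kernel_norm2 z)) (1/2)"
    by (simp add: bergman_norm_def Lp_norm_def)
  then have n: "(enn2real (bergman_norm 2 \<omega> (bergman_kernel \<omega> z)))\<^sup>2 = kernel_norm2 z"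
    using kernel_norm2_pos[OF z] by (simp add: ennpow_def powr_half_sqrt)
  have "berezin \<omega> \<mu> z = (\<integral>\<^sup>+\<zeta>. ennreal (1 / kernel_norm2 z) * ennreal ((norm (?s \<zeta>))\<^sup>2) \<partial>\<mu>)"
    unfolding berezin_def
  proof (rule nn_integral_cong)
    fix \<zeta> assume "\<zeta> \<in> space \<mu>"
    then have "\<zeta> \<in> disc" using \<mu> by auto
    then have "(norm (normalized_kernel \<omega> z \<zeta>))\<^sup>2 = 1 / kernel_norm2 z * (norm (?s \<zeta>))\<^sup>2"
      by (simp add: normalized_kernel_def bergman_kernel_eq[OF z] norm_divide power_divide n)
    then show "ennreal ((norm (normalized_kernel \<omega> z \<zeta>))\<^sup>2) = ennreal (1 / kernel_norm2 z) * ennreal ((norm (?s \<zeta>))\<^sup>2)"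
      by (simp only: ennreal_mult''[symmetric] zero_le_power2)
  qed
  also have "\<dots> = ennreal (1 / kernel_norm2 z) * (\<integral>\<^sup>+\<zeta>. ennreal ((norm (?s \<zeta>))\<^sup>2) \<partial>\<mu>)"
    by (rule nn_integral_cmult) measurable
  finally show ?thesis .
qed

text \<open>
  From above, the square is contained in the set where \<open>|1 - cnj z * \<xi>|\<close> is at most
  \<open>3 (1 - |z|)\<close>, so that \<open>test_function_norm\<close> applies; from below, it contains a disc of radius
  comparable with \<open>1 - |z|\<close>, whose measure is bounded by point evaluation of a constant function.
\<close>

lemma weight_box_bounds:
  obtains c C where "0 < c" "0 < C"
    "\<And>z. z \<in> disc \<Longrightarrow> c * box_size (1 - norm z) \<le> weight_box \<omega> z"
    "\<And>z. z \<in> disc \<Longrightarrow> weight_box \<omega> z \<le> C * box_size (1 - norm z)"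
proof -
  define \<gamma> where "\<gamma> = M + 2"
  obtain C where C: "0 < C"
    "\<And>z. z \<in> disc \<Longrightarrow> (\<integral>\<^sup>+\<xi>. ennreal (norm (1 - cnj z * \<xi>) powr (- \<gamma>)) \<partial>\<nu>)
      \<le> ennreal (C * ((1 - norm z) powr (- \<gamma>) * box_size (1 - norm z)))"
    using test_function_norm[of \<gamma>] by (auto simp: \<gamma>_def)
  obtain D where D: "0 < D"
    "\<And>f z. f holomorphic_on disc \<Longrightarrow> z \<in> disc \<Longrightarrow>
      ennreal (norm (f z) powr 1 * box_size (1 - norm z))
      \<le> ennreal D * (\<integral>\<^sup>+\<xi>. indicator (ball z (1/4 * (1 - norm z))) \<xi> * ennreal (norm (f \<xi>) powr 1) \<partial>\<nu>)"
    using point_evaluation_local[of 1 "1/4"] by auto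
  interpret fin: finite_measure \<nu> by (rule finite_weight_measure)
  have box: "carleson_box z \<in> sets \<nu>" if "z \<in> disc" for z
    using measurable_sets[OF identity_measurable_weight_measure' carleson_box_borel[OF that]] carleson_box_subset[OF that]
    by (simp add: Int_absorb2)
  have em: "emeasure \<nu> (carleson_box z) = ennreal (weight_box \<omega> z)" for z
    by (simp add: weight_box_def fin.emeasure_eq_measure)
  show ?thesis
  proof (rule that[of "1 / (D * (A * 2 powr (M + 1)))" "C * 3 powr \<gamma>"])
    show "0 < 1 / (D * (A * 2 powr (M + 1)))" "0 < C * 3 powr \<gamma>" using C D constants by auto
    fix z assume z: "z \<in> disc"
    define h where "h = 1 - norm z"
    have h: "0 < h" "h \<le> 1" using z by (auto simp: h_def)
    have "ennreal (weight_box \<omega> z) = (\<integral>\<^sup>+\<xi>. indicator (carleson_box z) \<xi> \<partial>\<nu>)"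
      using box[OF z] by (simp add: em)
    also have "\<dots> \<le> (\<integral>\<^sup>+\<xi>. ennreal ((3 * h) powr \<gamma>) * ennreal (norm (1 - cnj z * \<xi>) powr (- \<gamma>)) \<partial>\<nu>)"
    proof (rule nn_integral_mono)
      fix \<xi>
      show "indicator (carleson_box z) \<xi> \<le> ennreal ((3 * h) powr \<gamma>) * ennreal (norm (1 - cnj z * \<xi>) powr (- \<gamma>))"
      proof (cases "\<xi> \<in> carleson_box z")
        case True
        then have "\<xi> \<in> disc" using carleson_box_subset[OF z] by auto
        then have p: "0 < norm (1 - cnj z * \<xi>)" using kernel_dist_bounds[OF z] by simp
        have "norm (1 - cnj z * \<xi>) powr \<gamma> \<le> (3 * h) powr \<gamma>"
          using kernel_dist_on_carleson_box[OF z True] constants by (intro powr_mono2) (auto simp: h_def \<gamma>_def)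
        then have "1 \<le> (3 * h) powr \<gamma> * norm (1 - cnj z * \<xi>) powr (- \<gamma>)"
          using p by (simp add: powr_minus field_simps)
        then have "ennreal 1 \<le> ennreal ((3 * h) powr \<gamma> * norm (1 - cnj z * \<xi>) powr (- \<gamma>))" by (rule ennreal_leI)
        then show ?thesis using True by (simp add: ennreal_mult'')
      qed simp
    qed
    also have "\<dots> = ennreal ((3 * h) powr \<gamma>) * (\<integral>\<^sup>+\<xi>. ennreal (norm (1 - cnj z * \<xi>) powr (- \<gamma>)) \<partial>\<nu>)"
      by (rule nn_integral_cmult) measurable
    also have "\<dots> \<le> ennreal ((3 * h) powr \<gamma>) * ennreal (C * (h powr (- \<gamma>) * box_size h))"
      unfolding h_def by (intro mult_left_mono C(2) z) auto
    also have "\<dots> = ennreal ((3 * h) powr \<gamma> * (C * (h powr (- \<gamma>) * box_size h)))"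
      using C h box_size_pos[OF h(1)] by (intro ennreal_mult''[symmetric]) auto
    also have "(3 * h) powr \<gamma> * (C * (h powr (- \<gamma>) * box_size h)) = C * 3 powr \<gamma> * box_size h"
      using h by (simp add: powr_mult powr_minus field_simps)
    finally show "weight_box \<omega> z \<le> C * 3 powr \<gamma> * box_size (1 - norm z)"
      using C h box_size_pos[OF h(1)] by (subst (asm) ennreal_le_iff) (auto simp: h_def)
    have "\<exists>x\<in>disc. h / 2 \<le> 1 - norm x \<and> ball x (1/4 * (1 - norm x)) \<subseteq> carleson_box z"
    proof (cases "z = 0")
      case True
      then have "ball 0 (1/4 * (1 - norm (0::complex))) \<subseteq> carleson_box z" by (auto simp: carleson_box_def)
      then show ?thesis using True by (intro bexI[of _ 0]) (auto simp: h_def)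
    next
      case False
      define u where "u = sgn z"
      have u: "norm u = 1" "z = of_real (1 - h) * u" 
        using False by (simp add: u_def norm_sgn, simp add: u_def h_def sgn_eq)
      have h1: "h < 1" using False by (simp add: h_def)
      have "norm (of_real (1 - h / 2) * u) = 1 - h / 2" using u h by (simp only: norm_mult norm_of_real) simp
      note n = this
      have hh: "h * h \<le> h" using h by (simp add: mult_left_le)
      have "ball (of_real (1 - h / 2) * u) (h / 8) \<subseteq> carleson_box z"
        unfolding u(2) using u h h1 hh by (intro ball_subset_carleson_box) (auto simp: field_simps)
      then show ?thesis using h n by (intro bexI[of _ "of_real (1 - h / 2) * u"]) (simp_all only: mem_ball_0 n, simp_all)
    qed
    then obtain x where x: "x \<in> disc" "h / 2 \<le> 1 - norm x" "ball x (1/4 * (1 - norm x)) \<subseteq> carleson_box z" by blast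
    have "ennreal (box_size (1 - norm x)) \<le> ennreal D * (\<integral>\<^sup>+\<xi>. indicator (ball x (1/4 * (1 - norm x))) \<xi> \<partial>\<nu>)"
      using D(2)[of "\<lambda>_. 1", OF _ x(1)] by simp
    also have "\<dots> \<le> ennreal D * (\<integral>\<^sup>+\<xi>. indicator (carleson_box z) \<xi> \<partial>\<nu>)"
      using x by (intro mult_left_mono nn_integral_mono) (auto simp: indicator_def)
    also have "\<dots> = ennreal (D * weight_box \<omega> z)"
      using box[OF z] D by (simp add: em ennreal_mult'' weight_box_def)
    finally have 1: "box_size (1 - norm x) \<le> D * weight_box \<omega> z"
      using D by (subst (asm) ennreal_le_iff) (auto simp: weight_box_def)
    have "box_size h \<le> A * 2 powr (M + 1) * box_size (h / 2)" using h by (intro box_size_growth) auto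
    also have "\<dots> \<le> A * 2 powr (M + 1) * box_size (1 - norm x)"
      using x h constants by (intro mult_left_mono box_size_mono) auto
    also have "\<dots> \<le> A * 2 powr (M + 1) * (D * weight_box \<omega> z)" using 1 constants by (intro mult_left_mono) auto
    finally show "1 / (D * (A * 2 powr (M + 1))) * box_size (1 - norm z) \<le> weight_box \<omega> z"
      using D constants by (simp add: h_def field_simps)
  qed
qed

end

section \<open>Measures bounded on small discs\<close>

lemma borel_measure_on_disc_facts:
  assumes "borel_measure_on_disc \<mu>"
  shows "space \<mu> = disc" "(\<lambda>x. x) \<in> \<mu> \<rightarrow>\<^sub>M restrict_space borel disc" "(\<lambda>x. x) \<in> borel_measurable \<mu>"
    "\<And>S. S \<in> sets borel \<Longrightarrow> S \<subseteq> disc \<Longrightarrow> S \<in> sets \<mu>"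
proof -
  have s: "sets \<mu> = sets (restrict_space borel disc)" using assms by (simp add: borel_measure_on_disc_def)
  show "space \<mu> = disc" using sets_eq_imp_space_eq[OF s] by (simp add: space_restrict_space)
  show 1: "(\<lambda>x. x) \<in> \<mu> \<rightarrow>\<^sub>M restrict_space borel disc"
    using measurable_ident_sets[OF s] by simp
  show "(\<lambda>x. x) \<in> borel_measurable \<mu>"
    by (rule measurable_compose[OF 1 measurable_restrict_space1]) simp
  show "\<And>S. S \<in> sets borel \<Longrightarrow> S \<subseteq> disc \<Longrightarrow> S \<in> sets \<mu>"
    unfolding s by (subst sets_restrict_space_iff) auto
qed

context regular_profile
begin

text \<open>
  The local form of the Carleson condition, to which the conditions on squares and on the Berezin
  transform are both reduced.
\<close>

definition bounded_on_discs :: "real \<Rightarrow> real \<Rightarrow> real \<Rightarrow> complex measure \<Rightarrow> bool" where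
  "bounded_on_discs \<delta> \<alpha> K \<mu> \<longleftrightarrow>
    (\<forall>z\<in>disc. emeasure \<mu> (ball z (\<delta> * (1 - norm z))) \<le> ennreal (K * box_size (1 - norm z) powr \<alpha>))"

lemma close_points:
  assumes \<delta>: "0 < \<delta>" "\<delta> \<le> 1/2" and z: "\<zeta> \<in> disc" "\<xi> \<in> disc" and d: "dist \<zeta> \<xi> < \<delta> / 2 * (1 - norm \<zeta>)"
  shows "\<zeta> \<in> ball \<xi> (\<delta> * (1 - norm \<xi>))" "1 / box_size (1 - norm \<zeta>) \<le> A * 2 powr (M + 1) / box_size (1 - norm \<xi>)"
proof -
  define s t where "s = 1 - norm \<zeta>" and "t = 1 - norm \<xi>"
  have st: "0 < s" "0 < t" using z by (auto simp: s_def t_def)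
  have n: "norm \<zeta> \<le> norm \<xi> + dist \<zeta> \<xi>" "norm \<xi> \<le> norm \<zeta> + dist \<zeta> \<xi>"
    by (metis dist_norm norm_triangle_sub add.commute norm_minus_commute)+
  have ds: "\<delta> / 2 * s \<le> s / 4" using \<delta> st by (simp add: mult_right_mono)
  have 1: "t \<le> s + dist \<zeta> \<xi>" "s \<le> t + dist \<zeta> \<xi>" using n by (auto simp: s_def t_def)
  have 2: "t \<le> 2 * s" "s \<le> 2 * t" using 1 d ds st unfolding s_def[symmetric] by linarith+
  have "\<delta> / 2 * s \<le> \<delta> / 2 * (2 * t)" using 2 \<delta> by (intro mult_left_mono) auto
  then have "dist \<zeta> \<xi> < \<delta> * t" using d unfolding s_def[symmetric] by simp
  then show "\<zeta> \<in> ball \<xi> (\<delta> * (1 - norm \<xi>))" unfolding t_def by (simp add: dist_commute)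
  have "box_size t \<le> A * 2 powr (M + 1) * box_size s"
  proof (cases "s \<le> t")
    case True
    then show ?thesis using 2 st by (intro box_size_growth) auto
  next
    case False
    then have "box_size t \<le> 1 * box_size s" using st box_size_mono[of t s] by simp
    also have "1 * box_size s \<le> A * 2 powr (M + 1) * box_size s"
    proof -
      have "1 * 1 \<le> A * 2 powr (M + 1)" using constants by (intro mult_mono ge_one_powr_ge_zero) auto
      then show ?thesis using box_size_pos[OF st(1)] by (intro mult_right_mono) auto
    qed
    finally show ?thesis .
  qed
  then show "1 / box_size (1 - norm \<zeta>) \<le> A * 2 powr (M + 1) / box_size (1 - norm \<xi>)"
    using box_size_pos[OF st(1)] box_size_pos[OF st(2)] by (simp add: s_def t_def field_simps)
qed

text \<open>
  A function dominated by its local averages may be integrated against \<open>\<omega> dA\<close> instead of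
  \<open>\<mu>\<close>: after interchanging the integrals only the \<open>\<mu>\<close>-measure of small discs matters.
\<close>

lemma integral_le_averaged:
  assumes \<mu>: "borel_measure_on_disc \<mu>" "finite_measure \<mu>" and \<delta>: "0 < \<delta>" "\<delta> \<le> 1/2"
    and K: "bounded_on_discs \<delta> \<alpha> K \<mu>" "0 \<le> K"
    and H' [measurable]: "H' \<in> borel_measurable \<nu>"
    and H: "\<And>\<zeta>. \<zeta> \<in> disc \<Longrightarrow>
      H \<zeta> \<le> ennreal (1 / box_size (1 - norm \<zeta>)) * (\<integral>\<^sup>+\<xi>. indicator (ball \<zeta> (\<delta> / 2 * (1 - norm \<zeta>))) \<xi> * H' \<xi> \<partial>\<nu>)"
  shows "(\<integral>\<^sup>+\<zeta>. H \<zeta> \<partial>\<mu>)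
    \<le> ennreal (A * 2 powr (M + 1) * K) * (\<integral>\<^sup>+\<xi>. H' \<xi> * ennreal (box_size (1 - norm \<xi>) powr (\<alpha> - 1)) \<partial>\<nu>)"
proof -
  note sp = borel_measure_on_disc_facts[OF \<mu>(1)]
  interpret m: finite_measure \<mu> by fact
  interpret n: finite_measure \<nu> by (rule finite_weight_measure)
  interpret pair_sigma_finite \<mu> \<nu> ..
  have [measurable]: "fst \<in> borel_measurable (\<mu> \<Otimes>\<^sub>M \<nu>)" "snd \<in> borel_measurable (\<mu> \<Otimes>\<^sub>M \<nu>)"
    using measurable_compose[OF measurable_fst sp(3)] measurable_compose[OF measurable_snd identity_measurable_weight_measure']
    by auto
  note [measurable] = sp(3)
  let ?G = "\<lambda>\<zeta> \<xi>. if dist \<zeta> \<xi> < \<delta> / 2 * (1 - norm \<zeta>) then ennreal (1 / box_size (1 - norm \<zeta>)) else 0"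
  have G [measurable]: "(\<lambda>p. ?G (fst p) (snd p)) \<in> borel_measurable (\<mu> \<Otimes>\<^sub>M \<nu>)" by measurable
  have G1: "(\<lambda>\<zeta>. ?G \<zeta> \<xi>) \<in> borel_measurable \<mu>" for \<xi> by measurable
  have G2: "(\<lambda>\<xi>. ?G \<zeta> \<xi>) \<in> borel_measurable \<nu>" for \<zeta> by measurable
  have "(\<integral>\<^sup>+\<zeta>. H \<zeta> \<partial>\<mu>) \<le> (\<integral>\<^sup>+\<zeta>. \<integral>\<^sup>+\<xi>. ?G \<zeta> \<xi> * H' \<xi> \<partial>\<nu> \<partial>\<mu>)"
  proof (rule nn_integral_mono)
    fix \<zeta> assume "\<zeta> \<in> space \<mu>"
    then have z: "\<zeta> \<in> disc" by (simp add: sp)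
    have [measurable]: "(\<lambda>\<xi>. indicator (ball \<zeta> (\<delta> / 2 * (1 - norm \<zeta>))) \<xi> :: ennreal) \<in> borel_measurable \<nu>"
      by (rule measurable_compose[OF identity_measurable_weight_measure']) simp
    have "H \<zeta> \<le> ennreal (1 / box_size (1 - norm \<zeta>)) * (\<integral>\<^sup>+\<xi>. indicator (ball \<zeta> (\<delta> / 2 * (1 - norm \<zeta>))) \<xi> * H' \<xi> \<partial>\<nu>)"
      by (rule H[OF z])
    also have "\<dots> = (\<integral>\<^sup>+\<xi>. ennreal (1 / box_size (1 - norm \<zeta>)) * (indicator (ball \<zeta> (\<delta> / 2 * (1 - norm \<zeta>))) \<xi> * H' \<xi>) \<partial>\<nu>)"
      by (rule nn_integral_cmult[symmetric]) measurable
    also have "\<dots> = (\<integral>\<^sup>+\<xi>. ?G \<zeta> \<xi> * H' \<xi> \<partial>\<nu>)"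
      by (intro nn_integral_cong) (auto simp: indicator_def)
    finally show "H \<zeta> \<le> (\<integral>\<^sup>+\<xi>. ?G \<zeta> \<xi> * H' \<xi> \<partial>\<nu>)" .
  qed
  also have "\<dots> = (\<integral>\<^sup>+\<xi>. \<integral>\<^sup>+\<zeta>. ?G \<zeta> \<xi> * H' \<xi> \<partial>\<mu> \<partial>\<nu>)"
    by (rule Fubini'[symmetric]) measurable
  also have "\<dots> \<le> (\<integral>\<^sup>+\<xi>. ennreal (A * 2 powr (M + 1) * K) * (H' \<xi> * ennreal (box_size (1 - norm \<xi>) powr (\<alpha> - 1))) \<partial>\<nu>)"
  proof (rule nn_integral_mono)
    fix \<xi> assume "\<xi> \<in> space \<nu>"
    then have x: "\<xi> \<in> disc" by simp
    define B where "B = ball \<xi> (\<delta> * (1 - norm \<xi>))"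
    have "B \<subseteq> ball \<xi> ((1 - norm \<xi>) / 2)"
      unfolding B_def using \<delta> x by (intro subset_ball) (simp add: mult_right_mono[of \<delta> "1/2", simplified])
    then have Bd: "B \<subseteq> disc" using weight_on_ball(1)[OF x] by auto
    have B: "B \<in> sets \<mu>" by (rule sp(4)[OF _ Bd]) (simp add: B_def)
    have w: "0 < box_size (1 - norm \<xi>)" using x by (simp add: box_size_pos)
    have "(\<integral>\<^sup>+\<zeta>. ?G \<zeta> \<xi> * H' \<xi> \<partial>\<mu>) = (\<integral>\<^sup>+\<zeta>. ?G \<zeta> \<xi> \<partial>\<mu>) * H' \<xi>"
      by (rule nn_integral_multc) (rule G1)
    also have "(\<integral>\<^sup>+\<zeta>. ?G \<zeta> \<xi> \<partial>\<mu>) \<le> (\<integral>\<^sup>+\<zeta>. ennreal (A * 2 powr (M + 1) / box_size (1 - norm \<xi>)) * indicator B \<zeta> \<partial>\<mu>)"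
    proof (rule nn_integral_mono)
      fix \<zeta> assume "\<zeta> \<in> space \<mu>"
      then have z: "\<zeta> \<in> disc" by (simp add: sp)
      show "?G \<zeta> \<xi> \<le> ennreal (A * 2 powr (M + 1) / box_size (1 - norm \<xi>)) * indicator B \<zeta>"
        using close_points[OF \<delta> z x] by (auto simp: B_def intro!: ennreal_leI)
    qed
    also have "\<dots> = ennreal (A * 2 powr (M + 1) / box_size (1 - norm \<xi>)) * emeasure \<mu> B"
      by (rule nn_integral_cmult_indicator[OF B])
    also have "\<dots> \<le> ennreal (A * 2 powr (M + 1) / box_size (1 - norm \<xi>)) * ennreal (K * box_size (1 - norm \<xi>) powr \<alpha>)"
      using K(1) x by (intro mult_left_mono) (auto simp: bounded_on_discs_def B_def)
    also have "\<dots> = ennreal (A * 2 powr (M + 1) * K * box_size (1 - norm \<xi>) powr (\<alpha> - 1))"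
      using w K constants by (simp add: ennreal_mult''[symmetric] powr_diff)
    also have "\<dots> = ennreal (A * 2 powr (M + 1) * K) * ennreal (box_size (1 - norm \<xi>) powr (\<alpha> - 1))"
      by (rule ennreal_mult'') simp
    finally show "(\<integral>\<^sup>+\<zeta>. ?G \<zeta> \<xi> * H' \<xi> \<partial>\<mu>) \<le> ennreal (A * 2 powr (M + 1) * K) * (H' \<xi> * ennreal (box_size (1 - norm \<xi>) powr (\<alpha> - 1)))"
      by (simp add: mult_right_mono mult_ac)
  qed
  also have "\<dots> = ennreal (A * 2 powr (M + 1) * K) * (\<integral>\<^sup>+\<xi>. H' \<xi> * ennreal (box_size (1 - norm \<xi>) powr (\<alpha> - 1)) \<partial>\<nu>)"
    by (rule nn_integral_cmult) measurable
  finally show ?thesis .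
qed

lemma point_evaluation:
  fixes s :: real
  assumes s: "0 < s"
  obtains D where "0 < D"
    "\<And>f z I. f holomorphic_on disc \<Longrightarrow> z \<in> disc \<Longrightarrow> (\<integral>\<^sup>+\<xi>. ennreal (norm (f \<xi>) powr s) \<partial>\<nu>) \<le> ennreal I \<Longrightarrow> 0 \<le> I \<Longrightarrow>
      norm (f z) powr s * box_size (1 - norm z) \<le> D * I"
proof -
  obtain C where C: "0 < C"
    "\<And>f z. f holomorphic_on disc \<Longrightarrow> z \<in> disc \<Longrightarrow>
      ennreal (norm (f z) powr s * box_size (1 - norm z))
      \<le> ennreal C * (\<integral>\<^sup>+\<xi>. indicator (ball z (1/2 * (1 - norm z))) \<xi> * ennreal (norm (f \<xi>) powr s) \<partial>\<nu>)"
    using point_evaluation_local[of s "1/2"] s by auto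
  show ?thesis
  proof (rule that[OF C(1)])
    fix f z I assume f: "f holomorphic_on disc" and z: "z \<in> disc" and I: "(\<integral>\<^sup>+\<xi>. ennreal (norm (f \<xi>) powr s) \<partial>\<nu>) \<le> ennreal I" "0 \<le> I"
    have "(\<integral>\<^sup>+\<xi>. indicator (ball z (1/2 * (1 - norm z))) \<xi> * ennreal (norm (f \<xi>) powr s) \<partial>\<nu>) \<le> (\<integral>\<^sup>+\<xi>. ennreal (norm (f \<xi>) powr s) \<partial>\<nu>)"
      by (intro nn_integral_mono) (auto simp: indicator_def)
    then have "ennreal (norm (f z) powr s * box_size (1 - norm z)) \<le> ennreal C * ennreal I"
      using C(2)[OF f z] I by (meson mult_left_mono order_trans zero_le)
    then show "norm (f z) powr s * box_size (1 - norm z) \<le> C * I"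
      using C(1) I by (simp add: ennreal_mult''[symmetric] ennreal_le_iff)
  qed
qed

lemma averaged_from_point_evaluation:
  fixes s \<delta> :: real
  assumes s: "0 < s" and \<delta>: "0 < \<delta>" "\<delta> \<le> 1/2"
  obtains C where "0 < C"
    "\<And>f \<zeta>. f holomorphic_on disc \<Longrightarrow> \<zeta> \<in> disc \<Longrightarrow>
      ennreal (norm (f \<zeta>) powr s) \<le> ennreal (1 / box_size (1 - norm \<zeta>)) *
        (\<integral>\<^sup>+\<xi>. indicator (ball \<zeta> (\<delta> / 2 * (1 - norm \<zeta>))) \<xi> * (ennreal C * ennreal (norm (f \<xi>) powr s)) \<partial>\<nu>)"
proof -
  obtain C where C: "0 < C"
    "\<And>f z. f holomorphic_on disc \<Longrightarrow> z \<in> disc \<Longrightarrow>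
      ennreal (norm (f z) powr s * box_size (1 - norm z))
      \<le> ennreal C * (\<integral>\<^sup>+\<xi>. indicator (ball z (\<delta> / 2 * (1 - norm z))) \<xi> * ennreal (norm (f \<xi>) powr s) \<partial>\<nu>)"
    using point_evaluation_local[of s "\<delta> / 2"] s \<delta> by auto
  show ?thesis
  proof (rule that[OF C(1)])
    fix f \<zeta> assume f: "f holomorphic_on disc" and z: "\<zeta> \<in> disc"
    have w: "0 < box_size (1 - norm \<zeta>)" using z by (simp add: box_size_pos)
    have [measurable]: "(\<lambda>\<xi>. indicator (ball \<zeta> (\<delta> / 2 * (1 - norm \<zeta>))) \<xi> :: ennreal) \<in> borel_measurable \<nu>"
      by (rule measurable_compose[OF identity_measurable_weight_measure']) simp
    note [measurable] = holomorphic_measurable[OF f]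
    have "ennreal (norm (f \<zeta>) powr s) = ennreal (1 / box_size (1 - norm \<zeta>)) * ennreal (norm (f \<zeta>) powr s * box_size (1 - norm \<zeta>))"
      using w by (simp add: ennreal_mult''[symmetric])
    also have "\<dots> \<le> ennreal (1 / box_size (1 - norm \<zeta>)) * (ennreal C * (\<integral>\<^sup>+\<xi>. indicator (ball \<zeta> (\<delta> / 2 * (1 - norm \<zeta>))) \<xi> * ennreal (norm (f \<xi>) powr s) \<partial>\<nu>))"
      by (intro mult_left_mono C(2) f z) simp
    also have "ennreal C * (\<integral>\<^sup>+\<xi>. indicator (ball \<zeta> (\<delta> / 2 * (1 - norm \<zeta>))) \<xi> * ennreal (norm (f \<xi>) powr s) \<partial>\<nu>)
       = (\<integral>\<^sup>+\<xi>. ennreal C * (indicator (ball \<zeta> (\<delta> / 2 * (1 - norm \<zeta>))) \<xi> * ennreal (norm (f \<xi>) powr s)) \<partial>\<nu>)"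
      by (rule nn_integral_cmult[symmetric]) measurable
    finally show "ennreal (norm (f \<zeta>) powr s) \<le> ennreal (1 / box_size (1 - norm \<zeta>)) *
        (\<integral>\<^sup>+\<xi>. indicator (ball \<zeta> (\<delta> / 2 * (1 - norm \<zeta>))) \<xi> * (ennreal C * ennreal (norm (f \<xi>) powr s)) \<partial>\<nu>)"
      by (simp only: mult.left_commute)
  qed
qed

text \<open>
  After averaging, \<open>|f|\<^bsup>s\<alpha>\<^esup> box_size\<^bsup>\<alpha>-1\<^esup>\<close> is integrated against \<open>\<omega> dA\<close>; point evaluation
  bounds \<open>(|f|\<^bsup>s\<^esup> box_size)\<^bsup>\<alpha>-1\<^esup>\<close> and leaves \<open>|f|\<^bsup>s\<^esup>\<close>.
\<close>

lemma carleson_embedding: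
  fixes s \<alpha> \<delta> :: real
  assumes s: "0 < s" and \<alpha>: "1 \<le> \<alpha>" and \<delta>: "0 < \<delta>" "\<delta> \<le> 1/2"
  obtains C where "0 < C"
    "\<And>\<mu> K f I. borel_measure_on_disc \<mu> \<Longrightarrow> finite_measure \<mu> \<Longrightarrow> bounded_on_discs \<delta> \<alpha> K \<mu> \<Longrightarrow> 0 \<le> K \<Longrightarrow>
      f holomorphic_on disc \<Longrightarrow> (\<integral>\<^sup>+\<xi>. ennreal (norm (f \<xi>) powr s) \<partial>\<nu>) = ennreal I \<Longrightarrow> 0 \<le> I \<Longrightarrow>
      (\<integral>\<^sup>+\<zeta>. ennreal (norm (f \<zeta>) powr (s * \<alpha>)) \<partial>\<mu>) \<le> ennreal (C * K * I powr \<alpha>)"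
proof -
  have t: "0 < s * \<alpha>" using s \<alpha> by simp
  obtain C where C: "0 < C"
    "\<And>f \<zeta>. f holomorphic_on disc \<Longrightarrow> \<zeta> \<in> disc \<Longrightarrow>
      ennreal (norm (f \<zeta>) powr (s * \<alpha>)) \<le> ennreal (1 / box_size (1 - norm \<zeta>)) *
        (\<integral>\<^sup>+\<xi>. indicator (ball \<zeta> (\<delta> / 2 * (1 - norm \<zeta>))) \<xi> * (ennreal C * ennreal (norm (f \<xi>) powr (s * \<alpha>))) \<partial>\<nu>)"
    using averaged_from_point_evaluation[OF t \<delta>] by blast
  obtain D where D: "0 < D"
    "\<And>f z I. f holomorphic_on disc \<Longrightarrow> z \<in> disc \<Longrightarrow> (\<integral>\<^sup>+\<xi>. ennreal (norm (f \<xi>) powr s) \<partial>\<nu>) \<le> ennreal I \<Longrightarrow> 0 \<le> I \<Longrightarrow>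
      norm (f z) powr s * box_size (1 - norm z) \<le> D * I"
    using point_evaluation[OF s] by blast
  define C' where "C' = A * 2 powr (M + 1) * (C * D powr (\<alpha> - 1))"
  show ?thesis
  proof (rule that[of C'])
    show "0 < C'" using C D constants by (simp add: C'_def)
    fix \<mu> K f I
    assume \<mu>: "borel_measure_on_disc \<mu>" "finite_measure \<mu>" and K: "bounded_on_discs \<delta> \<alpha> K \<mu>" "0 \<le> K"
      and f: "f holomorphic_on disc" and I: "(\<integral>\<^sup>+\<xi>. ennreal (norm (f \<xi>) powr s) \<partial>\<nu>) = ennreal I" "0 \<le> I"
    note [measurable] = holomorphic_measurable[OF f]
    have "(\<integral>\<^sup>+\<zeta>. ennreal (norm (f \<zeta>) powr (s * \<alpha>)) \<partial>\<mu>)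
      \<le> ennreal (A * 2 powr (M + 1) * K) * (\<integral>\<^sup>+\<xi>. (ennreal C * ennreal (norm (f \<xi>) powr (s * \<alpha>))) * ennreal (box_size (1 - norm \<xi>) powr (\<alpha> - 1)) \<partial>\<nu>)"
    proof (rule integral_le_averaged[OF \<mu> \<delta> K])
      show "(\<lambda>\<xi>. ennreal C * ennreal (norm (f \<xi>) powr (s * \<alpha>))) \<in> borel_measurable \<nu>" by measurable
    qed (rule C(2)[OF f])
    also have "(\<integral>\<^sup>+\<xi>. (ennreal C * ennreal (norm (f \<xi>) powr (s * \<alpha>))) * ennreal (box_size (1 - norm \<xi>) powr (\<alpha> - 1)) \<partial>\<nu>)
      \<le> (\<integral>\<^sup>+\<xi>. ennreal (C * (D * I) powr (\<alpha> - 1)) * ennreal (norm (f \<xi>) powr s) \<partial>\<nu>)"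
    proof (rule nn_integral_mono)
      fix \<xi> assume "\<xi> \<in> space \<nu>"
      then have x: "\<xi> \<in> disc" by simp
      have w: "0 < box_size (1 - norm \<xi>)" using x by (simp add: box_size_pos)
      have "norm (f \<xi>) powr (s * \<alpha>) = norm (f \<xi>) powr s * norm (f \<xi>) powr (s * (\<alpha> - 1))"
        by (simp add: powr_add[symmetric] algebra_simps)
      then have "norm (f \<xi>) powr (s * \<alpha>) * box_size (1 - norm \<xi>) powr (\<alpha> - 1)
        = norm (f \<xi>) powr s * (norm (f \<xi>) powr s * box_size (1 - norm \<xi>)) powr (\<alpha> - 1)"
        using w by (simp add: powr_mult powr_powr)
      also have "\<dots> \<le> norm (f \<xi>) powr s * (D * I) powr (\<alpha> - 1)"
        using D(2)[OF f x _ I(2)] I(1) w \<alpha> by (intro mult_left_mono powr_mono2) auto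
      finally have "C * (norm (f \<xi>) powr (s * \<alpha>) * box_size (1 - norm \<xi>) powr (\<alpha> - 1)) \<le> C * (norm (f \<xi>) powr s * (D * I) powr (\<alpha> - 1))"
        using C by (intro mult_left_mono) auto
      then show "(ennreal C * ennreal (norm (f \<xi>) powr (s * \<alpha>))) * ennreal (box_size (1 - norm \<xi>) powr (\<alpha> - 1))
         \<le> ennreal (C * (D * I) powr (\<alpha> - 1)) * ennreal (norm (f \<xi>) powr s)"
      proof -
        have "ennreal C * ennreal X * ennreal Y = ennreal (C * (X * Y))" if "0 \<le> X" "0 \<le> Y" for X Y
          using that by (simp add: ennreal_mult''[symmetric] mult.assoc)
        moreover have "ennreal (C * P) * ennreal Q = ennreal (C * (Q * P))" if "0 \<le> Q" for P Q
          unfolding ennreal_mult''[OF that, symmetric] by (simp only: mult_ac)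
        ultimately show ?thesis
          using \<open>C * _ \<le> C * _\<close> by (simp only: powr_ge_zero ennreal_leI)
      qed
    qed
    also have "\<dots> = ennreal (C * (D * I) powr (\<alpha> - 1)) * ennreal I"
      by (subst nn_integral_cmult) (auto simp: I)
    also have "ennreal (A * 2 powr (M + 1) * K) * (ennreal (C * (D * I) powr (\<alpha> - 1)) * ennreal I) = ennreal (C' * K * I powr \<alpha>)"
    proof -
      have "I powr (\<alpha> - 1) * I = I powr \<alpha>" using I(2) by (cases "I = 0") (auto simp: powr_diff)
      then have e: "A * 2 powr (M + 1) * K * (C * (D * I) powr (\<alpha> - 1) * I) = C' * K * I powr \<alpha>"
        using D I by (simp add: C'_def powr_mult mult_ac)
      have "0 \<le> C * (D * I) powr (\<alpha> - 1) * I" using C(1) I(2) by simp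
      then show ?thesis unfolding ennreal_mult''[OF I(2), symmetric] e[symmetric] by (rule ennreal_mult''[symmetric])
    qed
    finally show "(\<integral>\<^sup>+\<zeta>. ennreal (norm (f \<zeta>) powr (s * \<alpha>)) \<partial>\<mu>) \<le> ennreal (C' * K * I powr \<alpha>)"
      by (simp add: mult_left_mono)
  qed
qed

section \<open>The maximal Bergman projection\<close>

text \<open>
  Schur's test with a small negative power of \<open>box_size\<close> as test function. The role of Hoelder's
  inequality is played by the elementary bound \<open>g \<le> t\<^bsup>1-q\<^esup> g\<^bsup>q\<^esup> + t\<close>, with \<open>t\<close> chosen so
  that the second term integrates to at most one half of the left-hand side.
\<close>

lemma schur_bound:
  fixes q :: real
  assumes q: "1 < q"
  obtains C where "0 < C"
    "\<And>g T. g \<in> borel_measurable \<nu> \<Longrightarrow> (\<And>\<xi>. 0 \<le> g \<xi>) \<Longrightarrow>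
      (\<And>z. z \<in> disc \<Longrightarrow> ennreal (norm (T z :: complex)) \<le> (\<integral>\<^sup>+\<xi>. ennreal (g \<xi> / box_size (norm (1 - cnj z * \<xi>))) \<partial>\<nu>)) \<Longrightarrow>
      (\<integral>\<^sup>+z. ennreal (norm (T z) powr q) \<partial>\<nu>) \<le> ennreal C * (\<integral>\<^sup>+\<xi>. ennreal (g \<xi> powr q) \<partial>\<nu>)"
proof -
  define q' where "q' = q / (q - 1)"
  have q': "1 < q'" "q' * (q - 1) = q" using q by (auto simp: q'_def field_simps)
  \<comment> \<open>So small that \<open>\<gamma> q\<close> and \<open>\<gamma> q'\<close> are both admissible exponents in \<open>weighted_forelli_rudin\<close>.\<close>
  define \<gamma> where "\<gamma> = \<kappa> / (2 * (1 + \<kappa>) * (q + q'))"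
  have \<gamma>: "0 < \<gamma>" using constants q q' by (simp add: \<gamma>_def)
  have small: "0 \<le> \<gamma> * e \<and> \<gamma> * e < \<kappa> * (1 - \<gamma> * e)" if e: "0 < e" "e \<le> q + q'" for e
  proof -
    have "\<gamma> * e \<le> \<gamma> * (q + q')" using e \<gamma> by (intro mult_left_mono) auto
    also have "\<dots> = \<kappa> / (2 * (1 + \<kappa>))" using q q' by (simp add: \<gamma>_def)
    finally have "\<gamma> * e * (1 + \<kappa>) \<le> \<kappa> / 2" using constants by (simp add: field_simps)
    then show ?thesis using e \<gamma> constants by (auto simp: algebra_simps intro!: mult_nonneg_nonneg)
  qed
  obtain C1 where C1: "0 < C1" "\<And>z. z \<in> disc \<Longrightarrow>
      (\<integral>\<^sup>+\<xi>. ennreal (box_size (norm (1 - cnj z * \<xi>)) powr (- 1) * box_size (1 - norm \<xi>) powr (- (\<gamma> * q'))) \<partial>\<nu>)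
      \<le> ennreal (C1 * box_size (1 - norm z) powr (1 - (\<gamma> * q') - 1))"
    using weighted_forelli_rudin[of "\<gamma> * q'" 1] small[of q'] \<gamma> q q' by auto
  obtain C2 where C2: "0 < C2" "\<And>z. z \<in> disc \<Longrightarrow>
      (\<integral>\<^sup>+\<xi>. ennreal (box_size (norm (1 - cnj z * \<xi>)) powr (- 1) * box_size (1 - norm \<xi>) powr (- (\<gamma> * q))) \<partial>\<nu>)
      \<le> ennreal (C2 * box_size (1 - norm z) powr (1 - (\<gamma> * q) - 1))"
    using weighted_forelli_rudin[of "\<gamma> * q" 1] small[of q] \<gamma> q q' by auto
  define D where "D = 2 powr q * C1 powr (q - 1)"
  have D: "0 < D" using C1 by (simp add: D_def)
  interpret n: finite_measure \<nu> by (rule finite_weight_measure)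
  interpret pair_sigma_finite \<nu> \<nu> ..
  have [measurable]: "fst \<in> borel_measurable (\<nu> \<Otimes>\<^sub>M \<nu>)" "snd \<in> borel_measurable (\<nu> \<Otimes>\<^sub>M \<nu>)"
    using measurable_compose[OF measurable_fst identity_measurable_weight_measure'] measurable_compose[OF measurable_snd identity_measurable_weight_measure']
    by auto
  show ?thesis
  proof (rule that[of "D * C2"])
    show "0 < D * C2" using D C2 by simp
    fix g :: "complex \<Rightarrow> real" and T :: "complex \<Rightarrow> complex"
    assume g [measurable]: "g \<in> borel_measurable \<nu>" and g0: "\<And>\<xi>. 0 \<le> g \<xi>"
      and T: "\<And>z. z \<in> disc \<Longrightarrow> ennreal (norm (T z)) \<le> (\<integral>\<^sup>+\<xi>. ennreal (g \<xi> / box_size (norm (1 - cnj z * \<xi>))) \<partial>\<nu>)"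
    let ?w = "\<lambda>z. box_size (1 - norm z)"
    let ?k = "\<lambda>z \<xi>. box_size (norm (1 - cnj z * \<xi>))"
    have [measurable]: "(\<lambda>p. cnj (fst p)) \<in> borel_measurable (\<nu> \<Otimes>\<^sub>M \<nu>)"
      by (rule measurable_compose[OF _ cnj_measurable]) measurable
    have gsnd [measurable]: "(\<lambda>p. g (snd p)) \<in> borel_measurable (\<nu> \<Otimes>\<^sub>M \<nu>)"
      by (rule measurable_compose[OF measurable_snd g])
    let ?X = "\<lambda>z. \<integral>\<^sup>+\<xi>. ennreal (1 / ?k z \<xi> * (?w \<xi> powr (\<gamma> * q) * g \<xi> powr q)) \<partial>\<nu>"
    have pointwise: "ennreal (norm (T z) powr q) \<le> ennreal (D * ?w z powr (- (\<gamma> * q))) * ?X z" if z: "z \<in> disc" for z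
    proof (cases "T z = 0 \<or> ?X z = top")
      case True
      have "0 < D * ?w z powr (- (\<gamma> * q))" using D z box_size_pos[of "1 - norm z"] by simp
      then show ?thesis using True q by (auto simp: ennreal_mult_top)
    next
      case False
      define a where "a = norm (T z)"
      have a: "0 < a" using False by (simp add: a_def)
      obtain x where x: "?X z = ennreal x" "0 \<le> x" using False by (cases "?X z") auto
      have wz: "0 < ?w z" using z by (simp add: box_size_pos)
      define y where "y = C1 * ?w z powr (- (\<gamma> * q'))"
      have y: "0 < y" using C1 wz by (simp add: y_def)
      define l where "l = a / (2 * y)"
      have l: "0 < l" "l * y = a / 2" using a y by (auto simp: l_def)
      have Y: "(\<integral>\<^sup>+\<xi>. ennreal (1 / ?k z \<xi> * ?w \<xi> powr (- (\<gamma> * q'))) \<partial>\<nu>) \<le> ennreal y"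
      proof -
        have "(\<integral>\<^sup>+\<xi>. ennreal (1 / ?k z \<xi> * ?w \<xi> powr (- (\<gamma> * q'))) \<partial>\<nu>)
          = (\<integral>\<^sup>+\<xi>. ennreal (?k z \<xi> powr (- 1) * ?w \<xi> powr (- (\<gamma> * q'))) \<partial>\<nu>)"
        proof (rule nn_integral_cong)
          fix \<xi> assume "\<xi> \<in> space \<nu>"
          then have "0 < ?k z \<xi>" using kernel_dist_bounds[OF z, of \<xi>] by (simp add: box_size_pos)
          then show "ennreal (1 / ?k z \<xi> * ?w \<xi> powr (- (\<gamma> * q'))) = ennreal (?k z \<xi> powr (- 1) * ?w \<xi> powr (- (\<gamma> * q')))"
            by (simp add: powr_minus_divide)
        qed
        then show ?thesis using C1(2)[OF z] by (simp add: y_def)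
      qed
      have "ennreal a \<le> (\<integral>\<^sup>+\<xi>. ennreal (g \<xi> / ?k z \<xi>) \<partial>\<nu>)" unfolding a_def by (rule T[OF z])
      also have "\<dots> \<le> (\<integral>\<^sup>+\<xi>. ennreal (l powr (1 - q)) * ennreal (1 / ?k z \<xi> * (?w \<xi> powr (\<gamma> * q) * g \<xi> powr q))
            + ennreal l * ennreal (1 / ?k z \<xi> * ?w \<xi> powr (- (\<gamma> * q'))) \<partial>\<nu>)"
      proof (rule nn_integral_mono)
        fix \<xi> assume "\<xi> \<in> space \<nu>"
        then have x: "\<xi> \<in> disc" by simp
        have w: "0 < ?w \<xi>" using x by (simp add: box_size_pos)
        have k: "0 < ?k z \<xi>" using kernel_dist_bounds[OF z x] by (simp add: box_size_pos)
        define t where "t = l * ?w \<xi> powr (- (\<gamma> * q'))"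
        have t: "0 < t" using l w by (simp add: t_def)
        have "g \<xi> \<le> t powr (1 - q) * g \<xi> powr q + t"
        proof (cases "g \<xi> \<le> t")
          case False
          then have "g \<xi> = g \<xi> powr (1 - q) * g \<xi> powr q" using t by (simp add: powr_add[symmetric])
          also have "\<dots> \<le> t powr (1 - q) * g \<xi> powr q"
            using False t q by (intro mult_right_mono powr_mono2') auto
          finally show ?thesis using t by simp
        qed (simp add: add_increasing)
        also have "t powr (1 - q) = l powr (1 - q) * ?w \<xi> powr (\<gamma> * q)"
        proof -
          have "- (\<gamma> * q') * (1 - q) = \<gamma> * (q' * (q - 1))" by (simp add: algebra_simps)
          then have "- (\<gamma> * q') * (1 - q) = \<gamma> * q" by (simp only: q')
          then show ?thesis using l w unfolding t_def by (simp add: powr_mult powr_powr)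
        qed
        finally have "g \<xi> / ?k z \<xi> \<le> (l powr (1 - q) * ?w \<xi> powr (\<gamma> * q) * g \<xi> powr q + t) / ?k z \<xi>"
          using k by (intro divide_right_mono) auto
        also have "\<dots> = l powr (1 - q) * (1 / ?k z \<xi> * (?w \<xi> powr (\<gamma> * q) * g \<xi> powr q)) + l * (1 / ?k z \<xi> * ?w \<xi> powr (- (\<gamma> * q')))"
          by (simp add: t_def add_divide_distrib)
        finally show "ennreal (g \<xi> / ?k z \<xi>) \<le> ennreal (l powr (1 - q)) * ennreal (1 / ?k z \<xi> * (?w \<xi> powr (\<gamma> * q) * g \<xi> powr q))
            + ennreal l * ennreal (1 / ?k z \<xi> * ?w \<xi> powr (- (\<gamma> * q')))"
          using l k by (simp add: ennreal_mult''[symmetric] ennreal_plus[symmetric] ennreal_leI del: ennreal_plus)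
      qed
      also have "\<dots> = ennreal (l powr (1 - q)) * ?X z + ennreal l * (\<integral>\<^sup>+\<xi>. ennreal (1 / ?k z \<xi> * ?w \<xi> powr (- (\<gamma> * q'))) \<partial>\<nu>)"
        by (subst nn_integral_add) (auto simp: nn_integral_cmult)
      also have "\<dots> \<le> ennreal (l powr (1 - q)) * ennreal x + ennreal l * ennreal y"
        unfolding x(1) by (intro add_left_mono mult_left_mono Y) simp
      also have "\<dots> = ennreal (l powr (1 - q) * x + l * y)"
        using x l y by (simp add: ennreal_mult''[symmetric] ennreal_plus[symmetric] del: ennreal_plus)
      finally have "a \<le> l powr (1 - q) * x + l * y"
        using x l y by (subst (asm) ennreal_le_iff) auto
      then have a1: "a \<le> 2 * (l powr (1 - q) * x)" using l(2) by linarith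
      have lq: "l powr (1 - q) = a powr (1 - q) * (2 * y) powr (q - 1)"
        using a y by (simp add: l_def powr_divide powr_diff divide_simps)
      have yq: "y powr (q - 1) = C1 powr (q - 1) * ?w z powr (- (\<gamma> * q))"
      proof -
        have "- (\<gamma> * q') * (q - 1) = - (\<gamma> * (q' * (q - 1)))" by (simp add: algebra_simps)
        then have "- (\<gamma> * q') * (q - 1) = - (\<gamma> * q)" by (simp only: q')
        then have "(?w z powr (- (\<gamma> * q'))) powr (q - 1) = ?w z powr (- (\<gamma> * q))" by (simp only: powr_powr)
        moreover have "y powr (q - 1) = C1 powr (q - 1) * (?w z powr (- (\<gamma> * q'))) powr (q - 1)"
          unfolding y_def by (rule powr_mult)
        ultimately show ?thesis by simp
      qed
      have "a powr q = a powr (q - 1) * a" using a by (simp add: powr_diff)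
      also have "\<dots> \<le> a powr (q - 1) * (2 * (l powr (1 - q) * x))" using a1 by (rule mult_left_mono) simp
      also have "\<dots> = (a powr (q - 1) * a powr (1 - q)) * (2 * (2 * y) powr (q - 1) * x)" unfolding lq by (simp only: mult_ac)
      also have "a powr (q - 1) * a powr (1 - q) = 1" using a by (simp add: powr_add[symmetric])
      also have "2 * (2 * y) powr (q - 1) = 2 powr q * y powr (q - 1)" using y by (simp add: powr_mult powr_diff)
      finally have "a powr q \<le> D * ?w z powr (- (\<gamma> * q)) * x" by (simp add: yq D_def mult_ac)
      then show ?thesis unfolding x(1) a_def[symmetric] using x by (simp add: ennreal_mult''[symmetric] ennreal_leI)
    qed
    have "(\<integral>\<^sup>+z. ennreal (norm (T z) powr q) \<partial>\<nu>) \<le> (\<integral>\<^sup>+z. ennreal (D * ?w z powr (- (\<gamma> * q))) * ?X z \<partial>\<nu>)"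
      by (intro nn_integral_mono) (use pointwise in simp)
    also have "\<dots> = (\<integral>\<^sup>+z. \<integral>\<^sup>+\<xi>. ennreal (D * ?w z powr (- (\<gamma> * q))) * ennreal (1 / ?k z \<xi> * (?w \<xi> powr (\<gamma> * q) * g \<xi> powr q)) \<partial>\<nu> \<partial>\<nu>)"
      by (intro nn_integral_cong nn_integral_cmult[symmetric]) measurable
    also have "\<dots> = (\<integral>\<^sup>+\<xi>. \<integral>\<^sup>+z. ennreal (D * ?w z powr (- (\<gamma> * q))) * ennreal (1 / ?k z \<xi> * (?w \<xi> powr (\<gamma> * q) * g \<xi> powr q)) \<partial>\<nu> \<partial>\<nu>)"
      by (rule Fubini'[symmetric]) (simp only: split_beta', measurable)
    also have "\<dots> \<le> (\<integral>\<^sup>+\<xi>. ennreal (D * C2) * ennreal (g \<xi> powr q) \<partial>\<nu>)"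
    proof (rule nn_integral_mono)
      fix \<xi> assume "\<xi> \<in> space \<nu>"
      then have x: "\<xi> \<in> disc" by simp
      have w: "0 < ?w \<xi>" using x by (simp add: box_size_pos)
      have "(\<integral>\<^sup>+z. ennreal (D * ?w z powr (- (\<gamma> * q))) * ennreal (1 / ?k z \<xi> * (?w \<xi> powr (\<gamma> * q) * g \<xi> powr q)) \<partial>\<nu>)
        = (\<integral>\<^sup>+z. ennreal (D * ?w \<xi> powr (\<gamma> * q) * g \<xi> powr q) * ennreal (?k \<xi> z powr (- 1) * ?w z powr (- (\<gamma> * q))) \<partial>\<nu>)"
      proof (rule nn_integral_cong)
        fix z assume "z \<in> space \<nu>"
        then have z: "z \<in> disc" by simp
        have "cnj (1 - cnj z * \<xi>) = 1 - cnj \<xi> * z" by (simp add: mult.commute)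
        then have sym: "norm (1 - cnj z * \<xi>) = norm (1 - cnj \<xi> * z)" by (metis complex_mod_cnj)
        have "0 < ?k \<xi> z" using kernel_dist_bounds[OF x z] by (simp add: box_size_pos)
        then have "1 / ?k z \<xi> = ?k \<xi> z powr (- 1)" unfolding sym by (simp add: powr_minus_divide)
        then have "D * ?w z powr (- (\<gamma> * q)) * (1 / ?k z \<xi> * (?w \<xi> powr (\<gamma> * q) * g \<xi> powr q))
          = (D * ?w \<xi> powr (\<gamma> * q) * g \<xi> powr q) * (?k \<xi> z powr (- 1) * ?w z powr (- (\<gamma> * q)))" by (simp only: mult_ac)
        moreover have "0 \<le> 1 / ?k z \<xi> * (?w \<xi> powr (\<gamma> * q) * g \<xi> powr q)" 
          using \<open>0 < ?k \<xi> z\<close> unfolding sym by simp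
        ultimately show "ennreal (D * ?w z powr (- (\<gamma> * q))) * ennreal (1 / ?k z \<xi> * (?w \<xi> powr (\<gamma> * q) * g \<xi> powr q))
          = ennreal (D * ?w \<xi> powr (\<gamma> * q) * g \<xi> powr q) * ennreal (?k \<xi> z powr (- 1) * ?w z powr (- (\<gamma> * q)))"
          by (simp only: ennreal_mult''[symmetric] powr_ge_zero mult_nonneg_nonneg)
      qed
      also have "\<dots> = ennreal (D * ?w \<xi> powr (\<gamma> * q) * g \<xi> powr q) * (\<integral>\<^sup>+z. ennreal (?k \<xi> z powr (- 1) * ?w z powr (- (\<gamma> * q))) \<partial>\<nu>)"
        by (rule nn_integral_cmult) measurable
      also have "\<dots> \<le> ennreal (D * ?w \<xi> powr (\<gamma> * q) * g \<xi> powr q) * ennreal (C2 * ?w \<xi> powr (1 - \<gamma> * q - 1))"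
        by (intro mult_left_mono C2(2) x) simp
      also have "\<dots> = ennreal (D * C2) * ennreal (g \<xi> powr q)"
      proof -
        have "D * ?w \<xi> powr (\<gamma> * q) * g \<xi> powr q * (C2 * ?w \<xi> powr (1 - \<gamma> * q - 1)) = D * C2 * g \<xi> powr q"
          using w by (simp add: powr_minus field_simps)
        moreover have "0 \<le> C2 * ?w \<xi> powr (1 - \<gamma> * q - 1)" using C2(1) by simp
        ultimately show ?thesis by (simp only: ennreal_mult''[symmetric] powr_ge_zero)
      qed
      finally show "(\<integral>\<^sup>+z. ennreal (D * ?w z powr (- (\<gamma> * q))) * ennreal (1 / ?k z \<xi> * (?w \<xi> powr (\<gamma> * q) * g \<xi> powr q)) \<partial>\<nu>)
        \<le> ennreal (D * C2) * ennreal (g \<xi> powr q)" .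
    qed
    also have "\<dots> = ennreal (D * C2) * (\<integral>\<^sup>+\<xi>. ennreal (g \<xi> powr q) \<partial>\<nu>)" by (rule nn_integral_cmult) measurable
    finally show "(\<integral>\<^sup>+z. ennreal (norm (T z) powr q) \<partial>\<nu>) \<le> ennreal (D * C2) * (\<integral>\<^sup>+\<xi>. ennreal (g \<xi> powr q) \<partial>\<nu>)" .
  qed
qed

end

section \<open>Toeplitz operators and Carleson embeddings\<close>

lemma Lp_norm_le:
  assumes "(\<integral>\<^sup>+z. ennreal (norm (f z) powr p) \<partial>N) \<le> ennreal (X powr p)" "0 \<le> X" "0 < p"
  shows "Lp_norm p N f \<le> ennreal X"
proof -
  obtain i where i: "(\<integral>\<^sup>+z. ennreal (norm (f z) powr p) \<partial>N) = ennreal i" "0 \<le> i"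
    using assms(1) by (cases "\<integral>\<^sup>+z. ennreal (norm (f z) powr p) \<partial>N") (auto simp: top_unique)
  have "i \<le> X powr p" using assms(1) i by (simp add: ennreal_le_iff)
  then have "i powr (1 / p) \<le> (X powr p) powr (1 / p)" using i assms by (intro powr_mono2) auto
  also have "\<dots> = X" using assms by (simp add: powr_powr)
  finally show ?thesis using i by (simp add: Lp_norm_def ennpow_def ennreal_leI)
qed

lemma Lp_norm_eq:
  assumes "(\<integral>\<^sup>+z. ennreal (norm (f z) powr p) \<partial>N) = ennreal I" "0 \<le> I"
  shows "Lp_norm p N f = ennreal (I powr (1 / p))"
  using assms by (simp add: Lp_norm_def ennpow_def)

lemma Lp_norm_le_D:
  assumes "Lp_norm p N f \<le> ennreal X" "0 \<le> X" "0 < p"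
  shows "(\<integral>\<^sup>+z. ennreal (norm (f z) powr p) \<partial>N) \<le> ennreal (X powr p)"
proof (cases "\<integral>\<^sup>+z. ennreal (norm (f z) powr p) \<partial>N")
  case (real i)
  then have "i powr (1 / p) \<le> X" using assms by (simp add: Lp_norm_eq ennreal_le_iff)
  then have "(i powr (1 / p)) powr p \<le> X powr p" using assms by (intro powr_mono2) auto
  then show ?thesis using real assms by (simp add: powr_powr ennreal_leI)
next
  case top
  then show ?thesis using assms by (simp add: Lp_norm_def ennpow_def top_unique)
qed

context regular_profile
begin

lemma kernel_slice_Lp:
  fixes p :: real
  assumes p: "1 < p"
  obtains C where "0 < C"
    "\<And>z. z \<in> disc \<Longrightarrow> (\<integral>\<^sup>+\<zeta>. ennreal (norm (kernel (cnj z * \<zeta>)) powr p) \<partial>\<nu>) \<le> ennreal (C * box_size (1 - norm z) powr (1 - p))"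
proof -
  obtain U where U: "0 < U" "\<And>w. norm w < 1 \<Longrightarrow> norm (kernel w) \<le> U / box_size (norm (1 - w))"
    using kernel_upper by blast
  obtain C where C: "0 < C" "\<And>z. z \<in> disc \<Longrightarrow>
      (\<integral>\<^sup>+\<xi>. ennreal (box_size (norm (1 - cnj z * \<xi>)) powr (- p) * box_size (1 - norm \<xi>) powr (- 0)) \<partial>\<nu>)
      \<le> ennreal (C * box_size (1 - norm z) powr (1 - 0 - p))"
    using weighted_forelli_rudin[of 0 p] p constants by auto
  show ?thesis
  proof (rule that[of "U powr p * C"])
    show "0 < U powr p * C" using U C by simp
    fix z assume z: "z \<in> disc"
    have "(\<integral>\<^sup>+\<zeta>. ennreal (norm (kernel (cnj z * \<zeta>)) powr p) \<partial>\<nu>)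
      \<le> (\<integral>\<^sup>+\<xi>. ennreal (U powr p) * ennreal (box_size (norm (1 - cnj z * \<xi>)) powr (- p) * box_size (1 - norm \<xi>) powr (- 0)) \<partial>\<nu>)"
    proof (rule nn_integral_mono)
      fix \<zeta> assume "\<zeta> \<in> space \<nu>"
      then have x: "\<zeta> \<in> disc" by simp
      have k: "0 < box_size (norm (1 - cnj z * \<zeta>))" using kernel_dist_bounds[OF z x] by (simp add: box_size_pos)
      have w: "0 < box_size (1 - norm \<zeta>)" using x by (simp add: box_size_pos)
      have "norm (kernel (cnj z * \<zeta>)) powr p \<le> (U / box_size (norm (1 - cnj z * \<zeta>))) powr p"
        using mult_in_disc[OF z x] p by (intro powr_mono2 U(2)) auto
      also have "\<dots> = U powr p * (box_size (norm (1 - cnj z * \<zeta>)) powr (- p) * box_size (1 - norm \<zeta>) powr (- 0))"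
        using k w by (simp add: powr_divide powr_minus_divide)
      finally show "ennreal (norm (kernel (cnj z * \<zeta>)) powr p)
         \<le> ennreal (U powr p) * ennreal (box_size (norm (1 - cnj z * \<zeta>)) powr (- p) * box_size (1 - norm \<zeta>) powr (- 0))"
        by (simp only: ennreal_mult''[symmetric] powr_ge_zero mult_nonneg_nonneg ennreal_leI)
    qed
    also have "\<dots> = ennreal (U powr p) * (\<integral>\<^sup>+\<xi>. ennreal (box_size (norm (1 - cnj z * \<xi>)) powr (- p) * box_size (1 - norm \<xi>) powr (- 0)) \<partial>\<nu>)"
      by (rule nn_integral_cmult) measurable
    also have "\<dots> \<le> ennreal (U powr p) * ennreal (C * box_size (1 - norm z) powr (1 - 0 - p))"
      by (intro mult_left_mono C(2) z) simp
    also have "\<dots> = ennreal (U powr p * C * box_size (1 - norm z) powr (1 - p))"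
      using C(1) by (simp add: ennreal_mult''[symmetric] mult.assoc)
    finally show "(\<integral>\<^sup>+\<zeta>. ennreal (norm (kernel (cnj z * \<zeta>)) powr p) \<partial>\<nu>) \<le> ennreal (U powr p * C * box_size (1 - norm z) powr (1 - p))" .
  qed
qed

lemma toeplitz_eq:
  assumes "space \<mu> = disc" "z \<in> disc"
  shows "toeplitz \<omega> \<mu> f z = (\<integral>\<zeta>. f \<zeta> * cnj (kernel (cnj z * \<zeta>)) \<partial>\<mu>)"
  unfolding toeplitz_def using assms
  by (intro Bochner_Integration.integral_cong) (auto simp: bergman_kernel_eq)

lemma holomorphic_measurable_disc:
  assumes "borel_measure_on_disc \<mu>" "f holomorphic_on disc"
  shows "f \<in> borel_measurable \<mu>"
  by (rule measurable_compose[OF borel_measure_on_disc_facts(2)[OF assms(1)]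
      borel_measurable_continuous_on_restrict[OF holomorphic_on_imp_continuous_on[OF assms(2)]]])

text \<open>
  Since the kernel is bounded in \<open>\<zeta>\<close> for fixed \<open>z\<close>, this makes the integral defining the Toeplitz
  operator converge absolutely.
\<close>

lemma bergman_integrable_disc_bound:
  assumes \<mu>: "borel_measure_on_disc \<mu>" "finite_measure \<mu>" and \<delta>: "0 < \<delta>" "\<delta> \<le> 1/2"
    and K: "bounded_on_discs \<delta> \<alpha> K \<mu>" "0 \<le> K" and \<alpha>: "1 \<le> \<alpha>"
    and f: "f \<in> bergman_space p \<omega>" and p: "1 \<le> p"
  shows "integrable \<mu> f"
proof (rule integrableI_bounded)
  have hol: "f holomorphic_on disc" using f by (simp add: bergman_space_iff)
  show "f \<in> borel_measurable \<mu>" by (rule holomorphic_measurable_disc[OF \<mu>(1) hol])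
  note [measurable] = holomorphic_measurable[OF hol]
  have int: "integrable \<nu> f" by (rule bergman_space_integrable[OF f p])
  obtain C where C: "0 < C" "\<And>f \<zeta>. f holomorphic_on disc \<Longrightarrow> \<zeta> \<in> disc \<Longrightarrow>
      ennreal (norm (f \<zeta>) powr 1) \<le> ennreal (1 / box_size (1 - norm \<zeta>)) *
        (\<integral>\<^sup>+\<xi>. indicator (ball \<zeta> (\<delta> / 2 * (1 - norm \<zeta>))) \<xi> * (ennreal C * ennreal (norm (f \<xi>) powr 1)) \<partial>\<nu>)"
    using averaged_from_point_evaluation[of 1 \<delta>] \<delta> by auto
  have "(\<integral>\<^sup>+\<zeta>. ennreal (norm (f \<zeta>)) \<partial>\<mu>) = (\<integral>\<^sup>+\<zeta>. ennreal (norm (f \<zeta>) powr 1) \<partial>\<mu>)" by simp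
  also have "\<dots> \<le> ennreal (A * 2 powr (M + 1) * K) * (\<integral>\<^sup>+\<xi>. (ennreal C * ennreal (norm (f \<xi>) powr 1)) * ennreal (box_size (1 - norm \<xi>) powr (\<alpha> - 1)) \<partial>\<nu>)"
  proof (rule integral_le_averaged[OF \<mu> \<delta> K])
    show "(\<lambda>\<xi>. ennreal C * ennreal (norm (f \<xi>) powr 1)) \<in> borel_measurable \<nu>" by measurable
  qed (rule C(2)[OF hol])
  also have "(\<integral>\<^sup>+\<xi>. (ennreal C * ennreal (norm (f \<xi>) powr 1)) * ennreal (box_size (1 - norm \<xi>) powr (\<alpha> - 1)) \<partial>\<nu>)
     \<le> (\<integral>\<^sup>+\<xi>. ennreal C * ennreal (norm (f \<xi>)) * ennreal (box_size 1 powr (\<alpha> - 1)) \<partial>\<nu>)"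
  proof (rule nn_integral_mono)
    fix \<xi> assume "\<xi> \<in> space \<nu>"
    then have x: "\<xi> \<in> disc" by simp
    have "box_size (1 - norm \<xi>) powr (\<alpha> - 1) \<le> box_size 1 powr (\<alpha> - 1)"
      using x \<alpha> box_size_pos[of "1 - norm \<xi>"] by (intro powr_mono2 box_size_mono) auto
    then show "(ennreal C * ennreal (norm (f \<xi>) powr 1)) * ennreal (box_size (1 - norm \<xi>) powr (\<alpha> - 1))
       \<le> ennreal C * ennreal (norm (f \<xi>)) * ennreal (box_size 1 powr (\<alpha> - 1))"
      by (simp add: mult_left_mono ennreal_leI)
  qed
  also have "\<dots> = ennreal C * (\<integral>\<^sup>+\<xi>. ennreal (norm (f \<xi>)) \<partial>\<nu>) * ennreal (box_size 1 powr (\<alpha> - 1))"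
    by (simp add: nn_integral_cmult nn_integral_multc)
  finally have "(\<integral>\<^sup>+\<zeta>. ennreal (norm (f \<zeta>)) \<partial>\<mu>) \<le> ennreal (A * 2 powr (M + 1) * K) * (ennreal C * (\<integral>\<^sup>+\<xi>. ennreal (norm (f \<xi>)) \<partial>\<nu>) * ennreal (box_size 1 powr (\<alpha> - 1)))"
    by (simp add: mult_left_mono)
  also have "\<dots> < \<infinity>" using int by (auto simp: ennreal_mult_less_top integrable_iff_bounded)
  finally show "(\<integral>\<^sup>+\<zeta>. ennreal (norm (f \<zeta>)) \<partial>\<mu>) < \<infinity>" .
qed

text \<open>
  Averaging replaces \<open>\<mu>\<close> by \<open>\<omega> dA\<close> and leaves the factor \<open>box_size\<^bsup>1/p - 1/q\<^esup>\<close>. The point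
  evaluation bound turns this factor together with \<open>|f|\<close> into \<open>|f|\<^bsup>p/q\<^esup>\<close>, and the maximal
  Bergman projection is bounded on \<open>L\<^bsup>q\<^esup>\<close>.
\<close>

lemma toeplitz_of_disc_bound:
  fixes p q \<delta> :: real
  assumes pq: "1 < p" "p \<le> q" and \<delta>: "0 < \<delta>" "\<delta> \<le> 1/2"
  obtains C where "0 < C"
    "\<And>\<mu> K f I. borel_measure_on_disc \<mu> \<Longrightarrow> finite_measure \<mu> \<Longrightarrow> bounded_on_discs \<delta> (1 + (1/p - 1/q)) K \<mu> \<Longrightarrow> 0 \<le> K \<Longrightarrow>
      f \<in> bergman_space p \<omega> \<Longrightarrow> (\<integral>\<^sup>+\<xi>. ennreal (norm (f \<xi>) powr p) \<partial>\<nu>) = ennreal I \<Longrightarrow> 0 \<le> I \<Longrightarrow>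
      f \<in> toeplitz_domain \<omega> \<mu> \<and> toeplitz \<omega> \<mu> f holomorphic_on disc \<and>
      (\<integral>\<^sup>+z. ennreal (norm (toeplitz \<omega> \<mu> f z) powr q) \<partial>\<nu>) \<le> ennreal ((C * K * I powr (1/p)) powr q)"
proof -
  define e where "e = 1/p - 1/q"
  have e: "0 \<le> e" using pq by (simp add: e_def field_simps)
  obtain U where U: "0 < U" "\<And>w. norm w < 1 \<Longrightarrow> norm (kernel w) \<le> U / box_size (norm (1 - w))"
    using kernel_upper by blast
  obtain C1 where C1: "0 < C1" "\<And>f \<zeta>. f holomorphic_on disc \<Longrightarrow> \<zeta> \<in> disc \<Longrightarrow>
      ennreal (norm (f \<zeta>) powr 1) \<le> ennreal (1 / box_size (1 - norm \<zeta>)) *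
        (\<integral>\<^sup>+\<xi>. indicator (ball \<zeta> (\<delta> / 2 * (1 - norm \<zeta>))) \<xi> * (ennreal C1 * ennreal (norm (f \<xi>) powr 1)) \<partial>\<nu>)"
    using averaged_from_point_evaluation[of 1 \<delta>] \<delta> by auto
  obtain D where D: "0 < D"
    "\<And>f z I. f holomorphic_on disc \<Longrightarrow> z \<in> disc \<Longrightarrow> (\<integral>\<^sup>+\<xi>. ennreal (norm (f \<xi>) powr p) \<partial>\<nu>) \<le> ennreal I \<Longrightarrow> 0 \<le> I \<Longrightarrow>
      norm (f z) powr p * box_size (1 - norm z) \<le> D * I"
    using point_evaluation[of p] pq by auto
  obtain S where S: "0 < S" "\<And>g T. g \<in> borel_measurable \<nu> \<Longrightarrow> (\<And>\<xi>. 0 \<le> g \<xi>) \<Longrightarrow>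
      (\<And>z. z \<in> disc \<Longrightarrow> ennreal (norm (T z :: complex)) \<le> (\<integral>\<^sup>+\<xi>. ennreal (g \<xi> / box_size (norm (1 - cnj z * \<xi>))) \<partial>\<nu>)) \<Longrightarrow>
      (\<integral>\<^sup>+z. ennreal (norm (T z) powr q) \<partial>\<nu>) \<le> ennreal S * (\<integral>\<^sup>+\<xi>. ennreal (g \<xi> powr q) \<partial>\<nu>)"
    using schur_bound[of q] pq by auto
  define G where "G = A * 2 powr (M + 1)"
  have G: "0 < G" using constants by (simp add: G_def)
  define c where "c = C1 * U * G"
  have c: "0 < c" using C1 U G by (simp add: c_def)
  define C where "C = S powr (1/q) * (G * c) * D powr e"
  show ?thesis
  proof (rule that[of C])
    show "0 < C" using S G c D by (simp add: C_def)
    fix \<mu> K f I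
    assume \<mu>: "borel_measure_on_disc \<mu>" "finite_measure \<mu>" and K': "bounded_on_discs \<delta> (1 + (1/p - 1/q)) K \<mu>" "0 \<le> K"
      and f: "f \<in> bergman_space p \<omega>" and I: "(\<integral>\<^sup>+\<xi>. ennreal (norm (f \<xi>) powr p) \<partial>\<nu>) = ennreal I" "0 \<le> I"
    have K: "bounded_on_discs \<delta> (1 + e) K \<mu>" "0 \<le> K" using K' by (auto simp: e_def)
    note sp = borel_measure_on_disc_facts[OF \<mu>(1)]
    have hol: "f holomorphic_on disc" using f by (simp add: bergman_space_iff)
    note [measurable] = holomorphic_measurable[OF hol]
    have int: "integrable \<mu> f"
      by (rule bergman_integrable_disc_bound[OF \<mu> \<delta> K _ f]) (use e pq in auto)
    have kint: "integrable \<mu> (\<lambda>\<zeta>. f \<zeta> * cnj (kernel (cnj z * \<zeta>)))" if "z \<in> disc" for z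
      by (rule kernel_series_integral(1)[OF _ sp(3) int that]) (simp add: sp)
    have dom: "f \<in> toeplitz_domain \<omega> \<mu>"
      unfolding toeplitz_domain_def
    proof (intro CollectI ballI)
      fix z assume z: "z \<in> disc"
      show "integrable \<mu> (\<lambda>\<zeta>. f \<zeta> * cnj (bergman_kernel \<omega> z \<zeta>))"
        by (rule Bochner_Integration.integrable_cong[THEN iffD1, OF refl _ kint[OF z]]) (simp add: sp bergman_kernel_eq[OF z])
    qed
    have Thol: "toeplitz \<omega> \<mu> f holomorphic_on disc"
    proof (rule power_series_holomorphic[where a="\<lambda>n. of_real (kernel_coeff n) * (\<integral>\<zeta>. f \<zeta> * cnj \<zeta> ^ n \<partial>\<mu>)"])
      fix z :: complex assume z: "z \<in> disc"
      have "(\<lambda>n. of_real (kernel_coeff n) * (\<integral>\<zeta>. f \<zeta> * cnj \<zeta> ^ n \<partial>\<mu>) * z ^ n) sums (\<integral>\<zeta>. f \<zeta> * cnj (kernel (cnj z * \<zeta>)) \<partial>\<mu>)"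
        by (rule kernel_series_integral(2)[OF _ sp(3) int z]) (simp add: sp)
      then show "(\<lambda>n. of_real (kernel_coeff n) * (\<integral>\<zeta>. f \<zeta> * cnj \<zeta> ^ n \<partial>\<mu>) * (z - 0) ^ n) sums toeplitz \<omega> \<mu> f z"
        by (simp add: toeplitz_eq[OF sp(1) z])
    qed
    define L where "L = G * K * c * (D * I) powr e"
    define g where "g = (\<lambda>\<xi>. L * norm (f \<xi>) powr (p / q))"
    have L: "0 \<le> L" using G K c by (simp add: L_def)
    have "(\<integral>\<^sup>+z. ennreal (norm (toeplitz \<omega> \<mu> f z) powr q) \<partial>\<nu>) \<le> ennreal S * (\<integral>\<^sup>+\<xi>. ennreal (g \<xi> powr q) \<partial>\<nu>)"
    proof (rule S(2))
      show "g \<in> borel_measurable \<nu>" unfolding g_def by measurable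
      show "0 \<le> g \<xi>" for \<xi> using L by (simp add: g_def)
      fix z assume z: "z \<in> disc"
      let ?k = "\<lambda>\<xi>. box_size (norm (1 - cnj z * \<xi>))"
      let ?H = "\<lambda>\<zeta>. ennreal (norm (f \<zeta> * cnj (kernel (cnj z * \<zeta>))))"
      let ?H' = "\<lambda>\<xi>. ennreal (c * norm (f \<xi>) / ?k \<xi>)"
      have "ennreal (norm (toeplitz \<omega> \<mu> f z)) \<le> (\<integral>\<^sup>+\<zeta>. ?H \<zeta> \<partial>\<mu>)"
        unfolding toeplitz_eq[OF sp(1) z] by (rule integral_norm_bound_ennreal[OF kint[OF z]])
      also have "\<dots> \<le> ennreal (A * 2 powr (M + 1) * K) * (\<integral>\<^sup>+\<xi>. ?H' \<xi> * ennreal (box_size (1 - norm \<xi>) powr (1 + e - 1)) \<partial>\<nu>)"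
      proof (rule integral_le_averaged[OF \<mu> \<delta> K])
        show "?H' \<in> borel_measurable \<nu>" by measurable
        fix \<zeta> assume x: "\<zeta> \<in> disc"
        let ?B = "ball \<zeta> (\<delta> / 2 * (1 - norm \<zeta>))"
        have [measurable]: "(\<lambda>\<xi>. indicator ?B \<xi> :: ennreal) \<in> borel_measurable \<nu>"
          by (rule measurable_compose[OF identity_measurable_weight_measure']) simp
        have kz: "0 < ?k \<zeta>" using kernel_dist_bounds[OF z x] by (simp add: box_size_pos)
        have "norm (f \<zeta> * cnj (kernel (cnj z * \<zeta>))) \<le> norm (f \<zeta>) powr 1 * (U / ?k \<zeta>)"
        proof -
          have "norm (kernel (cnj z * \<zeta>)) \<le> U / ?k \<zeta>" using mult_in_disc[OF z x] by (intro U(2)) simp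
          then have "norm (f \<zeta>) * norm (kernel (cnj z * \<zeta>)) \<le> norm (f \<zeta>) * (U / ?k \<zeta>)" by (rule mult_left_mono) simp
          then show ?thesis by (simp add: norm_mult)
        qed
        then have "?H \<zeta> \<le> ennreal (norm (f \<zeta>) powr 1) * ennreal (U / ?k \<zeta>)"
          using U(1) kz by (simp add: ennreal_mult''[symmetric] ennreal_leI)
        also have "\<dots> \<le> (ennreal (1 / box_size (1 - norm \<zeta>)) * (\<integral>\<^sup>+\<xi>. indicator ?B \<xi> * (ennreal C1 * ennreal (norm (f \<xi>) powr 1)) \<partial>\<nu>)) * ennreal (U / ?k \<zeta>)"
          by (intro mult_right_mono C1(2) hol x) simp
        also have "\<dots> = ennreal (1 / box_size (1 - norm \<zeta>)) * (\<integral>\<^sup>+\<xi>. indicator ?B \<xi> * (ennreal C1 * ennreal (norm (f \<xi>) powr 1)) * ennreal (U / ?k \<zeta>) \<partial>\<nu>)"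
          by (subst nn_integral_multc) (auto simp: mult.assoc)
        also have "\<dots> \<le> ennreal (1 / box_size (1 - norm \<zeta>)) * (\<integral>\<^sup>+\<xi>. indicator ?B \<xi> * ?H' \<xi> \<partial>\<nu>)"
        proof (intro mult_left_mono nn_integral_mono)
          fix \<xi> assume "\<xi> \<in> space \<nu>"
          then have y: "\<xi> \<in> disc" by simp
          show "indicator ?B \<xi> * (ennreal C1 * ennreal (norm (f \<xi>) powr 1)) * ennreal (U / ?k \<zeta>) \<le> indicator ?B \<xi> * ?H' \<xi>"
          proof (cases "\<xi> \<in> ?B")
            case True
            have d: "0 < norm (1 - cnj z * \<zeta>)" "0 < norm (1 - cnj z * \<xi>)" "1 - norm \<zeta> \<le> norm (1 - cnj z * \<zeta>)"
              using kernel_dist_bounds[OF z x] kernel_dist_bounds[OF z y] by auto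
            have "1 - cnj z * \<xi> = (1 - cnj z * \<zeta>) + cnj z * (\<zeta> - \<xi>)" by (simp add: algebra_simps)
            then have "norm (1 - cnj z * \<xi>) \<le> norm (1 - cnj z * \<zeta>) + norm (cnj z * (\<zeta> - \<xi>))" by (metis norm_triangle_ineq)
            moreover have "norm (cnj z * (\<zeta> - \<xi>)) \<le> 1 * dist \<zeta> \<xi>"
              unfolding norm_mult complex_mod_cnj dist_norm using z by (intro mult_right_mono) auto
            moreover have "1 * dist \<zeta> \<xi> \<le> 1 * (1 - norm \<zeta>)"
            proof -
              have "\<delta> / 2 * (1 - norm \<zeta>) \<le> 1 * (1 - norm \<zeta>)" using \<delta> x by (intro mult_right_mono) auto
              then show ?thesis using True by simp
            qed
            moreover have "x \<le> 2 * b" if "x \<le> b + y" "y \<le> 1 * e" "1 * e \<le> 1 * r" "r \<le> b" for b e r x y :: real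
              using that by linarith
            ultimately have "norm (1 - cnj z * \<xi>) \<le> 2 * norm (1 - cnj z * \<zeta>)" using d(3) by blast
            then have "?k \<xi> \<le> box_size (2 * norm (1 - cnj z * \<zeta>))" using d by (intro box_size_mono) auto
            also have "\<dots> \<le> G * ?k \<zeta>" unfolding G_def using d by (intro box_size_growth) auto
            finally have k: "?k \<xi> \<le> G * ?k \<zeta>" .
            have k0: "0 < ?k \<xi>" using d by (simp add: box_size_pos)
            have "1 / ?k \<zeta> \<le> G / ?k \<xi>" using k k0 kz by (simp add: field_simps)
            then have "C1 * norm (f \<xi>) * U * (1 / ?k \<zeta>) \<le> C1 * norm (f \<xi>) * U * (G / ?k \<xi>)"
              using C1(1) U(1) by (intro mult_left_mono) auto
            then have "C1 * norm (f \<xi>) powr 1 * (U / ?k \<zeta>) \<le> c * norm (f \<xi>) / ?k \<xi>"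
              by (simp add: c_def mult_ac)
            then have "ennreal C1 * ennreal (norm (f \<xi>) powr 1) * ennreal (U / ?k \<zeta>) \<le> ?H' \<xi>"
              using U(1) kz by (simp add: ennreal_mult''[symmetric] ennreal_leI)
            then show ?thesis using True by simp
          qed simp
        qed simp
        finally show "?H \<zeta> \<le> ennreal (1 / box_size (1 - norm \<zeta>)) * (\<integral>\<^sup>+\<xi>. indicator ?B \<xi> * ?H' \<xi> \<partial>\<nu>)" .
      qed
      also have "\<dots> = (\<integral>\<^sup>+\<xi>. ennreal (G * K) * (?H' \<xi> * ennreal (box_size (1 - norm \<xi>) powr e)) \<partial>\<nu>)"
        unfolding G_def[symmetric] by (subst nn_integral_cmult) auto
      also have "\<dots> \<le> (\<integral>\<^sup>+\<xi>. ennreal (g \<xi> / ?k \<xi>) \<partial>\<nu>)"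
      proof (rule nn_integral_mono)
        fix \<xi> assume "\<xi> \<in> space \<nu>"
        then have y: "\<xi> \<in> disc" by simp
        have w: "0 < box_size (1 - norm \<xi>)" using y by (simp add: box_size_pos)
        have k0: "0 < ?k \<xi>" using kernel_dist_bounds[OF z y] by (simp add: box_size_pos)
        have "norm (f \<xi>) = norm (f \<xi>) powr (p / q) * norm (f \<xi>) powr (p * e)"
        proof -
          have "p / q + p * e = 1" using pq by (simp add: e_def field_simps)
          then show ?thesis by (simp add: powr_add[symmetric])
        qed
        then have "norm (f \<xi>) * box_size (1 - norm \<xi>) powr e = norm (f \<xi>) powr (p / q) * (norm (f \<xi>) powr (p * e) * box_size (1 - norm \<xi>) powr e)"
          by (metis mult.assoc)
        also have "norm (f \<xi>) powr (p * e) * box_size (1 - norm \<xi>) powr e = (norm (f \<xi>) powr p * box_size (1 - norm \<xi>)) powr e"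
          using w by (simp add: powr_mult powr_powr)
        also have "norm (f \<xi>) powr (p / q) * (norm (f \<xi>) powr p * box_size (1 - norm \<xi>)) powr e \<le> norm (f \<xi>) powr (p / q) * (D * I) powr e"
          using D(2)[OF hol y _ I(2)] I(1) w e by (intro mult_left_mono powr_mono2) auto
        finally have "(G * K * c / ?k \<xi>) * (norm (f \<xi>) * box_size (1 - norm \<xi>) powr e) \<le> (G * K * c / ?k \<xi>) * (norm (f \<xi>) powr (p / q) * (D * I) powr e)"
          using G K c k0 by (intro mult_left_mono) auto
        then have "G * K * (c * norm (f \<xi>) / ?k \<xi> * box_size (1 - norm \<xi>) powr e) \<le> g \<xi> / ?k \<xi>"
          by (simp add: g_def L_def mult_ac)
        then show "ennreal (G * K) * (?H' \<xi> * ennreal (box_size (1 - norm \<xi>) powr e)) \<le> ennreal (g \<xi> / ?k \<xi>)"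
          using c k0 by (simp add: ennreal_mult''[symmetric] ennreal_leI)
      qed
      finally show "ennreal (norm (toeplitz \<omega> \<mu> f z)) \<le> (\<integral>\<^sup>+\<xi>. ennreal (g \<xi> / ?k \<xi>) \<partial>\<nu>)" .
    qed
    also have "(\<integral>\<^sup>+\<xi>. ennreal (g \<xi> powr q) \<partial>\<nu>) = (\<integral>\<^sup>+\<xi>. ennreal (L powr q) * ennreal (norm (f \<xi>) powr p) \<partial>\<nu>)"
      using L pq by (intro nn_integral_cong) (simp add: g_def powr_mult powr_powr ennreal_mult'')
    also have "\<dots> = ennreal (L powr q) * ennreal I" by (subst nn_integral_cmult) (auto simp: I)
    also have "ennreal S * (ennreal (L powr q) * ennreal I) = ennreal (S * (L powr q * I))"
      using S(1) I by (simp add: ennreal_mult''[symmetric])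
    also have "S * (L powr q * I) = (C * K * I powr (1/p)) powr q"
    proof -
      have q0: "0 < q" using pq by simp
      have 1: "(C * K * I powr (1/p)) powr q = (S powr (1/q)) powr q * (G * c * K) powr q * (D powr e) powr q * (I powr (1/p)) powr q"
        using S(1) G c D(1) K by (simp add: C_def powr_mult mult_ac)
      have 2: "(S powr (1/q)) powr q = S" using S(1) q0 by (simp add: powr_powr)
      have 3: "L powr q = (G * c * K) powr q * (D powr e) powr q * (I powr e) powr q"
        using G c D(1) K I(2) by (simp add: L_def powr_mult mult_ac)
      have 4: "(I powr e) powr q * I = (I powr (1/p)) powr q"
      proof (cases "I = 0")
        case False
        have e: "1/p * q = e * q + 1" using pq by (simp add: e_def field_simps)
        have "(I powr (1/p)) powr q = I powr (e * q + 1)" by (simp only: powr_powr e)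
        also have "\<dots> = (I powr e) powr q * I" using False I(2) by (simp add: powr_add powr_powr)
        finally show ?thesis by simp
      qed simp
      show ?thesis unfolding 1 2 3 4[symmetric] by (simp add: mult_ac)
    qed
    finally show "f \<in> toeplitz_domain \<omega> \<mu> \<and> toeplitz \<omega> \<mu> f holomorphic_on disc \<and>
      (\<integral>\<^sup>+z. ennreal (norm (toeplitz \<omega> \<mu> f z) powr q) \<partial>\<nu>) \<le> ennreal ((C * K * I powr (1/p)) powr q)"
      using dom Thol by blast
  qed
qed

text \<open>
  The value at \<open>z\<close> of the Toeplitz transform of \<open>B\<^sub>z\<close> is \<open>\<integral>|B\<^sub>z|\<^sup>2 d\<mu>\<close>. Point evaluation in
  \<open>A\<^bsup>q\<^esup>\<close> and the norm of \<open>B\<^sub>z\<close> in \<open>A\<^bsup>p\<^esup>\<close> bound it.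
\<close>

lemma berezin_of_toeplitz:
  fixes p q :: real
  assumes pq: "1 < p" "p \<le> q"
  obtains C where "0 < C"
    "\<And>\<mu> N z. borel_measure_on_disc \<mu> \<Longrightarrow>
      op_bound (bergman_space p \<omega>) (bergman_norm p \<omega>) (bergman_space q \<omega>) (bergman_norm q \<omega>)
        (toeplitz_domain \<omega> \<mu>) (toeplitz \<omega> \<mu>) (ennreal N) \<Longrightarrow> 0 \<le> N \<Longrightarrow> z \<in> disc \<Longrightarrow>
      berezin \<omega> \<mu> z \<le> ennreal (C * N * box_size (1 - norm z) powr (1/p - 1/q))"
proof -
  obtain C1 where C1: "0 < C1" "\<And>z. z \<in> disc \<Longrightarrow>
     (\<integral>\<^sup>+\<zeta>. ennreal (norm (kernel (cnj z * \<zeta>)) powr p) \<partial>\<nu>) \<le> ennreal (C1 * box_size (1 - norm z) powr (1 - p))"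
    using kernel_slice_Lp[OF pq(1)] by blast
  obtain D where D: "0 < D"
    "\<And>f z I. f holomorphic_on disc \<Longrightarrow> z \<in> disc \<Longrightarrow> (\<integral>\<^sup>+\<xi>. ennreal (norm (f \<xi>) powr q) \<partial>\<nu>) \<le> ennreal I \<Longrightarrow> 0 \<le> I \<Longrightarrow>
      norm (f z) powr q * box_size (1 - norm z) \<le> D * I"
    using point_evaluation[of q] pq by auto
  obtain c C2 where c: "0 < c" "\<And>z. z \<in> disc \<Longrightarrow> c / box_size (1 - norm z) \<le> kernel_norm2 z"
    using kernel_norm2_bounds by metis
  define C where "C = D powr (1/q) * C1 powr (1/p) / c"
  show ?thesis
  proof (rule that[of C])
    show "0 < C" using C1 D c by (simp add: C_def)
    fix \<mu> N z
    assume \<mu>: "borel_measure_on_disc \<mu>" and N: "0 \<le> N" and z: "z \<in> disc"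
      and op: "op_bound (bergman_space p \<omega>) (bergman_norm p \<omega>) (bergman_space q \<omega>) (bergman_norm q \<omega>)
        (toeplitz_domain \<omega> \<mu>) (toeplitz \<omega> \<mu>) (ennreal N)"
    note sp = borel_measure_on_disc_facts[OF \<mu>]
    define w where "w = box_size (1 - norm z)"
    have w: "0 < w" using z by (simp add: w_def box_size_pos)
    let ?s = "\<lambda>\<zeta>. kernel (cnj z * \<zeta>)"
    define B where "B = bergman_kernel \<omega> z"
    have Bs: "B \<zeta> = ?s \<zeta>" if "\<zeta> \<in> disc" for \<zeta> using that z by (simp add: B_def bergman_kernel_eq)
    have Bn: "(\<integral>\<^sup>+\<zeta>. ennreal (norm (B \<zeta>) powr p) \<partial>\<nu>) = (\<integral>\<^sup>+\<zeta>. ennreal (norm (?s \<zeta>) powr p) \<partial>\<nu>)"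
      by (intro nn_integral_weight_measure_cong) (simp only: Bs)
    have "?s \<in> bergman_space p \<omega>" using pq by (intro kernel_slice_bergman z) auto
    then have Bp: "B \<in> bergman_space p \<omega>"
      unfolding bergman_space_iff Bn using holomorphic_cong[of disc disc B ?s] Bs by auto
    have R0: "0 \<le> N * (C1 * w powr (1 - p)) powr (1/p)" using N by simp
    have "bergman_norm p \<omega> B \<le> ennreal ((C1 * w powr (1 - p)) powr (1/p))"
      unfolding bergman_norm_def
    proof (rule Lp_norm_le)
      have "((C1 * w powr (1 - p)) powr (1/p)) powr p = C1 * w powr (1 - p)" using pq C1(1) w by (simp add: powr_powr)
      then show "(\<integral>\<^sup>+\<zeta>. ennreal (norm (B \<zeta>) powr p) \<partial>\<nu>) \<le> ennreal (((C1 * w powr (1 - p)) powr (1/p)) powr p)"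
        unfolding Bn using C1(2)[OF z] by (simp add: w_def)
    qed (use pq in auto)
    then have "bergman_norm q \<omega> (toeplitz \<omega> \<mu> B) \<le> ennreal N * ennreal ((C1 * w powr (1 - p)) powr (1/p))"
      using op Bp unfolding op_bound_def by (meson mult_left_mono order_trans zero_le)
    then have "Lp_norm q \<nu> (toeplitz \<omega> \<mu> B) \<le> ennreal (N * (C1 * w powr (1 - p)) powr (1/p))"
      by (simp add: bergman_norm_def ennreal_mult'')
    then have "(\<integral>\<^sup>+\<xi>. ennreal (norm (toeplitz \<omega> \<mu> B \<xi>) powr q) \<partial>\<nu>) \<le> ennreal ((N * (C1 * w powr (1 - p)) powr (1/p)) powr q)"
      using R0 pq by (intro Lp_norm_le_D) auto
    moreover have dom: "B \<in> toeplitz_domain \<omega> \<mu>" and "toeplitz \<omega> \<mu> B holomorphic_on disc"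
      using op Bp by (auto simp: op_bound_def bergman_space_iff)
    ultimately have "norm (toeplitz \<omega> \<mu> B z) powr q * w \<le> D * (N * (C1 * w powr (1 - p)) powr (1/p)) powr q"
      unfolding w_def using z by (intro D(2)) auto
    then have "norm (toeplitz \<omega> \<mu> B z) powr q \<le> D * (N * (C1 * w powr (1 - p)) powr (1/p)) powr q / w"
      using w by (simp add: field_simps)
    then have "(norm (toeplitz \<omega> \<mu> B z) powr q) powr (1/q) \<le> (D * (N * (C1 * w powr (1 - p)) powr (1/p)) powr q / w) powr (1/q)"
      using pq by (intro powr_mono2) auto
    moreover have "(norm (toeplitz \<omega> \<mu> B z) powr q) powr (1/q) = norm (toeplitz \<omega> \<mu> B z)" using pq by (simp add: powr_powr)
    moreover have "(D * (N * (C1 * w powr (1 - p)) powr (1/p)) powr q / w) powr (1/q)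
       = D powr (1/q) * (N * (C1 * w powr (1 - p)) powr (1/p)) / w powr (1/q)"
    proof -
      have "((N * (C1 * w powr (1 - p)) powr (1/p)) powr q) powr (1/q) = N * (C1 * w powr (1 - p)) powr (1/p)"
        using pq R0 by (simp only: powr_powr) simp
      then show ?thesis using D(1) w by (simp only: powr_divide powr_mult)
    qed
    ultimately have T: "norm (toeplitz \<omega> \<mu> B z) \<le> D powr (1/q) * (N * (C1 * w powr (1 - p)) powr (1/p)) / w powr (1/q)" by simp
    have "integrable \<mu> (\<lambda>\<zeta>. B \<zeta> * cnj (B \<zeta>))" using dom z by (simp add: toeplitz_domain_def B_def)
    then have int: "integrable \<mu> (\<lambda>\<zeta>. complex_of_real ((norm (?s \<zeta>))\<^sup>2))"
      by (rule Bochner_Integration.integrable_cong[THEN iffD1, rotated -1]) (simp_all add: sp Bs complex_norm_square del: of_real_power)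
    have int': "integrable \<mu> (\<lambda>\<zeta>. (norm (?s \<zeta>))\<^sup>2)" using int by (simp only: complex_of_real_integrable_eq)
    have "toeplitz \<omega> \<mu> B z = (\<integral>\<zeta>. complex_of_real ((norm (?s \<zeta>))\<^sup>2) \<partial>\<mu>)"
      unfolding toeplitz_eq[OF sp(1) z]
      by (intro Bochner_Integration.integral_cong) (auto simp add: sp Bs complex_norm_square simp del: of_real_power)
    also have "\<dots> = of_real (\<integral>\<zeta>. (norm (?s \<zeta>))\<^sup>2 \<partial>\<mu>)" by (rule integral_complex_of_real)
    finally have "norm (toeplitz \<omega> \<mu> B z) = \<bar>\<integral>\<zeta>. (norm (?s \<zeta>))\<^sup>2 \<partial>\<mu>\<bar>" by (simp only: norm_of_real)
    also have "\<dots> = (\<integral>\<zeta>. (norm (?s \<zeta>))\<^sup>2 \<partial>\<mu>)" by (simp add: integral_nonneg_AE)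
    finally have nT: "norm (toeplitz \<omega> \<mu> B z) = (\<integral>\<zeta>. (norm (?s \<zeta>))\<^sup>2 \<partial>\<mu>)" .
    have "(\<integral>\<^sup>+\<zeta>. ennreal ((norm (?s \<zeta>))\<^sup>2) \<partial>\<mu>) = ennreal (norm (toeplitz \<omega> \<mu> B z))"
      unfolding nT by (rule nn_integral_eq_integral[OF int']) auto
    then have "berezin \<omega> \<mu> z = ennreal (1 / kernel_norm2 z * norm (toeplitz \<omega> \<mu> B z))"
      using berezin_eq[OF z _ sp(2)] sp(1) by (subst ennreal_mult'') simp_all
    also have "1 / kernel_norm2 z * norm (toeplitz \<omega> \<mu> B z) \<le> (w / c) * (D powr (1/q) * (N * (C1 * w powr (1 - p)) powr (1/p)) / w powr (1/q))"
    proof (rule mult_mono[OF _ T])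
      show "1 / kernel_norm2 z \<le> w / c"
        using c(2)[OF z] c(1) kernel_norm2_pos[OF z] w by (simp add: w_def[symmetric] field_simps)
    qed (use w c in auto)
    also have "(w / c) * (D powr (1/q) * (N * (C1 * w powr (1 - p)) powr (1/p)) / w powr (1/q)) = C * N * w powr (1/p - 1/q)"
    proof -
      have "(C1 * w powr (1 - p)) powr (1/p) = C1 powr (1/p) * w powr (1/p - 1)"
      proof -
        have "(1 - p) * (1/p) = 1/p - 1" using pq by (simp add: field_simps)
        then show ?thesis using C1(1) w by (simp add: powr_mult powr_powr)
      qed
      moreover have "w * w powr (1/p - 1) / w powr (1/q) = w powr (1/p - 1/q)"
        using w by (simp add: powr_diff)
      moreover have "w / c * (d * (N * (a * x)) / y) = d * a / c * N * (w * x / y)" for a d x y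
        by simp
      ultimately show ?thesis unfolding C_def by (simp only:)
    qed
    finally show "berezin \<omega> \<mu> z \<le> ennreal (C * N * box_size (1 - norm z) powr (1/p - 1/q))"
      by (simp add: w_def ennreal_leI)
  qed
qed

text \<open>
  On a small disc around \<open>z\<close> the normalized kernel has size \<open>box_size (1 - |z|)\<^bsup>-1/2\<^esup>\<close>. At
  \<open>z = 0\<close> the kernel is constant, so that the Berezin transform bounds the total mass.
\<close>

lemma disc_bound_of_berezin:
  obtains \<delta> C where "0 < \<delta>" "\<delta> \<le> 1/2" "0 < C"
    "\<And>\<mu> K e. borel_measure_on_disc \<mu> \<Longrightarrow> 0 \<le> K \<Longrightarrow>
      (\<And>z. z \<in> disc \<Longrightarrow> berezin \<omega> \<mu> z \<le> ennreal (K * box_size (1 - norm z) powr e)) \<Longrightarrow>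
      finite_measure \<mu> \<and> bounded_on_discs \<delta> (1 + e) (C * K) \<mu>"
proof -
  obtain \<delta> c where \<delta>: "0 < \<delta>" "\<delta> \<le> 1/2" "0 < c"
    and low: "\<And>z \<zeta>. z \<in> disc \<Longrightarrow> \<zeta> \<in> ball z (\<delta> * (1 - norm z)) \<Longrightarrow> c / box_size (1 - norm z) \<le> norm (kernel (cnj z * \<zeta>))"
    using kernel_near_diagonal_lower by metis
  obtain c' C2 where C2: "0 < C2" "\<And>z. z \<in> disc \<Longrightarrow> kernel_norm2 z \<le> C2 / box_size (1 - norm z)"
    using kernel_norm2_bounds by metis
  define C where "C = C2 / c\<^sup>2"
  have C: "0 < C" using C2 \<delta> by (simp add: C_def)
  show ?thesis
  proof (rule that[OF \<delta>(1,2) C], intro conjI)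
    fix \<mu> K and e :: real
    assume \<mu>: "borel_measure_on_disc \<mu>" and K: "0 \<le> K"
      and b: "\<And>z. z \<in> disc \<Longrightarrow> berezin \<omega> \<mu> z \<le> ennreal (K * box_size (1 - norm z) powr e)"
    note sp = borel_measure_on_disc_facts[OF \<mu>]
    have be: "berezin \<omega> \<mu> z = ennreal (1 / kernel_norm2 z) * (\<integral>\<^sup>+\<zeta>. ennreal ((norm (kernel (cnj z * \<zeta>)))\<^sup>2) \<partial>\<mu>)"
      if "z \<in> disc" for z by (rule berezin_eq[OF that _ sp(2)]) (simp add: sp)
    show "finite_measure \<mu>"
    proof
      have n0: "0 < kernel_norm2 0" by (rule kernel_norm2_pos) simp
      have k0: "norm (kernel 0) = kernel_norm2 0"
        using kernel_norm2_eq[of 0] n0 by (metis abs_of_pos centre_in_ball norm_of_real norm_zero of_real_0 power_zero_numeral zero_less_one)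
      have "ennreal (1 / kernel_norm2 0) * (ennreal ((kernel_norm2 0)\<^sup>2) * emeasure \<mu> (space \<mu>)) = berezin \<omega> \<mu> 0"
        by (subst be) (simp_all add: k0)
      also have "\<dots> \<le> ennreal (K * box_size 1 powr e)" using b[of 0] by simp
      also have "\<dots> < \<infinity>" by simp
      finally show "emeasure \<mu> (space \<mu>) \<noteq> \<infinity>" using n0 by (auto simp: ennreal_mult_top ennreal_mult_less_top)
    qed
    show "bounded_on_discs \<delta> (1 + e) (C * K) \<mu>"
      unfolding bounded_on_discs_def
    proof (intro ballI)
      fix z assume z: "z \<in> disc"
      define w B where "w = box_size (1 - norm z)" and "B = ball z (\<delta> * (1 - norm z))"
      have w: "0 < w" using z by (simp add: w_def box_size_pos)
      have "\<delta> * (1 - norm z) \<le> 1/2 * (1 - norm z)" using \<delta> z by (intro mult_right_mono) auto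
      then have "B \<subseteq> ball z ((1 - norm z) / 2)" unfolding B_def by (intro subset_ball) simp
      then have Bd: "B \<subseteq> disc" using weight_on_ball(1)[OF z] by auto
      have B: "B \<in> sets \<mu>" by (rule sp(4)[OF _ Bd]) (simp add: B_def)
      have n0: "0 < kernel_norm2 z" by (rule kernel_norm2_pos[OF z])
      have "ennreal ((c / w)\<^sup>2) * emeasure \<mu> B = (\<integral>\<^sup>+\<zeta>. ennreal ((c / w)\<^sup>2) * indicator B \<zeta> \<partial>\<mu>)"
        by (rule nn_integral_cmult_indicator[OF B, symmetric])
      also have "\<dots> \<le> (\<integral>\<^sup>+\<zeta>. ennreal ((norm (kernel (cnj z * \<zeta>)))\<^sup>2) \<partial>\<mu>)"
      proof (rule nn_integral_mono)
        fix \<zeta>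
        show "ennreal ((c / w)\<^sup>2) * indicator B \<zeta> \<le> ennreal ((norm (kernel (cnj z * \<zeta>)))\<^sup>2)"
          using low[OF z, of \<zeta>] w \<delta> by (auto simp: indicator_def B_def w_def intro!: ennreal_leI power_mono)
      qed
      finally have 1: "ennreal ((c / w)\<^sup>2) * emeasure \<mu> B \<le> (\<integral>\<^sup>+\<zeta>. ennreal ((norm (kernel (cnj z * \<zeta>)))\<^sup>2) \<partial>\<mu>)" .
      have "w / C2 \<le> 1 / kernel_norm2 z" using C2(2)[OF z] C2(1) n0 w by (simp add: w_def[symmetric] field_simps)
      then have "ennreal (w / C2) * (ennreal ((c / w)\<^sup>2) * emeasure \<mu> B) \<le> berezin \<omega> \<mu> z"
        unfolding be[OF z] by (intro mult_mono ennreal_leI 1) auto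
      also have "\<dots> \<le> ennreal (K * w powr e)" using b[OF z] by (simp add: w_def)
      finally have 2: "ennreal (w / C2) * (ennreal ((c / w)\<^sup>2) * emeasure \<mu> B) \<le> ennreal (K * w powr e)" .
      have inv: "C * w * (w / C2 * (c / w)\<^sup>2) = 1" using w C2(1) \<delta> by (simp add: C_def power2_eq_square field_simps)
      have "emeasure \<mu> B = ennreal (C * w * (w / C2 * (c / w)\<^sup>2)) * emeasure \<mu> B" by (simp only: inv ennreal_1 mult_1)
      also have "\<dots> = ennreal (C * w) * (ennreal (w / C2) * (ennreal ((c / w)\<^sup>2) * emeasure \<mu> B))"
      proof -
        have "ennreal (C * w * (w / C2 * (c / w)\<^sup>2)) = ennreal (C * w) * (ennreal (w / C2) * ennreal ((c / w)\<^sup>2))"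
          using w C2(1) by (simp only: ennreal_mult''[symmetric] zero_le_power2 mult_nonneg_nonneg less_imp_le divide_nonneg_pos)
        then show ?thesis by (simp only: mult.assoc)
      qed
      also have "\<dots> \<le> ennreal (C * w) * ennreal (K * w powr e)" by (rule mult_left_mono[OF 2]) simp
      also have "\<dots> = ennreal (C * K * w powr (1 + e))"
        using K w by (simp add: ennreal_mult''[symmetric] powr_add mult_ac)
      finally show "emeasure \<mu> (ball z (\<delta> * (1 - norm z))) \<le> ennreal (C * K * box_size (1 - norm z) powr (1 + e))"
        by (simp add: B_def w_def)
    qed
  qed
qed

text \<open>
  A small disc at distance \<open>t\<close> from the circle lies in the square of the point in the same direction
  at distance \<open>8 t\<close>, or, if \<open>t \<ge> 1/8\<close>, in the square of the origin, which is the whole disc.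
\<close>

lemma disc_bound_of_box:
  fixes \<alpha> \<delta> :: real
  assumes \<alpha>: "0 \<le> \<alpha>" and \<delta>: "0 < \<delta>" "\<delta> \<le> 1/2"
  obtains C where "0 < C"
    "\<And>\<mu> K. borel_measure_on_disc \<mu> \<Longrightarrow> 0 \<le> K \<Longrightarrow>
      (\<And>z. z \<in> disc \<Longrightarrow> emeasure \<mu> (carleson_box z) \<le> ennreal (K * box_size (1 - norm z) powr \<alpha>)) \<Longrightarrow>
      finite_measure \<mu> \<and> bounded_on_discs \<delta> \<alpha> (C * K) \<mu>"
proof -
  define G where "G = A * 8 powr (M + 1)"
  have G: "0 < G" using constants by (simp add: G_def)
  show ?thesis
  proof (rule that[of "G powr \<alpha>"], goal_cases)
    case 1 then show ?case using G by simp
  next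
    case (2 \<mu> K)
    note sp = borel_measure_on_disc_facts[OF 2(1)]
    have box: "\<And>z. z \<in> disc \<Longrightarrow> emeasure \<mu> (carleson_box z) \<le> ennreal (K * box_size (1 - norm z) powr \<alpha>)" by fact
    have "emeasure \<mu> (space \<mu>) \<noteq> \<infinity>"
      using box[of 0] by (auto simp: carleson_box_def sp top_unique)
    then have "finite_measure \<mu>" by (rule finite_measureI)
    moreover have "emeasure \<mu> (ball z (\<delta> * (1 - norm z))) \<le> ennreal (G powr \<alpha> * K * box_size (1 - norm z) powr \<alpha>)" if z: "z \<in> disc" for z
    proof -
      define t where "t = 1 - norm z"
      have t: "0 < t" "t \<le> 1" using z by (auto simp: t_def)
      have "\<exists>a\<in>disc. t \<le> 1 - norm a \<and> 1 - norm a \<le> 8 * t \<and> ball z (\<delta> * t) \<subseteq> carleson_box a"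
      proof (cases "1/8 \<le> t")
        case True
        have "\<delta> * (1 - norm z) \<le> 1/2 * (1 - norm z)" using \<delta> z by (intro mult_right_mono) auto
        then have "ball z (\<delta> * t) \<subseteq> ball z ((1 - norm z) / 2)" unfolding t_def by (intro subset_ball) simp
        also have "\<dots> \<subseteq> disc" using weight_on_ball(1)[OF z] by auto
        finally show ?thesis using True t by (intro bexI[of _ 0]) (auto simp: carleson_box_def)
      next
        case False
        have z0: "z \<noteq> 0" using False by (auto simp: t_def)
        define u where "u = sgn z"
        have u: "norm u = 1" using z0 by (simp add: u_def norm_sgn)
        have uz: "of_real (1 - t) * u = z" using z0 by (simp add: u_def t_def sgn_eq)
        define a where "a = of_real (1 - 8 * t) * u"
        have na: "norm a = 1 - 8 * t" unfolding a_def norm_mult norm_of_real u using False by simp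
        have "ball (of_real (1 - t) * u) (\<delta> * t) \<subseteq> carleson_box (of_real (1 - 8 * t) * u)"
        proof (rule ball_subset_carleson_box[OF u])
          have dt: "\<delta> * t \<le> t / 2" using \<delta> t by (simp add: mult_right_mono)
          show "1 - 8 * t \<le> 1 - t - \<delta> * t" "1 - t + \<delta> * t \<le> 1" using dt t by linarith+
          have "3/4 \<le> 1 - t - \<delta> * t" using dt False by linarith
          then have "4 * t * (3/4) \<le> 4 * t * (1 - t - \<delta> * t)" by (rule mult_left_mono) (use t in simp)
          then show "\<delta> * t \<le> 8 * t / 2 * (1 - t - \<delta> * t)" using dt t by linarith
        qed (use t False \<delta> in auto)
        then have "ball z (\<delta> * t) \<subseteq> carleson_box a" unfolding uz a_def[symmetric] .
        then show ?thesis using na t False by (intro bexI[of _ a]) auto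
      qed
      then obtain a where a: "a \<in> disc" "t \<le> 1 - norm a" "1 - norm a \<le> 8 * t" "ball z (\<delta> * t) \<subseteq> carleson_box a" by blast
      have "emeasure \<mu> (ball z (\<delta> * t)) \<le> emeasure \<mu> (carleson_box a)"
        using a by (intro emeasure_mono sp(4) carleson_box_borel carleson_box_subset) auto
      also have "\<dots> \<le> ennreal (K * box_size (1 - norm a) powr \<alpha>)" by (rule box[OF a(1)])
      also have "\<dots> \<le> ennreal (K * (G * box_size t) powr \<alpha>)"
      proof (intro ennreal_leI mult_left_mono powr_mono2)
        show "box_size (1 - norm a) \<le> G * box_size t" unfolding G_def using t a by (intro box_size_growth) auto
        show "0 \<le> box_size (1 - norm a)" using t a box_size_pos[of "1 - norm a"] by simp
      qed (use 2 \<alpha> in auto)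
      also have "K * (G * box_size t) powr \<alpha> = G powr \<alpha> * K * box_size t powr \<alpha>"
        using G box_size_pos[OF t(1)] by (simp add: powr_mult)
      finally show ?thesis by (simp add: t_def)
    qed
    ultimately show ?case by (auto simp: bounded_on_discs_def)
  qed
qed

text \<open>
  The test function \<open>(1 - cnj z * \<zeta>)\<^bsup>-\<gamma>/s\<^esup>\<close> is at least \<open>(3 (1 - |z|))\<^bsup>-\<gamma>/s\<^esup>\<close> in modulus on the
  square of \<open>z\<close>.
\<close>

lemma box_of_embedding:
  fixes s \<alpha> :: real
  assumes s: "0 < s" and \<alpha>: "1 \<le> \<alpha>"
  obtains C where "0 < C"
    "\<And>\<mu> N z. borel_measure_on_disc \<mu> \<Longrightarrow>
      op_bound (bergman_space s \<omega>) (bergman_norm s \<omega>) (Lp_space (s * \<alpha>) \<mu>) (Lp_norm (s * \<alpha>) \<mu>) UNIV id (ennreal N) \<Longrightarrow>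
      0 \<le> N \<Longrightarrow> z \<in> disc \<Longrightarrow>
      emeasure \<mu> (carleson_box z) \<le> ennreal (C * N powr (s * \<alpha>) * box_size (1 - norm z) powr \<alpha>)"
proof -
  define \<gamma> where "\<gamma> = M + 2"
  have \<gamma>: "0 < \<gamma>" using constants by (simp add: \<gamma>_def)
  obtain C where C: "0 < C"
    "\<And>z. z \<in> disc \<Longrightarrow> (\<integral>\<^sup>+\<xi>. ennreal (norm (1 - cnj z * \<xi>) powr (- \<gamma>)) \<partial>\<nu>)
      \<le> ennreal (C * ((1 - norm z) powr (- \<gamma>) * box_size (1 - norm z)))"
    using test_function_norm[of \<gamma>] by (auto simp: \<gamma>_def)
  have t: "0 < s * \<alpha>" using s \<alpha> by simp
  show ?thesis
  proof (rule that[of "3 powr (\<gamma> * \<alpha>) * C powr \<alpha>"])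
    show "0 < 3 powr (\<gamma> * \<alpha>) * C powr \<alpha>" using C by simp
    fix \<mu> N z
    assume \<mu>: "borel_measure_on_disc \<mu>" and N: "0 \<le> N" and z: "z \<in> disc"
      and op: "op_bound (bergman_space s \<omega>) (bergman_norm s \<omega>) (Lp_space (s * \<alpha>) \<mu>) (Lp_norm (s * \<alpha>) \<mu>) UNIV id (ennreal N)"
    note sp = borel_measure_on_disc_facts[OF \<mu>]
    define h w where "h = 1 - norm z" and "w = box_size h"
    have h: "0 < h" using z by (simp add: h_def)
    have w: "0 < w" using h by (simp add: w_def box_size_pos)
    define f where "f = (\<lambda>\<zeta>. exp (- (of_real (\<gamma> / s)) * Ln (1 - cnj z * \<zeta>)))"
    have half: "0 < Re (1 - cnj z * \<zeta>)" if "\<zeta> \<in> disc" for \<zeta>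
      using mult_in_disc[OF z that] complex_Re_le_cmod[of "cnj z * \<zeta>"] by simp
    have hol: "f holomorphic_on disc"
      unfolding f_def
    proof (intro holomorphic_intros)
      fix \<zeta> :: complex assume "\<zeta> \<in> disc"
      then show "1 - cnj z * \<zeta> \<notin> \<real>\<^sub>\<le>\<^sub>0" using half complex_nonpos_Reals_iff[of "1 - cnj z * \<zeta>"] by force
    qed
    have nf: "norm (f \<zeta>) = norm (1 - cnj z * \<zeta>) powr (- (\<gamma> / s))" if "\<zeta> \<in> disc" for \<zeta>
    proof -
      have "1 - cnj z * \<zeta> \<noteq> 0" using half[OF that] by (metis less_irrefl zero_complex.simps(1))
      then have "norm (f \<zeta>) = exp (- (\<gamma> / s) * ln (norm (1 - cnj z * \<zeta>)))"
        unfolding f_def norm_exp_eq_Re by (simp del: of_real_divide)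
      then show ?thesis using \<open>1 - cnj z * \<zeta> \<noteq> 0\<close> by (simp add: powr_def)
    qed
    have "(\<integral>\<^sup>+\<xi>. ennreal (norm (f \<xi>) powr s) \<partial>\<nu>) = (\<integral>\<^sup>+\<xi>. ennreal (norm (1 - cnj z * \<xi>) powr (- \<gamma>)) \<partial>\<nu>)"
      using s by (intro nn_integral_weight_measure_cong) (simp add: nf powr_powr)
    also have "\<dots> \<le> ennreal (C * (h powr (- \<gamma>) * w))" using C(2)[OF z] by (simp add: h_def w_def)
    finally have fs: "(\<integral>\<^sup>+\<xi>. ennreal (norm (f \<xi>) powr s) \<partial>\<nu>) \<le> ennreal (C * (h powr (- \<gamma>) * w))" .
    define Q where "Q = C * (h powr (- \<gamma>) * w)"
    have Q: "0 \<le> Q" using C w by (simp add: Q_def)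
    have "f \<in> bergman_space s \<omega>" unfolding bergman_space_iff using hol fs by (auto intro: le_less_trans)
    moreover have "bergman_norm s \<omega> f \<le> ennreal (Q powr (1/s))"
      unfolding bergman_norm_def using fs s Q by (intro Lp_norm_le) (auto simp: powr_powr Q_def[symmetric])
    ultimately have "Lp_norm (s * \<alpha>) \<mu> f \<le> ennreal N * ennreal (Q powr (1/s))"
      using op unfolding op_bound_def by (metis id_apply mult_left_mono order_trans zero_le)
    then have "Lp_norm (s * \<alpha>) \<mu> f \<le> ennreal (N * Q powr (1/s))" by (simp add: ennreal_mult'')
    then have fm: "(\<integral>\<^sup>+\<zeta>. ennreal (norm (f \<zeta>) powr (s * \<alpha>)) \<partial>\<mu>) \<le> ennreal ((N * Q powr (1/s)) powr (s * \<alpha>))"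
      using N t by (intro Lp_norm_le_D) auto
    have pw: "(N * Q powr (1/s)) powr (s * \<alpha>) = N powr (s * \<alpha>) * Q powr \<alpha>"
      using N s by (simp add: powr_mult powr_powr)
    define b where "b = (3 * h) powr (- (\<gamma> * \<alpha>))"
    have b: "0 < b" using h by (simp add: b_def)
    have box: "carleson_box z \<in> sets \<mu>" using z by (intro sp(4) carleson_box_borel carleson_box_subset)
    have "ennreal b * emeasure \<mu> (carleson_box z) = (\<integral>\<^sup>+\<zeta>. ennreal b * indicator (carleson_box z) \<zeta> \<partial>\<mu>)"
      by (rule nn_integral_cmult_indicator[OF box, symmetric])
    also have "\<dots> \<le> (\<integral>\<^sup>+\<zeta>. ennreal (norm (f \<zeta>) powr (s * \<alpha>)) \<partial>\<mu>)"
    proof (rule nn_integral_mono)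
      fix \<zeta>
      show "ennreal b * indicator (carleson_box z) \<zeta> \<le> ennreal (norm (f \<zeta>) powr (s * \<alpha>))"
      proof (cases "\<zeta> \<in> carleson_box z")
        case True
        then have x: "\<zeta> \<in> disc" using carleson_box_subset[OF z] by auto
        have "b \<le> norm (1 - cnj z * \<zeta>) powr (- (\<gamma> * \<alpha>))"
          unfolding b_def using kernel_dist_on_carleson_box[OF z True] kernel_dist_bounds[OF z x] \<gamma> \<alpha>
          by (intro powr_mono2') (auto simp: h_def)
        also have "\<dots> = norm (f \<zeta>) powr (s * \<alpha>)" using s by (simp add: nf[OF x] powr_powr)
        finally show ?thesis using True by (simp add: ennreal_leI)
      qed simp
    qed
    also have "\<dots> \<le> ennreal (N powr (s * \<alpha>) * Q powr \<alpha>)" using fm by (simp add: pw)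
    finally have 1: "ennreal b * emeasure \<mu> (carleson_box z) \<le> ennreal (N powr (s * \<alpha>) * Q powr \<alpha>)" .
    have "emeasure \<mu> (carleson_box z) = ennreal (1 / b) * (ennreal b * emeasure \<mu> (carleson_box z))"
      using b by (simp add: mult.assoc[symmetric] ennreal_mult''[symmetric])
    also have "\<dots> \<le> ennreal (1 / b) * ennreal (N powr (s * \<alpha>) * Q powr \<alpha>)" by (rule mult_left_mono[OF 1]) simp
    also have "\<dots> = ennreal (1 / b * (N powr (s * \<alpha>) * Q powr \<alpha>))" by (rule ennreal_mult''[symmetric]) simp
    also have "1 / b * (N powr (s * \<alpha>) * Q powr \<alpha>) = 3 powr (\<gamma> * \<alpha>) * C powr \<alpha> * N powr (s * \<alpha>) * w powr \<alpha>"
    proof -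
      have "Q powr \<alpha> = C powr \<alpha> * (h powr (- (\<gamma> * \<alpha>)) * w powr \<alpha>)"
        using C w h by (simp add: Q_def powr_mult powr_powr)
      moreover have "1 / b = 3 powr (\<gamma> * \<alpha>) * h powr (\<gamma> * \<alpha>)" using h by (simp add: b_def powr_minus powr_mult field_simps)
      moreover have "h powr (\<gamma> * \<alpha>) * h powr (- (\<gamma> * \<alpha>)) = 1" using h by (simp add: powr_add[symmetric])
      ultimately show ?thesis by (simp add: mult_ac)
    qed
    finally show "emeasure \<mu> (carleson_box z) \<le> ennreal (3 powr (\<gamma> * \<alpha>) * C powr \<alpha> * N powr (s * \<alpha>) * box_size (1 - norm z) powr \<alpha>)"
      by (simp add: w_def h_def)
  qed
qed

end

section \<open>The profile of a regular weight\<close>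

lemma doubling_iterate:
  fixes \<Omega> :: "real \<Rightarrow> real"
  assumes mono: "mono \<Omega>" and pos: "\<And>t. 0 < t \<Longrightarrow> 0 < \<Omega> t"
    and B: "2 \<le> B" and dbl: "\<And>t. 0 < t \<Longrightarrow> \<Omega> t \<le> B * \<Omega> (t / 2)"
    and st: "0 < s" "s \<le> t"
  shows "\<Omega> t \<le> B * (t / s) powr (log 2 B) * \<Omega> s"
proof -
  have it: "\<Omega> t \<le> B ^ n * \<Omega> (t / 2 ^ n)" for n
  proof (induction n)
    case (Suc n)
    have "\<Omega> (t / 2 ^ n) \<le> B * \<Omega> (t / 2 ^ n / 2)" using st by (intro dbl) auto
    then have "B ^ n * \<Omega> (t / 2 ^ n) \<le> B ^ n * (B * \<Omega> (t / 2 ^ n / 2))" using B by (intro mult_left_mono) auto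
    then show ?case using Suc by (simp add: mult_ac)
  qed simp
  define x n where "x = t / s" and "n = nat \<lceil>log 2 x\<rceil>"
  have x: "1 \<le> x" using st by (simp add: x_def)
  have l0: "0 \<le> log 2 x" using x by simp
  have n: "log 2 x \<le> real n" "real n \<le> log 2 x + 1"
    unfolding n_def using l0 by linarith+
  have "x = 2 powr (log 2 x)" using x by simp
  also have "\<dots> \<le> 2 powr real n" using n by (intro powr_mono) auto
  also have "\<dots> = 2 ^ n" by (simp add: powr_realpow)
  finally have "t / 2 ^ n \<le> s" using st by (simp add: x_def field_simps)
  then have 1: "\<Omega> (t / 2 ^ n) \<le> \<Omega> s" by (rule monoD[OF mono])
  have "B ^ n = B powr real n" using B by (simp add: powr_realpow)
  also have "\<dots> \<le> B powr (log 2 x + 1)" using n B by (intro powr_mono) auto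
  also have "\<dots> = B * B powr (log 2 x)" using B by (simp add: powr_add)
  also have "B powr (log 2 x) = x powr (log 2 B)"
  proof -
    have "B powr (log 2 x) = (2 powr (log 2 B)) powr (log 2 x)" using B by simp
    also have "\<dots> = (2 powr (log 2 x)) powr (log 2 B)" by (simp only: powr_powr mult.commute)
    also have "2 powr (log 2 x) = x" using x by simp
    finally show ?thesis .
  qed
  finally have 2: "B ^ n \<le> B * x powr (log 2 B)" .
  have "\<Omega> t \<le> B ^ n * \<Omega> (t / 2 ^ n)" by (rule it)
  also have "\<dots> \<le> (B * x powr (log 2 B)) * \<Omega> s"
    using 1 2 B pos[of "t / 2 ^ n"] st by (intro mult_mono) auto
  finally show ?thesis by (simp add: x_def)
qed

lemma halving_iterate:
  fixes \<Omega> :: "real \<Rightarrow> real"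
  assumes mono: "mono \<Omega>" and pos: "\<And>t. 0 < t \<Longrightarrow> 0 < \<Omega> t" and L: "0 < L"
    and hlv: "\<And>t. 0 < t \<Longrightarrow> t \<le> 1 \<Longrightarrow> \<Omega> (exp (- L) * t) \<le> \<Omega> t / 2"
    and st: "0 < s" "s \<le> t" "t \<le> 1"
  shows "\<Omega> s \<le> 2 * (s / t) powr (ln 2 / L) * \<Omega> t"
proof -
  have it: "\<Omega> (exp (- L) ^ n * t) \<le> \<Omega> t / 2 ^ n" for n
  proof (induction n)
    case (Suc n)
    have "exp (- L) ^ n * t \<le> 1 * 1" using L st by (intro mult_mono power_le_one) auto
    then have "\<Omega> (exp (- L) * (exp (- L) ^ n * t)) \<le> \<Omega> (exp (- L) ^ n * t) / 2" using st by (intro hlv) auto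
    also have "\<dots> \<le> \<Omega> t / 2 ^ n / 2" using Suc by (intro divide_right_mono) auto
    finally show ?case by (simp add: mult_ac)
  qed simp
  define y n where "y = ln (t / s) / L" and "n = nat \<lfloor>y\<rfloor>"
  have y0: "0 \<le> y" using st L by (simp add: y_def)
  have n: "real n \<le> y" "y \<le> real n + 1" unfolding n_def using y0 by linarith+
  have ln: "ln (t / s) = L * y" using L by (simp add: y_def)
  have "s / t = exp (- ln (t / s))" using st by (simp add: exp_minus)
  also have "\<dots> \<le> exp (real n * (- L))" unfolding ln using n(1) L by (simp add: mult.commute)
  also have "\<dots> = exp (- L) ^ n" by (rule exp_of_nat_mult)
  finally have "s \<le> exp (- L) ^ n * t" using st by (simp add: field_simps)
  then have "\<Omega> s \<le> \<Omega> (exp (- L) ^ n * t)" by (rule monoD[OF mono])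
  also have "\<dots> \<le> \<Omega> t / 2 ^ n" by (rule it)
  also have "\<dots> = (1 / 2 ^ n) * \<Omega> t" by simp
  also have "1 / 2 ^ n \<le> 2 * (s / t) powr (ln 2 / L)"
  proof -
    have "(s / t) powr (ln 2 / L) = exp (- (ln 2 * y))"
      using st L by (simp add: powr_def y_def ln_div field_simps)
    also have "\<dots> \<ge> exp (- (ln 2 * (real n + 1)))" using n(2) by simp
    also have "exp (- (ln 2 * (real n + 1))) = 1 / 2 ^ n / 2"
    proof -
      have "exp (ln 2 * (real n + 1)) = 2 powr (real n + 1)" by (simp add: powr_def mult.commute)
      also have "\<dots> = 2 ^ n * 2" by (simp add: powr_add powr_realpow)
      finally show ?thesis by (simp only: exp_minus) (simp add: field_simps)
    qed
    finally show ?thesis by simp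
  qed
  finally show ?thesis using pos[of t] st by (simp add: mult_right_mono)
qed

text \<open>
  The lower bound in the definition of a regular weight says that the tail \<open>\<Omega>\<close> satisfies
  \<open>\<Omega>(t) \<ge> c \<integral>\<^sub>0\<^sup>t \<Omega>(x) / x dx\<close>; integrating only over \<open>[\<lambda> t, t]\<close> for a small \<open>\<lambda>\<close>
  yields \<open>\<Omega>(\<lambda> t) \<le> \<Omega>(t) / 2\<close>, hence the decay of \<open>\<Omega>\<close> at the rate of a positive power. The upper
  growth bound is the iterated doubling condition.
\<close>

lemma regular_weight_profile:
  assumes "regular_weight \<omega>"
  obtains \<Omega> A M \<kappa> where "regular_profile \<omega> \<Omega> A M \<kappa>"
proof -
  obtain C1 where rad: "radial_weight \<omega>" and C1: "0 < C1"
    "\<And>r. r \<in> {0..<1} \<Longrightarrow> weight_tail \<omega> r \<le> ennreal C1 * weight_tail \<omega> ((1 + r) / 2)"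
    using assms by (auto simp: regular_weight_def doubling_weight_def)
  obtain C2 where C2: "0 < C2" "\<And>r. r \<in> {0..<1} \<Longrightarrow>
      comparable C2 (ennreal (\<omega> (complex_of_real r))) (weight_tail \<omega> r / ennreal (1 - r))"
    using assms by (auto simp: regular_weight_def)
  have radial: "\<And>z. z \<in> disc \<Longrightarrow> \<omega> z = \<omega> (complex_of_real (norm z))" and nonneg: "\<And>z. z \<in> disc \<Longrightarrow> 0 \<le> \<omega> z"
    and tail_pos: "\<And>r. r \<in> {0..<1} \<Longrightarrow> 0 < weight_tail \<omega> r" and int: "set_integrable lebesgue disc \<omega>"
    using rad unfolding radial_weight_def by blast+
  have anti: "weight_tail \<omega> r' \<le> weight_tail \<omega> r" if "r \<le> r'" for r r'
    unfolding weight_tail_def using that by (intro nn_integral_mono) (auto simp: indicator_def)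
  have "weight_tail \<omega> 0 < \<infinity>"
  proof -
    have "weight_tail \<omega> 0 / ennreal (1 - 0) \<le> ennreal C2 * ennreal (\<omega> (complex_of_real 0))"
      using C2(2)[of 0] by (simp only: comparable_def) simp
    also have "\<dots> < \<infinity>" by (simp add: ennreal_mult_less_top)
    finally show ?thesis by (simp add: divide_ennreal_def)
  qed
  then have tail_fin: "weight_tail \<omega> r < \<infinity>" if "0 \<le> r" for r using anti[OF that] by (rule le_less_trans[rotated])
  \<comment> \<open>The maximum makes \<open>\<Omega>\<close> constant from 1 on, where \<open>1 - t\<close> is not a radius.\<close>
  define \<Omega> where "\<Omega> = (\<lambda>t. enn2real (weight_tail \<omega> (max 0 (1 - t))))"
  have eq: "ennreal (\<Omega> t) = weight_tail \<omega> (max 0 (1 - t))" for t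
    using tail_fin[of "max 0 (1 - t)"] by (simp add: \<Omega>_def)
  have nn: "0 \<le> \<Omega> t" for t by (simp add: \<Omega>_def)
  have mono: "mono \<Omega>"
  proof (rule monoI)
    fix s t :: real assume "s \<le> t"
    then have "ennreal (\<Omega> s) \<le> ennreal (\<Omega> t)" unfolding eq by (intro anti) auto
    then show "\<Omega> s \<le> \<Omega> t" using nn by (simp add: ennreal_le_iff)
  qed
  have pos: "0 < \<Omega> t" if "0 < t" for t
  proof -
    have "0 < ennreal (\<Omega> t)" unfolding eq using that by (intro tail_pos) auto
    then show ?thesis by simp
  qed
  have const: "\<Omega> t = \<Omega> 1" if "1 \<le> t" for t using that by (simp add: \<Omega>_def max_def)
  define B where "B = max 2 C1"
  have B: "2 \<le> B" "C1 \<le> B" by (auto simp: B_def)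
  have dbl: "\<Omega> t \<le> B * \<Omega> (t / 2)" if t: "0 < t" for t
  proof -
    have le1: "\<Omega> t \<le> C1 * \<Omega> (t / 2)" if t: "0 < t" "t \<le> 1" for t
    proof -
      have "max 0 (1 - t / 2) = (1 + (1 - t)) / 2" "max 0 (1 - t) = 1 - t" using t by (auto simp: max_def field_simps)
      then have "ennreal (\<Omega> t) \<le> ennreal C1 * ennreal (\<Omega> (t / 2))" unfolding eq using C1(2)[of "1 - t"] t by (simp only:) simp
      then show ?thesis using nn C1(1) by (simp add: ennreal_mult''[symmetric] ennreal_le_iff)
    qed
    have "\<Omega> t \<le> C1 * \<Omega> (t / 2)"
    proof (cases "t \<le> 1")
      case False
      then have "\<Omega> t = \<Omega> 1" by (intro const) simp
      also have "\<dots> \<le> C1 * \<Omega> (1 / 2)" by (rule le1) auto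
      also have "\<dots> \<le> C1 * \<Omega> (t / 2)" using False C1(1) by (intro mult_left_mono monoD[OF mono]) auto
      finally show ?thesis .
    qed (use le1 t in simp)
    also have "\<dots> \<le> B * \<Omega> (t / 2)" using B nn by (intro mult_right_mono) auto
    finally show ?thesis .
  qed
  have wb: "\<omega> z \<le> C2 * (\<Omega> (1 - norm z) / (1 - norm z))" "\<Omega> (1 - norm z) / (1 - norm z) \<le> C2 * \<omega> z" if z: "z \<in> disc" for z
  proof -
    have h: "0 < 1 - norm z" using z by simp
    have "weight_tail \<omega> (norm z) = ennreal (\<Omega> (1 - norm z))" by (simp add: eq)
    then have "comparable C2 (ennreal (\<omega> z)) (ennreal (\<Omega> (1 - norm z) / (1 - norm z)))"
      using C2(2)[of "norm z"] z h nn radial[OF z] by (simp add: divide_ennreal)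
    then have c: "ennreal (\<omega> z) \<le> ennreal (C2 * (\<Omega> (1 - norm z) / (1 - norm z)))"
      "ennreal (\<Omega> (1 - norm z) / (1 - norm z)) \<le> ennreal (C2 * \<omega> z)"
      using C2(1) h nn nonneg[OF z] by (simp_all add: comparable_def ennreal_mult''[symmetric])
    show "\<omega> z \<le> C2 * (\<Omega> (1 - norm z) / (1 - norm z))"
      using c(1) C2(1) h nn[of "1 - norm z"] by (subst (asm) ennreal_le_iff) auto
    show "\<Omega> (1 - norm z) / (1 - norm z) \<le> C2 * \<omega> z"
      using c(2) C2(1) nonneg[OF z] by (subst (asm) ennreal_le_iff) auto
  qed
  define L where "L = 2 * C2"
  have L: "0 < L" using C2 by (simp add: L_def)
  have hlv: "\<Omega> (exp (- L) * t) \<le> \<Omega> t / 2" if t: "0 < t" "t \<le> 1" for t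
  proof -
    define s where "s = exp (- L) * t"
    have s: "0 < s" "s < t" using t L by (auto simp: s_def)
    have "((\<lambda>x. 1 / (1 - x)) has_integral (- ln (1 - (1 - s)) - (- ln (1 - (1 - t))))) {1 - t..1 - s}"
    proof (rule fundamental_theorem_of_calculus)
      fix x assume "x \<in> {1 - t..1 - s}"
      then have "0 < 1 - x" using s by simp
      then have "((\<lambda>x. - ln (1 - x)) has_real_derivative 1 / (1 - x)) (at x within {1 - t..1 - s})"
        by (auto intro!: derivative_eq_intros)
      then show "((\<lambda>x. - ln (1 - x)) has_vector_derivative 1 / (1 - x)) (at x within {1 - t..1 - s})"
        by (simp add: has_real_derivative_iff_has_vector_derivative)
    qed (use s in simp)
    moreover have "- ln (1 - (1 - s)) - (- ln (1 - (1 - t))) = L" using t by (simp add: s_def ln_mult)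
    ultimately have "((\<lambda>x. 1 / (1 - x)) has_integral L) {1 - t..1 - s}" by simp
    then have I: "(\<integral>\<^sup>+x. ennreal (indicator {1 - t..1 - s} x * (1 / (1 - x))) \<partial>lborel) = ennreal L"
      using s by (intro nn_integral_has_integral_lebesgue) auto
    have "ennreal (\<Omega> s / C2) * ennreal L = (\<integral>\<^sup>+x. ennreal (\<Omega> s / C2) * ennreal (indicator {1 - t..1 - s} x * (1 / (1 - x))) \<partial>lborel)"
      by (subst nn_integral_cmult) (simp_all only: I, measurable)
    also have "\<dots> \<le> (\<integral>\<^sup>+x. ennreal (\<omega> (complex_of_real x)) * indicator {1 - t..<1} x \<partial>lborel)"
    proof (rule nn_integral_mono)
      fix x :: real
      show "ennreal (\<Omega> s / C2) * ennreal (indicator {1 - t..1 - s} x * (1 / (1 - x))) \<le> ennreal (\<omega> (complex_of_real x)) * indicator {1 - t..<1} x"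
      proof (cases "x \<in> {1 - t..1 - s}")
        case True
        then have x: "0 \<le> x" "x < 1" "s \<le> 1 - x" using s t by auto
        then have xd: "complex_of_real x \<in> disc" by simp
        have "\<Omega> s / (1 - x) \<le> \<Omega> (1 - x) / (1 - x)" using x by (intro divide_right_mono monoD[OF mono]) auto
        also have "\<dots> \<le> C2 * \<omega> (complex_of_real x)" using wb(2)[OF xd] x by simp
        finally have "\<Omega> s / C2 * (1 / (1 - x)) \<le> \<omega> (complex_of_real x)" using C2(1) x by (simp add: field_simps)
        then have "ennreal (\<Omega> s / C2) * ennreal (1 / (1 - x)) \<le> ennreal (\<omega> (complex_of_real x))"
          using x by (simp add: ennreal_mult''[symmetric] ennreal_leI)
        then show ?thesis using True x by simp
      qed simp
    qed
    also have "\<dots> = ennreal (\<Omega> t)" using t by (simp add: eq weight_tail_def nn_integral_completion)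
    finally have "ennreal (\<Omega> s / C2 * L) \<le> ennreal (\<Omega> t)" using L by (subst ennreal_mult'') auto
    then have "\<Omega> s / C2 * L \<le> \<Omega> t" using nn by (simp add: ennreal_le_iff)
    then show ?thesis using C2(1) by (simp add: L_def s_def)
  qed
  define \<kappa> M where "\<kappa> = ln 2 / L" and "M = log 2 B"
  have \<kappa>: "0 < \<kappa>" using L by (simp add: \<kappa>_def)
  have M: "0 < M" using B by (simp add: M_def)
  define A where "A = 1 + B + C2 + 2 * 4 powr \<kappa>"
  have A: "1 \<le> A" "B \<le> A" "C2 \<le> A" "2 * 4 powr \<kappa> \<le> A" using B C2(1) by (auto simp: A_def)
  have "regular_profile \<omega> \<Omega> A M \<kappa>"
  proof
    show "\<Omega> t \<le> A * (t / s) powr M * \<Omega> s" if "0 < s" "s \<le> t" for s t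
    proof -
      have "\<Omega> t \<le> B * (t / s) powr M * \<Omega> s" unfolding M_def by (rule doubling_iterate[OF mono pos B(1) dbl that])
      also have "\<dots> \<le> A * (t / s) powr M * \<Omega> s" using A nn by (intro mult_right_mono) auto
      finally show ?thesis .
    qed
    show "\<Omega> s \<le> A * (s / t) powr \<kappa> * \<Omega> t" if st: "0 < s" "s \<le> t" "t \<le> 4" for s t
    proof -
      have half: "\<Omega> s \<le> 2 * (s / t) powr \<kappa> * \<Omega> t" if "0 < s" "s \<le> t" "t \<le> 1" for s t
        unfolding \<kappa>_def by (rule halving_iterate[OF mono pos L hlv that])
      have "\<Omega> s \<le> 2 * 4 powr \<kappa> * (s / t) powr \<kappa> * \<Omega> t"
      proof -
        define s' t' where "s' = min s 1" and "t' = min t 1"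
        have "\<Omega> s = \<Omega> s'" "\<Omega> t = \<Omega> t'"
          using const[of s] const[of t] by (cases "s \<le> 1"; cases "t \<le> 1"; simp add: s'_def t'_def)+
        moreover have "\<Omega> s' \<le> 2 * (s' / t') powr \<kappa> * \<Omega> t'" using st by (intro half) (auto simp: s'_def t'_def)
        moreover have "s' / t' \<le> 4 * (s / t)" using st by (auto simp: s'_def t'_def min_def field_simps)
        then have "(s' / t') powr \<kappa> \<le> (4 * (s / t)) powr \<kappa>" using st \<kappa> by (intro powr_mono2) (auto simp: s'_def t'_def)
        then have "2 * (s' / t') powr \<kappa> * \<Omega> t' \<le> 2 * (4 * (s / t)) powr \<kappa> * \<Omega> t'" using nn by (intro mult_right_mono) auto
        ultimately have "\<Omega> s \<le> 2 * (4 * (s / t)) powr \<kappa> * \<Omega> t" by (metis order_trans)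
        also have "(4 * (s / t)) powr \<kappa> = 4 powr \<kappa> * (s / t) powr \<kappa>" using st by (intro powr_mult)
        finally show ?thesis by (simp only: mult.assoc)
      qed
      also have "\<dots> \<le> A * (s / t) powr \<kappa> * \<Omega> t" using A nn by (intro mult_right_mono) auto
      finally show ?thesis .
    qed
    fix z assume z: "z \<in> disc"
    show "\<omega> z = \<omega> (of_real (norm z))" by (rule radial[OF z])
    have "0 < 1 - norm z" using z by simp
    then have "C2 * (\<Omega> (1 - norm z) / (1 - norm z)) \<le> A * (\<Omega> (1 - norm z) / (1 - norm z))" using A nn by (intro mult_right_mono) auto
    then show "\<omega> z \<le> A * (\<Omega> (1 - norm z) / (1 - norm z))" using wb(1)[OF z] by linarith
    have "C2 * \<omega> z \<le> A * \<omega> z" using A nonneg[OF z] by (intro mult_right_mono) auto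
    then show "\<Omega> (1 - norm z) / (1 - norm z) \<le> A * \<omega> z" using wb(2)[OF z] by linarith
  qed (use A M \<kappa> int mono pos in auto)
  then show ?thesis by (rule that)
qed

section \<open>Norms with values in the extended half-line\<close>

lemma op_norm_less_top_iff: "op_norm X NX Y NY D T < \<infinity> \<longleftrightarrow> bounded_op X NX Y NY D T"
  by (auto simp: op_norm_def bounded_op_def Inf_less_iff)

lemma op_norm_le: "op_bound X NX Y NY D T C \<Longrightarrow> op_norm X NX Y NY D T \<le> C"
  unfolding op_norm_def by (rule Inf_lower) simp

lemma ennreal_le_times_from_real:
  assumes "0 < c" "\<And>K. 0 \<le> K \<Longrightarrow> y \<le> ennreal K \<Longrightarrow> x \<le> ennreal (c * K)"
  shows "x \<le> ennreal c * y"
proof (cases y)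
  case (real K)
  then show ?thesis using assms by (simp add: ennreal_mult''[symmetric])
next
  case top
  then show ?thesis using assms by (simp add: ennreal_mult_top)
qed

text \<open>
  The operator norm is the infimum of the admissible constants \<open>N\<close>; solving the bound for \<open>N\<close> makes
  \<open>(x / c)\<^bsup>1/t\<^esup>\<close> a lower bound of them.
\<close>

lemma ennpow_op_norm_ge:
  assumes c: "0 < c" and t: "0 < t"
    and le: "\<And>N. 0 \<le> N \<Longrightarrow> op_bound X NX Y NY D T (ennreal N) \<Longrightarrow> x \<le> ennreal (c * N powr t)"
  shows "x \<le> ennreal c * ennpow (op_norm X NX Y NY D T) t"
proof (cases "op_norm X NX Y NY D T = \<infinity>")
  case True
  then show ?thesis using c by (simp add: ennpow_def ennreal_mult_top)
next
  case False
  then have "op_norm X NX Y NY D T < \<infinity>" by (simp add: top.not_eq_extremum)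
  then obtain C where C: "C < \<infinity>" "op_bound X NX Y NY D T C"
    using op_norm_less_top_iff[of X NX Y NY D T] unfolding bounded_op_def by blast
  then have "x < \<infinity>" using le[of "enn2real C"] by (auto intro: le_less_trans)
  then obtain r where r: "x = ennreal r" "0 \<le> r" by (cases x) auto
  have lower: "ennreal ((r / c) powr (1 / t)) \<le> op_norm X NX Y NY D T"
    unfolding op_norm_def
  proof (rule Inf_greatest)
    fix N assume "N \<in> {C. op_bound X NX Y NY D T C}"
    then have N: "op_bound X NX Y NY D T N" by simp
    show "ennreal ((r / c) powr (1 / t)) \<le> N"
    proof (cases N)
      case (real n)
      then have "r \<le> c * n powr t" using le[of n] N r c by (simp add: ennreal_le_iff)
      then have "(r / c) powr (1 / t) \<le> (n powr t) powr (1 / t)" using c r t by (intro powr_mono2) (auto simp: field_simps)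
      then show ?thesis using real t by (simp add: powr_powr ennreal_leI)
    qed simp
  qed
  obtain i where i: "op_norm X NX Y NY D T = ennreal i" "0 \<le> i" using False by (cases "op_norm X NX Y NY D T") auto
  have "(r / c) powr (1 / t) \<le> i" using lower i by (simp add: ennreal_le_iff)
  then have "((r / c) powr (1 / t)) powr t \<le> i powr t" using t by (intro powr_mono2) auto
  then have "r \<le> c * i powr t" using t c r by (simp add: powr_powr field_simps)
  then show ?thesis using r i c by (simp add: ennpow_def ennreal_mult''[symmetric] ennreal_leI)
qed

lemma ennpow_mono:
  assumes "x \<le> y" "0 < a"
  shows "ennpow x a \<le> ennpow y a"
proof (cases "y = \<infinity>")
  case False
  then have "x \<noteq> \<infinity>" using assms by (auto simp: top_unique)
  then show ?thesis using False assms
    by (auto simp: ennpow_def top.not_eq_extremum intro!: ennreal_leI powr_mono2 enn2real_mono)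
qed (simp add: ennpow_def)

lemma divide_ennreal_le_iff:
  assumes "0 < y" "0 \<le> K"
  shows "x / ennreal y \<le> ennreal K \<longleftrightarrow> x \<le> ennreal (K * y)"
proof (cases x)
  case (real r)
  then show ?thesis using assms by (simp add: divide_ennreal ennreal_le_iff field_simps)
next
  case top
  then show ?thesis using assms by (simp add: ennreal_top_divide top_unique)
qed

text \<open>
  Any two neighbours in a cycle of four inequalities are connected in the reverse direction by three
  steps.
\<close>

lemma comparable_cycle:
  assumes c: "1 \<le> c" and "t \<le> ennreal c * x" "b \<le> ennreal c * t" "e \<le> ennreal c * b" "x \<le> ennreal c * e"
  shows "comparable (c ^ 3) t b \<and> comparable (c ^ 3) b e \<and> comparable (c ^ 3) e x"
proof -
  have tr: "u \<le> ennreal (a * c) * w" if "u \<le> ennreal a * v" "v \<le> ennreal c * w" "0 \<le> a" for u v w a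
  proof -
    have "u \<le> ennreal a * (ennreal c * w)" using that by (meson mult_left_mono order_trans zero_le)
    then show ?thesis using c that by (simp add: ennreal_mult mult.assoc)
  qed
  have up: "u \<le> ennreal (c ^ 3) * w" if "u \<le> ennreal a * w" "a \<le> c ^ 3" for u w a
    using that by (meson ennreal_leI mult_right_mono order_trans zero_le)
  have c1: "c \<le> c ^ 3" "c * c \<le> c ^ 3" "c * c * c \<le> c ^ 3"
    using self_le_power[OF c, of 3] power_increasing[OF _ c, of 2 3]
    by (auto simp: power3_eq_cube power2_eq_square)
  have "t \<le> ennreal (c * c * c) * b" by (rule tr[OF tr[OF assms(2,5)] assms(4)]) (use c in auto)
  moreover have "b \<le> ennreal (c * c * c) * e" by (rule tr[OF tr[OF assms(3,2)] assms(5)]) (use c in auto)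
  moreover have "e \<le> ennreal (c * c * c) * x" by (rule tr[OF tr[OF assms(4,3)] assms(2)]) (use c in auto)
  ultimately show ?thesis unfolding comparable_def
    using up[OF _ c1(3)] up[OF assms(3) c1(1)] up[OF assms(4) c1(1)] up[OF assms(5) c1(1)] by blast
qed

section \<open>The four quantities are comparable\<close>

context regular_profile
begin

lemma weight_box_powr_bounds:
  fixes e :: real
  assumes e: "0 \<le> e"
  obtains c C where "0 < c" "0 < C"
    "\<And>z. z \<in> disc \<Longrightarrow> 0 < weight_box \<omega> z powr e"
    "\<And>z. z \<in> disc \<Longrightarrow> c * box_size (1 - norm z) powr e \<le> weight_box \<omega> z powr e"
    "\<And>z. z \<in> disc \<Longrightarrow> weight_box \<omega> z powr e \<le> C * box_size (1 - norm z) powr e"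
proof -
  obtain c C where cC: "0 < c" "0 < C"
    "\<And>z. z \<in> disc \<Longrightarrow> c * box_size (1 - norm z) \<le> weight_box \<omega> z"
    "\<And>z. z \<in> disc \<Longrightarrow> weight_box \<omega> z \<le> C * box_size (1 - norm z)"
    using weight_box_bounds by blast
  show ?thesis
  proof (rule that[of "c powr e" "C powr e"])
    fix z assume z: "z \<in> disc"
    have w: "0 < box_size (1 - norm z)" using z by (simp add: box_size_pos)
    have p: "0 < weight_box \<omega> z" using cC(3)[OF z] cC(1) w by (smt (verit) mult_pos_pos)
    then show "0 < weight_box \<omega> z powr e" by simp
    have "(c * box_size (1 - norm z)) powr e \<le> weight_box \<omega> z powr e" using cC(1,3) z w e by (intro powr_mono2) auto
    then show "c powr e * box_size (1 - norm z) powr e \<le> weight_box \<omega> z powr e" using cC(1) w by (simp add: powr_mult)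
    have "weight_box \<omega> z powr e \<le> (C * box_size (1 - norm z)) powr e" using cC(2,4) z p e by (intro powr_mono2) auto
    then show "weight_box \<omega> z powr e \<le> C powr e * box_size (1 - norm z) powr e" using cC(2) w by (simp add: powr_mult)
  qed (use cC in auto)
qed

lemma sup_quotient_le_D:
  assumes e: "0 \<le> e"
  obtains C where "0 < C"
    "\<And>F K z. (SUP z\<in>disc. F z / ennreal (weight_box \<omega> z powr e)) \<le> ennreal K \<Longrightarrow> 0 \<le> K \<Longrightarrow> z \<in> disc \<Longrightarrow>
      F z \<le> ennreal (C * K * box_size (1 - norm z) powr e)"
proof -
  obtain C where C: "0 < C" "\<And>z. z \<in> disc \<Longrightarrow> 0 < weight_box \<omega> z powr e"
    "\<And>z. z \<in> disc \<Longrightarrow> weight_box \<omega> z powr e \<le> C * box_size (1 - norm z) powr e"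
    using weight_box_powr_bounds[OF e] by metis
  show ?thesis
  proof (rule that[OF C(1)])
    fix F :: "complex \<Rightarrow> ennreal" and K z
    assume S: "(SUP z\<in>disc. F z / ennreal (weight_box \<omega> z powr e)) \<le> ennreal K" and K: "0 \<le> K" and z: "z \<in> disc"
    have "F z / ennreal (weight_box \<omega> z powr e) \<le> ennreal K" using S z by (simp only: SUP_le_iff)
    then have "F z \<le> ennreal (K * weight_box \<omega> z powr e)" using C(2)[OF z] K by (simp only: divide_ennreal_le_iff)
    also have "\<dots> \<le> ennreal (K * (C * box_size (1 - norm z) powr e))" using C(3)[OF z] K by (intro ennreal_leI mult_left_mono) auto
    also have "K * (C * box_size (1 - norm z) powr e) = C * K * box_size (1 - norm z) powr e" by simp
    finally show "F z \<le> ennreal (C * K * box_size (1 - norm z) powr e)" .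
  qed
qed

lemma sup_quotient_leI:
  assumes e: "0 \<le> e"
  obtains C where "0 < C"
    "\<And>F K. (\<And>z. z \<in> disc \<Longrightarrow> F z \<le> ennreal (K * box_size (1 - norm z) powr e)) \<Longrightarrow> 0 \<le> K \<Longrightarrow>
      (SUP z\<in>disc. F z / ennreal (weight_box \<omega> z powr e)) \<le> ennreal (C * K)"
proof -
  obtain c where c: "0 < c" "\<And>z. z \<in> disc \<Longrightarrow> 0 < weight_box \<omega> z powr e"
    "\<And>z. z \<in> disc \<Longrightarrow> c * box_size (1 - norm z) powr e \<le> weight_box \<omega> z powr e"
    using weight_box_powr_bounds[OF e] by metis
  show ?thesis
  proof (rule that[of "1 / c"])
    show "0 < 1 / c" using c by simp
    fix F :: "complex \<Rightarrow> ennreal" and K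
    assume F: "\<And>z. z \<in> disc \<Longrightarrow> F z \<le> ennreal (K * box_size (1 - norm z) powr e)" and K: "0 \<le> K"
    show "(SUP z\<in>disc. F z / ennreal (weight_box \<omega> z powr e)) \<le> ennreal (1 / c * K)"
    proof (rule SUP_least)
      fix z assume z: "z \<in> disc"
      have "box_size (1 - norm z) powr e \<le> 1 / c * weight_box \<omega> z powr e" using c(1) c(3)[OF z] by (simp add: field_simps)
      then have "K * box_size (1 - norm z) powr e \<le> K * (1 / c * weight_box \<omega> z powr e)" using K by (rule mult_left_mono)
      then have "F z \<le> ennreal (1 / c * K * weight_box \<omega> z powr e)"
        using F[OF z] by (simp add: ennreal_leI order_trans mult_ac)
      moreover have "0 \<le> 1 / c * K" using c K by simp
      ultimately show "F z / ennreal (weight_box \<omega> z powr e) \<le> ennreal (1 / c * K)"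
        using c(2)[OF z] by (simp only: divide_ennreal_le_iff)
    qed
  qed
qed

text \<open>
  A quantity that bounds the next one in the cycle may be assumed finite, which reduces each
  inequality to a statement about a real bound.
\<close>

lemma norms_cycle:
  fixes p q s \<alpha> :: real
  assumes pq: "1 < p" "p \<le> q" and \<alpha>: "\<alpha> = 1 + (1/p - 1/q)" and s: "0 < s"
  obtains c where "1 \<le> c"
    "\<And>\<mu>. borel_measure_on_disc \<mu> \<Longrightarrow>
      toeplitz_norm p q \<omega> \<mu> \<le> ennreal c * sup_norm_on_disc (box_quotient \<alpha> \<omega> \<mu>) \<and>
      sup_norm_on_disc (berezin_quotient (\<alpha> - 1) \<omega> \<mu>) \<le> ennreal c * toeplitz_norm p q \<omega> \<mu> \<and>
      ennpow (embedding_norm s (s * \<alpha>) \<omega> \<mu>) (s * \<alpha>) \<le> ennreal c * sup_norm_on_disc (berezin_quotient (\<alpha> - 1) \<omega> \<mu>) \<and>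
      sup_norm_on_disc (box_quotient \<alpha> \<omega> \<mu>) \<le> ennreal c * ennpow (embedding_norm s (s * \<alpha>) \<omega> \<mu>) (s * \<alpha>)"
proof -
  have e: "0 \<le> \<alpha> - 1" "1 \<le> \<alpha>" using pq by (auto simp: \<alpha> field_simps)
  have t: "0 < s * \<alpha>" using s e by simp
  obtain \<delta> Cb where \<delta>: "0 < \<delta>" "\<delta> \<le> 1/2" and Cb: "0 < Cb"
    "\<And>\<mu> K e. borel_measure_on_disc \<mu> \<Longrightarrow> 0 \<le> K \<Longrightarrow>
      (\<And>z. z \<in> disc \<Longrightarrow> berezin \<omega> \<mu> z \<le> ennreal (K * box_size (1 - norm z) powr e)) \<Longrightarrow>
      finite_measure \<mu> \<and> bounded_on_discs \<delta> (1 + e) (Cb * K) \<mu>"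
    using disc_bound_of_berezin by metis
  obtain Cx where Cx: "0 < Cx"
    "\<And>\<mu> K. borel_measure_on_disc \<mu> \<Longrightarrow> 0 \<le> K \<Longrightarrow>
      (\<And>z. z \<in> disc \<Longrightarrow> emeasure \<mu> (carleson_box z) \<le> ennreal (K * box_size (1 - norm z) powr \<alpha>)) \<Longrightarrow>
      finite_measure \<mu> \<and> bounded_on_discs \<delta> \<alpha> (Cx * K) \<mu>"
    using disc_bound_of_box[of \<alpha> \<delta>] \<delta> e by auto
  obtain Ce where Ce: "0 < Ce"
    "\<And>\<mu> K f I. borel_measure_on_disc \<mu> \<Longrightarrow> finite_measure \<mu> \<Longrightarrow> bounded_on_discs \<delta> \<alpha> K \<mu> \<Longrightarrow> 0 \<le> K \<Longrightarrow>
      f holomorphic_on disc \<Longrightarrow> (\<integral>\<^sup>+\<xi>. ennreal (norm (f \<xi>) powr s) \<partial>\<nu>) = ennreal I \<Longrightarrow> 0 \<le> I \<Longrightarrow>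
      (\<integral>\<^sup>+\<zeta>. ennreal (norm (f \<zeta>) powr (s * \<alpha>)) \<partial>\<mu>) \<le> ennreal (Ce * K * I powr \<alpha>)"
    using carleson_embedding[OF s e(2) \<delta>] by blast
  obtain Ct where Ct: "0 < Ct"
    "\<And>\<mu> K f I. borel_measure_on_disc \<mu> \<Longrightarrow> finite_measure \<mu> \<Longrightarrow> bounded_on_discs \<delta> \<alpha> K \<mu> \<Longrightarrow> 0 \<le> K \<Longrightarrow>
      f \<in> bergman_space p \<omega> \<Longrightarrow> (\<integral>\<^sup>+\<xi>. ennreal (norm (f \<xi>) powr p) \<partial>\<nu>) = ennreal I \<Longrightarrow> 0 \<le> I \<Longrightarrow>
      f \<in> toeplitz_domain \<omega> \<mu> \<and> toeplitz \<omega> \<mu> f holomorphic_on disc \<and>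
      (\<integral>\<^sup>+z. ennreal (norm (toeplitz \<omega> \<mu> f z) powr q) \<partial>\<nu>) \<le> ennreal ((Ct * K * I powr (1/p)) powr q)"
    using toeplitz_of_disc_bound[OF pq \<delta>] unfolding \<alpha>[symmetric] by blast
  obtain Cq where Cq: "0 < Cq"
    "\<And>\<mu> N z. borel_measure_on_disc \<mu> \<Longrightarrow>
      op_bound (bergman_space p \<omega>) (bergman_norm p \<omega>) (bergman_space q \<omega>) (bergman_norm q \<omega>)
        (toeplitz_domain \<omega> \<mu>) (toeplitz \<omega> \<mu>) (ennreal N) \<Longrightarrow> 0 \<le> N \<Longrightarrow> z \<in> disc \<Longrightarrow>
      berezin \<omega> \<mu> z \<le> ennreal (Cq * N * box_size (1 - norm z) powr (\<alpha> - 1))"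
    using berezin_of_toeplitz[OF pq] unfolding \<alpha> add_diff_cancel_left' by metis
  obtain Cm where Cm: "0 < Cm"
    "\<And>\<mu> N z. borel_measure_on_disc \<mu> \<Longrightarrow>
      op_bound (bergman_space s \<omega>) (bergman_norm s \<omega>) (Lp_space (s * \<alpha>) \<mu>) (Lp_norm (s * \<alpha>) \<mu>) UNIV id (ennreal N) \<Longrightarrow>
      0 \<le> N \<Longrightarrow> z \<in> disc \<Longrightarrow>
      emeasure \<mu> (carleson_box z) \<le> ennreal (Cm * N powr (s * \<alpha>) * box_size (1 - norm z) powr \<alpha>)"
    using box_of_embedding[OF s e(2)] by metis
  obtain D1 where D1: "0 < D1" "\<And>F K z. (SUP z\<in>disc. F z / ennreal (weight_box \<omega> z powr \<alpha>)) \<le> ennreal K \<Longrightarrow> 0 \<le> K \<Longrightarrow> z \<in> disc \<Longrightarrow>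
      F z \<le> ennreal (D1 * K * box_size (1 - norm z) powr \<alpha>)"
    using sup_quotient_le_D[of \<alpha>] e by auto
  obtain D2 where D2: "0 < D2" "\<And>F K z. (SUP z\<in>disc. F z / ennreal (weight_box \<omega> z powr (\<alpha> - 1))) \<le> ennreal K \<Longrightarrow> 0 \<le> K \<Longrightarrow> z \<in> disc \<Longrightarrow>
      F z \<le> ennreal (D2 * K * box_size (1 - norm z) powr (\<alpha> - 1))"
    using sup_quotient_le_D[of "\<alpha> - 1"] e by auto
  obtain D3 where D3: "0 < D3" "\<And>F K. (\<And>z. z \<in> disc \<Longrightarrow> F z \<le> ennreal (K * box_size (1 - norm z) powr \<alpha>)) \<Longrightarrow> 0 \<le> K \<Longrightarrow>
      (SUP z\<in>disc. F z / ennreal (weight_box \<omega> z powr \<alpha>)) \<le> ennreal (D3 * K)"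
    using sup_quotient_leI[of \<alpha>] e by auto
  obtain D4 where D4: "0 < D4" "\<And>F K. (\<And>z. z \<in> disc \<Longrightarrow> F z \<le> ennreal (K * box_size (1 - norm z) powr (\<alpha> - 1))) \<Longrightarrow> 0 \<le> K \<Longrightarrow>
      (SUP z\<in>disc. F z / ennreal (weight_box \<omega> z powr (\<alpha> - 1))) \<le> ennreal (D4 * K)"
    using sup_quotient_leI[of "\<alpha> - 1"] e by auto
  define c1 c2 c3 c4 where "c1 = Ct * (Cx * D1)" and "c2 = D4 * Cq" and "c3 = Ce * (Cb * D2)" and "c4 = D3 * Cm"
  have c: "0 < c1" "0 < c2" "0 < c3" "0 < c4"
    using Ct(1) Cx(1) D1(1) D4(1) Cq(1) Ce(1) Cb(1) D2(1) D3(1) Cm(1) by (auto simp: c1_def c2_def c3_def c4_def)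
  define c where "c = 1 + c1 + c2 + c3 + c4"
  have up: "x \<le> ennreal c * y" if "x \<le> ennreal a * y" "a \<le> c" for a x y
    using that by (meson ennreal_leI mult_right_mono order_trans zero_le)
  show ?thesis
  proof (rule that[of c])
    show "1 \<le> c" using c by (simp add: c_def)
    fix \<mu> assume \<mu>: "borel_measure_on_disc \<mu>"
    have 1: "toeplitz_norm p q \<omega> \<mu> \<le> ennreal c1 * sup_norm_on_disc (box_quotient \<alpha> \<omega> \<mu>)"
    proof (rule ennreal_le_times_from_real[OF c(1)])
      fix K assume K: "0 \<le> K" and S: "sup_norm_on_disc (box_quotient \<alpha> \<omega> \<mu>) \<le> ennreal K"
      have "emeasure \<mu> (carleson_box z) \<le> ennreal (D1 * K * box_size (1 - norm z) powr \<alpha>)" if "z \<in> disc" for z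
        using D1(2)[of "\<lambda>z. emeasure \<mu> (carleson_box z)" K z] S K that by (simp add: sup_norm_on_disc_def box_quotient_def)
      then have b: "finite_measure \<mu> \<and> bounded_on_discs \<delta> \<alpha> (Cx * (D1 * K)) \<mu>"
        using D1(1) K by (intro Cx(2) \<mu>) auto
      have K1: "0 \<le> Cx * (D1 * K)" using Cx(1) D1(1) K by simp
      have "op_bound (bergman_space p \<omega>) (bergman_norm p \<omega>) (bergman_space q \<omega>) (bergman_norm q \<omega>)
        (toeplitz_domain \<omega> \<mu>) (toeplitz \<omega> \<mu>) (ennreal (c1 * K))"
        unfolding op_bound_def
      proof
        fix f assume f: "f \<in> bergman_space p \<omega>"
        then obtain I where I: "(\<integral>\<^sup>+\<xi>. ennreal (norm (f \<xi>) powr p) \<partial>\<nu>) = ennreal I" "0 \<le> I"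
          by (cases "\<integral>\<^sup>+\<xi>. ennreal (norm (f \<xi>) powr p) \<partial>\<nu>") (auto simp: bergman_space_iff)
        have r: "f \<in> toeplitz_domain \<omega> \<mu>" "toeplitz \<omega> \<mu> f holomorphic_on disc"
          "(\<integral>\<^sup>+z. ennreal (norm (toeplitz \<omega> \<mu> f z) powr q) \<partial>\<nu>) \<le> ennreal ((Ct * (Cx * (D1 * K)) * I powr (1/p)) powr q)"
          using Ct(2)[OF \<mu> _ _ K1 f I] b by auto
        have "bergman_norm q \<omega> (toeplitz \<omega> \<mu> f) \<le> ennreal (Ct * (Cx * (D1 * K)) * I powr (1/p))"
          unfolding bergman_norm_def using r(3) Ct(1) K1 pq by (intro Lp_norm_le) auto
        also have "\<dots> = ennreal (c1 * K) * bergman_norm p \<omega> f"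
          unfolding bergman_norm_def Lp_norm_eq[OF I]
          by (subst ennreal_mult''[symmetric]) (simp_all add: c1_def mult_ac)
        finally show "f \<in> toeplitz_domain \<omega> \<mu> \<and> toeplitz \<omega> \<mu> f \<in> bergman_space q \<omega> \<and>
          bergman_norm q \<omega> (toeplitz \<omega> \<mu> f) \<le> ennreal (c1 * K) * bergman_norm p \<omega> f"
          using r by (auto simp: bergman_space_iff intro: le_less_trans)
      qed
      then show "toeplitz_norm p q \<omega> \<mu> \<le> ennreal (c1 * K)" unfolding toeplitz_norm_def by (rule op_norm_le)
    qed
    have 2: "sup_norm_on_disc (berezin_quotient (\<alpha> - 1) \<omega> \<mu>) \<le> ennreal c2 * ennpow (toeplitz_norm p q \<omega> \<mu>) 1"
      unfolding toeplitz_norm_def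
    proof (rule ennpow_op_norm_ge[OF c(2)])
      fix N :: real
      assume N: "0 \<le> N" and op: "op_bound (bergman_space p \<omega>) (bergman_norm p \<omega>) (bergman_space q \<omega>) (bergman_norm q \<omega>)
        (toeplitz_domain \<omega> \<mu>) (toeplitz \<omega> \<mu>) (ennreal N)"
      have "(SUP z\<in>disc. berezin \<omega> \<mu> z / ennreal (weight_box \<omega> z powr (\<alpha> - 1))) \<le> ennreal (D4 * (Cq * N))"
        using Cq(1) N by (intro D4(2) Cq(2)[OF \<mu> op N]) auto
      then show "sup_norm_on_disc (berezin_quotient (\<alpha> - 1) \<omega> \<mu>) \<le> ennreal (c2 * N powr 1)"
        using N by (simp add: sup_norm_on_disc_def berezin_quotient_def c2_def mult.assoc)
    qed simp
    have p1: "ennpow x 1 = x" for x :: ennreal by (cases x) (auto simp: ennpow_def)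
    have 3: "ennpow (embedding_norm s (s * \<alpha>) \<omega> \<mu>) (s * \<alpha>) \<le> ennreal c3 * sup_norm_on_disc (berezin_quotient (\<alpha> - 1) \<omega> \<mu>)"
    proof (rule ennreal_le_times_from_real[OF c(3)])
      fix K assume K: "0 \<le> K" and S: "sup_norm_on_disc (berezin_quotient (\<alpha> - 1) \<omega> \<mu>) \<le> ennreal K"
      have "berezin \<omega> \<mu> z \<le> ennreal (D2 * K * box_size (1 - norm z) powr (\<alpha> - 1))" if "z \<in> disc" for z
        using D2(2)[of "berezin \<omega> \<mu>" K z] S K that by (simp add: sup_norm_on_disc_def berezin_quotient_def)
      then have "finite_measure \<mu> \<and> bounded_on_discs \<delta> (1 + (\<alpha> - 1)) (Cb * (D2 * K)) \<mu>"
        using D2(1) K by (intro Cb(2) \<mu>) auto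
      then have b: "finite_measure \<mu> \<and> bounded_on_discs \<delta> \<alpha> (Cb * (D2 * K)) \<mu>" by simp
      have K1: "0 \<le> Cb * (D2 * K)" using Cb(1) D2(1) K by simp
      define R where "R = c3 * K"
      have R: "0 \<le> R" using c K by (simp add: R_def)
      have "op_bound (bergman_space s \<omega>) (bergman_norm s \<omega>) (Lp_space (s * \<alpha>) \<mu>) (Lp_norm (s * \<alpha>) \<mu>) UNIV id (ennreal (R powr (1 / (s * \<alpha>))))"
        unfolding op_bound_def
      proof
        fix f assume f: "f \<in> bergman_space s \<omega>"
        then have hol: "f holomorphic_on disc" by (simp add: bergman_space_iff)
        obtain I where I: "(\<integral>\<^sup>+\<xi>. ennreal (norm (f \<xi>) powr s) \<partial>\<nu>) = ennreal I" "0 \<le> I"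
          using f by (cases "\<integral>\<^sup>+\<xi>. ennreal (norm (f \<xi>) powr s) \<partial>\<nu>") (auto simp: bergman_space_iff)
        have "(\<integral>\<^sup>+\<zeta>. ennreal (norm (f \<zeta>) powr (s * \<alpha>)) \<partial>\<mu>) \<le> ennreal (Ce * (Cb * (D2 * K)) * I powr \<alpha>)"
          using Ce(2)[OF \<mu> _ _ K1 hol I] b by auto
        moreover have "Ce * (Cb * (D2 * K)) * I powr \<alpha> = (R powr (1 / (s * \<alpha>)) * I powr (1 / s)) powr (s * \<alpha>)"
        proof -
          have "(I powr (1 / s)) powr (s * \<alpha>) = I powr \<alpha>" using s by (simp add: powr_powr)
          moreover have "(R powr (1 / (s * \<alpha>))) powr (s * \<alpha>) = R" using s e R by (simp add: powr_powr)
          ultimately show ?thesis by (simp add: powr_mult R_def c3_def mult_ac)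
        qed
        ultimately have "Lp_norm (s * \<alpha>) \<mu> f \<le> ennreal (R powr (1 / (s * \<alpha>)) * I powr (1 / s))"
          using t by (intro Lp_norm_le) auto
        also have "\<dots> = ennreal (R powr (1 / (s * \<alpha>))) * bergman_norm s \<omega> f"
          unfolding bergman_norm_def Lp_norm_eq[OF I] by (simp add: ennreal_mult''[symmetric])
        finally have le: "Lp_norm (s * \<alpha>) \<mu> f \<le> ennreal (R powr (1 / (s * \<alpha>))) * bergman_norm s \<omega> f" .
        also have "\<dots> < \<infinity>" using f by (simp add: bergman_space_def ennreal_mult_less_top)
        finally have "f \<in> Lp_space (s * \<alpha>) \<mu>" using holomorphic_measurable_disc[OF \<mu> hol] by (simp add: Lp_space_def)
        with le show "f \<in> UNIV \<and> id f \<in> Lp_space (s * \<alpha>) \<mu> \<and>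
          Lp_norm (s * \<alpha>) \<mu> (id f) \<le> ennreal (R powr (1 / (s * \<alpha>))) * bergman_norm s \<omega> f" by simp
      qed
      then have "embedding_norm s (s * \<alpha>) \<omega> \<mu> \<le> ennreal (R powr (1 / (s * \<alpha>)))"
        unfolding embedding_norm_def by (rule op_norm_le)
      then have "ennpow (embedding_norm s (s * \<alpha>) \<omega> \<mu>) (s * \<alpha>) \<le> ennpow (ennreal (R powr (1 / (s * \<alpha>)))) (s * \<alpha>)"
        using t by (rule ennpow_mono)
      also have "\<dots> = ennreal R" using s e R by (simp add: ennpow_def powr_powr)
      finally show "ennpow (embedding_norm s (s * \<alpha>) \<omega> \<mu>) (s * \<alpha>) \<le> ennreal (c3 * K)" by (simp add: R_def)
    qed
    have 4: "sup_norm_on_disc (box_quotient \<alpha> \<omega> \<mu>) \<le> ennreal c4 * ennpow (embedding_norm s (s * \<alpha>) \<omega> \<mu>) (s * \<alpha>)"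
      unfolding embedding_norm_def
    proof (rule ennpow_op_norm_ge[OF c(4) t])
      fix N :: real
      assume N: "0 \<le> N" and op: "op_bound (bergman_space s \<omega>) (bergman_norm s \<omega>) (Lp_space (s * \<alpha>) \<mu>) (Lp_norm (s * \<alpha>) \<mu>) UNIV id (ennreal N)"
      have "(SUP z\<in>disc. emeasure \<mu> (carleson_box z) / ennreal (weight_box \<omega> z powr \<alpha>)) \<le> ennreal (D3 * (Cm * N powr (s * \<alpha>)))"
        using Cm(1) N by (intro D3(2) Cm(2)[OF \<mu> op N]) auto
      then show "sup_norm_on_disc (box_quotient \<alpha> \<omega> \<mu>) \<le> ennreal (c4 * N powr (s * \<alpha>))"
        by (simp add: sup_norm_on_disc_def box_quotient_def c4_def mult.assoc)
    qed
    show "toeplitz_norm p q \<omega> \<mu> \<le> ennreal c * sup_norm_on_disc (box_quotient \<alpha> \<omega> \<mu>) \<and>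
      sup_norm_on_disc (berezin_quotient (\<alpha> - 1) \<omega> \<mu>) \<le> ennreal c * toeplitz_norm p q \<omega> \<mu> \<and>
      ennpow (embedding_norm s (s * \<alpha>) \<omega> \<mu>) (s * \<alpha>) \<le> ennreal c * sup_norm_on_disc (berezin_quotient (\<alpha> - 1) \<omega> \<mu>) \<and>
      sup_norm_on_disc (box_quotient \<alpha> \<omega> \<mu>) \<le> ennreal c * ennpow (embedding_norm s (s * \<alpha>) \<omega> \<mu>) (s * \<alpha>)"
      using up[OF 1] up[OF 2[unfolded p1]] up[OF 3] up[OF 4] c by (auto simp: c_def)
  qed
qed

end

theorem theorem1:
  fixes p q q' :: real and \<omega> :: "complex \<Rightarrow> real"
  assumes "1 < p" and "p \<le> q" and "1 / q + 1 / q' = 1"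
    and "regular_weight \<omega>"
  shows
    "(\<forall>\<mu>. borel_measure_on_disc \<mu> \<longrightarrow>
        (toeplitz_bounded p q \<omega> \<mu> \<longleftrightarrow>
           sup_norm_on_disc (berezin_quotient (1 / p + 1 / q' - 1) \<omega> \<mu>) < \<infinity>) \<and>
        (toeplitz_bounded p q \<omega> \<mu> \<longleftrightarrow>
           (\<exists>s>0. carleson_measure (s * (p + q') / (p * q')) s \<omega> \<mu>)) \<and>
        (toeplitz_bounded p q \<omega> \<mu> \<longleftrightarrow>
           (\<forall>s>0. carleson_measure (s * (p + q') / (p * q')) s \<omega> \<mu>)) \<and>
        (toeplitz_bounded p q \<omega> \<mu> \<longleftrightarrow>
           sup_norm_on_disc (box_quotient (1 / p + 1 / q') \<omega> \<mu>) < \<infinity>)) \<and>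
     (\<forall>s>0. \<exists>C>0. \<forall>\<mu>. borel_measure_on_disc \<mu> \<longrightarrow>
        comparable C
          (toeplitz_norm p q \<omega> \<mu>)
          (sup_norm_on_disc (berezin_quotient (1 / p + 1 / q' - 1) \<omega> \<mu>)) \<and>
        comparable C
          (sup_norm_on_disc (berezin_quotient (1 / p + 1 / q' - 1) \<omega> \<mu>))
          (ennpow (embedding_norm s (s * (p + q') / (p * q')) \<omega> \<mu>) (s * (p + q') / (p * q'))) \<and>
        comparable C
          (ennpow (embedding_norm s (s * (p + q') / (p * q')) \<omega> \<mu>) (s * (p + q') / (p * q')))
          (sup_norm_on_disc (box_quotient (1 / p + 1 / q') \<omega> \<mu>)))"
proof -
  define \<alpha> where "\<alpha> = 1 + (1/p - 1/q)"
  have q: "1 < q" using assms by simp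
  have "1 / q < 1" using q by simp
  then have "0 < 1 / q'" using assms(3) by linarith
  then have q': "0 < q'" by (simp add: zero_less_divide_iff)
  have e1: "1 / p + 1 / q' = \<alpha>" and e2: "1 / p + 1 / q' - 1 = \<alpha> - 1"
    using assms(3) by (simp_all add: \<alpha>_def)
  have e3: "s * (p + q') / (p * q') = s * \<alpha>" for s
    using assms(1) q' unfolding e1[symmetric] by (simp add: field_simps)
  obtain \<Omega> A M \<kappa> where "regular_profile \<omega> \<Omega> A M \<kappa>" using regular_weight_profile[OF assms(4)] by blast
  then interpret regular_profile \<omega> \<Omega> A M \<kappa> .
  let ?T = "toeplitz_norm p q \<omega>" and ?B = "\<lambda>\<mu>. sup_norm_on_disc (berezin_quotient (\<alpha> - 1) \<omega> \<mu>)"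
    and ?E = "\<lambda>s \<mu>. ennpow (embedding_norm s (s * \<alpha>) \<omega> \<mu>) (s * \<alpha>)"
    and ?X = "\<lambda>\<mu>. sup_norm_on_disc (box_quotient \<alpha> \<omega> \<mu>)"
  have cycle: "\<exists>c\<ge>1. \<forall>\<mu>. borel_measure_on_disc \<mu> \<longrightarrow> ?T \<mu> \<le> ennreal c * ?X \<mu> \<and> ?B \<mu> \<le> ennreal c * ?T \<mu> \<and>
      ?E s \<mu> \<le> ennreal c * ?B \<mu> \<and> ?X \<mu> \<le> ennreal c * ?E s \<mu>" if "0 < s" for s
    by (rule norms_cycle[OF assms(1,2) \<alpha>_def that]) blast
  have T: "toeplitz_bounded p q \<omega> \<mu> \<longleftrightarrow> ?T \<mu> < \<infinity>" for \<mu>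
    by (simp only: toeplitz_bounded_def toeplitz_norm_def op_norm_less_top_iff)
  have E: "carleson_measure (s * \<alpha>) s \<omega> \<mu> \<longleftrightarrow> ?E s \<mu> < \<infinity>" for s \<mu>
    by (simp add: carleson_measure_def embedding_norm_def op_norm_less_top_iff[symmetric])
  have fin: "x < \<infinity>" if "x \<le> ennreal c * y" "y < \<infinity>" for x y c
    using that by (auto intro: le_less_trans simp: ennreal_mult_less_top)
  have equiv: "(?T \<mu> < \<infinity> \<longleftrightarrow> ?B \<mu> < \<infinity>) \<and> (?T \<mu> < \<infinity> \<longleftrightarrow> ?E s \<mu> < \<infinity>) \<and> (?T \<mu> < \<infinity> \<longleftrightarrow> ?X \<mu> < \<infinity>)"
    if "borel_measure_on_disc \<mu>" "0 < s" for \<mu> s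
    using cycle[OF that(2)] that(1) fin by meson
  have norms: "\<exists>C>0. \<forall>\<mu>. borel_measure_on_disc \<mu> \<longrightarrow>
      comparable C (?T \<mu>) (?B \<mu>) \<and> comparable C (?B \<mu>) (?E s \<mu>) \<and> comparable C (?E s \<mu>) (?X \<mu>)" if s: "0 < s" for s
  proof -
    obtain c where c: "1 \<le> c" "\<forall>\<mu>. borel_measure_on_disc \<mu> \<longrightarrow> ?T \<mu> \<le> ennreal c * ?X \<mu> \<and> ?B \<mu> \<le> ennreal c * ?T \<mu> \<and>
      ?E s \<mu> \<le> ennreal c * ?B \<mu> \<and> ?X \<mu> \<le> ennreal c * ?E s \<mu>" using cycle[OF s] by blast
    show ?thesis using c by (intro exI[of _ "c ^ 3"] conjI allI impI comparable_cycle[OF c(1)]) auto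
  qed
  show ?thesis
    unfolding e2 e3 e1 T E using equiv norms zero_less_one by blast
qed


end
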